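(* Let $\nabla=d+(p_{-1}+u)dt$ be a monodromy-free cyclotomic Miura $\mathfrak g$-oper as in the setting described in the context, and let $Y\in B_-(\mathcal M)$ be the solution of $\nabla_{\rm r}Y=0$ with $Y(0)=\mathrm{Id}$. If $\nabla^g\in\mathrm{MOp}^\Gamma_{\mathfrak g}(\mathbb P^1)^{\rm gen}_{\nabla,0}$, then $Y\,g_{\rm r}(0)^{-1}=g_{\rm r}^{-1}\,Y_g$ and $g_{\rm r}(0)\in N^\vartheta$. Conversely, for every $g_0\in N^\vartheta$ there exist unique $n\in N^{\hat\vartheta}(\mathcal M)$ and $\widetilde Y\in B_-^{\hat\vartheta}(\mathcal M)$ such that $$Y\,g_0^{-1}=n^{-1}\,\widetilde Y.$$ Defining $g:=t^{\check\lambda_0}\,n\,t^{-\check\lambda_0}$, so that $n=g_{\rm r}$, we have $\nabla^g\in\mathrm{MOp}^\Gamma_{\mathfrak g}(\mathbb P^1)^{\rm gen}_{\nabla,0}$, $g_{\rm r}(0)=g_0$ and $\widetilde Y=Y_g$.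
   Context: **Lie algebra.** $\mathfrak g$ is a finite-dimensional complex semisimple Lie algebra with Cartan subalgebra $\mathfrak h$, simple roots $\alpha_i$ ($i\in I$), Chevalley-Serre generators $E_i,\check\alpha_i,F_i$, and $\mathfrak g=\mathfrak n_-\oplus\mathfrak h\oplus\mathfrak n$, $\mathfrak b=\mathfrak h\oplus\mathfrak n$, $\mathfrak b_-=\mathfrak h\oplus\mathfrak n_-$. $G$ is the adjoint group, $H$ the maximal torus with Lie algebra $\mathfrak h$, $N$ the unipotent subgroup with Lie algebra $\mathfrak n$, $B_-$ the Borel subgroup with Lie algebra $\mathfrak b_-$, $W$ the Weyl group (acting on $\mathfrak h$). A coweight $\check\lambda\in\mathfrak h$ is integral if all $\langle\alpha_i,\check\lambda\rangle\in\mathbb Z$ and dominant if all $\langle\alpha_i,\check\lambda\rangle\ge 0$. $\check\rho\in\mathfrak h$ is defined by $\langle\alpha_i,\check\rho\rangle=1$ for all $i$; $p_{-1}=\sum_i F_i$; $2\check\rho=\sum_i c_i\check\alpha_i$, $p_1=\sum_i c_iE_i$, $\mathfrak a=\ker(\operatorname{ad}_{p_1})\subset\mathfrak n$. Shifted action: $w\cdot\check\lambda=w(\check\lambda+\check\rho)-\check\rho$. **Cyclotomic data.** $\nu:I\to I$ is a diagram automorphism (preserving the Cartan matrix), also denoting the automorphism $E_i\mapsto E_{\nu(i)}$, $\check\alpha_i\mapsto\check\alpha_{\nu(i)}$, $F_i\mapsto F_{\nu(i)}$ of $\mathfrak g$; it acts on $W$ by conjugation, and $W^\nu$, $\mathfrak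 h^\nu$ denote invariants. $T\ge 1$ is a multiple of the order of $\nu$, $\omega$ a primitive $T$-th root of unity, $\Gamma=\langle\omega\rangle$, acting on $\mathbb P^1$ (coordinate $t$) by multiplication. $\mathcal M$ is the algebra of meromorphic (rational) functions on $\mathbb P^1$; for $\mathfrak p\subset\mathfrak g$, $\Omega(\mathfrak p)=\mathfrak p\otimes\mathcal M\,dt$. For an automorphism $\upsilon$ of $\mathfrak g$ with $\upsilon^T=\mathrm{Id}$ (lifted to $G$ by conjugation), $\hat\upsilon$ acts on $G(\mathcal M)$ by $(\hat\upsilon g)(t)=\upsilon(g(\omega^{-1}t))$ and on $\Omega(\mathfrak g)$ by $\hat\upsilon(X\otimes\varpi)=\upsilon(X)\otimes\mu_{\omega^{-1}}^*\varpi$, where $\mu_{\omega^{-1}}(t)=\omega^{-1}t$. A superscript $\hat\upsilon$ (resp. $\upsilon$) denotes invariants, e.g. $N^{\hat\upsilon}(\mathcal M)$, $\Omega^{\hat\upsilon}(\mathfrak p)$, $N^\upsilon$. Put $\varsigma=\operatorname{Ad}_{\omega^{-\check\rho}}\circ\nu$, so $\varsigma(E_i)=\omega^{-1}E_{\nu(i)}$, $\varsigma(\check\alpha_i)=\check\alpha_{\nu(i)}$, $\varsigma(F_i)=\omega F_{\nu(i)}$. **Opers.** $G(\mathcal M)$ acts on $\mathfrak g$-connections $d+A$, $A\in\Omega(\mathfrak g)$, by $g(d+A)g^{-1}=d-dg\,g^{-1}+\operatorname{Ad}_gA$. "$Z\in G(\mathcal M)$ solves $(d+A)Z=0$" means $dZ\,Z^{-1}=-A$.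 $\mathrm{op}^\Gamma_{\mathfrak g}=\{d+p_{-1}dt+v: v\in\Omega^{\hat\varsigma}(\mathfrak b)\}$; $[\nabla]_\Gamma$ is the $N^{\hat\varsigma}(\mathcal M)$-orbit of $\nabla\in\mathrm{op}^\Gamma_{\mathfrak g}$. Each orbit has a unique canonical representative $d+p_{-1}dt+c$, $c\in\Omega^{\hat\varsigma}(\mathfrak a)$; $[\nabla]_\Gamma$ is regular at $x\in\mathbb C$ if $c$ has no pole at $x$. A cyclotomic Miura $\mathfrak g$-oper is a connection $d+p_{-1}dt+u\,dt$ with $u\,dt\in\Omega^{\hat\nu}(\mathfrak h)$. A connection is monodromy-free if its monodromy representation is trivial. **Setting for $\nabla$.** $z_1,\dots,z_L\in\mathbb C^\times$ have pairwise disjoint $\Gamma$-orbits, $\check\lambda_1,\dots,\check\lambda_L\in\mathfrak h$ and $\check\lambda_0,\check\lambda_\infty\in\mathfrak h^\nu$ are integral dominant coweights, and $\nabla=d+(p_{-1}+u)dt$ with $$u(t)=-\frac{\check\lambda_0}{t}-\sum_{r=0}^{T-1}\Big(\sum_{i=1}^L\frac{\nu^r(w_i\cdot\check\lambda_i)}{t-\omega^rz_i}+\sum_{j=1}^m\frac{\nu^r(y_j\cdot 0)}{t-\omega^rx_j}\Big),$$ with $w_i,y_j\in W$, $m\ge0$, $x_j\in\mathbb C^\times$ outside the $\Gamma$-orbits of the $z_i$, such that $[\nabla]_\Gamma$ is regular at every $x_j$ and $\operatorname{res}_\infty(u\,dt)=w_\infty\cdot\check\lambda_\infty$ for some $w_\infty\in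 W^\nu$. **Notation in the claim.** For $f\in\mathcal M^\times$ (or $\mathbb C^\times$) and an integral coweight $\check\lambda$, $f^{\check\lambda}\in H(\mathcal M)$ (or $H$) acts on the root space of $\alpha$ by $f^{\langle\alpha,\check\lambda\rangle}$. $\nabla^g=g\nabla g^{-1}$; for $g\in N(\mathcal M)$, $g_{\rm r}=t^{-\check\lambda_0}g\,t^{\check\lambda_0}$; the regularisation of a connection $\nabla'$ is $\nabla'_{\rm r}=t^{-\check\lambda_0}\nabla' t^{\check\lambda_0}$ (gauge action), so $\nabla_{\rm r}=d+\sum_it^{\langle\alpha_i,\check\lambda_0\rangle}F_i\,dt+(u+\check\lambda_0/t)dt$ is regular at $0$. $\mathrm{MOp}^\Gamma_{\mathfrak g}(\mathbb P^1)^{\rm gen}_{\nabla,0}$ is the set of cyclotomic Miura $\mathfrak g$-opers of the form $\nabla^g$ with $g\in N^{\hat\varsigma}(\mathcal M)$ and $g_{\rm r}$ regular at $0$. For such $g$, $Y_g$ is the solution of $(\nabla^g)_{\rm r}Y_g=0$ with $Y_g(0)=\mathrm{Id}$. $\vartheta=\operatorname{Ad}_{\omega^{-\check\lambda_0}}\circ\varsigma$, an automorphism of $\mathfrak g$ and of $G$ with $\vartheta^T=\mathrm{Id}$. *)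

theory Defs
  imports
    "HOL-Analysis.Analysis"
    "HOL-Complex_Analysis.Complex_Residues"
    "HOL-Computational_Algebra.Computational_Algebra"
    "HOL-Computational_Algebra.Field_as_Ring"
begin

section \<open>Rational functions on the projective line\<close>

text \<open>The field of meromorphic functions on the projective line, with coordinate \<open>t\<close>.\<close>

type_synonym ratfun = "complex poly fract"

definition rat_const :: "complex \<Rightarrow> ratfun" where
  "rat_const c = to_fract [:c:]"

definition rat_t :: ratfun where
  "rat_t = to_fract [:0, 1:]"

text \<open>\<^const>\<open>quot_of_fract\<close> returns the coprime numerator and (monic) denominator.\<close>

definition rat_regular_at :: "ratfun \<Rightarrow> complex \<Rightarrow> bool" where
  "rat_regular_at f x \<longleftrightarrow> poly (snd (quot_of_fract f)) x \<noteq> 0"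

definition rat_eval :: "ratfun \<Rightarrow> complex \<Rightarrow> complex" where
  "rat_eval f x = poly (fst (quot_of_fract f)) x / poly (snd (quot_of_fract f)) x"

definition rat_deriv :: "ratfun \<Rightarrow> ratfun" where
  "rat_deriv f = (case quot_of_fract f of
     (p, q) \<Rightarrow> Fract (pderiv p * q - p * pderiv q) (q * q))"

text \<open>The substitution \<open>f(t) \<mapsto> f(c t)\<close>, for \<open>c \<noteq> 0\<close>.\<close>

definition rat_rescale :: "complex \<Rightarrow> ratfun \<Rightarrow> ratfun" where
  "rat_rescale c f = (case quot_of_fract f of
     (p, q) \<Rightarrow> Fract (pcompose p [:0, c:]) (pcompose q [:0, c:]))"

text \<open>In the coordinate \<open>s = 1/t\<close> one has \<open>f dt = - f(1/s) s\<^sup>-\<^sup>2 ds\<close>.\<close>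

definition rat_residue_infinity :: "ratfun \<Rightarrow> complex" where
  "rat_residue_infinity f = residue (\<lambda>s. - rat_eval f (1 / s) / s ^ 2) 0"

text \<open>Extension of scalars along a field embedding, for vectors and matrices.\<close>

definition ext_vec :: "(complex \<Rightarrow> 'k) \<Rightarrow> complex^'n \<Rightarrow> 'k^'n" where
  "ext_vec emb v = (\<chi> a. emb (v $ a))"

definition ext_mat :: "(complex \<Rightarrow> 'k) \<Rightarrow> complex^'n^'m \<Rightarrow> 'k^'n^'m" where
  "ext_mat emb A = (\<chi> a b. emb (A $ a $ b))"

abbreviation const_vec :: "complex^'n \<Rightarrow> ratfun^'n" where
  "const_vec \<equiv> ext_vec rat_const"

abbreviation const_mat :: "complex^'n^'m \<Rightarrow> ratfun^'n^'m" where
  "const_mat \<equiv> ext_mat rat_const"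

definition vec_regular_at :: "ratfun^'n \<Rightarrow> complex \<Rightarrow> bool" where
  "vec_regular_at v x \<longleftrightarrow> (\<forall>a. rat_regular_at (v $ a) x)"

definition vec_eval :: "ratfun^'n \<Rightarrow> complex \<Rightarrow> complex^'n" where
  "vec_eval v x = (\<chi> a. rat_eval (v $ a) x)"

definition vec_rescale :: "complex \<Rightarrow> ratfun^'n \<Rightarrow> ratfun^'n" where
  "vec_rescale c v = (\<chi> a. rat_rescale c (v $ a))"

definition vec_residue_infinity :: "ratfun^'n \<Rightarrow> complex^'n" where
  "vec_residue_infinity v = (\<chi> a. rat_residue_infinity (v $ a))"

definition mat_regular_at :: "ratfun^'n^'m \<Rightarrow> complex \<Rightarrow> bool" where
  "mat_regular_at Z x \<longleftrightarrow> (\<forall>a b. rat_regular_at (Z $ a $ b) x)"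

definition mat_eval :: "ratfun^'n^'m \<Rightarrow> complex \<Rightarrow> complex^'n^'m" where
  "mat_eval Z x = (\<chi> a b. rat_eval (Z $ a $ b) x)"

definition mat_deriv :: "ratfun^'n^'m \<Rightarrow> ratfun^'n^'m" where
  "mat_deriv Z = (\<chi> a b. rat_deriv (Z $ a $ b))"

definition mat_rescale :: "complex \<Rightarrow> ratfun^'n^'m \<Rightarrow> ratfun^'n^'m" where
  "mat_rescale c Z = (\<chi> a b. rat_rescale c (Z $ a $ b))"


section \<open>Semisimple Lie algebras\<close>

text \<open>
  The Lie algebra is \<open>\<complex>\<^sup>n\<close> with an arbitrary bracket.  The values of
  the simple roots \<open>sroot i\<close> matter only on the Cartan subalgebra.
\<close>

record ('n, 'i) lie_data =
  brk :: "complex^'n \<Rightarrow> complex^'n \<Rightarrow> complex^'n"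
  cartan :: "(complex^'n) set"
  sroot :: "'i \<Rightarrow> complex^'n \<Rightarrow> complex"
  coroot :: "'i \<Rightarrow> complex^'n"
  genE :: "'i \<Rightarrow> complex^'n"
  genF :: "'i \<Rightarrow> complex^'n"

definition lie_algebra :: "('n::finite, 'i) lie_data \<Rightarrow> bool" where
  "lie_algebra \<gg> \<longleftrightarrow>
     (\<forall>x y z. brk \<gg> (x + y) z = brk \<gg> x z + brk \<gg> y z) \<and>
     (\<forall>x y z. brk \<gg> x (y + z) = brk \<gg> x y + brk \<gg> x z) \<and>
     (\<forall>c x y. brk \<gg> (c *s x) y = c *s brk \<gg> x y) \<and>
     (\<forall>c x y. brk \<gg> x (c *s y) = c *s brk \<gg> x y) \<and>
     (\<forall>x. brk \<gg> x x = 0) \<and>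
     (\<forall>x y z. brk \<gg> x (brk \<gg> y z) + brk \<gg> y (brk \<gg> z x) + brk \<gg> z (brk \<gg> x y) = 0)"

definition lie_subalgebra :: "('n::finite, 'i) lie_data \<Rightarrow> (complex^'n) set \<Rightarrow> bool" where
  "lie_subalgebra \<gg> S \<longleftrightarrow> vec.subspace S \<and> (\<forall>x\<in>S. \<forall>y\<in>S. brk \<gg> x y \<in> S)"

definition lie_ideal :: "('n::finite, 'i) lie_data \<Rightarrow> (complex^'n) set \<Rightarrow> bool" where
  "lie_ideal \<gg> S \<longleftrightarrow> vec.subspace S \<and> (\<forall>x. \<forall>y\<in>S. brk \<gg> x y \<in> S)"

definition brk_span :: "('n::finite, 'i) lie_data \<Rightarrow> (complex^'n) set \<Rightarrow> (complex^'n) set \<Rightarrow> (complex^'n) set" where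
  "brk_span \<gg> S S' = vec.span {brk \<gg> x y | x y. x \<in> S \<and> y \<in> S'}"

definition lie_solvable :: "('n::finite, 'i) lie_data \<Rightarrow> (complex^'n) set \<Rightarrow> bool" where
  "lie_solvable \<gg> S \<longleftrightarrow> (\<exists>k. ((\<lambda>D. brk_span \<gg> D D) ^^ k) S = {0})"

definition lie_nilpotent :: "('n::finite, 'i) lie_data \<Rightarrow> (complex^'n) set \<Rightarrow> bool" where
  "lie_nilpotent \<gg> S \<longleftrightarrow> (\<exists>k. (brk_span \<gg> S ^^ k) S = {0})"

definition semisimple :: "('n::finite, 'i) lie_data \<Rightarrow> bool" where
  "semisimple \<gg> \<longleftrightarrow> lie_algebra \<gg> \<and> (\<forall>S. lie_ideal \<gg> S \<and> lie_solvable \<gg> S \<longrightarrow> S = {0})"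

definition cartan_subalgebra :: "('n::finite, 'i) lie_data \<Rightarrow> (complex^'n) set \<Rightarrow> bool" where
  "cartan_subalgebra \<gg> S \<longleftrightarrow>
     lie_subalgebra \<gg> S \<and> lie_nilpotent \<gg> S \<and> (\<forall>x. (\<forall>y\<in>S. brk \<gg> x y \<in> S) \<longrightarrow> x \<in> S)"

definition root_space :: "('n::finite, 'i) lie_data \<Rightarrow> (complex^'n \<Rightarrow> complex) \<Rightarrow> (complex^'n) set" where
  "root_space \<gg> \<alpha> = {x. \<forall>h\<in>cartan \<gg>. brk \<gg> h x = \<alpha> h *s x}"

definition is_root :: "('n::finite, 'i) lie_data \<Rightarrow> (complex^'n \<Rightarrow> complex) \<Rightarrow> bool" where
  "is_root \<gg> \<alpha> \<longleftrightarrow> (\<exists>h\<in>cartan \<gg>. \<alpha> h \<noteq> 0) \<and> root_space \<gg> \<alpha> \<noteq> {0}"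

definition simple_roots :: "('n::finite, 'i::finite) lie_data \<Rightarrow> bool" where
  "simple_roots \<gg> \<longleftrightarrow>
     (\<forall>i. is_root \<gg> (sroot \<gg> i)) \<and>
     (\<forall>c. (\<forall>h\<in>cartan \<gg>. (\<Sum>i\<in>UNIV. c i * sroot \<gg> i h) = 0) \<longrightarrow> (\<forall>i. c i = 0)) \<and>
     (\<forall>\<beta>. is_root \<gg> \<beta> \<longrightarrow>
        (\<exists>k :: 'i \<Rightarrow> nat.
           (\<forall>h\<in>cartan \<gg>. \<beta> h = (\<Sum>i\<in>UNIV. of_nat (k i) * sroot \<gg> i h)) \<or>
           (\<forall>h\<in>cartan \<gg>. \<beta> h = - (\<Sum>i\<in>UNIV. of_nat (k i) * sroot \<gg> i h))))"

definition chevalley_generators :: "('n::finite, 'i) lie_data \<Rightarrow> bool" where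
  "chevalley_generators \<gg> \<longleftrightarrow>
     (\<forall>i. coroot \<gg> i \<in> cartan \<gg> \<and> sroot \<gg> i (coroot \<gg> i) = 2) \<and>
     (\<forall>i. \<forall>h\<in>cartan \<gg>. brk \<gg> h (genE \<gg> i) = sroot \<gg> i h *s genE \<gg> i) \<and>
     (\<forall>i. \<forall>h\<in>cartan \<gg>. brk \<gg> h (genF \<gg> i) = - sroot \<gg> i h *s genF \<gg> i) \<and>
     (\<forall>i j. brk \<gg> (genE \<gg> i) (genF \<gg> j) = (if i = j then coroot \<gg> i else 0))"

definition semisimple_data :: "('n::finite, 'i::finite) lie_data \<Rightarrow> bool" where
  "semisimple_data \<gg> \<longleftrightarrow> semisimple \<gg> \<and> cartan_subalgebra \<gg> (cartan \<gg>) \<and>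
     simple_roots \<gg> \<and> chevalley_generators \<gg>"

definition lie_generated :: "('n::finite, 'i) lie_data \<Rightarrow> (complex^'n) set \<Rightarrow> (complex^'n) set" where
  "lie_generated \<gg> S = \<Inter>{S'. lie_subalgebra \<gg> S' \<and> S \<subseteq> S'}"

definition nil_plus :: "('n::finite, 'i) lie_data \<Rightarrow> (complex^'n) set" where
  "nil_plus \<gg> = lie_generated \<gg> (range (genE \<gg>))"

definition nil_minus :: "('n::finite, 'i) lie_data \<Rightarrow> (complex^'n) set" where
  "nil_minus \<gg> = lie_generated \<gg> (range (genF \<gg>))"

definition borel_minus :: "('n::finite, 'i) lie_data \<Rightarrow> (complex^'n) set" where
  "borel_minus \<gg> = {x + y | x y. x \<in> cartan \<gg> \<and> y \<in> nil_minus \<gg>}"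

definition p_minus :: "('n::finite, 'i::finite) lie_data \<Rightarrow> complex^'n" where
  "p_minus \<gg> = (\<Sum>i\<in>UNIV. genF \<gg> i)"

definition rho_check :: "('n::finite, 'i) lie_data \<Rightarrow> complex^'n" where
  "rho_check \<gg> = (THE x. x \<in> cartan \<gg> \<and> (\<forall>i. sroot \<gg> i x = 1))"

definition rho_coeff :: "('n::finite, 'i::finite) lie_data \<Rightarrow> 'i \<Rightarrow> complex" where
  "rho_coeff \<gg> = (THE c. 2 *s rho_check \<gg> = (\<Sum>i\<in>UNIV. c i *s coroot \<gg> i))"

definition p_plus :: "('n::finite, 'i::finite) lie_data \<Rightarrow> complex^'n" where
  "p_plus \<gg> = (\<Sum>i\<in>UNIV. rho_coeff \<gg> i *s genE \<gg> i)"

definition p_plus_kernel :: "('n::finite, 'i::finite) lie_data \<Rightarrow> (complex^'n) set" where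
  "p_plus_kernel \<gg> = {x. brk \<gg> (p_plus \<gg>) x = 0}"

definition integral_coweight :: "('n::finite, 'i) lie_data \<Rightarrow> complex^'n \<Rightarrow> bool" where
  "integral_coweight \<gg> l \<longleftrightarrow> l \<in> cartan \<gg> \<and> (\<forall>i. sroot \<gg> i l \<in> \<int>)"

definition dominant_coweight :: "('n::finite, 'i) lie_data \<Rightarrow> complex^'n \<Rightarrow> bool" where
  "dominant_coweight \<gg> l \<longleftrightarrow> l \<in> cartan \<gg> \<and> (\<forall>i. sroot \<gg> i l \<in> \<real> \<and> 0 \<le> Re (sroot \<gg> i l))"

text \<open>
  The Weyl group.  Its elements are functions on the whole of \<open>\<complex>\<^sup>n\<close>, but only their
  restrictions to the Cartan subalgebra are meaningful.
\<close>

definition simple_reflection :: "('n::finite, 'i) lie_data \<Rightarrow> 'i \<Rightarrow> complex^'n \<Rightarrow> complex^'n" where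
  "simple_reflection \<gg> i x = x - sroot \<gg> i x *s coroot \<gg> i"

inductive_set weyl_group :: "('n::finite, 'i) lie_data \<Rightarrow> (complex^'n \<Rightarrow> complex^'n) set"
  for \<gg> where
  "id \<in> weyl_group \<gg>"
| "w \<in> weyl_group \<gg> \<Longrightarrow> simple_reflection \<gg> i \<circ> w \<in> weyl_group \<gg>"

definition shifted_action ::
  "('n::finite, 'i) lie_data \<Rightarrow> (complex^'n \<Rightarrow> complex^'n) \<Rightarrow> complex^'n \<Rightarrow> complex^'n" where
  "shifted_action \<gg> w l = w (l + rho_check \<gg>) - rho_check \<gg>"


section \<open>The adjoint group and its subgroups\<close>

definition mat_exp :: "complex^'n^'n \<Rightarrow> complex^'n^'n" where
  "mat_exp A = (\<Sum>k. inverse (fact k) *\<^sub>R (((**) A) ^^ k) (mat 1))"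

text \<open>
  The connected subgroup of \<open>GL(\<gg>)\<close> whose Lie algebra is the image under \<open>ad\<close> of the
  subalgebra \<open>S\<close>.  It is generated by the \<open>exp(ad x)\<close> with \<open>x \<in> S\<close>; as \<open>S = - S\<close>, closure
  under inverses is automatic.
\<close>

inductive_set adjoint_subgroup ::
  "('n::finite, 'i) lie_data \<Rightarrow> (complex^'n) set \<Rightarrow> (complex^'n^'n) set"
  for \<gg> S where
  "mat 1 \<in> adjoint_subgroup \<gg> S"
| "g \<in> adjoint_subgroup \<gg> S \<Longrightarrow> x \<in> S \<Longrightarrow>
     mat_exp (matrix (brk \<gg> x)) ** g \<in> adjoint_subgroup \<gg> S"

definition grp_G :: "('n::finite, 'i) lie_data \<Rightarrow> (complex^'n^'n) set" where
  "grp_G \<gg> = adjoint_subgroup \<gg> UNIV"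

definition grp_N :: "('n::finite, 'i) lie_data \<Rightarrow> (complex^'n^'n) set" where
  "grp_N \<gg> = adjoint_subgroup \<gg> (nil_plus \<gg>)"

definition grp_B_minus :: "('n::finite, 'i) lie_data \<Rightarrow> (complex^'n^'n) set" where
  "grp_B_minus \<gg> = adjoint_subgroup \<gg> (borel_minus \<gg>)"

text \<open>
  For a Zariski closed subgroup \<open>K\<close> of \<open>GL(\<gg>)\<close>, the group of points of \<open>K\<close> over the field of
  rational functions, i.e. the rational maps from the projective line to \<open>K\<close>.
\<close>

definition rat_points :: "(complex^'n^'n) set \<Rightarrow> (ratfun^'n^'n) set" where
  "rat_points K = {Z. finite {x. \<not> (mat_regular_at Z x \<and> mat_eval Z x \<in> K)}}"

text \<open>The space \<open>\<pp> \<otimes> \<M>\<close>; its elements \<open>A\<close> stand for the forms \<open>A dt\<close>.\<close>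

definition rat_forms :: "(complex^'n) set \<Rightarrow> (ratfun^'n) set" where
  "rat_forms S = vec.span (const_vec ` S)"

text \<open>The matrix of \<open>ad X\<close> for \<open>X \<in> \<gg> \<otimes> \<M>\<close>, by scalar extension of the bracket.\<close>

definition rat_ad :: "('n::finite, 'i) lie_data \<Rightarrow> ratfun^'n \<Rightarrow> ratfun^'n^'n" where
  "rat_ad \<gg> X = (\<chi> a b. \<Sum>j\<in>UNIV. X $ j * rat_const (brk \<gg> (axis j 1) (axis b 1) $ a))"

text \<open>
  The torus element \<open>f\<^sup>l\<close> for an integral coweight \<open>l\<close>, over the field \<open>'k\<close> (the complex
  numbers or the rational functions) into which \<open>emb\<close> embeds the complex numbers.
\<close>

definition torus ::
  "('n::finite, 'i) lie_data \<Rightarrow> (complex \<Rightarrow> 'k::field) \<Rightarrow> 'k \<Rightarrow> complex^'n \<Rightarrow> 'k^'n^'n" where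
  "torus \<gg> emb f l = (THE Z.
     (\<forall>x\<in>cartan \<gg>. Z *v ext_vec emb x = ext_vec emb x) \<and>
     (\<forall>\<alpha>. is_root \<gg> \<alpha> \<longrightarrow> (\<forall>x\<in>root_space \<gg> \<alpha>. \<forall>k::int. \<alpha> l = of_int k \<longrightarrow>
        Z *v ext_vec emb x = (f powi k) *s ext_vec emb x)))"

abbreviation const_torus :: "('n::finite, 'i) lie_data \<Rightarrow> complex \<Rightarrow> complex^'n \<Rightarrow> complex^'n^'n" where
  "const_torus \<gg> \<equiv> torus \<gg> (\<lambda>c. c)"

abbreviation t_torus :: "('n::finite, 'i) lie_data \<Rightarrow> complex^'n \<Rightarrow> ratfun^'n^'n" where
  "t_torus \<gg> \<equiv> torus \<gg> rat_const rat_t"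


section \<open>Connections and gauge transformations\<close>

text \<open>
  A connection \<open>d + A dt\<close> is represented by \<open>A \<in> \<gg> \<otimes> \<M>\<close>.  As \<open>ad\<close> is faithful, the
  \<open>\<gg>\<close>-valued form \<open>dZ Z\<^sup>-\<^sup>1\<close> is identified by its matrix in the adjoint representation.
\<close>

definition log_deriv :: "('n::finite, 'i) lie_data \<Rightarrow> ratfun^'n^'n \<Rightarrow> ratfun^'n" where
  "log_deriv \<gg> Z = (THE X. rat_ad \<gg> X = mat_deriv Z ** matrix_inv Z)"

definition gauge_transform :: "('n::finite, 'i) lie_data \<Rightarrow> ratfun^'n^'n \<Rightarrow> ratfun^'n \<Rightarrow> ratfun^'n" where
  "gauge_transform \<gg> g A = g *v A - log_deriv \<gg> g"

text \<open>\<open>Z\<close> solves \<open>(d + A dt) Z = 0\<close> with \<open>Z(0) = 1\<close>.\<close>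

definition normalized_solution ::
  "('n::finite, 'i) lie_data \<Rightarrow> ratfun^'n \<Rightarrow> ratfun^'n^'n \<Rightarrow> bool" where
  "normalized_solution \<gg> A Z \<longleftrightarrow>
     Z \<in> rat_points (grp_G \<gg>) \<and>
     mat_deriv Z ** matrix_inv Z = - rat_ad \<gg> A \<and>
     mat_regular_at Z 0 \<and> mat_eval Z 0 = mat 1"

text \<open>
  Trivial monodromy: parallel transport along every loop avoiding the poles is the identity.
  Continuously differentiable loops represent all homotopy classes, and loops through the
  point at infinity are not needed, even if the connection is regular there.
\<close>

definition monodromy_free :: "('n::finite, 'i) lie_data \<Rightarrow> ratfun^'n \<Rightarrow> bool" where
  "monodromy_free \<gg> A \<longleftrightarrow>
     (\<forall>(\<gamma> :: real \<Rightarrow> complex) (Z :: real \<Rightarrow> complex^'n^'n).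
        \<gamma> C1_differentiable_on {0..1} \<and> pathstart \<gamma> = pathfinish \<gamma> \<and>
        (\<forall>s\<in>{0..1}. vec_regular_at A (\<gamma> s)) \<and>
        (\<forall>s\<in>{0..1}. (Z has_vector_derivative
           - (matrix (brk \<gg> (vector_derivative \<gamma> (at s) *s vec_eval A (\<gamma> s))) ** Z s))
           (at s within {0..1})) \<and>
        Z 0 = mat 1 \<longrightarrow> Z 1 = mat 1)"

definition regularized_connection ::
  "('n::finite, 'i) lie_data \<Rightarrow> complex^'n \<Rightarrow> ratfun^'n \<Rightarrow> ratfun^'n" where
  "regularized_connection \<gg> l0 A = gauge_transform \<gg> (t_torus \<gg> (- l0)) A"

definition regularized_group_elt ::
  "('n::finite, 'i) lie_data \<Rightarrow> complex^'n \<Rightarrow> ratfun^'n^'n \<Rightarrow> ratfun^'n^'n" where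
  "regularized_group_elt \<gg> l0 g = t_torus \<gg> (- l0) ** g ** t_torus \<gg> l0"


section \<open>Cyclotomic structures\<close>

definition diagram_automorphism ::
  "('n::finite, 'i) lie_data \<Rightarrow> ('i \<Rightarrow> 'i) \<Rightarrow> bool" where
  "diagram_automorphism \<gg> \<nu> \<longleftrightarrow> bij \<nu> \<and>
     (\<forall>i j. sroot \<gg> (\<nu> j) (coroot \<gg> (\<nu> i)) = sroot \<gg> j (coroot \<gg> i))"

definition lie_automorphism :: "('n::finite, 'i) lie_data \<Rightarrow> complex^'n^'n \<Rightarrow> bool" where
  "lie_automorphism \<gg> U \<longleftrightarrow> invertible U \<and>
     (\<forall>x y. U *v brk \<gg> x y = brk \<gg> (U *v x) (U *v y))"

text \<open>\<open>V\<close> is the automorphism of the Lie algebra induced by the diagram automorphism \<open>\<nu>\<close>.\<close>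

definition induced_automorphism ::
  "('n::finite, 'i) lie_data \<Rightarrow> ('i \<Rightarrow> 'i) \<Rightarrow> complex^'n^'n \<Rightarrow> bool" where
  "induced_automorphism \<gg> \<nu> V \<longleftrightarrow> lie_automorphism \<gg> V \<and>
     (\<forall>i. V *v genE \<gg> i = genE \<gg> (\<nu> i) \<and> V *v coroot \<gg> i = coroot \<gg> (\<nu> i) \<and>
          V *v genF \<gg> i = genF \<gg> (\<nu> i))"

definition primitive_root_of_unity :: "nat \<Rightarrow> complex \<Rightarrow> bool" where
  "primitive_root_of_unity T \<omega> \<longleftrightarrow> \<omega> ^ T = 1 \<and> (\<forall>k. 0 < k \<and> k < T \<longrightarrow> \<omega> ^ k \<noteq> 1)"

definition Gamma_orbit :: "complex \<Rightarrow> complex \<Rightarrow> complex set" where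
  "Gamma_orbit \<omega> z = range (\<lambda>r::nat. \<omega> ^ r * z)"

definition cartan_invariants ::
  "('n::finite, 'i) lie_data \<Rightarrow> complex^'n^'n \<Rightarrow> (complex^'n) set" where
  "cartan_invariants \<gg> V = {x \<in> cartan \<gg>. V *v x = x}"

definition weyl_invariants ::
  "('n::finite, 'i) lie_data \<Rightarrow> complex^'n^'n \<Rightarrow> (complex^'n \<Rightarrow> complex^'n) set" where
  "weyl_invariants \<gg> V = {w \<in> weyl_group \<gg>. \<forall>x\<in>cartan \<gg>. V *v w x = w (V *v x)}"

text \<open>An automorphism \<open>U\<close> of the Lie algebra acts on the adjoint group by conjugation.\<close>

definition fixed_points :: "complex^'n^'n \<Rightarrow> (complex^'n^'n) set \<Rightarrow> (complex^'n^'n) set" where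
  "fixed_points U K = {g \<in> K. U ** g ** matrix_inv U = g}"

definition group_hat :: "complex \<Rightarrow> complex^'n^'n \<Rightarrow> ratfun^'n^'n \<Rightarrow> ratfun^'n^'n" where
  "group_hat \<omega> U Z = const_mat U ** mat_rescale (inverse \<omega>) Z ** const_mat (matrix_inv U)"

text \<open>The scalar factor is the pullback of \<open>dt\<close>.\<close>

definition form_hat :: "complex \<Rightarrow> complex^'n^'n \<Rightarrow> ratfun^'n \<Rightarrow> ratfun^'n" where
  "form_hat \<omega> U A = rat_const (inverse \<omega>) *s (const_mat U *v vec_rescale (inverse \<omega>) A)"

definition inv_points :: "complex \<Rightarrow> complex^'n^'n \<Rightarrow> (complex^'n^'n) set \<Rightarrow> (ratfun^'n^'n) set" where
  "inv_points \<omega> U K = {Z \<in> rat_points K. group_hat \<omega> U Z = Z}"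

definition inv_forms :: "complex \<Rightarrow> complex^'n^'n \<Rightarrow> (complex^'n) set \<Rightarrow> (ratfun^'n) set" where
  "inv_forms \<omega> U S = {A \<in> rat_forms S. form_hat \<omega> U A = A}"

definition varsigma ::
  "('n::finite, 'i) lie_data \<Rightarrow> complex \<Rightarrow> complex^'n^'n \<Rightarrow> complex^'n^'n" where
  "varsigma \<gg> \<omega> V = const_torus \<gg> \<omega> (- rho_check \<gg>) ** V"

definition vartheta ::
  "('n::finite, 'i) lie_data \<Rightarrow> complex \<Rightarrow> complex^'n^'n \<Rightarrow> complex^'n \<Rightarrow> complex^'n^'n" where
  "vartheta \<gg> \<omega> V l0 = const_torus \<gg> \<omega> (- l0) ** varsigma \<gg> \<omega> V"


section \<open>Cyclotomic Miura opers\<close>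

definition cyc_miura_oper ::
  "('n::finite, 'i::finite) lie_data \<Rightarrow> complex \<Rightarrow> complex^'n^'n \<Rightarrow> ratfun^'n \<Rightarrow> bool" where
  "cyc_miura_oper \<gg> \<omega> V A \<longleftrightarrow>
     (\<exists>u \<in> inv_forms \<omega> V (cartan \<gg>). A = const_vec (p_minus \<gg>) + u)"

text \<open>
  Regularity at \<open>x\<close> of the class of the oper \<open>A\<close> modulo the invariant points of \<open>N\<close>: the
  canonical representative, which is unique, has no pole at \<open>x\<close>.
\<close>

definition cyc_oper_regular_at ::
  "('n::finite, 'i::finite) lie_data \<Rightarrow> complex \<Rightarrow> complex^'n^'n \<Rightarrow> ratfun^'n \<Rightarrow> complex \<Rightarrow> bool" where
  "cyc_oper_regular_at \<gg> \<omega> V A x \<longleftrightarrow>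
     (\<exists>c \<in> inv_forms \<omega> (varsigma \<gg> \<omega> V) (p_plus_kernel \<gg>).
        (\<exists>g \<in> inv_points \<omega> (varsigma \<gg> \<omega> V) (grp_N \<gg>).
           gauge_transform \<gg> g A = const_vec (p_minus \<gg>) + c) \<and>
        vec_regular_at c x)"

text \<open>The points, coweights and Weyl group elements are indexed by \<open>1..l\<close> and \<open>1..m\<close>.\<close>

definition cyc_miura_u ::
  "('n::finite, 'i) lie_data \<Rightarrow> nat \<Rightarrow> complex \<Rightarrow> complex^'n^'n \<Rightarrow> complex^'n \<Rightarrow>
   nat \<Rightarrow> (nat \<Rightarrow> complex) \<Rightarrow> (nat \<Rightarrow> complex^'n) \<Rightarrow> (nat \<Rightarrow> complex^'n \<Rightarrow> complex^'n) \<Rightarrow>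
   nat \<Rightarrow> (nat \<Rightarrow> complex) \<Rightarrow> (nat \<Rightarrow> complex^'n \<Rightarrow> complex^'n) \<Rightarrow> ratfun^'n" where
  "cyc_miura_u \<gg> T \<omega> V l0 l z lam w m x y =
     - (1 / rat_t) *s const_vec l0
     - (\<Sum>r<T.
          (\<Sum>i=1..l. (1 / (rat_t - rat_const (\<omega> ^ r * z i))) *s
             const_vec (((*v) V ^^ r) (shifted_action \<gg> (w i) (lam i)))) +
          (\<Sum>j=1..m. (1 / (rat_t - rat_const (\<omega> ^ r * x j))) *s
             const_vec (((*v) V ^^ r) (shifted_action \<gg> (y j) 0))))"

definition MOp_gen ::
  "('n::finite, 'i::finite) lie_data \<Rightarrow> complex \<Rightarrow> complex^'n^'n \<Rightarrow> complex^'n \<Rightarrow>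
   ratfun^'n \<Rightarrow> (ratfun^'n) set" where
  "MOp_gen \<gg> \<omega> V l0 A = {A'. cyc_miura_oper \<gg> \<omega> V A' \<and>
     (\<exists>g \<in> inv_points \<omega> (varsigma \<gg> \<omega> V) (grp_N \<gg>).
        mat_regular_at (regularized_group_elt \<gg> l0 g) 0 \<and> A' = gauge_transform \<gg> g A)}"

definition Y_sol ::
  "('n::finite, 'i) lie_data \<Rightarrow> complex^'n \<Rightarrow> ratfun^'n \<Rightarrow> ratfun^'n^'n \<Rightarrow> ratfun^'n^'n" where
  "Y_sol \<gg> l0 A g = (THE Z. normalized_solution \<gg> (regularized_connection \<gg> l0 (gauge_transform \<gg> g A)) Z)"

end

theory Submission
  imports Defs
begin

text \<open>
  The correspondence is the factorisation of \<open>Y g\<^sub>0\<^sup>-\<^sup>1\<close> in the big cell \<open>N B\<^sub>-\<close>.  If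
  \<open>n = g\<^sub>r\<close> gauges \<open>\<nabla>\<^sub>r\<close> to a connection \<open>\<nabla>'\<^sub>r\<close>, then \<open>n Y n(0)\<^sup>-\<^sup>1\<close> is the normalised
  solution of \<open>\<nabla>'\<^sub>r\<close>; conversely, the lower triangular factor of \<open>Y g\<^sub>0\<^sup>-\<^sup>1\<close> has a lower
  triangular logarithmic derivative, while gauging \<open>p\<^sub>-\<^sub>1 + u\<close> by \<open>N\<close> changes it only in
  degrees \<open>\<ge> 0\<close>, so that the gauged connection is again a Miura oper.  The factorisation exists
  because \<open>Y(0) g\<^sub>0\<^sup>-\<^sup>1\<close> lies in \<open>N\<close>, and it is unique since \<open>N \<inter> B\<^sub>- = 1\<close>; uniqueness also
  yields the invariance under the twisted cyclic action.  Freeness of the action of \<open>N\<close> on opers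
  follows from the injectivity of \<open>ad p\<^sub>-\<^sub>1\<close> in positive degrees.

  Degrees are eigenvalues of \<open>ad \<rho>\<close>; their integrality and the triangular decomposition come from
  the \<open>sl\<^sub>2\<close>-triples spanned by \<open>E\<^sub>i, F\<^sub>i\<close> and the coroots.
\<close>

section \<open>Calculus of rational functions\<close>

text \<open>The definitions give little structure: the Cartan subalgebra is only nilpotent and
  self-normalising, and the groups are generated by exponentials. Two obstacles result. First,
  commutativity of the Cartan subalgebra and the existence of degrees must be derived. Coroots act
  diagonalisably with integer weights, and the Killing form makes \<open>rho\<close> a nonnegative
  combination of them; a vector outside the sum of the triangular parts, of least absolute degree,
  would then have a degree of the wrong sign. Second, rational points are tested pointwise, so N and
  B_- need descriptions by matrix entries: N consists of the automorphisms g with g - 1 raising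
  degrees, and a lower triangular automorphism lies in B_- once it is the identity on the Cartan
  block. This last condition excludes diagram automorphisms and is forced by the value 1 at the
  origin. Freeness is needed because membership of a transformed connection in
  \<open>MOp_gen\<close> only provides some group element with regular regularisation, a priori not
  the given one.\<close>

lemma ratfun_cases:
  obtains p q :: "complex poly" where "f = Fract p q" "q \<noteq> 0"
  by (rule Fract_cases)

lemma quot_Fract:
  fixes p q :: "complex poly"
  assumes "q \<noteq> 0"
  obtains p0 q0 where "quot_of_fract (Fract p q) = (p0, q0)" "q0 \<noteq> 0" "coprime p0 q0" "p * q0 = p0 * q"
proof -
  obtain p0 q0 where *: "quot_of_fract (Fract p q) = (p0, q0)" by force
  have q0: "q0 \<noteq> 0" using snd_quot_of_fract_nonzero[of "Fract p q"] * by simp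
  have "Fract p0 q0 = Fract p q" using Fract_quot_of_fract[of "Fract p q"] * by simp
  hence "p * q0 = p0 * q" using assms q0 by (simp add: eq_fract)
  moreover have "coprime p0 q0" using coprime_quot_of_fract[of "Fract p q"] * by simp
  ultimately show ?thesis using that * q0 by blast
qed

text \<open>Regularity and values are defined through the coprime representative. A zero of its
  denominator would be a common zero of numerator and denominator, so any representative whose
  denominator does not vanish at the point may be used.\<close>

lemma rat_eval_Fract:
  assumes "poly q x \<noteq> 0"
  shows "rat_regular_at (Fract p q) x" "rat_eval (Fract p q) x = poly p x / poly q x"
proof -
  have q: "q \<noteq> 0" using assms by auto
  obtain p0 q0 where *: "quot_of_fract (Fract p q) = (p0, q0)" "q0 \<noteq> 0" "coprime p0 q0" "p * q0 = p0 * q"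
    using quot_Fract[OF q] .
  have e: "poly p x * poly q0 x = poly p0 x * poly q x" using *(4) by (metis poly_mult)
  have r: "poly q0 x \<noteq> 0"
  proof
    assume z: "poly q0 x = 0"
    hence "poly p0 x = 0" using e assms by simp
    hence "[:-x,1:] dvd p0" "[:-x,1:] dvd q0" using z by (auto simp: poly_eq_0_iff_dvd)
    hence "is_unit [:-x,1:]" using *(3) by (meson coprime_common_divisor)
    thus False by (simp add: is_unit_iff_degree)
  qed
  show "rat_regular_at (Fract p q) x" using * r by (simp add: rat_regular_at_def)
  show "rat_eval (Fract p q) x = poly p x / poly q x"
    using * r e assms by (simp add: rat_eval_def field_simps)
qed

lemma rat_regular_atE:
  assumes "rat_regular_at f x"
  obtains p q where "f = Fract p q" "poly q x \<noteq> 0"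
  using assms by (metis rat_regular_at_def Fract_quot_of_fract)

lemma eventually_rat_regular: "\<forall>\<^sub>F x in cofinite. rat_regular_at f x"
  by (simp add: eventually_cofinite rat_regular_at_def poly_roots_finite)

lemma rat_regular_add [intro]:
  assumes "rat_regular_at f x" "rat_regular_at g x"
  shows "rat_regular_at (f + g) x" "rat_eval (f + g) x = rat_eval f x + rat_eval g x"
proof -
  obtain p q p' q' where f: "f = Fract p q" "poly q x \<noteq> 0" and g: "g = Fract p' q'" "poly q' x \<noteq> 0"
    using assms by (metis rat_regular_atE)
  have e: "f + g = Fract (p * q' + p' * q) (q * q')" unfolding f(1) g(1) using f(2) g(2) by (subst add_fract) auto
  have nz: "poly (q * q') x \<noteq> 0" using f g by simp
  show "rat_regular_at (f + g) x" unfolding e by (rule rat_eval_Fract(1)[OF nz])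
  have "rat_eval f x = poly p x / poly q x" "rat_eval g x = poly p' x / poly q' x"
    using f g rat_eval_Fract(2) by metis+
  thus "rat_eval (f + g) x = rat_eval f x + rat_eval g x"
    unfolding e rat_eval_Fract(2)[OF nz] using f(2) g(2) by (simp add: field_simps)
qed

lemma rat_regular_mult [intro]:
  assumes "rat_regular_at f x" "rat_regular_at g x"
  shows "rat_regular_at (f * g) x" "rat_eval (f * g) x = rat_eval f x * rat_eval g x"
proof -
  obtain p q p' q' where f: "f = Fract p q" "poly q x \<noteq> 0" and g: "g = Fract p' q'" "poly q' x \<noteq> 0"
    using assms by (metis rat_regular_atE)
  have e: "f * g = Fract (p * p') (q * q')" unfolding f(1) g(1) using f(2) g(2) by simp
  have nz: "poly (q * q') x \<noteq> 0" using f g by simp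
  show "rat_regular_at (f * g) x" unfolding e by (rule rat_eval_Fract(1)[OF nz])
  have "rat_eval f x = poly p x / poly q x" "rat_eval g x = poly p' x / poly q' x"
    using f g rat_eval_Fract(2) by metis+
  thus "rat_eval (f * g) x = rat_eval f x * rat_eval g x"
    unfolding e rat_eval_Fract(2)[OF nz] using f(2) g(2) by (simp)
qed

lemma rat_regular_inverse [intro]:
  assumes "rat_regular_at f x" "rat_eval f x \<noteq> 0"
  shows "rat_regular_at (inverse f) x" "rat_eval (inverse f) x = inverse (rat_eval f x)"
proof -
  obtain p q where f: "f = Fract p q" "poly q x \<noteq> 0" using assms by (metis rat_regular_atE)
  hence "poly p x \<noteq> 0" using assms by (auto simp: rat_eval_Fract)
  thus "rat_regular_at (inverse f) x" "rat_eval (inverse f) x = inverse (rat_eval f x)"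
    using f by (simp_all add: rat_eval_Fract)
qed

lemma rat_const_Fract: "rat_const c = Fract [:c:] 1"
  by (simp add: rat_const_def to_fract_def)

lemma rat_const [simp, intro]: "rat_regular_at (rat_const c) x" "rat_eval (rat_const c) x = c"
  by (simp_all add: rat_const_Fract rat_eval_Fract)

lemma rat_t [simp, intro]: "rat_regular_at rat_t x" "rat_eval rat_t x = x"
  by (simp_all add: rat_t_def to_fract_def rat_eval_Fract)

lemma rat_const_hom [simp]:
  "rat_const 0 = 0" "rat_const 1 = 1" "rat_const (a + b) = rat_const a + rat_const b"
  "rat_const (a * b) = rat_const a * rat_const b" "rat_const (- a) = - rat_const a"
  "rat_const (a - b) = rat_const a - rat_const b"
  by (simp_all add: rat_const_Fract Zero_fract_def One_fract_def one_pCons mult.commute)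

lemma rat_0 [simp]: "rat_regular_at 0 x" "rat_eval 0 x = 0"
  using rat_const[of 0 x] by simp_all

lemma rat_1 [simp]: "rat_regular_at 1 x" "rat_eval 1 x = 1"
  using rat_const[of 1 x] by simp_all

lemma rat_const_eq_iff [simp]: "rat_const a = rat_const b \<longleftrightarrow> a = b"
  by (metis rat_const(2))

lemma rat_const_sum: "rat_const (sum f S) = (\<Sum>a\<in>S. rat_const (f a))"
  by (induction S rule: infinite_finite_induct) auto

lemma rat_const_inverse [simp]: "rat_const (inverse a) = inverse (rat_const a)"
proof (cases "a = 0")
  case False
  have "rat_const (inverse a) * rat_const a = rat_const 1" using False by (metis rat_const_hom(4) left_inverse)
  thus ?thesis by (metis inverse_unique mult.commute rat_const_hom(2))
qed simp

lemma rat_const_powi: "rat_const (a powi k) = rat_const a powi k"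
proof -
  have "rat_const (a ^ j) = rat_const a ^ j" for a j by (induction j) auto
  thus ?thesis by (simp add: power_int_def)
qed

lemma rat_t_nonzero [simp]: "rat_t \<noteq> 0"
  using rat_t(2)[of 1] by (metis rat_0(2) zero_neq_one)

lemma rat_regular_uminus:
  assumes "rat_regular_at f x"
  shows "rat_regular_at (- f) x" "rat_eval (- f) x = - rat_eval f x"
proof -
  have "- f = rat_const (- 1) * f" by simp
  thus "rat_regular_at (- f) x" "rat_eval (- f) x = - rat_eval f x"
    using rat_regular_mult[OF rat_const(1)[of "- 1" x] assms] rat_const(2)[of "- 1" x] by (simp_all del: rat_const_hom)
qed

lemma rat_regular_diff:
  assumes "rat_regular_at f x" "rat_regular_at g x"
  shows "rat_regular_at (f - g) x" "rat_eval (f - g) x = rat_eval f x - rat_eval g x"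
  using rat_regular_add[OF assms(1) rat_regular_uminus(1)[OF assms(2)]] rat_regular_uminus[OF assms(2)] by simp_all

lemma rat_regular_sum:
  assumes "\<And>a. a \<in> S \<Longrightarrow> rat_regular_at (f a) x"
  shows "rat_regular_at (sum f S) x" "rat_eval (sum f S) x = (\<Sum>a\<in>S. rat_eval (f a) x)"
  using assms by (induction S rule: infinite_finite_induct) (auto simp: rat_regular_add)

lemma rat_regular_prod:
  assumes "\<And>a. a \<in> S \<Longrightarrow> rat_regular_at (f a) x"
  shows "rat_regular_at (prod f S) x" "rat_eval (prod f S) x = (\<Prod>a\<in>S. rat_eval (f a) x)"
  using assms by (induction S rule: infinite_finite_induct) (auto simp: rat_regular_mult)

lemma cofinite_nontrivial: "\<forall>\<^sub>F x::complex in cofinite. P x \<Longrightarrow> \<exists>x. P x"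
  by (metis (mono_tags, lifting) Collect_cong UNIV_def eventually_cofinite infinite_UNIV_char_0)

lemma rat_zeroI:
  assumes "\<forall>\<^sub>F x in cofinite. rat_eval f x = 0"
  shows "f = 0"
proof -
  obtain p q where f: "f = Fract p q" "q \<noteq> 0" by (rule ratfun_cases)
  have "\<forall>\<^sub>F x in cofinite. poly q x \<noteq> 0" using f by (simp add: eventually_cofinite poly_roots_finite)
  with assms have "\<forall>\<^sub>F x in cofinite. poly p x = 0"
    by eventually_elim (auto simp: f rat_eval_Fract)
  hence "finite (UNIV - {x. poly p x = 0})" by (simp add: eventually_cofinite Collect_neg_eq Compl_eq_Diff_UNIV)
  hence "infinite {x. poly p x = 0}" using infinite_UNIV_char_0[where 'a=complex] by (metis finite_Diff2)
  hence "p = 0" using poly_roots_finite by blast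
  thus ?thesis using f by (simp add: Zero_fract_def eq_fract)
qed

text \<open>The bridge from pointwise identities, proved in the complex groups, to identities of
  rational functions; poles are absorbed by the finite exceptional set.\<close>

lemma rat_eqI:
  assumes "\<forall>\<^sub>F x in cofinite. rat_eval f x = rat_eval g x"
  shows "f = g"
proof -
  have "\<forall>\<^sub>F x in cofinite. rat_eval (f - g) x = 0"
    using assms eventually_rat_regular[of f] eventually_rat_regular[of g]
    by eventually_elim (simp add: rat_regular_diff)
  thus ?thesis using rat_zeroI by fastforce
qed

text \<open>The quotient rule is independent of the representative: differentiate the
  cross-multiplied equation \<open>p * q0 = p0 * q\<close>.\<close>

lemma rat_deriv_Fract:
  fixes p q :: "complex poly"
  assumes "q \<noteq> 0"
  shows "rat_deriv (Fract p q) = Fract (pderiv p * q - p * pderiv q) (q * q)"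
proof -
  obtain p0 q0 where *: "quot_of_fract (Fract p q) = (p0, q0)" "q0 \<noteq> 0" "coprime p0 q0" "p * q0 = p0 * q"
    using quot_Fract[OF assms] .
  have d: "pderiv p * q0 + p * pderiv q0 = pderiv p0 * q + p0 * pderiv q"
    using arg_cong[OF *(4), of pderiv] by (simp add: pderiv_mult algebra_simps)
  have "(pderiv p0 * q0 - p0 * pderiv q0) * (q * q) = (pderiv p * q - p * pderiv q) * (q0 * q0)"
    using d *(4) by algebra
  thus ?thesis using * assms by (simp add: rat_deriv_def eq_fract)
qed

lemma rat_deriv_add: "rat_deriv (f + g) = rat_deriv f + rat_deriv g"
proof -
  obtain p q p' q' where f: "f = Fract p q" "q \<noteq> 0" and g: "g = Fract p' q'" "q' \<noteq> 0"
    by (metis ratfun_cases)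
  show ?thesis using f(2) g(2) by (simp add: f(1) g(1) rat_deriv_Fract pderiv_mult pderiv_add eq_fract algebra_simps)
qed

lemma rat_deriv_mult: "rat_deriv (f * g) = rat_deriv f * g + f * rat_deriv g"
proof -
  obtain p q p' q' where f: "f = Fract p q" "q \<noteq> 0" and g: "g = Fract p' q'" "q' \<noteq> 0"
    by (metis ratfun_cases)
  show ?thesis using f(2) g(2) by (simp add: f(1) g(1) rat_deriv_Fract pderiv_mult pderiv_add eq_fract algebra_simps)
qed

lemma rat_deriv_const [simp]: "rat_deriv (rat_const c) = 0"
  by (simp add: rat_const_Fract rat_deriv_Fract Zero_fract_def pderiv_pCons)

lemma rat_deriv_t [simp]: "rat_deriv rat_t = 1"
  by (simp add: rat_t_def to_fract_def rat_deriv_Fract One_fract_def pderiv_pCons one_pCons)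

lemma rat_deriv_0 [simp]: "rat_deriv 0 = 0" using rat_deriv_const[of 0] by simp
lemma rat_deriv_1 [simp]: "rat_deriv 1 = 0" using rat_deriv_const[of 1] by simp

lemma rat_deriv_sum: "rat_deriv (sum f S) = (\<Sum>a\<in>S. rat_deriv (f a))"
  by (induction S rule: infinite_finite_induct) (auto simp: rat_deriv_add)

lemma rat_deriv_inverse: "f \<noteq> 0 \<Longrightarrow> rat_deriv (inverse f) = - rat_deriv f / (f * f)"
proof -
  assume f: "f \<noteq> 0"
  have "rat_deriv f * inverse f + f * rat_deriv (inverse f) = rat_deriv 1"
    using f by (metis rat_deriv_mult right_inverse)
  thus ?thesis using f by (simp add: field_simps) (metis add.commute add_eq_0_iff)
qed

lemma rat_deriv_t_powi: "rat_deriv (rat_t powi k) = rat_const (of_int k) * (1 / rat_t) * rat_t powi k"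
proof -
  have n: "rat_deriv (rat_t ^ j) = rat_const (of_nat j) * (1 / rat_t) * rat_t ^ j" for j
    by (induction j) (auto simp: rat_deriv_mult field_simps)
  show ?thesis
  proof (cases "k \<ge> 0")
    case True thus ?thesis using n[of "nat k"] by (simp add: power_int_def)
  next
    case False
    hence e: "rat_t powi k = inverse (rat_t ^ nat (- k))" by (simp add: power_int_def power_inverse)
    have c: "(of_int k :: complex) = - of_nat (nat (- k))" using False by simp
    show ?thesis unfolding e c by (simp add: rat_deriv_inverse n divide_inverse del: of_nat_nat)
  qed
qed

text \<open>In lowest terms p' q = p q' makes q divide q', which has smaller degree; so q' vanishes,
  and then p' does.\<close>

lemma rat_deriv_zero:
  assumes "rat_deriv f = 0"
  shows "\<exists>c. f = rat_const c"
proof -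
  obtain p q where q: "quot_of_fract f = (p, q)" by force
  have nz: "q \<noteq> 0" and cop: "coprime p q"
    using snd_quot_of_fract_nonzero[of f] coprime_quot_of_fract[of f] q by simp_all
  have f: "f = Fract p q" using Fract_quot_of_fract[of f] q by simp
  have e: "pderiv p * q = p * pderiv q"
    using assms nz by (simp add: f rat_deriv_Fract Zero_fract_def eq_fract)
  hence "q dvd p * pderiv q" by (metis dvd_triv_right)
  hence "q dvd pderiv q" using cop by (simp add: coprime_commute coprime_dvd_mult_right_iff)
  hence q': "pderiv q = 0"
    by (metis degree_pderiv dvd_imp_degree_le diff_less le_zero_eq not_le nz pderiv_eq_0_iff zero_less_one neq0_conv)
  hence "pderiv p = 0" using e nz by simp
  then obtain a b where "p = [:a:]" "q = [:b:]" using q' by (metis pderiv_eq_0_iff degree_eq_zeroE)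
  moreover have "b \<noteq> 0" using nz calculation by auto
  ultimately have "f = rat_const (a / b)" using f by (simp add: rat_const_Fract eq_fract)
  thus ?thesis ..
qed

lemma rat_rescale_Fract:
  fixes p q :: "complex poly"
  assumes "q \<noteq> 0" "c \<noteq> 0"
  shows "rat_rescale c (Fract p q) = Fract (pcompose p [:0, c:]) (pcompose q [:0, c:])"
    "pcompose q [:0, c:] \<noteq> 0"
proof -
  have nz: "pcompose r [:0, c:] \<noteq> 0" if "r \<noteq> 0" for r
    using that assms(2) by (simp add: pcompose_eq_0_iff)
  obtain p0 q0 where *: "quot_of_fract (Fract p q) = (p0, q0)" "q0 \<noteq> 0" "coprime p0 q0" "p * q0 = p0 * q"
    using quot_Fract[OF assms(1)] .
  show "pcompose q [:0, c:] \<noteq> 0" using nz assms by simp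
  show "rat_rescale c (Fract p q) = Fract (pcompose p [:0, c:]) (pcompose q [:0, c:])"
    using * nz assms by (simp add: rat_rescale_def eq_fract) (metis pcompose_mult)
qed

lemma rat_rescale_hom:
  assumes "c \<noteq> 0"
  shows "rat_rescale c (f + g) = rat_rescale c f + rat_rescale c g"
    "rat_rescale c (f * g) = rat_rescale c f * rat_rescale c g"
proof -
  obtain p q p' q' where f: "f = Fract p q" "q \<noteq> 0" and g: "g = Fract p' q'" "q' \<noteq> 0"
    by (metis ratfun_cases)
  show "rat_rescale c (f + g) = rat_rescale c f + rat_rescale c g"
    using f g assms by (simp add: rat_rescale_Fract pcompose_add pcompose_mult)
  show "rat_rescale c (f * g) = rat_rescale c f * rat_rescale c g"
    using f g assms by (simp add: rat_rescale_Fract pcompose_mult)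
qed

lemma rat_rescale_const [simp]: "c \<noteq> 0 \<Longrightarrow> rat_rescale c (rat_const a) = rat_const a"
  by (simp add: rat_const_Fract rat_rescale_Fract one_pCons)

lemma rat_rescale_t: "c \<noteq> 0 \<Longrightarrow> rat_rescale c rat_t = rat_const c * rat_t"
  by (simp add: rat_const_Fract rat_t_def to_fract_def rat_rescale_Fract pcompose_pCons one_pCons)

lemma rat_rescale_0 [simp]: "c \<noteq> 0 \<Longrightarrow> rat_rescale c 0 = 0" using rat_rescale_const[of c 0] by simp
lemma rat_rescale_1 [simp]: "c \<noteq> 0 \<Longrightarrow> rat_rescale c 1 = 1" using rat_rescale_const[of c 1] by simp

lemma rat_rescale_sum: "c \<noteq> 0 \<Longrightarrow> rat_rescale c (sum f S) = (\<Sum>a\<in>S. rat_rescale c (f a))"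
  by (induction S rule: infinite_finite_induct) (auto simp: rat_rescale_hom)

lemma rat_rescale_t_powi:
  assumes "c \<noteq> 0"
  shows "rat_rescale c (rat_t powi k) = rat_const (c powi k) * rat_t powi k"
proof -
  have n: "rat_rescale c (rat_t ^ j) = (rat_const c * rat_t) ^ j" for j
    by (induction j) (auto simp: rat_rescale_hom rat_rescale_t assms)
  have i: "rat_rescale c (inverse f) = inverse (rat_rescale c f)" for f
  proof (cases "f = 0")
    case False
    hence "rat_rescale c (inverse f) * rat_rescale c f = 1" using assms by (simp flip: rat_rescale_hom)
    thus ?thesis by (metis inverse_unique mult.commute)
  qed (simp add: assms)
  show ?thesis
    by (simp add: power_int_def n i power_inverse rat_const_powi[of c k, unfolded power_int_def] power_mult_distrib)
qed

lemma rat_rescale_eval: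
  assumes "c \<noteq> 0" "rat_regular_at f (c * x)"
  shows "rat_regular_at (rat_rescale c f) x" "rat_eval (rat_rescale c f) x = rat_eval f (c * x)"
proof -
  obtain p q where f: "f = Fract p q" "poly q (c * x) \<noteq> 0" using assms by (metis rat_regular_atE)
  hence "q \<noteq> 0" by auto
  hence e: "rat_rescale c f = Fract (pcompose p [:0, c:]) (pcompose q [:0, c:])"
    using f assms by (simp add: rat_rescale_Fract)
  have "poly (pcompose q [:0,c:]) x \<noteq> 0" using f by (simp add: poly_pcompose mult.commute)
  thus "rat_regular_at (rat_rescale c f) x" "rat_eval (rat_rescale c f) x = rat_eval f (c * x)"
    unfolding e using f by (simp_all add: rat_eval_Fract poly_pcompose mult.commute)
qed

lemma rat_deriv_rescale:
  assumes "c \<noteq> 0"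
  shows "rat_deriv (rat_rescale c f) = rat_const c * rat_rescale c (rat_deriv f)"
proof -
  obtain p q where f: "f = Fract p q" "q \<noteq> 0" by (metis ratfun_cases)
  show ?thesis using f assms rat_rescale_Fract(2)[of q c]
    by (simp add: rat_deriv_Fract rat_rescale_Fract rat_const_Fract pderiv_pcompose pderiv_pCons
        pcompose_mult pcompose_diff algebra_simps)
qed

no_notation fps_nth (infixl "$" 75)

section \<open>Matrices of rational functions\<close>

lemma matrix_mult_simps:
  fixes A :: "'a::comm_ring_1^'n^'m" and B :: "'a^'k^'n"
  shows "(- A) ** B = - (A ** B)" "A ** (- B) = - (A ** B)"
    "(A - A') ** B = A ** B - A' ** B" "A ** (B - B') = A ** B - A ** B'"
    "0 ** B = 0" "A ** 0 = (0 :: 'a^'k^'m)"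
  by (simp_all add: matrix_matrix_mult_def vec_eq_iff sum_negf algebra_simps sum_subtractf)

lemma matrix_vector_simps:
  fixes A :: "'a::field^'n^'m"
  shows "(- A) *v x = - (A *v x)" "A *v (- x) = - (A *v x)"
    "(A - A') *v x = A *v x - A' *v x" "A *v (x - x') = A *v x - A *v x'"
    "(A + A') *v x = A *v x + A' *v x" "A *v (x + x') = A *v x + A *v x'"
    "A *v (c *s x) = c *s (A *v x)" "A *v 0 = 0" "0 *v x = (0 :: 'a^'m)"
  by (simp_all add: matrix_vector_mult_def vec_eq_iff sum_negf algebra_simps sum_subtractf sum.distrib sum_distrib_left)

lemma matrix_inv:
  fixes A :: "'a::semiring_1^'n^'m"
  assumes "invertible A"
  shows "A ** matrix_inv A = mat 1" "matrix_inv A ** A = mat 1"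
proof -
  have "\<exists>B. A ** B = mat 1 \<and> B ** A = mat 1" using assms by (simp add: invertible_def)
  hence "A ** matrix_inv A = mat 1 \<and> matrix_inv A ** A = mat 1"
    unfolding matrix_inv_def by (rule someI_ex)
  thus "A ** matrix_inv A = mat 1" "matrix_inv A ** A = mat 1" by simp_all
qed

lemma matrix_inv_unique:
  fixes A :: "'a::field^'n^'n"
  assumes "A ** B = mat 1"
  shows "invertible A" "matrix_inv A = B" "B ** A = mat 1"
proof -
  show *: "B ** A = mat 1" using assms by (simp add: matrix_left_right_inverse)
  show i: "invertible A" using assms * by (auto simp: invertible_def)
  have "matrix_inv A = (B ** A) ** matrix_inv A" by (simp add: *)
  also have "\<dots> = B" using matrix_inv(1)[OF i] by (simp flip: matrix_mul_assoc)
  finally show "matrix_inv A = B" .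
qed

lemma matrix_inv_mult:
  fixes A B :: "'a::field^'n^'n"
  assumes "invertible A" "invertible B"
  shows "invertible (A ** B)" "matrix_inv (A ** B) = matrix_inv B ** matrix_inv A"
proof -
  have "(A ** B) ** (matrix_inv B ** matrix_inv A) = A ** (B ** matrix_inv B) ** matrix_inv A"
    by (simp add: matrix_mul_assoc)
  hence "(A ** B) ** (matrix_inv B ** matrix_inv A) = mat 1" using assms by (simp add: matrix_inv)
  from matrix_inv_unique[OF this] show "invertible (A ** B)" "matrix_inv (A ** B) = matrix_inv B ** matrix_inv A"
    by simp_all
qed

lemma invertible_matrix_inv:
  fixes A :: "'a::field^'n^'n"
  assumes "invertible A"
  shows "invertible (matrix_inv A)" "matrix_inv (matrix_inv A) = A"
  using matrix_inv_unique[OF matrix_inv(2)[OF assms]] by simp_all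

lemma rat_const_of_int: "rat_const (of_int k) = of_int k"
proof -
  have n: "rat_const (of_nat j) = of_nat j" for j by (induction j) auto
  show ?thesis by (cases k) (auto simp: n simp del: of_nat_Suc)
qed

lemma const_mat_hom:
  "const_mat (A ** B) = const_mat A ** const_mat B"
  "const_mat A *v const_vec x = const_vec (A *v x)"
  "const_mat (C + D) = const_mat C + const_mat D"
  "const_mat (C - D) = const_mat C - const_mat D"
  "const_mat (- D) = - const_mat D"
  "const_mat 0 = 0" "const_mat (mat 1) = mat 1"
  by (simp_all add: ext_mat_def ext_vec_def matrix_matrix_mult_def matrix_vector_mult_def vec_eq_iff
      rat_const_sum mat_def mult.commute)

lemma const_vec_hom:
  "const_vec (x + y) = const_vec x + const_vec y"
  "const_vec (x - y) = const_vec x - const_vec y"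
  "const_vec (- x) = - const_vec x"
  "const_vec (c *s x) = rat_const c *s const_vec x" "const_vec 0 = 0"
  by (simp_all add: ext_vec_def vec_eq_iff mult.commute)

lemma const_mat_inv:
  assumes "invertible (A :: complex^'n^'n)"
  shows "invertible (const_mat A)" "matrix_inv (const_mat A) = const_mat (matrix_inv A)"
  using matrix_inv_unique[of "const_mat A" "const_mat (matrix_inv A)"] matrix_inv(1)[OF assms]
  by (simp_all flip: const_mat_hom)

lemma mat_reg_const [simp]: "mat_regular_at (const_mat A) x" "mat_eval (const_mat A) x = A"
  by (simp_all add: mat_regular_at_def mat_eval_def ext_mat_def vec_eq_iff)

lemma vec_reg_const [simp]: "vec_regular_at (const_vec v) x" "vec_eval (const_vec v) x = v"
  by (simp_all add: vec_regular_at_def vec_eval_def ext_vec_def vec_eq_iff)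

lemma mat_reg_mult:
  assumes "mat_regular_at A x" "mat_regular_at B x"
  shows "mat_regular_at (A ** B) x" "mat_eval (A ** B) x = mat_eval A x ** mat_eval B x"
  using assms by (simp_all add: mat_regular_at_def mat_eval_def matrix_matrix_mult_def vec_eq_iff
      rat_regular_sum rat_regular_mult)

lemma mat_reg_vec:
  assumes "mat_regular_at A x" "vec_regular_at v x"
  shows "vec_regular_at (A *v v) x" "vec_eval (A *v v) x = mat_eval A x *v vec_eval v x"
  using assms by (simp_all add: mat_regular_at_def vec_regular_at_def vec_eval_def mat_eval_def
      matrix_vector_mult_def vec_eq_iff rat_regular_sum rat_regular_mult)

lemma mat_reg_add:
  assumes "mat_regular_at A x" "mat_regular_at B x"
  shows "mat_regular_at (A + B) x" "mat_eval (A + B) x = mat_eval A x + mat_eval B x"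
  using assms by (simp_all add: mat_regular_at_def mat_eval_def vec_eq_iff rat_regular_add)

lemma mat_reg_sum:
  assumes "\<And>a. a \<in> S \<Longrightarrow> mat_regular_at (f a) x"
  shows "mat_regular_at (sum f S) x" "mat_eval (sum f S) x = (\<Sum>a\<in>S. mat_eval (f a) x)"
  using assms by (simp_all add: mat_regular_at_def mat_eval_def vec_eq_iff rat_regular_sum)

lemma mat_reg_diff:
  assumes "mat_regular_at A x" "mat_regular_at B x"
  shows "mat_regular_at (A - B) x" "mat_eval (A - B) x = mat_eval A x - mat_eval B x"
  using assms by (simp_all add: mat_regular_at_def mat_eval_def vec_eq_iff rat_regular_diff)

lemma vec_reg_diff:
  assumes "vec_regular_at A x" "vec_regular_at B x"
  shows "vec_regular_at (A - B) x" "vec_eval (A - B) x = vec_eval A x - vec_eval B x"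
  using assms by (simp_all add: vec_regular_at_def vec_eval_def vec_eq_iff rat_regular_diff)

lemma eventually_mat_regular: "\<forall>\<^sub>F x in cofinite. mat_regular_at Z x"
  by (simp add: mat_regular_at_def eventually_all_finite eventually_rat_regular)

lemma eventually_vec_regular: "\<forall>\<^sub>F x in cofinite. vec_regular_at v x"
  by (simp add: vec_regular_at_def eventually_all_finite eventually_rat_regular)

lemma mat_eqI:
  assumes "\<forall>\<^sub>F x in cofinite. mat_eval A x = mat_eval B x"
  shows "A = B"
proof -
  have "A $ i $ j = B $ i $ j" for i j
    by (rule rat_eqI, rule eventually_mono[OF assms]) (simp add: mat_eval_def vec_eq_iff)
  thus ?thesis by (simp add: vec_eq_iff)
qed

lemma vec_eqI:
  assumes "\<forall>\<^sub>F x in cofinite. vec_eval A x = vec_eval B x"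
  shows "A = B"
proof -
  have "A $ i = B $ i" for i
    by (rule rat_eqI, rule eventually_mono[OF assms]) (simp add: vec_eval_def vec_eq_iff)
  thus ?thesis by (simp add: vec_eq_iff)
qed

text \<open>Only finitely many points are poles of a rational matrix, so the regularity clause of
  \<open>rat_points\<close> holds off a finite set anyway.\<close>

lemma rat_points_iff: "Z \<in> rat_points K \<longleftrightarrow> (\<forall>\<^sub>F x in cofinite. mat_eval Z x \<in> K)"
proof -
  have "Z \<in> rat_points K \<longleftrightarrow> (\<forall>\<^sub>F x in cofinite. mat_regular_at Z x \<and> mat_eval Z x \<in> K)"
    by (simp add: rat_points_def eventually_cofinite)
  thus ?thesis using eventually_mat_regular[of Z] by (simp add: eventually_conj_iff)
qed

lemma rat_points_mono: "Z \<in> rat_points K \<Longrightarrow> K \<subseteq> K' \<Longrightarrow> Z \<in> rat_points K'"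
  unfolding rat_points_iff by (erule eventually_mono) auto

lemma rat_points_const: "A \<in> K \<Longrightarrow> const_mat A \<in> rat_points K"
  by (simp add: rat_points_iff)

lemma rat_points_mult:
  assumes "A \<in> rat_points S" "B \<in> rat_points S'" "\<And>a b. a \<in> S \<Longrightarrow> b \<in> S' \<Longrightarrow> a ** b \<in> S''"
  shows "A ** B \<in> rat_points S''"
  using assms(1,2) eventually_mat_regular[of A] eventually_mat_regular[of B] unfolding rat_points_iff
  by eventually_elim (simp add: mat_reg_mult assms(3))

lemma det_reg:
  assumes "mat_regular_at Z x"
  shows "rat_regular_at (det Z) x" "rat_eval (det Z) x = det (mat_eval Z x)"
proof -
  have i: "rat_regular_at (of_int k) x" "rat_eval (of_int k) x = of_int k" for k
    by (simp_all flip: rat_const_of_int)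
  show "rat_regular_at (det Z) x" "rat_eval (det Z) x = det (mat_eval Z x)"
    using assms by (simp_all add: det_def mat_regular_at_def mat_eval_def rat_regular_sum
        rat_regular_mult rat_regular_prod i)
qed

lemma invertible_ratI:
  fixes Z :: "ratfun^'n^'n"
  assumes "mat_regular_at Z x" "invertible (mat_eval Z x)"
  shows "invertible Z"
  using assms det_reg[OF assms(1)] by (metis invertible_det_nz rat_0(2))

text \<open>Cramer's rule. It exhibits the determinant as the only denominator, whence the inverse
  is regular wherever the matrix is regular with invertible value.\<close>

lemma mat_inv_entry:
  fixes A :: "'a::field^'n^'n"
  assumes "det A \<noteq> 0"
  shows "matrix_inv A $ k $ j = det (\<chi> i l. if l = k then mat 1 $ i $ j else A $ i $ l) / det A"
proof -
  have "A *v column j (matrix_inv A) = column j (mat 1)"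
    using matrix_inv(1)[of A] assms invertible_det_nz[of A]
    by (simp add: matrix_vector_mult_def matrix_matrix_mult_def column_def vec_eq_iff)
  hence "column j (matrix_inv A) = (\<chi> k. det (\<chi> i l. if l = k then column j (mat 1) $ i else A $ i $ l) / det A)"
    using cramer[OF assms] by blast
  from arg_cong[OF this, of "\<lambda>v. v $ k"] show ?thesis
    by (simp add: column_def cong: if_cong)
qed

lemma mat_reg_inv:
  fixes Z :: "ratfun^'n^'n"
  assumes r: "mat_regular_at Z x" and "invertible (mat_eval Z x)"
  shows "mat_regular_at (matrix_inv Z) x" "mat_eval (matrix_inv Z) x = matrix_inv (mat_eval Z x)"
proof -
  have nz: "det Z \<noteq> 0" using assms invertible_ratI by (metis invertible_det_nz)
  have nz': "det (mat_eval Z x) \<noteq> 0" using assms by (simp add: invertible_det_nz)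
  have m: "mat_regular_at (\<chi> i l. if l = k then mat 1 $ i $ j else Z $ i $ l) x" for k j
    using r by (simp add: mat_regular_at_def mat_def)
  have e: "rat_regular_at (matrix_inv Z $ k $ j) x \<and> rat_eval (matrix_inv Z $ k $ j) x = matrix_inv (mat_eval Z x) $ k $ j" for k j
  proof -
    have "mat_eval (\<chi> i l. if l = k then mat 1 $ i $ j else Z $ i $ l) x
        = (\<chi> i l. if l = k then mat 1 $ i $ j else mat_eval Z x $ i $ l)"
      by (simp add: mat_eval_def mat_def vec_eq_iff)
    moreover note det_reg[OF m, of k j] det_reg[OF r]
    ultimately show ?thesis
      unfolding mat_inv_entry[OF nz] mat_inv_entry[OF nz'] divide_inverse
      using nz' by (simp add: rat_regular_mult rat_regular_inverse)
  qed
  show "mat_regular_at (matrix_inv Z) x" using e by (simp add: mat_regular_at_def)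
  show "mat_eval (matrix_inv Z) x = matrix_inv (mat_eval Z x)" using e by (simp add: mat_eval_def vec_eq_iff)
qed

lemma rat_points_inv:
  fixes Z :: "ratfun^'n^'n"
  assumes "Z \<in> rat_points S" "\<And>a. a \<in> S \<Longrightarrow> invertible a \<and> matrix_inv a \<in> S'"
  shows "invertible Z" "matrix_inv Z \<in> rat_points S'"
proof -
  have "\<forall>\<^sub>F x in cofinite. mat_regular_at Z x \<and> mat_eval Z x \<in> S"
    using assms(1) eventually_mat_regular[of Z] unfolding rat_points_iff by eventually_elim simp
  thus "invertible Z" using cofinite_nontrivial invertible_ratI assms(2) by blast
  show "matrix_inv Z \<in> rat_points S'"
    using assms(1) eventually_mat_regular[of Z] unfolding rat_points_iff
    by eventually_elim (simp add: mat_reg_inv assms(2))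
qed

lemma mat_deriv_mult: "mat_deriv (A ** B) = mat_deriv A ** B + A ** mat_deriv B"
  by (simp add: mat_deriv_def matrix_matrix_mult_def vec_eq_iff rat_deriv_sum rat_deriv_mult sum.distrib)

lemma mat_deriv_add: "mat_deriv (A + B) = mat_deriv A + mat_deriv B"
  by (simp add: mat_deriv_def vec_eq_iff rat_deriv_add)

lemma mat_deriv_const [simp]: "mat_deriv (const_mat A) = 0"
  by (simp add: mat_deriv_def ext_mat_def vec_eq_iff)

lemma mat_deriv_zero:
  assumes "mat_deriv Z = 0" "mat_regular_at Z x"
  shows "Z = const_mat (mat_eval Z x)"
proof -
  have "Z $ i $ j = rat_const (rat_eval (Z $ i $ j) x)" for i j
  proof -
    have "rat_deriv (Z $ i $ j) = mat_deriv Z $ i $ j" by (simp add: mat_deriv_def)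
    then obtain c where "Z $ i $ j = rat_const c" using rat_deriv_zero assms(1) by auto
    thus ?thesis by simp
  qed
  thus ?thesis by (simp add: vec_eq_iff ext_mat_def mat_eval_def)
qed

lemma mat_deriv_inv:
  fixes Z :: "ratfun^'n^'n"
  assumes "invertible Z"
  shows "mat_deriv (matrix_inv Z) = - (matrix_inv Z ** mat_deriv Z ** matrix_inv Z)"
proof -
  have "mat_deriv (const_mat (mat 1 :: complex^'n^'n)) = 0" by (rule mat_deriv_const)
  hence "mat_deriv (matrix_inv Z ** Z) = 0" by (simp add: matrix_inv[OF assms] const_mat_hom)
  hence "mat_deriv (matrix_inv Z) ** Z = - (matrix_inv Z ** mat_deriv Z)"
    by (simp add: mat_deriv_mult add_eq_0_iff2)
  hence "mat_deriv (matrix_inv Z) ** Z ** matrix_inv Z = - (matrix_inv Z ** mat_deriv Z) ** matrix_inv Z"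
    by simp
  thus ?thesis using matrix_inv[OF assms]
    by (simp add: matrix_mult_simps flip: matrix_mul_assoc)
qed

lemma mat_rescale_mult: "c \<noteq> 0 \<Longrightarrow> mat_rescale c (A ** B) = mat_rescale c A ** mat_rescale c B"
  by (simp add: mat_rescale_def matrix_matrix_mult_def vec_eq_iff rat_rescale_sum rat_rescale_hom)

lemma mat_rescale_vec: "c \<noteq> 0 \<Longrightarrow> vec_rescale c (A *v v) = mat_rescale c A *v vec_rescale c v"
  by (simp add: mat_rescale_def vec_rescale_def matrix_vector_mult_def vec_eq_iff rat_rescale_sum rat_rescale_hom)

lemma mat_rescale_const [simp]: "c \<noteq> 0 \<Longrightarrow> mat_rescale c (const_mat A) = const_mat A"
  by (simp add: mat_rescale_def ext_mat_def vec_eq_iff)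

lemma vec_rescale_const [simp]: "c \<noteq> 0 \<Longrightarrow> vec_rescale c (const_vec A) = const_vec A"
  by (simp add: vec_rescale_def ext_vec_def vec_eq_iff)

lemma vec_rescale_add: "c \<noteq> 0 \<Longrightarrow> vec_rescale c (u + v) = vec_rescale c u + vec_rescale c v"
  by (simp add: vec_rescale_def vec_eq_iff rat_rescale_hom)

lemma mat_rescale_inv:
  fixes Z :: "ratfun^'n^'n"
  assumes "c \<noteq> 0" "invertible Z"
  shows "invertible (mat_rescale c Z)" "matrix_inv (mat_rescale c Z) = mat_rescale c (matrix_inv Z)"
proof -
  have "mat_rescale c (const_mat (mat 1 :: complex^'n^'n)) = const_mat (mat 1)" using assms(1) by (rule mat_rescale_const)
  hence "mat_rescale c Z ** mat_rescale c (matrix_inv Z) = mat 1"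
    using assms by (simp flip: mat_rescale_mult add: matrix_inv const_mat_hom)
  from matrix_inv_unique[OF this] show "invertible (mat_rescale c Z)" "matrix_inv (mat_rescale c Z) = mat_rescale c (matrix_inv Z)"
    by simp_all
qed

lemma mat_rescale_eval:
  assumes "c \<noteq> 0" "mat_regular_at Z (c * x)"
  shows "mat_regular_at (mat_rescale c Z) x" "mat_eval (mat_rescale c Z) x = mat_eval Z (c * x)"
  using assms by (simp_all add: mat_regular_at_def mat_eval_def mat_rescale_def rat_rescale_eval vec_eq_iff)

lemma eventually_cofinite_rescale:
  fixes c :: complex
  assumes "c \<noteq> 0" "\<forall>\<^sub>F x in cofinite. P x"
  shows "\<forall>\<^sub>F x in cofinite. P (c * x)"
proof -
  have "inj ((*) c)" using assms by (auto simp: inj_def)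
  hence "finite ((*) c -` {x. \<not> P x})" using assms by (intro finite_vimageI) (auto simp: eventually_cofinite)
  thus ?thesis by (simp add: eventually_cofinite vimage_def)
qed

lemma rat_points_rescale:
  assumes "c \<noteq> 0" "Z \<in> rat_points S"
  shows "mat_rescale c Z \<in> rat_points S"
  using eventually_cofinite_rescale[OF assms(1) assms(2)[unfolded rat_points_iff]]
    eventually_cofinite_rescale[OF assms(1) eventually_mat_regular[of Z]]
  unfolding rat_points_iff by eventually_elim (simp add: mat_rescale_eval assms)

lemma mat_deriv_rescale:
  assumes "c \<noteq> 0"
  shows "mat_deriv (mat_rescale c Z) = (\<chi> i j. rat_const c * mat_rescale c (mat_deriv Z) $ i $ j)"
  using assms by (simp add: mat_deriv_def mat_rescale_def rat_deriv_rescale)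

section \<open>Polynomials in an operator\<close>

abbreviation clin :: "(complex^'n \<Rightarrow> complex^'m) \<Rightarrow> bool" where
  "clin f \<equiv> Vector_Spaces.linear (*s) (*s) f"

lemma clinI:
  assumes "\<And>x y. f (x + y) = f x + f y" "\<And>c x. f (c *s x) = c *s f x"
  shows "clin f"
  using assms by (simp add: Vector_Spaces.linear_iff vec.vector_space_axioms)

lemmas clin_simps = vec.linear_add vec.linear_scale vec.linear_0 vec.linear_diff vec.linear_neg

text \<open>Horner form of p(f) v. The operator is a function and not a matrix, so that adjoint
  operators can be inserted directly.\<close>

definition poly_op :: "(complex^'n \<Rightarrow> complex^'n) \<Rightarrow> complex poly \<Rightarrow> complex^'n \<Rightarrow> complex^'n" where
  "poly_op f p v = fold_coeffs (\<lambda>a w. a *s v + f w) p 0"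

lemma poly_op_0 [simp]: "poly_op f 0 v = 0"
  by (simp add: poly_op_def)

lemma poly_op_pCons:
  assumes "clin f"
  shows "poly_op f (pCons a p) v = a *s v + f (poly_op f p v)"
  using clin_simps(3)[OF assms]
  by (cases "a = 0"; cases "p = 0") (auto simp: poly_op_def fold_coeffs_pCons_coeff_not_0_eq fold_coeffs_pCons_not_0_0_eq)

lemma poly_op_1 [simp]: "clin f \<Longrightarrow> poly_op f 1 v = v"
  by (simp add: one_pCons poly_op_pCons clin_simps)

lemma poly_op_X: "clin f \<Longrightarrow> poly_op f [:- c, 1:] v = f v - c *s v"
  by (simp add: poly_op_pCons clin_simps)

lemma poly_op_add: "clin f \<Longrightarrow> poly_op f (p + q) v = poly_op f p v + poly_op f q v"
  by (induction p q rule: poly_induct2) (simp_all add: poly_op_pCons clin_simps vec.scale_left_distrib)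

lemma poly_op_smult: "clin f \<Longrightarrow> poly_op f (smult c p) v = c *s poly_op f p v"
  by (induction p) (simp_all add: poly_op_pCons clin_simps vec.scale_right_distrib)

lemma poly_op_mult: "clin f \<Longrightarrow> poly_op f (p * q) v = poly_op f p (poly_op f q v)"
  by (induction p) (simp_all add: poly_op_pCons poly_op_add poly_op_smult)

lemma poly_op_lin:
  assumes "clin f"
  shows "clin (poly_op f p)"
proof (rule clinI)
  show "poly_op f p (x + y) = poly_op f p x + poly_op f p y" for x y
    by (induction p) (simp_all add: poly_op_pCons assms clin_simps vec.scale_right_distrib)
  show "poly_op f p (c *s x) = c *s poly_op f p x" for c x
    by (induction p) (simp_all add: poly_op_pCons assms clin_simps vec.scale_right_distrib mult.commute)
qed

lemma poly_op_sum: "clin f \<Longrightarrow> poly_op f (sum g S) v = (\<Sum>a\<in>S. poly_op f (g a) v)"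
  by (induction S rule: infinite_finite_induct) (simp_all add: poly_op_add)

lemma poly_op_monom:
  assumes "clin f"
  shows "poly_op f (monom c i) v = c *s (f ^^ i) v"
  by (induction i) (simp_all add: monom_Suc monom_0 poly_op_pCons assms clin_simps)

lemma poly_op_stable:
  assumes "clin f" "vec.subspace W" "\<And>x. x \<in> W \<Longrightarrow> f x \<in> W" "v \<in> W"
  shows "poly_op f p v \<in> W"
  by (induction p) (simp_all add: poly_op_pCons assms vec.subspace_add vec.subspace_scale vec.subspace_0)

lemma poly_op_commute:
  assumes "clin f" "clin g" "\<And>x. g (f x) = f (g x)"
  shows "poly_op f p (g v) = g (poly_op f p v)"
  by (induction p) (simp_all add: poly_op_pCons assms clin_simps)

lemma poly_op_dvd:
  assumes "clin f" "poly_op f p v = 0" "p dvd q"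
  shows "poly_op f q v = 0"
  using assms by (metis dvdE mult.commute poly_op_mult clin_simps(3) poly_op_lin)

text \<open>Bezout: some combination of p and q is 1, and it annihilates v.\<close>

lemma poly_op_coprime:
  assumes "clin f" "poly_op f p v = 0" "poly_op f q v = 0" "coprime p q"
  shows "v = 0"
proof -
  obtain r s where "r * p + s * q = gcd p q" by (metis bezout_coefficients_fst_snd)
  hence "poly_op f (r * p + s * q) v = v" using assms by simp
  thus ?thesis using assms by (simp add: poly_op_add poly_op_mult clin_simps(3)[OF poly_op_lin])
qed

text \<open>The iterates v, f v, ..., f^n v are n + 1 vectors in dimension n; a linear relation
  among them is the polynomial.\<close>

lemma poly_op_annihilator_vec:
  fixes f :: "complex^'n \<Rightarrow> complex^'n"
  assumes "clin f"
  shows "\<exists>p. p \<noteq> 0 \<and> poly_op f p v = 0"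
proof (cases "inj_on (\<lambda>i. (f ^^ i) v) {..CARD('n)}")
  case True
  define S where "S = (\<lambda>i. (f ^^ i) v) ` {..CARD('n)}"
  have "card S = Suc CARD('n)" using True by (simp add: S_def card_image)
  hence "\<not> vec.independent S"
    using vec.independent_bound_general[of S] vec.dim_subset[of S UNIV] by (auto simp: vec_dim_card simp del: vec.dim_UNIV)
  moreover have "finite S" by (simp add: S_def)
  ultimately obtain u where u: "\<exists>v\<in>S. u v \<noteq> 0" "(\<Sum>v\<in>S. u v *s v) = 0"
    using vec.dependent_finite by blast
  define p where "p = (\<Sum>i\<le>CARD('n). monom (u ((f ^^ i) v)) i)"
  have "poly_op f p v = (\<Sum>i\<le>CARD('n). u ((f ^^ i) v) *s (f ^^ i) v)"
    by (simp add: p_def poly_op_sum assms poly_op_monom)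
  also have "\<dots> = (\<Sum>v\<in>S. u v *s v)" unfolding S_def by (simp add: sum.reindex[OF True] o_def)
  finally have "poly_op f p v = 0" using u by simp
  moreover have "p \<noteq> 0"
  proof
    assume "p = 0"
    hence "coeff p i = 0" for i by simp
    moreover have "coeff p i = u ((f ^^ i) v)" if "i \<le> CARD('n)" for i
      using that by (simp add: p_def coeff_sum)
    ultimately have "u ((f ^^ i) v) = 0" if "i \<le> CARD('n)" for i using that by metis
    thus False using u(1) by (auto simp: S_def)
  qed
  ultimately show ?thesis by blast
next
  \<comment> \<open>If two iterates coincide, the set of iterates is too small for the dimension
    count, but then X^i - X^j does the job.\<close>
  case False
  then obtain i j where ij: "i \<noteq> j" "(f ^^ i) v = (f ^^ j) v" by (auto simp: inj_on_def)
  have "poly_op f (monom 1 i + monom (- 1) j) v = 0"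
    using ij by (simp add: poly_op_add poly_op_monom assms)
  moreover have "coeff (monom 1 i + monom (- 1) j) i = (1::complex)" using ij by (simp)
  hence "monom 1 i + monom (- 1 :: complex) j \<noteq> 0" by (metis coeff_0 zero_neq_one)
  ultimately show ?thesis by blast
qed

lemma poly_op_annihilator:
  fixes f :: "complex^'n \<Rightarrow> complex^'n"
  assumes "clin f"
  obtains p where "p \<noteq> 0" "\<And>v. poly_op f p v = 0"
proof -
  have ex: "\<forall>i. \<exists>p. p \<noteq> 0 \<and> poly_op f p (axis i 1) = 0" using poly_op_annihilator_vec[OF assms] by blast
  then obtain p where p: "\<And>i. p i \<noteq> 0 \<and> poly_op f (p i) (axis i 1) = 0" using choice[OF ex] by blast
  define q where "q = prod p UNIV"
  have q: "poly_op f q (axis i 1) = 0" for i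
  proof (rule poly_op_dvd[OF assms])
    show "poly_op f (p i) (axis i 1) = 0" using p by blast
    show "p i dvd q" unfolding q_def by (rule dvd_prodI) simp_all
  qed
  have "poly_op f q v = 0" for v
  proof -
    have "v = (\<Sum>i\<in>UNIV. (v $ i) *s axis i 1)" by (simp add: basis_expansion)
    hence "poly_op f q v = (\<Sum>i\<in>UNIV. (v $ i) *s poly_op f q (axis i 1))"
      by (metis (no_types, lifting) sum.cong vec.linear_scale vec.linear_sum poly_op_lin[OF assms])
    thus ?thesis by (simp add: q)
  qed
  moreover have "q \<noteq> 0" using p by (simp add: q_def)
  ultimately show ?thesis using that by blast
qed

text \<open>Strip a linear factor X - c from p. If the quotient still kills v, continue with the
  quotient; otherwise the quotient applied to v is an eigenvector for c. That the eigenvalue is a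
  root of the given polynomial serves later to exclude the eigenvalue 0.\<close>

lemma eigenvector_exists:
  assumes f: "clin f" and W: "vec.subspace W" "\<And>x. x \<in> W \<Longrightarrow> f x \<in> W"
  shows "p \<noteq> 0 \<Longrightarrow> poly_op f p v = 0 \<Longrightarrow> v \<in> W \<Longrightarrow> v \<noteq> 0 \<Longrightarrow>
    \<exists>c w. poly p c = 0 \<and> w \<in> W \<and> w \<noteq> 0 \<and> f w = c *s w"
proof (induction "degree p" arbitrary: p rule: less_induct)
  case less
  show ?case
  proof (cases "degree p = 0")
    case True
    then obtain a where "p = [:a:]" by (metis degree_eq_zeroE)
    thus ?thesis using less by (simp add: poly_op_pCons f clin_simps)
  next
    case False
    then obtain c where c: "poly p c = 0" using alg_closed_imp_poly_has_root by blast
    then obtain q where q: "p = [:- c, 1:] * q" by (metis poly_eq_0_iff_dvd dvdE)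
    have qn: "q \<noteq> 0" using less q by auto
    define w where "w = poly_op f q v"
    have w: "w \<in> W" unfolding w_def by (rule poly_op_stable) (use f W less in auto)
    show ?thesis
    proof (cases "w = 0")
      case True
      have "degree q < degree p" using q qn by (simp add: degree_mult_eq del: mult_pCons_left)
      from less.hyps[OF this qn] show ?thesis using True less w_def q by (metis mult_zero_right poly_mult)
    next
      case False
      have "f w - c *s w = 0" using less.prems(2) unfolding q poly_op_mult[OF f] poly_op_X[OF f] w_def[symmetric] .
      thus ?thesis using False w c by auto
    qed
  qed
qed

lemma eigenvector_in_subspace:
  assumes "clin f" "vec.subspace W" "\<And>x. x \<in> W \<Longrightarrow> f x \<in> W" "W \<noteq> {0}"
  obtains c w where "w \<in> W" "w \<noteq> 0" "f w = c *s w"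
proof -
  obtain v where "v \<in> W" "v \<noteq> 0" using assms vec.subspace_0 by blast
  thus ?thesis using poly_op_annihilator[OF assms(1)] eigenvector_exists[OF assms(1-3)] that by metis
qed

text \<open>Primary decomposition, by Bezout, one factor at a time. The components are polynomials
  in f applied to v, so they inherit eigenvector properties for operators commuting with f.\<close>

lemma poly_op_split:
  assumes f: "clin f" and "finite S"
  shows "\<forall>c\<in>S. \<forall>d\<in>S. c \<noteq> d \<longrightarrow> coprime (p c) (p d) \<Longrightarrow> poly_op f (\<Prod>c\<in>S. p c) v = 0 \<Longrightarrow>
    \<exists>q. v = (\<Sum>c\<in>S. poly_op f (q c) v) \<and> (\<forall>c\<in>S. poly_op f (p c) (poly_op f (q c) v) = 0)"
  using assms(2)
proof (induction S arbitrary: v)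
  case empty
  thus ?case using f by simp
next
  case (insert c S)
  define R where "R = (\<Prod>c\<in>S. p c)"
  have "coprime (p c) R" unfolding R_def using insert by (intro prod_coprime_right) auto
  then obtain r s where rs: "r * p c + s * R = 1"
    by (metis bezout_coefficients_fst_snd coprime_iff_gcd_eq_1)
  have P: "poly_op f (p c * R) v = 0" using insert by (simp add: R_def)
  define v2 where "v2 = poly_op f (r * p c) v"
  have v: "v = v2 + poly_op f (s * R) v"
    using rs f by (metis v2_def poly_op_add poly_op_1)
  have "poly_op f R v2 = poly_op f (r * (p c * R)) v"
    unfolding v2_def by (simp add: poly_op_mult[OF f, symmetric] mult_ac)
  also have "\<dots> = 0" using P f by (simp add: poly_op_mult clin_simps(3)[OF poly_op_lin])
  finally obtain q where q: "v2 = (\<Sum>c\<in>S. poly_op f (q c) v2)" "\<forall>c\<in>S. poly_op f (p c) (poly_op f (q c) v2) = 0"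
    using insert.IH[of v2] insert.prems by (auto simp: R_def)
  have s: "poly_op f (p c) (poly_op f (s * R) v) = 0"
  proof -
    have "poly_op f (p c) (poly_op f (s * R) v) = poly_op f (s * (p c * R)) v"
      by (simp add: poly_op_mult[OF f, symmetric] mult_ac)
    thus ?thesis using P f by (simp add: poly_op_mult clin_simps(3)[OF poly_op_lin])
  qed
  define q' where "q' = (\<lambda>d. if d = c then s * R else q d * (r * p c))"
  have e: "poly_op f (q' d) v = poly_op f (q d) v2" if "d \<in> S" for d
    using that insert.hyps f by (auto simp: q'_def v2_def poly_op_mult)
  have "v = (\<Sum>c\<in>insert c S. poly_op f (q' c) v)"
  proof -
    have "(\<Sum>c\<in>insert c S. poly_op f (q' c) v) = poly_op f (s * R) v + (\<Sum>c\<in>S. poly_op f (q c) v2)"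
      using insert.hyps e by (simp add: q'_def)
    thus ?thesis using v q(1) by (metis add.commute)
  qed
  moreover have "\<forall>d\<in>insert c S. poly_op f (p d) (poly_op f (q' d) v) = 0"
    using s q(2) e by (auto simp: q'_def)
  ultimately show ?case by blast
qed

lemma coprime_no_common_root:
  fixes p q :: "complex poly"
  assumes "p \<noteq> 0" "\<And>c. poly p c = 0 \<Longrightarrow> poly q c \<noteq> 0"
  shows "coprime p q"
proof (rule coprimeI)
  fix d assume d: "d dvd p" "d dvd q"
  show "is_unit d"
  proof (rule ccontr)
    assume n: "\<not> is_unit d"
    have "d \<noteq> 0" using d assms by auto
    hence "degree d > 0" using n is_unit_iff_degree by blast
    then obtain c where "poly d c = 0" using alg_closed_imp_poly_has_root by blast
    thus False using d assms by (metis poly_0 poly_mult mult_zero_left dvdE)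
  qed
qed

lemma coprime_linear:
  fixes c d :: complex
  assumes "c \<noteq> d"
  shows "coprime [:- c, 1:] [:- d, 1:]"
  by (rule coprime_no_common_root) (use assms in \<open>auto simp: add_eq_0_iff2\<close>)

section \<open>Finite-dimensional representations of the three-dimensional simple Lie algebra\<close>

locale sl2_triple =
  fixes E H F :: "complex^'n \<Rightarrow> complex^'n"
  assumes lin: "clin E" "clin H" "clin F"
    and HE: "\<And>v. H (E v) = E (H v) + 2 *s E v"
    and HF: "\<And>v. H (F v) = F (H v) - 2 *s F v"
    and EF: "\<And>v. E (F v) = F (E v) + H v"
begin

lemmas lin_simps = clin_simps[OF lin(1)] clin_simps[OF lin(2)] clin_simps[OF lin(3)]

lemma pow_lin: "clin (E ^^ k)" "clin (F ^^ k)"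
  by (induction k; rule clinI; simp add: lin_simps clin_simps)+

text \<open>From H E = E (H + 2) one gets p(H - 2) E = E p(H).\<close>

lemma shift_E: "poly_op H (pcompose p [:- 2, 1:]) (E v) = E (poly_op H p v)"
proof (induction p)
  case (pCons a p)
  have "poly_op H (pcompose (pCons a p) [:- 2, 1:]) (E v)
      = a *s E v + (H (E (poly_op H p v)) - 2 *s E (poly_op H p v))"
    by (simp add: pcompose_pCons poly_op_add[OF lin(2)] poly_op_mult[OF lin(2)] poly_op_X[OF lin(2)]
        poly_op_pCons[OF lin(2)] lin_simps pCons.IH del: mult_pCons_left)
  thus ?case by (simp add: HE poly_op_pCons[OF lin(2)] lin_simps)
qed (simp add: lin_simps)

text \<open>E raises generalised eigenvalues of H by 2. Choose N such that 2 N is not a difference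
  of two roots of an annihilating polynomial P of H. Then P and its shift by 2 N are coprime and
  both kill E^N v.\<close>

lemma nil_E: "\<exists>N. \<forall>v. (E ^^ N) v = 0"
proof -
  obtain P where P: "P \<noteq> 0" "\<And>v. poly_op H P v = 0" using poly_op_annihilator[OF lin(2)] by blast
  have sh: "\<exists>q. q \<noteq> 0 \<and> poly_op H q ((E ^^ N) v) = 0 \<and> (\<forall>c. poly q c = poly P (c - 2 * of_nat N))" for N v
  proof (induction N)
    case 0 thus ?case using P by auto
  next
    case (Suc N)
    then obtain q where q: "q \<noteq> 0" "poly_op H q ((E ^^ N) v) = 0" "\<forall>c. poly q c = poly P (c - 2 * of_nat N)" by blast
    have "poly_op H (pcompose q [:- 2, 1:]) ((E ^^ Suc N) v) = 0"
      using shift_E[of q "(E ^^ N) v"] q by (simp add: lin_simps)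
    moreover have "pcompose q [:- 2, 1:] \<noteq> 0" using q by (simp add: pcompose_eq_0_iff)
    moreover have "\<forall>c. poly (pcompose q [:- 2, 1:]) c = poly P (c - 2 * of_nat (Suc N))"
      using q(3) by (simp add: poly_pcompose algebra_simps)
    ultimately show ?case by blast
  qed
  define D where "D = (\<lambda>(a, b). a - b) ` ({c. poly P c = 0} \<times> {c. poly P c = 0})"
  have "finite D" using P by (simp add: D_def poly_roots_finite)
  moreover have "infinite (range (\<lambda>N::nat. 2 * complex_of_nat N))"
    by (rule range_inj_infinite) (auto simp: inj_def)
  ultimately obtain N where N: "2 * complex_of_nat N \<notin> D" by (meson finite_subset image_subsetI)
  have "(E ^^ N) v = 0" for v
  proof -
    obtain q where q: "q \<noteq> 0" "poly_op H q ((E ^^ N) v) = 0" "\<forall>c. poly q c = poly P (c - 2 * of_nat N)"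
      using sh by blast
    have "coprime q P"
    proof (rule coprime_no_common_root[OF q(1)])
      fix c assume "poly q c = 0"
      hence "poly P (c - 2 * of_nat N) = 0" using q by simp
      moreover have "2 * of_nat N = c - (c - 2 * of_nat N)" by simp
      ultimately show "poly P c \<noteq> 0" using N unfolding D_def by (force simp: image_iff)
    qed
    thus ?thesis using poly_op_coprime[OF lin(2) q(2) P(2)] by blast
  qed
  thus ?thesis by blast
qed

lemma E_F_power: "E ((F ^^ Suc k) v) = (F ^^ Suc k) (E v) + of_nat (Suc k) *s (F ^^ k) (H v - of_nat k *s v)"
proof (induction k)
  case 0 thus ?case by (simp add: EF)
next
  case (Suc k)
  have HFk: "H ((F ^^ j) w) = (F ^^ j) (H w) - (2 * of_nat j) *s (F ^^ j) w" for j w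
  proof (induction j)
    case (Suc j)
    show ?case unfolding funpow.simps o_apply HF Suc.IH lin_simps by (simp add: vec_eq_iff algebra_simps)
  qed simp
  have "E ((F ^^ Suc (Suc k)) v) = F (E ((F ^^ Suc k) v)) + H ((F ^^ Suc k) v)" by (simp add: EF)
  also have "F (E ((F ^^ Suc k) v)) = (F ^^ Suc (Suc k)) (E v) + of_nat (Suc k) *s (F ^^ Suc k) (H v - of_nat k *s v)"
    unfolding Suc by (simp add: lin_simps)
  also have "H ((F ^^ Suc k) v) = (F ^^ Suc k) (H v - (2 * of_nat (Suc k)) *s v)"
    unfolding HFk using clin_simps[OF pow_lin(2)[of "Suc k"]] by simp
  also have "(F ^^ Suc (Suc k)) (E v) + of_nat (Suc k) *s (F ^^ Suc k) (H v - of_nat k *s v)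
      + (F ^^ Suc k) (H v - (2 * of_nat (Suc k)) *s v)
    = (F ^^ Suc (Suc k)) (E v) + of_nat (Suc (Suc k)) *s (F ^^ Suc k) (H v - of_nat (Suc k) *s v)"
    unfolding clin_simps[OF pow_lin(2)[of "Suc k"]]
    by (simp add: vec_eq_iff algebra_simps)
  finally show ?case .
qed

text \<open>Applying E to F^(k+1) w = 0 leaves (k + 1) F^k (H - k) w = 0, and (H - k) w is again in
  the kernel of E, with one power of F less.\<close>

lemma kernel_F_power:
  "E w = 0 \<Longrightarrow> (F ^^ k) w = 0 \<Longrightarrow> poly_op H (\<Prod>m<k. [:- of_nat m, 1:]) w = 0"
proof (induction k arbitrary: w)
  case 0 thus ?case by (simp add: lin)
next
  case (Suc k)
  define w' where "w' = H w - of_nat k *s w"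
  have "0 = of_nat (Suc k) *s (F ^^ k) w'"
    using E_F_power[of k w] Suc.prems clin_simps(3)[OF pow_lin(2)[of "Suc k"]] lin_simps(3) by (simp add: w'_def)
  moreover have "complex_of_nat (Suc k) \<noteq> 0" by (rule of_nat_neq_0)
  ultimately have "(F ^^ k) w' = 0" by (metis vec.scale_eq_0_iff)
  moreover have "E (H w) = 0" using HE[of w] Suc.prems lin_simps by simp
  hence "E w' = 0" using Suc.prems by (simp add: w'_def lin_simps)
  ultimately have "poly_op H (\<Prod>m<k. [:- of_nat m, 1:]) w' = 0" using Suc.IH by blast
  thus ?case by (simp add: w'_def poly_op_mult[OF lin(2)] flip: poly_op_X[OF lin(2)] del: mult_pCons_right)
qed

text \<open>The Casimir element, normalised to be (H + 1)^2 on the kernel of E; in the irreducible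
  module of highest weight l it is the scalar (l + 1)^2.\<close>

definition casimir :: "complex^'n \<Rightarrow> complex^'n" where
  "casimir v = 4 *s F (E v) + H (H v) + 2 *s H v + v"

lemma casimir_lin: "clin casimir"
  by (rule clinI; simp add: casimir_def lin_simps vec_eq_iff algebra_simps)

lemma casimir_commute: "casimir (E v) = E (casimir v)" "casimir (H v) = H (casimir v)"
  by (simp_all add: casimir_def lin_simps EF HE HF) (simp_all add: vec_eq_iff algebra_simps)

text \<open>The kernel of E is stable under H, and there the Casimir operator is the value at H of
  (X + 1)^2, written \<open>[:1, 2, 1:]\<close>.\<close>

lemma casimir_kernel:
  assumes "E w = 0"
  shows "poly_op casimir q w = poly_op H (pcompose q [:1, 2, 1:]) w"
proof -
  have K: "E (H v) = 0" if "E v = 0" for v using HE[of v] that lin_simps by simp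
  have sub: "vec.subspace {v. E v = 0}" by (auto simp: vec.subspace_def lin_simps)
  have k: "E (poly_op H p w) = 0" for p
    using poly_op_stable[OF lin(2) sub, of w p] assms K by simp
  show ?thesis
  proof (induction q)
    case (pCons a q)
    have h: "poly_op H [:1, 2, 1:] v = H (H v) + 2 *s H v + v" for v
      by (simp add: poly_op_pCons[OF lin(2)] lin_simps vec_eq_iff algebra_simps)
    have "poly_op casimir (pCons a q) w = a *s w + casimir (poly_op H (pcompose q [:1, 2, 1:]) w)"
      by (simp add: poly_op_pCons[OF casimir_lin] pCons.IH)
    also have "casimir (poly_op H (pcompose q [:1, 2, 1:]) w)
        = poly_op H [:1, 2, 1:] (poly_op H (pcompose q [:1, 2, 1:]) w)"
      unfolding h by (simp add: casimir_def k lin_simps)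
    also have "a *s w + \<dots> = poly_op H (pcompose (pCons a q) [:1, 2, 1:]) w"
      by (simp add: pcompose_pCons poly_op_add[OF lin(2)] poly_op_mult[OF lin(2)] poly_op_pCons[OF lin(2), of a]
          lin_simps del: mult_pCons_left)
    finally show ?case .
  qed simp
qed


text \<open>Exchanging E and F and negating H gives a triple of the same kind.\<close>

lemma nil_F: "\<exists>N. \<forall>v. (F ^^ N) v = 0"
proof -
  interpret r: sl2_triple F "\<lambda>v. - H v" E
    by unfold_locales
      (auto intro!: clinI simp: lin lin_simps EF HE HF vec_eq_iff algebra_simps)
  show ?thesis by (rule r.nil_E)
qed

text \<open>On the kernel of E the eigenvalues of H are among 0, ..., M - 1, so those of the Casimir
  operator are among the squares (m + 1)^2. Since it commutes with E, each further factor lowers by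
  one the power of E needed to kill v.\<close>

lemma casimir_poly_nil:
  assumes "\<And>v. (F ^^ M) v = 0" and "(E ^^ k) v = 0"
  shows "poly_op casimir ((\<Prod>m<M. [:- ((of_nat (Suc m)) ^ 2), 1:]) ^ k) v = 0"
  using assms(2)
proof (induction k arbitrary: v)
  case (Suc k)
  define R where "R = (\<Prod>m<M. [:- ((of_nat (Suc m)) ^ 2), 1 :: complex:])"
  have d: "(\<Prod>m<M. [:- of_nat m, 1:]) dvd pcompose R [:1, 2, 1:]"
  proof -
    have "[:1, 2, 1:] - [:(of_nat (Suc m)) ^ 2:] = [:- of_nat m, 1:] * [:of_nat m + 2, 1 :: complex:]" for m
      by (simp add: algebra_simps power2_eq_square)
    hence "pcompose R [:1, 2, 1:] = (\<Prod>m<M. [:- of_nat m, 1:] * [:of_nat m + 2, 1 :: complex:])"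
      unfolding R_def pcompose_prod by (intro prod.cong refl) (simp add: pcompose_pCons)
    thus ?thesis by (simp add: prod.distrib del: mult_pCons_left mult_pCons_right)
  qed
  have "(E ^^ k) (E v) = 0" using Suc.prems by (simp add: funpow_swap1)
  have E: "E ((E ^^ k) v) = 0" using Suc.prems by simp
  have "poly_op H (pcompose R [:1, 2, 1:]) ((E ^^ k) v) = 0"
    using kernel_F_power[OF E assms(1)] d by (rule poly_op_dvd[OF lin(2)])
  hence "poly_op casimir R ((E ^^ k) v) = 0" using casimir_kernel[OF E] by simp
  moreover have "poly_op casimir R ((E ^^ k) v) = (E ^^ k) (poly_op casimir R v)"
    by (induction k) (simp_all add: poly_op_commute[OF casimir_lin lin(1)] casimir_commute)
  ultimately have "poly_op casimir (R ^ k) (poly_op casimir R v) = 0" using Suc.IH by (simp add: R_def)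
  hence "poly_op casimir (R ^ k * R) v = 0" by (simp only: poly_op_mult[OF casimir_lin])
  thus ?case unfolding R_def by (simp only: power_Suc2)
qed (simp add: casimir_lin)

text \<open>On a generalised eigenspace of the Casimir operator the highest weight is determined, so that
  the weights \<open>l, l - 2, \<dots>\<close> obtained on the kernel of \<open>E\<^sup>k\<close> are distinct.\<close>

lemma casimir_component:
  assumes F: "\<And>v. (F ^^ M) v = 0" and l: "l < M"
  shows "poly_op casimir ([:- ((of_nat (Suc l)) ^ 2), 1:] ^ N) v = 0 \<Longrightarrow> (E ^^ k) v = 0 \<Longrightarrow>
    poly_op H (\<Prod>j<k. [:- (of_nat l - 2 * of_nat j), 1:]) v = 0"
proof (induction k arbitrary: v)
  case 0 thus ?case by (simp add: lin)
next
  case (Suc k)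
  define Q where "Q = [:- ((of_nat (Suc l)) ^ 2), 1 :: complex:] ^ N"
  define p where "p = (\<Prod>j<k. [:- (of_nat l - 2 * of_nat (Suc j)), 1 :: complex:])"
  have QE: "poly_op casimir Q (E v) = 0"
    using Suc.prems(1) by (simp add: Q_def poly_op_commute[OF casimir_lin lin(1)] casimir_commute lin_simps)
  have "(E ^^ k) (E v) = 0" using Suc.prems by (simp add: funpow_swap1)
  hence "poly_op H (\<Prod>j<k. [:- (of_nat l - 2 * of_nat j), 1:]) (E v) = 0"
    using Suc.IH QE Q_def by blast
  moreover have "pcompose p [:- 2, 1:] = (\<Prod>j<k. [:- (of_nat l - 2 * of_nat j), 1:])"
    unfolding p_def pcompose_prod by (intro prod.cong refl) (simp add: pcompose_pCons algebra_simps)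
  ultimately have Ew: "E (poly_op H p v) = 0" using shift_E[of p v] by simp
  define w where "w = poly_op H p v"
  have "poly_op casimir Q w = poly_op H p (poly_op casimir Q v)"
    unfolding w_def
    using poly_op_commute[OF lin(2) poly_op_lin[OF casimir_lin], of Q p v]
      poly_op_commute[OF casimir_lin lin(2)] casimir_commute(2) by metis
  hence "poly_op casimir Q w = 0" using Suc.prems(1) by (simp add: Q_def clin_simps(3)[OF poly_op_lin[OF lin(2)]])
  hence 1: "poly_op H (pcompose Q [:1, 2, 1:]) w = 0" using casimir_kernel[of w Q] Ew w_def by simp
  have 2: "poly_op H (\<Prod>m<M. [:- of_nat m, 1:]) w = 0" using kernel_F_power[of w M] Ew F w_def by simp
  define u where "u = poly_op H [:- of_nat l, 1:] w"
  have "pcompose [:- ((of_nat (Suc l)) ^ 2), 1:] [:1, 2, 1:] = [:- of_nat l, 1:] * [:of_nat l + 2, 1 :: complex:]"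
    by (simp add: pcompose_pCons algebra_simps power2_eq_square)
  moreover have "pcompose (a ^ N) b = pcompose a b ^ N" for a b :: "complex poly"
    by (induction N) (simp_all add: pcompose_mult pcompose_1)
  ultimately have Q: "pcompose Q [:1, 2, 1:] = ([:- of_nat l, 1:] * [:of_nat l + 2, 1:]) ^ N"
    unfolding Q_def by metis
  define q where "q = (\<Prod>m\<in>{..<M} - {l}. [:- of_nat m, 1 :: complex:])"
  have "(\<Prod>m<M. [:- of_nat m, 1 :: complex:]) = q * [:- of_nat l, 1:]"
    unfolding q_def using l by (subst prod.remove[of _ l]) (simp_all add: mult.commute del: mult_pCons_left mult_pCons_right)
  hence a: "poly_op H q u = 0" using 2 by (simp add: u_def poly_op_mult[OF lin(2)] del: mult_pCons_left mult_pCons_right)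
  have b: "poly_op H (pcompose Q [:1, 2, 1:]) u = 0"
    unfolding u_def using 1 poly_op_commute[OF lin(2) poly_op_lin[OF lin(2)], of "[:- of_nat l, 1:]"]
      poly_op_commute[OF lin(2) lin(2)] by (metis clin_simps(3)[OF poly_op_lin[OF lin(2)]])
  \<comment> \<open>The polynomial (X + 1)^2 - (l + 1)^2 has the roots l and - l - 2. The second is
    negative, hence not a weight on the kernel of E, and \<open>q\<close> omits the first. So
    \<open>u\<close> is killed by coprime polynomials, which contributes the new factor H -
    l.\<close>
  have "coprime q ([:- of_nat l, 1:] * [:of_nat l + 2, 1:])"
  proof (rule coprime_no_common_root)
    show "q \<noteq> 0" by (simp add: q_def)
    fix c assume "poly q c = 0"
    then obtain m where m: "m \<noteq> l" "c = of_nat m" by (auto simp: q_def poly_prod)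
    have "of_nat (l + m + 2) \<noteq> (0 :: complex)" unfolding of_nat_eq_0_iff by simp
    hence "c + (of_nat l + 2) \<noteq> 0" using m by (simp add: add_ac)
    moreover have "c - of_nat l \<noteq> 0" using m by simp
    moreover have "poly ([:- of_nat l, 1:] * [:of_nat l + 2, 1:]) c = (c - of_nat l) * (c + (of_nat l + 2))"
      by (simp add: algebra_simps)
    ultimately show "poly ([:- of_nat l, 1:] * [:of_nat l + 2, 1:]) c \<noteq> 0" by simp
  qed
  hence "coprime q (pcompose Q [:1, 2, 1:])" unfolding Q by simp
  hence "u = 0" using poly_op_coprime[OF lin(2) a b] by blast
  hence "poly_op H ([:- of_nat l, 1:] * p) v = 0" by (simp add: u_def w_def poly_op_mult[OF lin(2)] del: mult_pCons_left)
  moreover have "[:- of_nat l, 1:] * p = (\<Prod>j<Suc k. [:- (of_nat l - 2 * of_nat j), 1:])"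
    unfolding p_def prod.lessThan_Suc_shift by simp
  ultimately show ?case by simp
qed

text \<open>Complete reducibility is bypassed: v splits into generalised Casimir components, on each
  of which H satisfies a polynomial with the distinct roots l, l - 2, and so on. As \<open>J\<close>
  is a set, the product over it has simple roots.\<close>

theorem H_diagonalisable:
  obtains J :: "int set" where "finite J" "\<And>v. poly_op H (\<Prod>j\<in>J. [:- of_int j, 1:]) v = 0"
proof -
  obtain M where M: "\<And>v. (F ^^ M) v = 0" using nil_F by blast
  obtain N where N: "\<And>v. (E ^^ N) v = 0" using nil_E by blast
  define J where "J = (\<lambda>(l, j). int l - 2 * int j) ` ({..<M} \<times> {..<N})"
  have fin: "finite J" by (simp add: J_def)
  have "poly_op H (\<Prod>j\<in>J. [:- of_int j, 1:]) v = 0" for v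
  proof -
    define Q where "Q = (\<lambda>m. [:- ((of_nat (Suc m)) ^ 2), 1 :: complex:] ^ N)"
    have cop: "\<forall>c\<in>{..<M}. \<forall>d\<in>{..<M}. c \<noteq> d \<longrightarrow> coprime (Q c) (Q d)"
    proof safe
      fix c d :: nat assume cd: "c \<noteq> d"
      have "(complex_of_nat (Suc c))\<^sup>2 \<noteq> (of_nat (Suc d))\<^sup>2"
        unfolding of_nat_power[symmetric] of_nat_eq_iff using cd power_inject_base[of "Suc c" 1 "Suc d"]
        by (metis Suc_inject power2_eq_iff_nonneg zero_le)
      thus "coprime (Q c) (Q d)" unfolding Q_def by (intro coprime_power_left_iff[THEN iffD2] coprime_power_right_iff[THEN iffD2] disjI1 coprime_linear)
    qed
    have "poly_op casimir (\<Prod>m<M. Q m) v = 0"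
      using casimir_poly_nil[OF M N, of v] by (simp add: Q_def prod_power_distrib)
    from poly_op_split[OF casimir_lin _ cop this] obtain q where
      q: "v = (\<Sum>c<M. poly_op casimir (q c) v)" "\<forall>c<M. poly_op casimir (Q c) (poly_op casimir (q c) v) = 0"
      by auto
    have "poly_op H (\<Prod>j\<in>J. [:- of_int j, 1:]) (poly_op casimir (q l) v) = 0" if l: "l < M" for l
    proof (rule poly_op_dvd[OF lin(2)])
      show "poly_op H (\<Prod>j<N. [:- (of_nat l - 2 * of_nat j), 1:]) (poly_op casimir (q l) v) = 0"
        using casimir_component[OF M l _ N] q(2) l by (auto simp: Q_def)
      have "(\<Prod>j<N. [:- (of_nat l - 2 * of_nat j), 1 :: complex:]) = (\<Prod>i\<in>(\<lambda>j. int l - 2 * int j) ` {..<N}. [:- of_int i, 1:])"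
        by (subst prod.reindex) (auto simp: inj_on_def)
      also have "\<dots> dvd (\<Prod>j\<in>J. [:- of_int j, 1:])"
        using l by (intro prod_dvd_prod_subset fin) (auto simp: J_def)
      finally show "(\<Prod>j<N. [:- (of_nat l - 2 * of_nat j), 1 :: complex:]) dvd (\<Prod>j\<in>J. [:- of_int j, 1:])" .
    qed
    hence "(\<Sum>c<M. poly_op H (\<Prod>j\<in>J. [:- of_int j, 1:]) (poly_op casimir (q c) v)) = 0" by simp
    thus ?thesis using q(1) vec.linear_sum[OF poly_op_lin[OF lin(2)]] by metis
  qed
  thus ?thesis using fin that by blast
qed

text \<open>Modulo the stable subspace U, v is a lowest weight vector of a finite-dimensional
  module. Instead of forming a quotient, take the least k with E^k v in U: the commutation relation
  puts a multiple of E^(k-1) v into U, so the factor of that multiple must vanish.\<close>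

lemma weight_mod_subspace:
  assumes U: "vec.subspace U" "\<And>x. x \<in> U \<Longrightarrow> E x \<in> U" "\<And>x. x \<in> U \<Longrightarrow> F x \<in> U"
    and v: "v \<notin> U" "F v \<in> U" "H v = \<mu> *s v"
  shows "\<exists>k::nat. \<mu> = - of_nat k"
proof -
  obtain N where N: "(E ^^ N) v = 0" using nil_E by blast
  define k where "k = (LEAST k. (E ^^ k) v \<in> U)"
  have k: "(E ^^ k) v \<in> U" unfolding k_def using N vec.subspace_0[OF U(1)] by (metis LeastI)
  have "k \<noteq> 0" using k v by (metis funpow_0)
  then obtain m where m: "k = Suc m" by (metis nat.exhaust)
  have nm: "(E ^^ m) v \<notin> U" using not_less_Least[of m "\<lambda>k. (E ^^ k) v \<in> U"] m k_def by auto
  interpret r: sl2_triple F "\<lambda>v. - H v" E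
    by unfold_locales
      (auto intro!: clinI simp: lin lin_simps EF HE HF vec_eq_iff algebra_simps)
  have "F ((E ^^ Suc m) v) = (E ^^ Suc m) (F v) + of_nat (Suc m) *s (E ^^ m) (- H v - of_nat m *s v)"
    by (rule r.E_F_power)
  also have "- H v - of_nat m *s v = (- \<mu> - of_nat m) *s v" by (simp add: v vec_eq_iff algebra_simps)
  finally have "(of_nat (Suc m) * (- \<mu> - of_nat m)) *s (E ^^ m) v = F ((E ^^ Suc m) v) - (E ^^ Suc m) (F v)"
    by (simp add: clin_simps[OF pow_lin(1)] del: funpow.simps) (simp add: vec_eq_iff algebra_simps)
  moreover have "(E ^^ j) w \<in> U" if "w \<in> U" for j w by (induction j) (use that U in auto)
  ultimately have "(of_nat (Suc m) * (- \<mu> - of_nat m)) *s (E ^^ m) v \<in> U"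
    using k m v(2) U by (metis vec.subspace_diff)
  hence "of_nat (Suc m) * (- \<mu> - of_nat m) = 0"
    using nm vec.subspace_scale[OF U(1), of _ "inverse (of_nat (Suc m) * (- \<mu> - of_nat m))"]
    by (metis left_inverse vec.scale_one vec.scale_scale)
  hence "- \<mu> - of_nat m = 0" using of_nat_neq_0[where 'a=complex, of m] by (metis mult_eq_0_iff)
  hence "\<mu> = - of_nat m" by (metis add.inverse_inverse eq_iff_diff_eq_0)
  thus ?thesis ..
qed

end


text \<open>For every polynomial p, B p(A) x = c p(A) x + t p'(A) x. If p annihilates x with least
  degree and t is nonzero, then p' annihilates x too, against minimality. This plays the part of the
  trace argument in Lie's theorem and asks only for one eigenvector of B.\<close>

lemma heisenberg_zero:
  assumes A: "clin A" and B: "clin B" and W: "vec.subspace W" "\<And>w. w \<in> W \<Longrightarrow> A w \<in> W"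
    and AB: "\<And>w. w \<in> W \<Longrightarrow> B (A w) = A (B w) + t *s w"
    and x: "x \<in> W" "x \<noteq> 0" "B x = c *s x"
  shows "t = 0"
proof (rule ccontr)
  assume t: "t \<noteq> 0"
  have D: "B (poly_op A p x) = c *s poly_op A p x + t *s poly_op A (pderiv p) x" for p
  proof (induction p)
    case 0 thus ?case by (simp add: clin_simps(3)[OF B])
  next
    case (pCons a p)
    have w: "poly_op A p x \<in> W" by (rule poly_op_stable[OF A W x(1)])
    show ?case
      by (simp add: poly_op_pCons[OF A] pderiv_pCons poly_op_add[OF A] clin_simps[OF B] clin_simps[OF A]
          AB[OF w] pCons.IH x)
  qed
  obtain p0 where "p0 \<noteq> 0 \<and> poly_op A p0 x = 0" using poly_op_annihilator_vec[OF A] by blast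
  from ex_has_least_nat[where P = "\<lambda>p. p \<noteq> 0 \<and> poly_op A p x = 0" and m = degree, OF this]
  obtain p where p: "p \<noteq> 0" "poly_op A p x = 0"
    and mn: "\<And>q. q \<noteq> 0 \<and> poly_op A q x = 0 \<Longrightarrow> degree p \<le> degree q" by blast
  have "t *s poly_op A (pderiv p) x = 0" using D[of p] p by (simp add: clin_simps(3)[OF B])
  hence z: "poly_op A (pderiv p) x = 0" using t by simp
  show False
  proof (cases "degree p = 0")
    case True
    then obtain a where "p = [:a:]" by (metis degree_eq_zeroE)
    thus False using p x by (simp add: poly_op_pCons[OF A] clin_simps(3)[OF A])
  next
    case False
    hence "pderiv p \<noteq> 0" by (simp add: pderiv_eq_0_iff)
    from mn[of "pderiv p"] this z False show False by (simp add: degree_pderiv)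
  qed
qed

lemma minimal_subspace:
  fixes W0 :: "(complex^'n) set"
  assumes "P W0" "\<And>W. P W \<Longrightarrow> vec.subspace W"
  obtains W where "P W" "W \<subseteq> W0" "\<And>W'. P W' \<Longrightarrow> W' \<subseteq> W \<Longrightarrow> W' = W"
proof -
  from ex_has_least_nat[where P = "\<lambda>W. P W \<and> W \<subseteq> W0" and m = vec.dim and k = W0]
  obtain W where W: "P W" "W \<subseteq> W0" "\<And>W'. P W' \<and> W' \<subseteq> W0 \<Longrightarrow> vec.dim W \<le> vec.dim W'"
    using assms(1) by blast
  have "W' = W" if "P W'" "W' \<subseteq> W" for W'
    using vec.subspace_dim_equal[of W' W] that W assms(2) by blast
  thus ?thesis using that W by blast
qed

lemma span_basis_coords:
  fixes b :: "'n \<Rightarrow> complex^'n"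
  assumes "vec.span (range b) = UNIV"
  shows "invertible (\<chi> r a. b a $ r)"
    and "\<exists>c. x = (\<Sum>a\<in>UNIV. c a *s b a)"
    and "(\<Sum>a\<in>UNIV. c a *s b a) = 0 \<Longrightarrow> c a = 0"
proof -
  let ?P = "\<chi> r a. b a $ r"
  have "columns ?P = range b" by (auto simp: columns_def column_def)
  thus inv: "invertible ?P" using assms matrix_right_invertible_span_columns[of ?P]
    by (metis matrix_inv_unique(1))
  have P: "?P *v v = (\<Sum>a\<in>UNIV. v $ a *s b a)" for v
    by (simp add: matrix_vector_mult_def vec_eq_iff mult.commute)
  have "x = ?P *v (matrix_inv ?P *v x)" by (simp add: matrix_vector_mul_assoc matrix_inv[OF inv])
  thus "\<exists>c. x = (\<Sum>a\<in>UNIV. c a *s b a)" using P by metis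
  assume "(\<Sum>a\<in>UNIV. c a *s b a) = 0"
  hence "?P *v (\<chi> a. c a) = 0" using P by simp
  hence "(\<chi> a. c a) = 0" using matrix_inv(2)[OF inv]
    by (metis matrix_vector_mul_assoc matrix_vector_mul_lid matrix_vector_mult_0_right)
  thus "c a = 0" by (simp add: vec_eq_iff)
qed

section \<open>Structure of semisimple Lie algebras\<close>

locale lie_alg =
  fixes \<gg> :: "('n::finite, 'i::finite) lie_data"
  assumes lie: "lie_algebra \<gg>"
begin

abbreviation br where "br \<equiv> brk \<gg>"

lemma ad_lin: "clin (br x)" "clin (\<lambda>x. br x y)"
  using lie by (auto intro!: clinI simp: lie_algebra_def)

lemma br_simps:
  "br x (y + z) = br x y + br x z" "br x (c *s y) = c *s br x y" "br x 0 = 0"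
  "br x (y - z) = br x y - br x z" "br x (- y) = - br x y"
  "br (y + z) x = br y x + br z x" "br (c *s y) x = c *s br y x" "br 0 x = 0"
  "br (y - z) x = br y x - br z x" "br (- y) x = - br y x"
  using clin_simps[OF ad_lin(1)] clin_simps[OF ad_lin(2)] by simp_all

lemma br_sum:
  "br x (sum f S) = (\<Sum>a\<in>S. br x (f a))" "br (sum f S) x = (\<Sum>a\<in>S. br (f a) x)"
  using vec.linear_sum[OF ad_lin(1)] vec.linear_sum[OF ad_lin(2)] by simp_all

lemma br_self [simp]: "br x x = 0"
  using lie by (simp add: lie_algebra_def)

lemma br_anti: "br x y = - br y x"
proof -
  have "br (x + y) (x + y) = 0" by (rule br_self)
  hence "br x y + br y x = 0" unfolding br_simps by (simp add: add.commute)
  thus ?thesis by (rule eq_neg_iff_add_eq_0[THEN iffD2])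
qed

lemma jacobi: "br x (br y z) = br (br x y) z + br y (br x z)"
proof -
  have "br x (br y z) + br y (br z x) + br z (br x y) = 0" using lie by (simp add: lie_algebra_def)
  moreover have "br y (br z x) = - br y (br x z)" using br_anti[of z x] by (simp add: br_simps)
  moreover have "br z (br x y) = - br (br x y) z" by (rule br_anti)
  ultimately show ?thesis by (simp add: algebra_simps)
qed

lemma gen_base: "S \<subseteq> lie_generated \<gg> S" by (auto simp: lie_generated_def)

lemma gen_subalgebra: "lie_subalgebra \<gg> (lie_generated \<gg> S)"
  unfolding lie_generated_def lie_subalgebra_def by (auto intro!: vec.subspace_Inter)

lemma gen_minimal: "S \<subseteq> S' \<Longrightarrow> lie_subalgebra \<gg> S' \<Longrightarrow> lie_generated \<gg> S \<subseteq> S'"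
  by (auto simp: lie_generated_def)

definition AD :: "complex^'n \<Rightarrow> complex^'n^'n" where "AD x = matrix (br x)"

lemma AD: "AD x *v y = br x y"
  by (simp add: AD_def matrix_works[OF ad_lin(1)])

lemma AD_br: "AD (br x y) = AD x ** AD y - AD y ** AD x"
  by (subst matrix_eq) (simp add: AD matrix_vector_mul_assoc[symmetric] matrix_vector_simps jacobi[of x y])

definition killing where "killing x y = trace (AD x ** AD y)"

lemma killing_invariant: "killing (br x y) z = killing x (br y z)"
proof -
  have "trace (AD y ** AD x ** AD z) = trace (AD x ** AD z ** AD y)"
    using trace_mul_sym[of "AD y" "AD x ** AD z"] by (simp add: matrix_mul_assoc)
  thus ?thesis by (simp add: killing_def AD_br matrix_mult_simps trace_sub matrix_mul_assoc)
qed

end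

locale ss = lie_alg \<gg> for \<gg> :: "('n::finite, 'i::finite) lie_data" +
  assumes ss: "semisimple_data \<gg>"
begin

abbreviation "hh \<equiv> cartan \<gg>"
abbreviation "al \<equiv> sroot \<gg>"
abbreviation "Hc \<equiv> coroot \<gg>"
abbreviation "Eg \<equiv> genE \<gg>"
abbreviation "Fg \<equiv> genF \<gg>"

text \<open>The centre is an abelian, hence solvable, ideal.\<close>

lemma center_trivial:
  assumes "\<And>y. br x y = 0"
  shows "x = 0"
proof -
  define S where "S = {x. \<forall>y. br x y = 0}"
  have sub: "vec.subspace S" by (auto simp: S_def vec.subspace_def br_simps)
  have "lie_ideal \<gg> S"
    unfolding lie_ideal_def
  proof (intro conjI allI ballI sub)
    fix x y assume "y \<in> S"
    hence "br x y = 0" by (subst br_anti) (simp add: S_def)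
    thus "br x y \<in> S" using vec.subspace_0[OF sub] by simp
  qed
  moreover have "{br x y |x y. x \<in> S \<and> y \<in> S} \<subseteq> {0}" by (auto simp: S_def)
  hence "brk_span \<gg> S S \<subseteq> {0}" unfolding brk_span_def by (rule vec.span_minimal) (rule vec.subspace_single_0)
  hence "brk_span \<gg> S S = {0}" unfolding brk_span_def using vec.span_zero by auto
  hence "lie_solvable \<gg> S" unfolding lie_solvable_def by (intro exI[of _ 1]) simp
  ultimately have "S = {0}" using ss by (simp add: semisimple_data_def semisimple_def)
  thus ?thesis using assms by (auto simp: S_def)
qed

lemma cartan: "cartan_subalgebra \<gg> hh"
  using ss by (simp add: semisimple_data_def)

lemma hh_sub: "vec.subspace hh" and hh_br: "x \<in> hh \<Longrightarrow> y \<in> hh \<Longrightarrow> br x y \<in> hh"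
  using cartan unfolding cartan_subalgebra_def lie_subalgebra_def by blast+

lemma hh_normaliser:
  assumes "\<And>y. y \<in> hh \<Longrightarrow> br x y \<in> hh"
  shows "x \<in> hh"
  using cartan assms unfolding cartan_subalgebra_def by blast

lemma chev: "Hc i \<in> hh" "al i (Hc i) = 2" "h \<in> hh \<Longrightarrow> br h (Eg i) = al i h *s Eg i"
  "h \<in> hh \<Longrightarrow> br h (Fg i) = - al i h *s Fg i" "br (Eg i) (Fg j) = (if i = j then Hc i else 0)"
  using ss unfolding semisimple_data_def chevalley_generators_def by blast+

text \<open>Simple roots are given as bare functions. Linearity on the Cartan subalgebra is read off
  from a nonzero root vector, since the bracket is linear.\<close>

lemma al_lin:
  assumes "x \<in> hh" "y \<in> hh"
  shows "al i (x + y) = al i x + al i y" "al i (c *s x) = c * al i x" "al i 0 = 0"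
    "al i (- x) = - al i x"
proof -
  have "is_root \<gg> (al i)" using ss by (simp add: semisimple_data_def simple_roots_def)
  hence "root_space \<gg> (al i) \<noteq> {0}" by (simp add: is_root_def)
  moreover have "0 \<in> root_space \<gg> (al i)" by (simp add: root_space_def br_simps)
  ultimately obtain v where "v \<noteq> 0" "v \<in> root_space \<gg> (al i)" by blast
  then obtain v where v: "v \<noteq> 0" "\<And>h. h \<in> hh \<Longrightarrow> br h v = al i h *s v"
    by (auto simp: root_space_def)
  have u: "a *s v = b *s v \<Longrightarrow> a = b" for a b using v(1) by simp
  show "al i (x + y) = al i x + al i y"
    by (rule u) (simp add: v(2)[symmetric] assms vec.subspace_add[OF hh_sub] br_simps vec.scale_left_distrib)
  show c: "al i (c *s x) = c * al i x" for c
    by (rule u) (simp only: v(2)[symmetric] assms vec.subspace_scale[OF hh_sub] br_simps vec.scale_scale[symmetric])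
  show "al i 0 = 0" using c[of 0] by simp
  show "al i (- x) = - al i x" using c[of "-1"] by simp
qed

lemma al_0: "al i 0 = 0" using al_lin(3)[OF chev(1) chev(1)] .

lemma al_scale: "x \<in> hh \<Longrightarrow> al i (c *s x) = c * al i x" by (rule al_lin(2))

lemma al_sum: "(\<And>a. a \<in> S \<Longrightarrow> f a \<in> hh) \<Longrightarrow> al i (\<Sum>a\<in>S. c a *s f a) = (\<Sum>a\<in>S. c a * al i (f a))"
  by (induction S rule: infinite_finite_induct)
    (simp_all add: al_0 al_scale al_lin(1) vec.subspace_scale[OF hh_sub] vec.subspace_sum[OF hh_sub])

lemma al_indep:
  assumes "\<And>h. h \<in> hh \<Longrightarrow> (\<Sum>i\<in>UNIV. c i * al i h) = 0"
  shows "c i = 0"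
proof -
  have "simple_roots \<gg>" using ss by (simp add: semisimple_data_def)
  hence "\<forall>c. (\<forall>h\<in>hh. (\<Sum>i\<in>UNIV. c i * al i h) = 0) \<longrightarrow> (\<forall>i. c i = 0)"
    unfolding simple_roots_def by (elim conjE)
  thus ?thesis using assms by blast
qed

lemma EF_nonzero: "Eg i \<noteq> 0" "Fg i \<noteq> 0" "Hc i \<noteq> 0"
proof -
  show "Hc i \<noteq> 0" using chev(2)[of i] al_0[of i] by auto
  thus "Eg i \<noteq> 0" "Fg i \<noteq> 0" using chev(5)[of i i] by (auto simp: br_simps)
qed

text \<open>\<open>Hc j\<close> is the bracket of \<open>Eg j\<close> and \<open>Fg j\<close>, whose
  weights cancel. Commutativity of the whole Cartan subalgebra is not yet available.\<close>

lemma H_commute: "br (Hc i) (Hc j) = 0"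
proof -
  have "br (Hc i) (br (Eg j) (Fg j)) = 0"
    by (subst jacobi) (simp add: chev br_simps)
  thus ?thesis by (simp add: chev)
qed

lemma sl2_ad: "sl2_triple (br (Eg i)) (br (Hc i)) (br (Fg i))"
proof
  show "br (Hc i) (br (Eg i) v) = br (Eg i) (br (Hc i) v) + 2 *s br (Eg i) v" for v
    by (subst jacobi) (simp add: chev br_simps)
  show "br (Hc i) (br (Fg i) v) = br (Fg i) (br (Hc i) v) - 2 *s br (Fg i) v" for v
    by (subst jacobi) (simp add: chev br_simps)
  show "br (Eg i) (br (Fg i) v) = br (Fg i) (br (Eg i) v) + br (Hc i) v" for v
    by (subst jacobi) (simp add: chev)
qed (simp_all add: br_simps)

lemma sl2_ad': "sl2_triple (br (Fg i)) (\<lambda>v. - br (Hc i) v) (br (Eg i))"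
proof -
  interpret sl2_triple "br (Eg i)" "br (Hc i)" "br (Fg i)" by (rule sl2_ad)
  show ?thesis
    by unfold_locales (auto intro!: clinI simp: lin lin_simps EF HE HF vec_eq_iff algebra_simps)
qed

text \<open>The commuting operators \<open>br (Hc i)\<close> are diagonalised one after the other.
  The components of a joint eigenvector under the next operator are polynomials in that operator
  applied to it, hence remain eigenvectors for the previous ones.\<close>

lemma joint_eigenvectors_span:
  assumes "finite J"
  shows "vec.span {x. \<forall>i\<in>J. \<exists>k::int. br (Hc i) x = of_int k *s x} = UNIV"
  using assms
proof (induction J)
  case empty thus ?case by simp
next
  case (insert j J)
  let ?V = "\<lambda>J. {x. \<forall>i\<in>J. \<exists>k::int. br (Hc i) x = of_int k *s x}"
  interpret sl2_triple "br (Eg j)" "br (Hc j)" "br (Fg j)" by (rule sl2_ad)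
  obtain K :: "int set" where K: "finite K" "\<And>v. poly_op (br (Hc j)) (\<Prod>k\<in>K. [:- of_int k, 1:]) v = 0"
    using H_diagonalisable by blast
  have "x \<in> vec.span (?V (insert j J))" if x: "x \<in> ?V J" for x
  proof -
    have cop: "\<forall>c\<in>K. \<forall>d\<in>K. c \<noteq> d \<longrightarrow> coprime [:- of_int c, 1:] [:- of_int d, 1 :: complex:]"
      by (simp add: coprime_linear)
    from poly_op_split[OF ad_lin(1) K(1) cop K(2)] obtain q where
      q: "x = (\<Sum>c\<in>K. poly_op (br (Hc j)) (q c) x)"
        "\<forall>c\<in>K. poly_op (br (Hc j)) [:- of_int c, 1:] (poly_op (br (Hc j)) (q c) x) = 0" by blast
    have "poly_op (br (Hc j)) (q c) x \<in> ?V (insert j J)" if c: "c \<in> K" for c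
    proof safe
      have "br (Hc j) (poly_op (br (Hc j)) (q c) x) = of_int c *s poly_op (br (Hc j)) (q c) x"
        using q(2) c by (simp add: poly_op_X[OF ad_lin(1)])
      thus "\<exists>k::int. br (Hc j) (poly_op (br (Hc j)) (q c) x) = of_int k *s poly_op (br (Hc j)) (q c) x" by blast
      fix i assume "i \<in> J"
      then obtain k :: int where k: "br (Hc i) x = of_int k *s x" using x by blast
      have "br (Hc i) (br (Hc j) v) = br (Hc j) (br (Hc i) v)" for v
        by (subst jacobi) (simp add: H_commute br_simps)
      hence "br (Hc i) (poly_op (br (Hc j)) (q c) x) = poly_op (br (Hc j)) (q c) (br (Hc i) x)"
        using poly_op_commute[OF ad_lin(1) ad_lin(1)] by metis
      thus "\<exists>k::int. br (Hc i) (poly_op (br (Hc j)) (q c) x) = of_int k *s poly_op (br (Hc j)) (q c) x"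
        unfolding k clin_simps(2)[OF poly_op_lin[OF ad_lin(1)]] by blast
    qed
    thus ?thesis by (subst q(1)) (intro vec.span_sum vec.span_base)
  qed
  hence "vec.span (?V J) \<subseteq> vec.span (?V (insert j J))" by (intro vec.span_minimal vec.subspace_span) blast
  thus ?case using insert.IH by blast
qed

lemma joint_eigenbasis:
  obtains b :: "'n \<Rightarrow> complex^'n" and n :: "'i \<Rightarrow> 'n \<Rightarrow> int" where
    "vec.span (range b) = UNIV" "\<And>i a. br (Hc i) (b a) = of_int (n i a) *s b a"
proof -
  define V where "V = {x. \<forall>i\<in>UNIV. \<exists>k::int. br (Hc i) x = of_int k *s x}"
  have V: "vec.span V = UNIV" unfolding V_def by (rule joint_eigenvectors_span) simp
  obtain B where B: "B \<subseteq> V" "vec.independent B" "V \<subseteq> vec.span B"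
    by (rule vec.maximal_independent_subset)
  have sB: "vec.span B = UNIV" using B(3) V by (metis UNIV_eq_I vec.span_minimal vec.subspace_span subsetD UNIV_I)
  have "vec.span B = vec.span (UNIV :: (complex^'n) set)" using sB by simp
  from vec.dim_eq_card[OF this B(2)] have "card B = CARD('n)" by (simp add: vec_dim_card del: vec.dim_UNIV)
  moreover have "finite B" using B(2) vec.independent_bound_general by blast
  ultimately obtain b where b: "bij_betw b (UNIV :: 'n set) B"
    using finite_same_card_bij[of "UNIV :: 'n set" B] by auto
  have "range b = B" using b by (simp add: bij_betw_def)
  hence 1: "vec.span (range b) = UNIV" using sB by simp
  have "\<forall>i a. \<exists>k::int. br (Hc i) (b a) = of_int k *s b a"
    using \<open>range b = B\<close> B(1) unfolding V_def by blast
  then obtain n :: "'i \<Rightarrow> 'n \<Rightarrow> int" where "\<And>i a. br (Hc i) (b a) = of_int (n i a) *s b a" by metis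
  thus ?thesis using that 1 by blast
qed

lemma killing_eigenbasis:
  fixes b :: "'n \<Rightarrow> complex^'n"
  assumes b: "vec.span (range b) = UNIV" and x: "\<And>a. br x (b a) = c a *s b a" and y: "\<And>a. br y (b a) = d a *s b a"
  shows "killing x y = (\<Sum>a\<in>UNIV. c a * d a)"
proof -
  define P where "P = (\<chi> r a. b a $ r)"
  have inv: "invertible P" unfolding P_def by (rule span_basis_coords[OF b])
  define D :: "('n \<Rightarrow> complex) \<Rightarrow> complex^'n^'n" where "D = (\<lambda>c. \<chi> r a. if r = a then c a else 0)"
  have e: "AD z = P ** D e ** matrix_inv P" if z: "\<And>a. br z (b a) = e a *s b a" for z e
  proof -
    have "(AD z ** P) $ r $ a = (P ** D e) $ r $ a" for r a
    proof -
      have "(AD z ** P) $ r $ a = (AD z *v b a) $ r"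
        by (simp add: matrix_matrix_mult_def matrix_vector_mult_def P_def)
      thus ?thesis unfolding AD z by (simp add: matrix_matrix_mult_def P_def D_def if_distrib cong: if_cong)
    qed
    hence "AD z ** P = P ** D e" by (simp add: vec_eq_iff)
    hence "AD z ** P ** matrix_inv P = P ** D e ** matrix_inv P" by simp
    thus ?thesis by (simp add: matrix_inv[OF inv] flip: matrix_mul_assoc)
  qed
  have "killing x y = trace (P ** D c ** matrix_inv P ** (P ** D d ** matrix_inv P))"
    unfolding killing_def e[OF x] e[OF y] ..
  also have "P ** D c ** matrix_inv P ** (P ** D d ** matrix_inv P) = P ** (D c ** (matrix_inv P ** P) ** D d ** matrix_inv P)"
    by (simp add: matrix_mul_assoc)
  also have "trace \<dots> = trace (D c ** D d)"
    by (subst trace_mul_sym) (simp add: matrix_inv[OF inv] flip: matrix_mul_assoc)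
  also have "\<dots> = (\<Sum>a\<in>UNIV. c a * d a)"
    by (simp add: trace_def matrix_matrix_mult_def D_def if_distrib[where f="\<lambda>z. z * _"] cong: if_cong)
  finally show ?thesis .
qed

lemma killing_H:
  assumes "y \<in> hh"
  shows "killing (Hc i) y = al i y * killing (Eg i) (Fg i)"
proof -
  have "killing (br (Eg i) (Fg i)) y = killing (Eg i) (br (Fg i) y)" by (rule killing_invariant)
  also have "br (Fg i) y = al i y *s Fg i" by (subst br_anti) (simp add: chev(4)[OF assms] vec_eq_iff)
  also have "killing (Eg i) (al i y *s Fg i) = al i y * killing (Eg i) (Fg i)"
  proof -
    have "AD (c *s x) $ r $ s = c * AD x $ r $ s" for c x r s
      by (simp add: AD_def matrix_def br_simps)
    thus ?thesis by (simp add: killing_def trace_def matrix_matrix_mult_def sum_distrib_left mult_ac)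
  qed
  finally show ?thesis by (simp add: chev)
qed

text \<open>The Gram matrix of the coroots under the Killing form is positive definite with nonpositive
  off-diagonal entries, so that \<open>\<rho>\<close> is a nonnegative combination of coroots.\<close>

lemma coroot_gram:
  fixes b :: "'n \<Rightarrow> complex^'n"
  assumes b: "vec.span (range b) = UNIV" and n: "\<And>i a. br (Hc i) (b a) = of_int (n i a) *s b a"
  obtains wt :: "'i \<Rightarrow> 'i \<Rightarrow> real" where
    "\<And>i k. al i (\<Sum>j\<in>UNIV. of_real (wt k j) *s Hc j) = (if i = k then 1 else 0)"
    "\<And>j. (\<Sum>k\<in>UNIV. wt k j) \<ge> 0"
proof -
  \<comment> \<open>\<open>G\<close> is the Killing form on coroots, a sum of squares because their
    adjoint eigenvalues \<open>n i a\<close> are integers. \<open>q i\<close> will be the value of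
    the Killing form on \<open>Eg i\<close> and \<open>Fg i\<close>; the division by 2 reflects
    \<open>al i (Hc i) = 2\<close>.\<close>
  define G :: "'i \<Rightarrow> 'i \<Rightarrow> real" where "G = (\<lambda>i j. \<Sum>a\<in>UNIV. of_int (n i a) * of_int (n j a))"
  define q :: "'i \<Rightarrow> real" where "q = (\<lambda>i. G i i / 2)"
  have kG: "killing (Hc i) (Hc j) = of_real (G i j)" for i j
    by (subst killing_eigenbasis[OF b n n]) (simp add: G_def)
  have kE: "killing (Eg i) (Fg i) = of_real (q i)" for i
    using killing_H[OF chev(1), of i i] kG[of i i] by (simp add: chev q_def)
  have alH: "al i (Hc j) * of_real (q i) = of_real (G i j)" for i j
    using killing_H[OF chev(1), of i j] kG[of i j] kE[of i] by simp
  have qpos: "q i > 0" for i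
  proof -
    have "G i i \<ge> 0" by (simp add: G_def sum_nonneg)
    moreover have "G i i \<noteq> 0"
    proof
      assume "G i i = 0"
      hence "\<forall>a. n i a = 0" unfolding G_def by (subst (asm) sum_nonneg_eq_0_iff) auto
      hence z: "br (Hc i) (b a) = 0" for a using n[of i a] by simp
      obtain c where c: "Eg i = (\<Sum>a\<in>UNIV. c a *s b a)" using span_basis_coords(2)[OF b] by blast
      have "br (Hc i) (Eg i) = 0" unfolding c by (simp add: br_sum br_simps z)
      thus False using chev(3)[OF chev(1), of i i] EF_nonzero[of i] by (simp add: chev)
    qed
    ultimately show ?thesis by (simp add: q_def)
  qed
  have sq: "(\<Sum>i\<in>UNIV. \<Sum>j\<in>UNIV. s i * G i j * s j) = (\<Sum>a\<in>UNIV. (\<Sum>i\<in>UNIV. s i * of_int (n i a))\<^sup>2)" for s :: "'i \<Rightarrow> real"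
  proof -
    have "(\<Sum>a\<in>UNIV. (\<Sum>i\<in>UNIV. s i * of_int (n i a))\<^sup>2)
        = (\<Sum>a\<in>UNIV. \<Sum>i\<in>UNIV. \<Sum>j\<in>UNIV. s i * of_int (n i a) * (s j * of_int (n j a)))"
      by (simp add: power2_eq_square sum_product)
    also have "\<dots> = (\<Sum>i\<in>UNIV. \<Sum>a\<in>UNIV. \<Sum>j\<in>UNIV. s i * of_int (n i a) * (s j * of_int (n j a)))" by (rule sum.swap)
    also have "\<dots> = (\<Sum>i\<in>UNIV. \<Sum>j\<in>UNIV. \<Sum>a\<in>UNIV. s i * of_int (n i a) * (s j * of_int (n j a)))"
      by (intro sum.cong refl sum.swap)
    also have "\<dots> = (\<Sum>i\<in>UNIV. \<Sum>j\<in>UNIV. s i * G i j * s j)"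
      by (simp add: G_def sum_distrib_left sum_distrib_right mult_ac)
    finally show ?thesis by simp
  qed
  define GM :: "real^'i^'i" where "GM = (\<chi> i j. G i j)"
  have symG: "G i j = G j i" for i j by (simp add: G_def mult.commute)
  have "\<forall>v. GM *v v = 0 \<longrightarrow> v = 0"
  proof (intro allI impI)
    fix v assume v: "GM *v v = 0"
    have "(\<Sum>j\<in>UNIV. G i j * v $ j) = 0" for i
      using arg_cong[OF v, of "\<lambda>w. w $ i"] by (simp add: GM_def matrix_vector_mult_def)
    hence "(\<Sum>i\<in>UNIV. v $ i * (\<Sum>j\<in>UNIV. G i j * v $ j)) = 0" by simp
    hence "(\<Sum>i\<in>UNIV. \<Sum>j\<in>UNIV. v $ i * G i j * v $ j) = 0" by (simp add: sum_distrib_left mult_ac)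
    hence "(\<Sum>a\<in>UNIV. (\<Sum>i\<in>UNIV. v $ i * of_int (n i a))\<^sup>2) = 0" using sq[of "\<lambda>i. v $ i"] by simp
    hence na: "(\<Sum>i\<in>UNIV. v $ i * of_int (n i a)) = 0" for a
      by (subst (asm) sum_nonneg_eq_0_iff) auto
    \<comment> \<open>A kernel vector of the Gram matrix yields a combination of coroots that acts
      by zero on the basis, hence is central, hence zero. Its vanishing Killing pairings with the
      Cartan subalgebra give a linear relation among the simple roots with coefficients
      \<open>v $ i\<close> times \<open>q i\<close>.\<close>
    define H' where "H' = (\<Sum>i\<in>UNIV. of_real (v $ i) *s Hc i)"
    have "br H' (b a) = 0" for a
    proof -
      have "br H' (b a) = (\<Sum>i\<in>UNIV. (of_real (v $ i) * of_int (n i a)) *s b a)"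
        by (simp add: H'_def br_sum br_simps n)
      also have "\<dots> = of_real (\<Sum>i\<in>UNIV. v $ i * of_int (n i a)) *s b a"
        by (simp add: vec.scale_sum_left)
      finally show ?thesis by (simp add: na)
    qed
    hence "br H' y = 0" for y
      using span_basis_coords(2)[OF b, of y] by (auto simp: br_sum br_simps)
    hence H0: "H' = 0" by (rule center_trivial)
    have "(\<Sum>i\<in>UNIV. (of_real (v $ i) * of_real (q i)) * al i y) = 0" if y: "y \<in> hh" for y
    proof -
      have AD0: "AD (\<Sum>i\<in>UNIV. c i *s Hc i) $ r $ s = (\<Sum>i\<in>UNIV. c i * AD (Hc i) $ r $ s)" for c r s
        by (simp add: AD_def matrix_def br_sum br_simps)
      have "killing (\<Sum>i\<in>UNIV. c i *s Hc i) y = (\<Sum>i\<in>UNIV. c i * killing (Hc i) y)" for c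
      proof -
        have "killing (\<Sum>i\<in>UNIV. c i *s Hc i) y = (\<Sum>r\<in>UNIV. \<Sum>s\<in>UNIV. \<Sum>i\<in>UNIV. c i * AD (Hc i) $ r $ s * AD y $ s $ r)"
          by (simp add: killing_def trace_def matrix_matrix_mult_def AD0 sum_distrib_right)
        also have "\<dots> = (\<Sum>r\<in>UNIV. \<Sum>i\<in>UNIV. \<Sum>s\<in>UNIV. c i * AD (Hc i) $ r $ s * AD y $ s $ r)"
          by (intro sum.cong refl sum.swap)
        also have "\<dots> = (\<Sum>i\<in>UNIV. \<Sum>r\<in>UNIV. \<Sum>s\<in>UNIV. c i * AD (Hc i) $ r $ s * AD y $ s $ r)" by (rule sum.swap)
        finally show ?thesis by (simp add: killing_def trace_def matrix_matrix_mult_def sum_distrib_left mult_ac)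
      qed
      from this[of "\<lambda>i. of_real (v $ i)"] have "killing H' y = (\<Sum>i\<in>UNIV. of_real (v $ i) * (al i y * of_real (q i)))"
        unfolding H'_def by (simp add: killing_H[OF y] kE)
      moreover have "killing H' y = 0" unfolding H0 by (simp add: killing_def AD_def trace_def matrix_matrix_mult_def matrix_def br_simps)
      ultimately show ?thesis by (simp add: mult_ac)
    qed
    hence "of_real (v $ i) * complex_of_real (q i) = 0" for i by (rule al_indep)
    hence "v $ i = 0" for i using qpos[of i] by (metis less_irrefl mult_eq_0_iff of_real_eq_0_iff)
    thus "v = 0" by (simp add: vec_eq_iff)
  qed
  hence inv: "invertible GM" by (simp add: invertible_left_inverse matrix_left_invertible_ker)
  \<comment> \<open>The k-th row solves G x = q k e_k, so it lists the coroot coefficients of the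
    k-th fundamental coweight.\<close>
  define wt where "wt = (\<lambda>k j. (matrix_inv GM *v axis k (q k)) $ j)"
  have wt: "(\<Sum>j\<in>UNIV. G i j * wt k j) = (if i = k then q k else 0)" for i k
  proof -
    have e: "GM *v (matrix_inv GM *v axis k (q k)) = axis k (q k)"
      by (simp add: matrix_vector_mul_assoc matrix_inv[OF inv])
    have m: "(\<Sum>j\<in>UNIV. G i j * w $ j) = (GM *v w) $ i" for w
      by (simp add: GM_def matrix_vector_mult_def)
    show ?thesis unfolding wt_def m e by (simp only: axis_def vec_lambda_beta)
  qed
  have 1: "al i (\<Sum>j\<in>UNIV. of_real (wt k j) *s Hc j) = (if i = k then 1 else 0)" for i k
  proof -
    have "al i (\<Sum>j\<in>UNIV. of_real (wt k j) *s Hc j) * of_real (q i)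
        = (\<Sum>j\<in>UNIV. of_real (wt k j) * (al i (Hc j) * of_real (q i)))"
      by (subst al_sum) (simp_all add: chev sum_distrib_left mult_ac)
    also have "\<dots> = of_real (\<Sum>j\<in>UNIV. G i j * wt k j)" unfolding alH by (simp add: mult_ac)
    also have "\<dots> = of_real (if i = k then q i else 0)" unfolding wt by simp
    finally show ?thesis using qpos[of i] by (auto split: if_splits)
  qed
  define r where "r = (\<lambda>j. \<Sum>k\<in>UNIV. wt k j)"
  have r: "(\<Sum>j\<in>UNIV. G i j * r j) = q i" for i
  proof -
    have "(\<Sum>j\<in>UNIV. G i j * r j) = (\<Sum>k\<in>UNIV. \<Sum>j\<in>UNIV. G i j * wt k j)"
      unfolding r_def sum_distrib_left by (rule sum.swap)
    thus ?thesis by (simp add: wt)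
  qed
  \<comment> \<open>For i different from j, \<open>Eg i\<close> is killed by \<open>Fg j\<close>, so
    it is a lowest weight vector for the j-th triple and its weight \<open>al i (Hc j)\<close> is a
    nonpositive integer.\<close>
  have off: "G i j \<le> 0" if "i \<noteq> j" for i j
  proof -
    interpret sl2_triple "br (Eg j)" "br (Hc j)" "br (Fg j)" by (rule sl2_ad)
    have "\<exists>k::nat. al i (Hc j) = - of_nat k"
    proof (rule weight_mod_subspace[where U = "{0}" and v = "Eg i"])
      show "br (Fg j) (Eg i) \<in> {0}" using that by (subst br_anti) (simp add: chev)
      show "br (Hc j) (Eg i) = al i (Hc j) *s Eg i" by (simp add: chev)
    qed (simp_all add: lin_simps EF_nonzero)
    then obtain k :: nat where "al i (Hc j) = - of_nat k" by blast
    hence "complex_of_real (G i j) = of_real (- of_nat k * q i)" using alH[of i j] by simp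
    hence "G i j = - of_nat k * q i" by (simp only: of_real_eq_iff)
    thus ?thesis using qpos[of i] by simp
  qed
  have "r j \<ge> 0" for j
  proof -
    \<comment> \<open>\<open>s\<close> and \<open>p\<close> are the negative and positive parts of
      \<open>r\<close>. Pair G r = q with s: s G s is a sum of squares, and s G p is nonnegative
      since s and p have disjoint supports and off-diagonal entries are nonpositive. But s paired
      with the positive vector q is nonpositive, which forces s = 0.\<close>
    define s where "s = (\<lambda>i. min (r i) 0)"
    define p where "p = (\<lambda>i. max (r i) 0)"
    have rsp: "r i = s i + p i" "s i \<le> 0" "p i \<ge> 0" "s i * p i = 0" for i by (auto simp: s_def p_def min_def max_def)
    have np: "(\<Sum>i\<in>UNIV. \<Sum>j\<in>UNIV. s i * G i j * s j) \<ge> 0" unfolding sq by (simp add: sum_nonneg)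
    have pp: "(\<Sum>i\<in>UNIV. \<Sum>j\<in>UNIV. s i * G i j * p j) \<ge> 0"
    proof (intro sum_nonneg)
      fix i j
      show "s i * G i j * p j \<ge> 0"
      proof (cases "i = j")
        case True thus ?thesis using rsp(4)[of j] by (auto simp: mult_ac)
      next
        case False thus ?thesis using off[OF False] rsp by (simp add: mult_nonpos_nonpos)
      qed
    qed
    have "(\<Sum>i\<in>UNIV. s i * q i) = (\<Sum>i\<in>UNIV. s i * (\<Sum>j\<in>UNIV. G i j * r j))" by (simp add: r)
    also have "\<dots> = (\<Sum>i\<in>UNIV. \<Sum>j\<in>UNIV. s i * G i j * s j) + (\<Sum>i\<in>UNIV. \<Sum>j\<in>UNIV. s i * G i j * p j)"
      by (simp add: sum_distrib_left rsp(1) algebra_simps sum.distrib)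
    also have "\<dots> \<ge> 0" using np pp by simp
    finally have ge: "(\<Sum>i\<in>UNIV. s i * q i) \<ge> 0" .
    have le: "s i * q i \<le> 0" for i using rsp(2)[of i] qpos[of i] by (simp add: mult_nonpos_nonneg)
    have "(\<Sum>i\<in>UNIV. - (s i * q i)) = 0" using ge sum_nonpos[of UNIV "\<lambda>i. s i * q i"] le by (simp add: sum_negf)
    hence "- (s j * q j) = 0" using le by (subst (asm) sum_nonneg_eq_0_iff) auto
    hence "s j = 0" using qpos[of j] by simp
    thus ?thesis using rsp by simp
  qed
  thus ?thesis using that 1 r_def by blast
qed

end


section \<open>Common eigenvectors of the Cartan subalgebra, known so far only to be
  nilpotent\<close>

context ss
begin

text \<open>The lower central series of the Cartan subalgebra.\<close>

definition lcs :: "nat \<Rightarrow> (complex^'n) set" where "lcs k = (brk_span \<gg> hh ^^ k) hh"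

lemma lcs_0 [simp]: "lcs 0 = hh" and lcs_Suc: "lcs (Suc k) = brk_span \<gg> hh (lcs k)"
  by (simp_all add: lcs_def)

lemma lcs_br: "x \<in> hh \<Longrightarrow> y \<in> lcs k \<Longrightarrow> br x y \<in> lcs (Suc k)"
  unfolding lcs_Suc brk_span_def by (rule vec.span_base) blast

lemma lcs_hh: "lcs k \<subseteq> hh"
proof (induction k)
  case (Suc k)
  show ?case unfolding lcs_Suc brk_span_def
    by (rule vec.span_minimal) (use Suc hh_br hh_sub in auto)
qed simp

lemma lcs_nil: obtains K where "lcs K = {0}"
  using cartan unfolding cartan_subalgebra_def lie_nilpotent_def lcs_def by blast

lemma ad_pow_lcs: "x \<in> hh \<Longrightarrow> y \<in> hh \<Longrightarrow> (br x ^^ k) y \<in> lcs k"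
  by (induction k) (simp_all add: lcs_br)

definition stable :: "(complex^'n) set \<Rightarrow> bool" where
  "stable W \<longleftrightarrow> vec.subspace W \<and> (\<forall>y\<in>hh. \<forall>x\<in>W. br y x \<in> W)"

lemma stableD: "stable W \<Longrightarrow> vec.subspace W" "stable W \<Longrightarrow> y \<in> hh \<Longrightarrow> x \<in> W \<Longrightarrow> br y x \<in> W"
  by (auto simp: stable_def)

text \<open>Lie's theorem for the nilpotent algebra \<open>hh\<close>. On a minimal stable subspace
  every element of the lower central series acts by a scalar, by induction from its last term
  upwards: for y in the next larger term, brackets of y with \<open>hh\<close> act by scalars, and
  these are 0 by \<open>heisenberg_zero\<close>. So an eigenspace of y is stable, and minimality
  makes it everything.\<close>

lemma common_eigenvector:
  assumes "stable W" "W \<noteq> {0}"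
  obtains x where "x \<in> W" "x \<noteq> 0" "\<And>y. y \<in> hh \<Longrightarrow> \<exists>c. br y x = c *s x"
proof -
  obtain W1 where W1: "stable W1 \<and> W1 \<noteq> {0}" "W1 \<subseteq> W"
    and mn: "\<And>W'. stable W' \<and> W' \<noteq> {0} \<Longrightarrow> W' \<subseteq> W1 \<Longrightarrow> W' = W1"
    by (rule minimal_subspace[where P = "\<lambda>W. stable W \<and> W \<noteq> {0}" and ?W0.0 = W]) (use assms stableD in auto)
  have sub: "vec.subspace W1" and st: "\<And>y x. y \<in> hh \<Longrightarrow> x \<in> W1 \<Longrightarrow> br y x \<in> W1"
    using W1 stableD by blast+
  obtain K where K: "lcs K = {0}" by (rule lcs_nil)
  have sc: "k \<le> K \<Longrightarrow> \<forall>y\<in>lcs (K - k). \<exists>c. \<forall>x\<in>W1. br y x = c *s x" for k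
  proof (induction k)
    case 0
    have "\<forall>x\<in>W1. br 0 x = 0 *s x" by (simp add: br_simps)
    thus ?case using K by auto
  next
    case (Suc k)
    show ?case
    proof
      fix y assume y: "y \<in> lcs (K - Suc k)"
      hence yh: "y \<in> hh" using lcs_hh by blast
      obtain c x0 where x0: "x0 \<in> W1" "x0 \<noteq> 0" "br y x0 = c *s x0"
        by (rule eigenvector_in_subspace[OF ad_lin(1)[of y] sub]) (use W1 st yh in auto)
      define U where "U = {x \<in> W1. br y x = c *s x}"
      have "stable U"
        unfolding stable_def
      proof (intro conjI ballI)
        show "vec.subspace U" unfolding U_def vec.subspace_def
          using sub by (auto simp: vec.subspace_def br_simps vec.scale_right_distrib mult.commute)
        fix y' x assume y': "y' \<in> hh" and x: "x \<in> U"
        have "br y' y \<in> lcs (K - k)"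
          using lcs_br[OF y' y] Suc.prems by (simp add: Suc_diff_Suc)
        then obtain s where s: "\<forall>x\<in>W1. br (br y' y) x = s *s x" using Suc by auto
        have com: "br y (br y' v) = br y' (br y v) + (- s) *s v" if "v \<in> W1" for v
          using jacobi[of y' y v] s that by (simp add: algebra_simps)
        have "- s = 0"
          by (rule heisenberg_zero[OF ad_lin(1)[of y'] ad_lin(1)[of y] sub _ com x0]) (use st y' in auto)
        hence "br y (br y' x) = c *s br y' x" using com[of x] x by (simp add: U_def br_simps)
        thus "br y' x \<in> U" using x st y' by (simp add: U_def)
      qed
      moreover have "U \<noteq> {0}" "U \<subseteq> W1" using x0 by (auto simp: U_def)
      ultimately have "U = W1" using mn by blast
      thus "\<exists>c. \<forall>x\<in>W1. br y x = c *s x" unfolding U_def by blast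
    qed
  qed
  have "\<forall>y\<in>hh. \<exists>c. \<forall>x\<in>W1. br y x = c *s x" using sc[of K] by simp
  moreover obtain x where "x \<in> W1" "x \<noteq> 0" using W1(1) vec.subspace_0[OF sub] by blast
  ultimately show ?thesis using that[of x] W1(2) by blast
qed

lemma weight_integral:
  assumes x: "x \<noteq> 0" "\<And>y. y \<in> hh \<Longrightarrow> \<exists>c. br y x = c *s x"
  obtains k :: "'i \<Rightarrow> int" where "\<And>y. y \<in> hh \<Longrightarrow> br y x = (\<Sum>i\<in>UNIV. of_int (k i) * al i y) *s x"
    "(\<forall>i. k i \<ge> 0) \<or> (\<forall>i. k i \<le> 0)"
proof -
  obtain \<beta> where \<beta>: "\<And>y. y \<in> hh \<Longrightarrow> br y x = \<beta> y *s x" using x(2) by metis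
  show ?thesis
  proof (cases "\<forall>y\<in>hh. \<beta> y = 0")
    case True thus ?thesis using \<beta> by (intro that[of "\<lambda>_. 0"]) auto
  next
    case False
    have "x \<in> root_space \<gg> \<beta>" using \<beta> by (simp add: root_space_def)
    hence "is_root \<gg> \<beta>" using False x(1) by (auto simp: is_root_def)
    moreover have "simple_roots \<gg>" using ss by (simp add: semisimple_data_def)
    hence "\<forall>\<beta>. is_root \<gg> \<beta> \<longrightarrow> (\<exists>k :: 'i \<Rightarrow> nat. (\<forall>h\<in>hh. \<beta> h = (\<Sum>i\<in>UNIV. of_nat (k i) * al i h)) \<or>
        (\<forall>h\<in>hh. \<beta> h = - (\<Sum>i\<in>UNIV. of_nat (k i) * al i h)))"
      unfolding simple_roots_def by (elim conjE)
    ultimately obtain k :: "'i \<Rightarrow> nat" where "(\<forall>h\<in>hh. \<beta> h = (\<Sum>i\<in>UNIV. of_nat (k i) * al i h)) \<or>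
        (\<forall>h\<in>hh. \<beta> h = - (\<Sum>i\<in>UNIV. of_nat (k i) * al i h))" by blast
    thus ?thesis
    proof
      assume "\<forall>h\<in>hh. \<beta> h = (\<Sum>i\<in>UNIV. of_nat (k i) * al i h)"
      thus ?thesis using \<beta> by (intro that[of "\<lambda>i. int (k i)"]) auto
    next
      assume "\<forall>h\<in>hh. \<beta> h = - (\<Sum>i\<in>UNIV. of_nat (k i) * al i h)"
      thus ?thesis using \<beta> by (intro that[of "\<lambda>i. - int (k i)"]) (auto simp: sum_negf)
    qed
  qed
qed

text \<open>On \<open>hh\<close> the operator \<open>br (Hc i)\<close> is nilpotent, by the lower
  central series, and it is annihilated by a polynomial with simple roots; together these make it
  vanish there.\<close>

lemma H_central:
  assumes y: "y \<in> hh"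
  shows "br (Hc i) y = 0"
proof -
  interpret sl2_triple "br (Eg i)" "br (Hc i)" "br (Fg i)" by (rule sl2_ad)
  obtain J :: "int set" where J: "finite J" "\<And>v. poly_op (br (Hc i)) (\<Prod>j\<in>J. [:- of_int j, 1:]) v = 0"
    using H_diagonalisable by blast
  obtain K where K: "lcs K = {0}" by (rule lcs_nil)
  have "(br (Hc i) ^^ K) y = 0" using ad_pow_lcs[OF chev(1)[of i] y, of K] K by simp
  hence "poly_op (br (Hc i)) ([:0, 1:] ^ K) y = 0"
    using poly_op_monom[OF ad_lin(1)[of "Hc i"], of 1 K y] by (simp add: monom_altdef)
  hence "poly_op (br (Hc i)) ([:0, 1:] ^ K * [:0, 1:]) y = 0" by (rule poly_op_dvd[OF ad_lin(1)]) (rule dvd_triv_left)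
  hence 1: "poly_op (br (Hc i)) ([:0, 1:] ^ K) (br (Hc i) y) = 0"
    by (simp only: poly_op_mult[OF ad_lin(1)]) (simp add: poly_op_pCons[OF ad_lin(1)] br_simps)
  define q where "q = (\<Prod>j\<in>J - {0}. [:- of_int j, 1 :: complex:])"
  have "(\<Prod>j\<in>J. [:- of_int j, 1 :: complex:]) dvd q * [:0, 1:]"
  proof (cases "0 \<in> J")
    case True thus ?thesis unfolding q_def using J by (subst prod.remove[of _ 0]) (simp_all add: mult.commute del: mult_pCons_left mult_pCons_right)
  next
    case False thus ?thesis unfolding q_def by (simp del: mult_pCons_left mult_pCons_right)
  qed
  hence "poly_op (br (Hc i)) (q * [:0, 1:]) y = 0" using poly_op_dvd[OF ad_lin(1) J(2)] by blast
  hence 2: "poly_op (br (Hc i)) q (br (Hc i) y) = 0"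
    by (simp only: poly_op_mult[OF ad_lin(1)]) (simp add: poly_op_pCons[OF ad_lin(1)] br_simps)
  have "coprime q ([:0, 1:] ^ K)"
    by (rule coprime_no_common_root) (auto simp: q_def J poly_prod)
  thus ?thesis using poly_op_coprime[OF ad_lin(1) 2 1] by blast
qed

section \<open>The subalgebras n_+ and n_- and their sum with the Cartan subalgebra\<close>

lemma subalgebra_sub: "lie_subalgebra \<gg> S \<Longrightarrow> vec.subspace S"
  and subalgebra_br: "lie_subalgebra \<gg> S \<Longrightarrow> x \<in> S \<Longrightarrow> y \<in> S \<Longrightarrow> br x y \<in> S"
  by (auto simp: lie_subalgebra_def)

lemma nil_plus_facts: "lie_subalgebra \<gg> (nil_plus \<gg>)" "Eg i \<in> nil_plus \<gg>"
  "lie_subalgebra \<gg> S \<Longrightarrow> (\<And>i. Eg i \<in> S) \<Longrightarrow> nil_plus \<gg> \<subseteq> S"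
  using gen_subalgebra gen_base[of "range Eg"] gen_minimal[of "range Eg" S]
  unfolding nil_plus_def by blast+

text \<open>The elements with the required property form a subalgebra containing the generators,
  hence contain the generated subalgebra. The facts about generated subalgebras below follow the
  same scheme.\<close>

lemma hh_nil_plus:
  assumes y: "y \<in> hh" and x: "x \<in> nil_plus \<gg>"
  shows "br y x \<in> nil_plus \<gg>"
proof -
  note N = subalgebra_sub[OF nil_plus_facts(1)] subalgebra_br[OF nil_plus_facts(1)]
  have "nil_plus \<gg> \<subseteq> {x \<in> nil_plus \<gg>. br y x \<in> nil_plus \<gg>}"
  proof (rule nil_plus_facts(3))
    show "lie_subalgebra \<gg> {x \<in> nil_plus \<gg>. br y x \<in> nil_plus \<gg>}"
      unfolding lie_subalgebra_def
    proof (intro conjI ballI)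
      show "vec.subspace {x \<in> nil_plus \<gg>. br y x \<in> nil_plus \<gg>}"
        using N(1) by (auto simp: vec.subspace_def br_simps)
      fix u v assume "u \<in> {x \<in> nil_plus \<gg>. br y x \<in> nil_plus \<gg>}" "v \<in> {x \<in> nil_plus \<gg>. br y x \<in> nil_plus \<gg>}"
      thus "br u v \<in> {x \<in> nil_plus \<gg>. br y x \<in> nil_plus \<gg>}"
        using N jacobi[of y u v] by (simp add: vec.subspace_add)
    qed
    show "Eg i \<in> {x \<in> nil_plus \<gg>. br y x \<in> nil_plus \<gg>}" for i
      using nil_plus_facts(2)[of i] vec.subspace_scale[OF N(1)] by (simp add: chev(3)[OF y])
  qed
  thus ?thesis using x by blast
qed

definition borel_plus where "borel_plus = {x + y | x y. x \<in> hh \<and> y \<in> nil_plus \<gg>}"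

lemma borel_plus_facts: "vec.subspace borel_plus" "hh \<subseteq> borel_plus" "nil_plus \<gg> \<subseteq> borel_plus"
proof -
  note N = subalgebra_sub[OF nil_plus_facts(1)]
  show "vec.subspace borel_plus" unfolding borel_plus_def by (rule vec.subspace_sums[OF hh_sub N])
  show "hh \<subseteq> borel_plus" "nil_plus \<gg> \<subseteq> borel_plus"
    unfolding borel_plus_def using vec.subspace_0[OF hh_sub] vec.subspace_0[OF N] by force+
qed

text \<open>The bracket of \<open>borel_plus\<close> with \<open>nil_plus\<close> stays in
  \<open>nil_plus\<close>. Hence F applied to a bracket of two good elements is even in
  \<open>nil_plus\<close>, and Cartan terms arise only from the generators.\<close>

lemma F_borel_plus:
  assumes x: "x \<in> nil_plus \<gg>"
  shows "br (Fg i) x \<in> borel_plus"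
proof -
  note N = subalgebra_sub[OF nil_plus_facts(1)] subalgebra_br[OF nil_plus_facts(1)]
  have bn: "br u v \<in> nil_plus \<gg>" if "u \<in> borel_plus" "v \<in> nil_plus \<gg>" for u v
    using that hh_nil_plus N by (auto simp: borel_plus_def br_simps vec.subspace_add)
  let ?S = "{x \<in> nil_plus \<gg>. br (Fg i) x \<in> borel_plus}"
  have "nil_plus \<gg> \<subseteq> ?S"
  proof (rule nil_plus_facts(3))
    show "lie_subalgebra \<gg> ?S"
      unfolding lie_subalgebra_def
    proof (intro conjI ballI)
      show "vec.subspace ?S"
        using N(1) borel_plus_facts(1) by (auto simp: vec.subspace_def br_simps)
      fix u v assume uv: "u \<in> ?S" "v \<in> ?S"
      have "br u (br (Fg i) v) \<in> nil_plus \<gg>"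
        using bn[of "br (Fg i) v" u] uv N(1) vec.subspace_neg by (subst br_anti) blast
      moreover have "br (br (Fg i) u) v \<in> nil_plus \<gg>" using bn uv by blast
      ultimately have "br (Fg i) (br u v) \<in> nil_plus \<gg>"
        by (subst jacobi) (rule vec.subspace_add[OF N(1)])
      thus "br u v \<in> ?S" using uv N(2) borel_plus_facts(3) by blast
    qed
    show "Eg j \<in> ?S" for j
    proof -
      have "br (Fg i) (Eg j) \<in> hh"
        by (subst br_anti) (use chev(1) vec.subspace_neg[OF hh_sub] vec.subspace_0[OF hh_sub] in \<open>simp add: chev(5)\<close>)
      thus ?thesis using nil_plus_facts(2) borel_plus_facts(2) by blast
    qed
  qed
  thus ?thesis using x by blast
qed

text \<open>The same Lie algebra with E and F exchanged and roots and coroots negated. It is again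
  semisimple data, so facts about \<open>nil_minus\<close> are facts about \<open>nil_plus\<close>
  of \<open>flip\<close>.\<close>

definition flip :: "('n, 'i) lie_data" where
  "flip = \<gg>\<lparr>sroot := \<lambda>i x. - al i x, coroot := \<lambda>i. - Hc i, genE := Fg, genF := Eg\<rparr>"

lemma flip_simps [simp]:
  "brk flip = br" "cartan flip = hh" "sroot flip i x = - al i x" "coroot flip i = - Hc i"
  "genE flip = Fg" "genF flip = Eg"
  by (simp_all add: flip_def)

lemma flip_ss: "ss flip"
proof
  have alg: "lie_subalgebra flip = lie_subalgebra \<gg>" "lie_ideal flip = lie_ideal \<gg>" "brk_span flip = brk_span \<gg>"
    by (intro ext, simp add: lie_subalgebra_def lie_ideal_def brk_span_def)+
  have root: "is_root flip = is_root \<gg>" by (intro ext) (simp add: is_root_def root_space_def)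
  show "lie_algebra flip" using lie by (simp add: lie_algebra_def)
  have "semisimple flip"
    using ss by (simp add: semisimple_data_def semisimple_def lie_solvable_def alg \<open>lie_algebra flip\<close>)
  moreover have "cartan_subalgebra flip (cartan flip)"
    using cartan by (simp add: cartan_subalgebra_def lie_nilpotent_def alg)
  moreover have "simple_roots flip"
  proof -
    have sr: "simple_roots \<gg>" using ss by (simp add: semisimple_data_def)
    have "is_root \<gg> (\<lambda>x. - al i x)" for i
    proof -
      have "Hc i \<in> hh \<and> - al i (Hc i) \<noteq> 0" using chev(1,2) by simp
      moreover have "Fg i \<in> root_space \<gg> (\<lambda>x. - al i x)" by (simp add: root_space_def chev(4))
      ultimately show ?thesis using EF_nonzero(2)[of i] by (auto simp: is_root_def)
    qed
    moreover have "\<forall>c. (\<forall>h\<in>hh. (\<Sum>i\<in>UNIV. c i * - al i h) = 0) \<longrightarrow> (\<forall>i. c i = 0)"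
    proof (intro allI impI)
      fix c i assume "\<forall>h\<in>hh. (\<Sum>i\<in>UNIV. c i * - al i h) = 0"
      thus "c i = 0" using al_indep[of c i] by (simp add: sum_negf)
    qed
    moreover have "\<exists>k :: 'i \<Rightarrow> nat. (\<forall>h\<in>hh. \<beta> h = (\<Sum>i\<in>UNIV. of_nat (k i) * - al i h)) \<or>
           (\<forall>h\<in>hh. \<beta> h = - (\<Sum>i\<in>UNIV. of_nat (k i) * - al i h))" if "is_root \<gg> \<beta>" for \<beta>
    proof -
      have "\<exists>k :: 'i \<Rightarrow> nat. (\<forall>h\<in>hh. \<beta> h = (\<Sum>i\<in>UNIV. of_nat (k i) * al i h)) \<or>
           (\<forall>h\<in>hh. \<beta> h = - (\<Sum>i\<in>UNIV. of_nat (k i) * al i h))"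
        using sr that unfolding simple_roots_def by (elim conjE) blast
      thus ?thesis by (simp add: sum_negf) blast
    qed
    ultimately show ?thesis unfolding simple_roots_def root flip_simps
      by (intro conjI allI impI) (simp_all add: flip_def)
  qed
  moreover have "chevalley_generators flip"
  proof -
    have "br (Fg i) (Eg j) = (if i = j then - Hc i else 0)" for i j
      by (subst br_anti) (simp add: chev(5))
    thus ?thesis
      unfolding chevalley_generators_def flip_simps
      using chev vec.subspace_neg[OF hh_sub] al_lin(4)[OF chev(1) chev(1)] by simp
  qed
  ultimately show "semisimple_data flip" by (simp add: semisimple_data_def)
qed

lemma flip_nil: "nil_plus flip = nil_minus \<gg>" "nil_minus flip = nil_plus \<gg>"
  by (simp_all add: nil_plus_def nil_minus_def lie_generated_def lie_subalgebra_def)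

lemma nil_minus_facts: "lie_subalgebra \<gg> (nil_minus \<gg>)" "Fg i \<in> nil_minus \<gg>"
  "lie_subalgebra \<gg> S \<Longrightarrow> (\<And>i. Fg i \<in> S) \<Longrightarrow> nil_minus \<gg> \<subseteq> S"
  "y \<in> hh \<Longrightarrow> x \<in> nil_minus \<gg> \<Longrightarrow> br y x \<in> nil_minus \<gg>"
  "x \<in> nil_minus \<gg> \<Longrightarrow> br (Eg i) x \<in> borel_minus \<gg>"
proof -
  interpret f: ss flip by (rule flip_ss)
  have alg: "lie_subalgebra flip = lie_subalgebra \<gg>" by (intro ext) (simp add: lie_subalgebra_def)
  have "f.borel_plus = borel_minus \<gg>" by (simp add: f.borel_plus_def borel_minus_def flip_nil)
  thus "lie_subalgebra \<gg> (nil_minus \<gg>)" "Fg i \<in> nil_minus \<gg>"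
    "lie_subalgebra \<gg> S \<Longrightarrow> (\<And>i. Fg i \<in> S) \<Longrightarrow> nil_minus \<gg> \<subseteq> S"
    "y \<in> hh \<Longrightarrow> x \<in> nil_minus \<gg> \<Longrightarrow> br y x \<in> nil_minus \<gg>"
    "x \<in> nil_minus \<gg> \<Longrightarrow> br (Eg i) x \<in> borel_minus \<gg>"
    using f.nil_plus_facts f.hh_nil_plus f.F_borel_plus by (simp_all add: flip_nil alg)
qed

text \<open>The candidate for the triangular decomposition. It is stable under all generators; that
  it exhausts the Lie algebra is \<open>triangular_UNIV\<close>.\<close>

definition triangular where
  "triangular = {x + y | x y. x \<in> borel_minus \<gg> \<and> y \<in> nil_plus \<gg>}"

lemma borel_minus_sub: "vec.subspace (borel_minus \<gg>)" "hh \<subseteq> borel_minus \<gg>" "nil_minus \<gg> \<subseteq> borel_minus \<gg>"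
proof -
  note N = subalgebra_sub[OF nil_minus_facts(1)]
  show "vec.subspace (borel_minus \<gg>)" unfolding borel_minus_def by (rule vec.subspace_sums[OF hh_sub N])
  show "hh \<subseteq> borel_minus \<gg>" "nil_minus \<gg> \<subseteq> borel_minus \<gg>"
    unfolding borel_minus_def using vec.subspace_0[OF hh_sub] vec.subspace_0[OF N] by force+
qed

lemma triangular_facts: "vec.subspace triangular" "borel_minus \<gg> \<subseteq> triangular" "borel_plus \<subseteq> triangular"
proof -
  note N = subalgebra_sub[OF nil_plus_facts(1)]
  show "vec.subspace triangular" unfolding triangular_def by (rule vec.subspace_sums[OF borel_minus_sub(1) N])
  show "borel_minus \<gg> \<subseteq> triangular" "borel_plus \<subseteq> triangular"
    unfolding triangular_def borel_plus_def using borel_minus_sub(2) vec.subspace_0[OF N] by force+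
qed

lemma triangular_stable: "x \<in> triangular \<Longrightarrow> br (Eg i) x \<in> triangular" "x \<in> triangular \<Longrightarrow> br (Fg i) x \<in> triangular"
proof -
  assume "x \<in> triangular"
  then obtain u h v where x: "x = h + u + v" "h \<in> hh" "u \<in> nil_minus \<gg>" "v \<in> nil_plus \<gg>"
    by (auto simp: triangular_def borel_minus_def)
  have n: "nil_plus \<gg> \<subseteq> triangular" "nil_minus \<gg> \<subseteq> triangular"
    using borel_minus_sub(3) triangular_facts(2,3) borel_plus_facts(3) by blast+
  have eh: "br (Eg i) h \<in> nil_plus \<gg>" "br (Fg i) h \<in> nil_minus \<gg>"
    using hh_nil_plus[OF x(2) nil_plus_facts(2)] nil_minus_facts(4)[OF x(2) nil_minus_facts(2)]
      vec.subspace_neg[OF subalgebra_sub[OF nil_plus_facts(1)]] vec.subspace_neg[OF subalgebra_sub[OF nil_minus_facts(1)]]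
    by (metis br_anti)+
  have "br (Eg i) u \<in> triangular" "br (Fg i) v \<in> triangular"
    using nil_minus_facts(5)[OF x(3)] F_borel_plus[OF x(4)] triangular_facts by blast+
  moreover have "br (Eg i) v \<in> triangular" "br (Fg i) u \<in> triangular"
    using subalgebra_br[OF nil_plus_facts(1,2) x(4)] subalgebra_br[OF nil_minus_facts(1,2) x(3)] n by blast+
  ultimately show "br (Eg i) x \<in> triangular" "br (Fg i) x \<in> triangular"
    unfolding x(1) br_simps using eh n vec.subspace_add[OF triangular_facts(1)] by blast+
qed

end


section \<open>The grading by the eigenvalues of ad rho\<close>

locale ss_basis = ss \<gg> for \<gg> :: "('n::finite, 'i::finite) lie_data" +
  fixes b :: "'n \<Rightarrow> complex^'n" and n :: "'i \<Rightarrow> 'n \<Rightarrow> int" and wt :: "'i \<Rightarrow> 'i \<Rightarrow> real"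
  assumes b_span: "vec.span (range b) = UNIV"
    and H_b: "\<And>i a. br (Hc i) (b a) = of_int (n i a) *s b a"
    and wt_dual: "\<And>i k. al i (\<Sum>j\<in>UNIV. of_real (wt k j) *s Hc j) = (if i = k then 1 else 0)"
    and wt_nonneg: "\<And>j. (\<Sum>k\<in>UNIV. wt k j) \<ge> 0"
begin

definition fcw :: "'i \<Rightarrow> complex^'n" where "fcw k = (\<Sum>j\<in>UNIV. of_real (wt k j) *s Hc j)"
definition rho :: "complex^'n" where "rho = (\<Sum>k\<in>UNIV. fcw k)"
definition rcf :: "'i \<Rightarrow> real" where "rcf j = (\<Sum>k\<in>UNIV. wt k j)"
text \<open>The eigenvalue of \<open>br rho\<close> on \<open>b a\<close>, computed from the
  expansion of \<open>rho\<close> in coroots; integrality comes with \<open>deg_int\<close>.\<close>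

definition deg :: "'n \<Rightarrow> real" where "deg a = (\<Sum>j\<in>UNIV. rcf j * of_int (n j a))"

lemma fcw: "fcw k \<in> hh" "al i (fcw k) = (if i = k then 1 else 0)"
  unfolding fcw_def by (intro vec.subspace_sum vec.subspace_scale hh_sub chev) (rule wt_dual)

lemma rho_H: "rho = (\<Sum>j\<in>UNIV. of_real (rcf j) *s Hc j)"
proof -
  have "rho = (\<Sum>j\<in>UNIV. \<Sum>k\<in>UNIV. of_real (wt k j) *s Hc j)"
    unfolding rho_def fcw_def by (rule sum.swap)
  thus ?thesis by (simp add: rcf_def vec.scale_sum_left)
qed

lemma rho_hh: "rho \<in> hh" unfolding rho_def by (intro vec.subspace_sum hh_sub fcw)

lemma al_rho: "al i rho = 1"
proof -
  have "al i (\<Sum>k\<in>UNIV. 1 *s fcw k) = (\<Sum>k\<in>UNIV. 1 * al i (fcw k))" by (rule al_sum) (rule fcw)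
  thus ?thesis by (simp add: rho_def fcw)
qed

lemma br_rho_b: "br rho (b a) = of_real (deg a) *s b a"
  unfolding rho_H br_sum br_simps H_b deg_def by (simp add: vec.scale_sum_left)

lemma rho_central: "y \<in> hh \<Longrightarrow> br rho y = 0"
  by (simp add: rho_H br_sum br_simps H_central)

lemma rho_EF: "br rho (Eg i) = Eg i" "br rho (Fg i) = - Fg i"
  using chev(3,4)[OF rho_hh, of i] by (simp_all add: al_rho)

lemmas b_expand = span_basis_coords(2)[OF b_span]
lemmas b_indep = span_basis_coords(3)[OF b_span]

lemma b_nonzero: "b a \<noteq> 0"
proof
  assume "b a = 0"
  hence "(\<Sum>a'\<in>UNIV. (if a' = a then 1 else 0) *s b a') = 0" by (intro sum.neutral) auto
  from b_indep[OF this, of a] show False by simp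
qed

text \<open>Degrees are only known to be real at this stage, so graded pieces are selected by
  predicates on the reals.\<close>

definition sp :: "(real \<Rightarrow> bool) \<Rightarrow> (complex^'n) set" where "sp P = vec.span {b a |a. P (deg a)}"

lemma sp_sub: "vec.subspace (sp P)" by (simp add: sp_def)

lemma sp_iff: "x \<in> sp P \<longleftrightarrow> (\<exists>c. (\<forall>a. \<not> P (deg a) \<longrightarrow> c a = 0) \<and> x = (\<Sum>a\<in>UNIV. c a *s b a))"
proof
  assume "x \<in> sp P"
  thus "\<exists>c. (\<forall>a. \<not> P (deg a) \<longrightarrow> c a = 0) \<and> x = (\<Sum>a\<in>UNIV. c a *s b a)"
    unfolding sp_def
  proof (induction rule: vec.span_induct_alt)
    case base show ?case by (intro exI[of _ "\<lambda>_. 0"]) simp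
  next
    case (step k x y)
    then obtain a c where a: "x = b a" "P (deg a)" and c: "\<forall>a. \<not> P (deg a) \<longrightarrow> c a = 0" "y = (\<Sum>a\<in>UNIV. c a *s b a)" by blast
    have "(\<Sum>a'\<in>UNIV. (if a' = a then k else 0) *s b a') = (\<Sum>a'\<in>{a}. k *s b a')"
      by (rule sum.mono_neutral_cong_right) auto
    hence "k *s x + y = (\<Sum>a'\<in>UNIV. (c a' + (if a' = a then k else 0)) *s b a')"
      by (simp add: a c vec.scale_left_distrib sum.distrib)
    thus ?case using a c by (intro exI[of _ "\<lambda>a'. c a' + (if a' = a then k else 0)"]) auto
  qed
next
  assume "\<exists>c. (\<forall>a. \<not> P (deg a) \<longrightarrow> c a = 0) \<and> x = (\<Sum>a\<in>UNIV. c a *s b a)"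
  then obtain c where c: "\<forall>a. \<not> P (deg a) \<longrightarrow> c a = 0" "x = (\<Sum>a\<in>UNIV. c a *s b a)" by blast
  have "c a *s b a \<in> sp P" for a
  proof (cases "P (deg a)")
    case True thus ?thesis unfolding sp_def by (intro vec.span_scale vec.span_base) blast
  next
    case False thus ?thesis using c vec.subspace_0[OF sp_sub] by simp
  qed
  thus "x \<in> sp P" unfolding c by (intro vec.subspace_sum sp_sub)
qed

lemma sp_disjoint:
  assumes "x \<in> sp P" "x \<in> sp Q" "\<And>t. \<not> (P t \<and> Q t)"
  shows "x = 0"
proof -
  obtain c e where c: "\<forall>a. \<not> P (deg a) \<longrightarrow> c a = 0" "x = (\<Sum>a\<in>UNIV. c a *s b a)"
    and e: "\<forall>a. \<not> Q (deg a) \<longrightarrow> e a = 0" "x = (\<Sum>a\<in>UNIV. e a *s b a)"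
    using assms(1,2) unfolding sp_iff by blast
  have "(\<Sum>a\<in>UNIV. (c a - e a) *s b a) = 0" using c(2) e(2) by (simp add: vec.scale_left_diff_distrib sum_subtractf)
  hence "c a = e a" for a using b_indep[of "\<lambda>a. c a - e a" a] by simp
  hence "c a = 0" for a using c(1) e(1) assms(3) by metis
  thus ?thesis using c(2) by simp
qed

lemma sp_eigen:
  assumes "br rho x = of_real \<mu> *s x"
  shows "x \<in> sp (\<lambda>t. t = \<mu>)"
proof -
  obtain c where c: "x = (\<Sum>a\<in>UNIV. c a *s b a)" using b_expand by blast
  have "br rho x - of_real \<mu> *s x = (\<Sum>a\<in>UNIV. c a *s (of_real (deg a) *s b a) - of_real \<mu> *s (c a *s b a))"
    by (simp only: c br_sum br_simps br_rho_b vec.scale_sum_right sum_subtractf)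
  also have "\<dots> = (\<Sum>a\<in>UNIV. (c a * of_real (deg a - \<mu>)) *s b a)"
    by (intro sum.cong refl) (simp add: vec_eq_iff algebra_simps)
  finally have "(\<Sum>a\<in>UNIV. (c a * of_real (deg a - \<mu>)) *s b a) = 0" unfolding assms by simp
  hence cz: "c a * of_real (deg a - \<mu>) = 0" for a by (rule b_indep)
  have "\<forall>a. \<not> (deg a = \<mu>) \<longrightarrow> c a = 0"
  proof (intro allI impI)
    fix a assume "\<not> (deg a = \<mu>)"
    thus "c a = 0" using cz[of a] by simp
  qed
  thus ?thesis unfolding sp_iff using c by blast
qed

lemma sp_mono: "(\<And>t. P t \<Longrightarrow> Q t) \<Longrightarrow> sp P \<subseteq> sp Q"
  unfolding sp_def by (intro vec.span_mono) blast

lemma sp_b: "P (deg a) \<Longrightarrow> b a \<in> sp P"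
  unfolding sp_def by (intro vec.span_base) blast

lemma sp_br:
  assumes "x \<in> sp P" "y \<in> sp Q" "\<And>s t. P s \<Longrightarrow> Q t \<Longrightarrow> R (s + t)"
  shows "br x y \<in> sp R"
proof -
  have 1: "br (b a) (b a') \<in> sp R" if "P (deg a)" "Q (deg a')" for a a'
  proof -
    have "br rho (br (b a) (b a')) = of_real (deg a + deg a') *s br (b a) (b a')"
      by (subst jacobi) (simp add: br_rho_b br_simps vec.scale_left_distrib)
    hence "br (b a) (b a') \<in> sp (\<lambda>t. t = deg a + deg a')" by (rule sp_eigen)
    thus ?thesis using sp_mono[of "\<lambda>t. t = deg a + deg a'" R] assms(3)[OF that] by auto
  qed
  obtain c e where c: "\<forall>a. \<not> P (deg a) \<longrightarrow> c a = 0" "x = (\<Sum>a\<in>UNIV. c a *s b a)"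
    and e: "\<forall>a. \<not> Q (deg a) \<longrightarrow> e a = 0" "y = (\<Sum>a\<in>UNIV. e a *s b a)"
    using assms(1,2) unfolding sp_iff by blast
  have "c a *s (e a' *s br (b a) (b a')) \<in> sp R" for a a'
  proof (cases "P (deg a) \<and> Q (deg a')")
    case True thus ?thesis using 1 by (intro vec.subspace_scale sp_sub) auto
  next
    case False
    hence "c a *s (e a' *s br (b a) (b a')) = 0" using c e by auto
    thus ?thesis using vec.subspace_0[OF sp_sub[of R]] by metis
  qed
  hence "(\<Sum>a'\<in>UNIV. \<Sum>a\<in>UNIV. c a *s (e a' *s br (b a) (b a'))) \<in> sp R"
    by (intro vec.subspace_sum sp_sub)
  moreover have "br x y = (\<Sum>a'\<in>UNIV. \<Sum>a\<in>UNIV. c a *s (e a' *s br (b a) (b a')))"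
    unfolding c(2) e(2) br_sum br_simps vec.scale_sum_right by (intro sum.cong refl) (simp add: mult.commute)
  ultimately show ?thesis by simp
qed

lemma sp_subalgebra:
  assumes "\<And>s t. P s \<Longrightarrow> P t \<Longrightarrow> P (s + t)"
  shows "lie_subalgebra \<gg> (sp P)"
  unfolding lie_subalgebra_def by (intro conjI ballI sp_sub) (erule (1) sp_br, rule assms)

lemma rho_stable: "stable {x. br rho x = \<mu> *s x}"
  unfolding stable_def
proof (intro conjI ballI)
  show "vec.subspace {x. br rho x = \<mu> *s x}"
    by (auto simp: vec.subspace_def br_simps vec.scale_right_distrib mult.commute)
  fix y x assume y: "y \<in> hh" and x: "x \<in> {x. br rho x = \<mu> *s x}"
  thus "br y x \<in> {x. br rho x = \<mu> *s x}"
    using jacobi[of rho y x] by (simp add: rho_central br_simps)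
qed

lemma weight_rho:
  assumes "\<And>y. y \<in> hh \<Longrightarrow> br y x = (\<Sum>i\<in>UNIV. of_int (k i) * al i y) *s x"
  shows "br rho x = of_int (\<Sum>i\<in>UNIV. k i) *s x"
  using assms[OF rho_hh] by (simp add: al_rho)

text \<open>Each eigenspace of \<open>br rho\<close> is stable under the Cartan subalgebra and so
  contains a common eigenvector. On it \<open>rho\<close> acts by the sum of the integer
  coefficients of its weight in the simple roots.\<close>

lemma deg_int: "\<exists>z::int. deg a = of_int z"
proof -
  have ne: "{x. br rho x = of_real (deg a) *s x} \<noteq> {0}" using br_rho_b[of a] b_nonzero[of a] by blast
  obtain x where x: "x \<in> {x. br rho x = of_real (deg a) *s x}" "x \<noteq> 0" "\<And>y. y \<in> hh \<Longrightarrow> \<exists>c. br y x = c *s x"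
    by (rule common_eigenvector[OF rho_stable ne]) (rule that; assumption)
  obtain k :: "'i \<Rightarrow> int" where "\<And>y. y \<in> hh \<Longrightarrow> br y x = (\<Sum>i\<in>UNIV. of_int (k i) * al i y) *s x"
    by (rule weight_integral[OF x(2,3)], assumption) (rule that; assumption)
  from weight_rho[OF this] have "of_int (\<Sum>i\<in>UNIV. k i) *s x = complex_of_real (deg a) *s x" using x(1) by simp
  hence "complex_of_real (of_int (\<Sum>i\<in>UNIV. k i)) = complex_of_real (deg a)"
    using x(2) vec.scale_right_imp_eq by (metis of_real_of_int_eq)
  thus ?thesis by (metis of_real_eq_iff)
qed

text \<open>The generalised eigenspace \<open>G\<close> of y for c inside degree 0 is stable under
  the Cartan subalgebra, so it contains a common eigenvector. Its weight has coefficients of one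
  sign that sum to 0, hence is zero, and y kills the vector; in \<open>G\<close> this is impossible
  for nonzero c.\<close>

lemma no_eigenvalue_degree_0:
  assumes y: "y \<in> hh" and x: "br rho x = 0" "x \<noteq> 0" "br y x = c *s x"
  shows "c = 0"
proof (rule ccontr)
  assume c: "c \<noteq> 0"
  define p :: "nat \<Rightarrow> complex poly" where "p = (\<lambda>N. [:- c, 1:] ^ N)"
  define G where "G = {x. br rho x = 0 \<and> (\<exists>N. poly_op (br y) (p N) x = 0)}"
  have Z: "br rho (br y' v) = 0" if "br rho v = 0" "y' \<in> hh" for y' v
    using jacobi[of rho y' v] that by (simp add: rho_central br_simps)
  have up: "poly_op (br y) (p M) v = 0" if "poly_op (br y) (p N) v = 0" "N \<le> M" for N M v
    using that by (intro poly_op_dvd[OF ad_lin(1) that(1)]) (simp add: p_def le_imp_power_dvd)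
  have pl: "poly_op (br y) (p N) (u + v) = poly_op (br y) (p N) u + poly_op (br y) (p N) v"
    "poly_op (br y) (p N) (k *s v) = k *s poly_op (br y) (p N) v" "poly_op (br y) (p N) 0 = 0" for N u v k
    using clin_simps[OF poly_op_lin[OF ad_lin(1)]] by blast+
  have sub: "vec.subspace G"
    unfolding vec.subspace_def
  proof (intro conjI ballI allI)
    show "0 \<in> G" by (simp add: G_def br_simps pl)
    fix u v k assume u: "u \<in> G" and v: "v \<in> G"
    then obtain N M where "poly_op (br y) (p N) u = 0" "poly_op (br y) (p M) v = 0" by (auto simp: G_def)
    hence "poly_op (br y) (p (max N M)) u = 0" "poly_op (br y) (p (max N M)) v = 0" using up by auto
    thus "u + v \<in> G" using u v by (auto simp: G_def br_simps pl intro!: exI[of _ "max N M"])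
  next
    fix u k assume "u \<in> G"
    thus "k *s u \<in> G" by (auto simp: G_def br_simps pl)
  qed
  have pS: "poly_op (br y) (p (Suc N)) v = poly_op (br y) (p N) (br y v - c *s v)" for N v
  proof -
    have "p (Suc N) = p N * [:- c, 1:]" by (simp only: p_def power_Suc2)
    thus ?thesis by (simp only: poly_op_mult[OF ad_lin(1)] poly_op_X[OF ad_lin(1)])
  qed
  have down: "v \<in> G" if "br y v - c *s v \<in> G" "br rho v = 0" for v
  proof -
    have "\<exists>N. poly_op (br y) (p N) (br y v - c *s v) = 0" using that(1) unfolding G_def by blast
    then obtain N where "poly_op (br y) (p N) (br y v - c *s v) = 0" ..
    hence "poly_op (br y) (p (Suc N)) v = 0" by (simp only: pS)
    thus ?thesis using that(2) unfolding G_def by blast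
  qed
  \<comment> \<open>Outer induction on the order K of nilpotency of ad y on y', inner induction on
    the power N that kills the vector: the bracket of y and y' has smaller K, and y - c lowers
    N.\<close>
  have st: "\<forall>y'\<in>hh. (br y ^^ K) y' = 0 \<longrightarrow> (\<forall>v\<in>G. br y' v \<in> G)" for K
  proof (induction K)
    case 0 thus ?case using vec.subspace_0[OF sub] by (auto simp: br_simps)
  next
    case (Suc K)
    note IH = Suc.IH
    show ?case
    proof (intro ballI impI)
      fix y' v assume y': "y' \<in> hh" and n: "(br y ^^ Suc K) y' = 0" and v: "v \<in> G"
      have "poly_op (br y) (p N) v = 0 \<Longrightarrow> br rho v = 0 \<Longrightarrow> br y' v \<in> G" for N v
      proof (induction N arbitrary: v)
        case 0
        hence "v = 0" using poly_op_1[OF ad_lin(1)] by (simp add: p_def)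
        thus ?case using vec.subspace_0[OF sub] by (simp add: br_simps)
      next
        case (Suc N)
        have v: "v \<in> G" using Suc.prems by (auto simp: G_def)
        let ?w = "br y v - c *s v"
        have "br y' ?w \<in> G"
          by (rule Suc.IH) (use Suc.prems pS Z y in \<open>auto simp: br_simps\<close>)
        moreover have "br (br y y') v \<in> G"
          using IH hh_br[OF y y'] n v
          by (simp add: funpow_swap1)
        ultimately have "br (br y y') v + br y' ?w \<in> G" by (rule vec.subspace_add[OF sub, rotated])
        moreover have "br y (br y' v) - c *s br y' v = br (br y y') v + br y' ?w"
          by (subst jacobi) (simp add: br_simps)
        ultimately have "br y (br y' v) - c *s br y' v \<in> G" by simp
        thus ?case by (rule down) (rule Z[OF Suc.prems(2) y'])
      qed
      thus "br y' v \<in> G" using v by (auto simp: G_def)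
    qed
  qed
  have "stable G"
    unfolding stable_def
  proof (intro conjI ballI sub)
    fix y' v assume y': "y' \<in> hh" and v: "v \<in> G"
    obtain K where "lcs K = {0}" by (rule lcs_nil)
    hence "(br y ^^ K) y' = 0" using ad_pow_lcs[OF y y', of K] by simp
    thus "br y' v \<in> G" using st v y' by blast
  qed
  moreover have "x \<in> G"
    using x pS[of 0 x] by (auto simp: G_def p_def ad_lin intro!: exI[of _ 1])
  hence "G \<noteq> {0}" using x by blast
  ultimately obtain v where v: "v \<in> G" "v \<noteq> 0" "\<And>y. y \<in> hh \<Longrightarrow> \<exists>c. br y v = c *s v"
    by (rule common_eigenvector) (rule that; assumption)
  obtain k :: "'i \<Rightarrow> int" where k: "\<And>y. y \<in> hh \<Longrightarrow> br y v = (\<Sum>i\<in>UNIV. of_int (k i) * al i y) *s v"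
    "(\<forall>i. k i \<ge> 0) \<or> (\<forall>i. k i \<le> 0)"
    by (rule weight_integral[OF v(2,3)], assumption) (rule that; assumption)
  have "of_int (\<Sum>i\<in>UNIV. k i) *s v = 0" using weight_rho[OF k(1)] v(1) by (simp add: G_def)
  hence "complex_of_int (\<Sum>i\<in>UNIV. k i) = 0" using v(2) by (simp del: of_int_sum)
  hence s0: "(\<Sum>i\<in>UNIV. k i) = 0" by (simp only: of_int_eq_0_iff)
  have "k i = 0" for i
    using k(2)
  proof
    assume "\<forall>i. k i \<ge> 0"
    thus ?thesis using s0 by (subst (asm) sum_nonneg_eq_0_iff) auto
  next
    assume "\<forall>i. k i \<le> 0"
    moreover have "(\<Sum>i\<in>UNIV. - k i) = 0" using s0 by (simp add: sum_negf)
    ultimately show ?thesis by (subst (asm) sum_nonneg_eq_0_iff) auto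
  qed
  hence y0: "br y v = 0" using k(1)[OF y] by simp
  obtain N where N: "poly_op (br y) (p N) v = 0" using v(1) by (auto simp: G_def)
  have "poly_op (br y) (p N) v = (- c) ^ N *s v" for N
  proof (induction N)
    case 0 show ?case by (simp add: p_def ad_lin)
  next
    case (Suc N)
    have "poly_op (br y) (p (Suc N)) v = poly_op (br y) (p N) ((- c) *s v)" unfolding pS y0 by simp
    thus ?case using Suc by (simp add: pl(2) del: vec.scale_minus_left)
  qed
  thus False using N v(2) c by simp
qed

text \<open>The Cartan subalgebra acts nilpotently on the centraliser \<open>Z\<close> of
  \<open>rho\<close>. If \<open>Z\<close> were larger than \<open>hh\<close>, take a minimal stable
  \<open>W\<close> strictly above \<open>hh\<close>. Climbing the lower central series shows that
  \<open>hh\<close> maps \<open>W\<close> into \<open>hh\<close>, so \<open>W\<close> normalises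
  \<open>hh\<close>, which is its own normaliser.\<close>

lemma degree_0_cartan:
  assumes "br rho x = 0"
  shows "x \<in> hh"
proof (rule ccontr)
  assume "x \<notin> hh"
  define Z where "Z = {x. br rho x = 0}"
  have Zst: "stable Z" using rho_stable[of 0] by (simp add: Z_def)
  have hZ: "hh \<subseteq> Z" using rho_central by (auto simp: Z_def)
  have nil: "\<exists>N. (br y ^^ N) v = 0" if y: "y \<in> hh" and v: "v \<in> Z" for y v
  proof -
    obtain p where p: "p \<noteq> 0" "poly_op (br y) p v = 0" using poly_op_annihilator_vec[OF ad_lin(1)] by blast
    \<comment> \<open>Separate the power of X from the annihilating polynomial. The cofactor q does
      not vanish at 0, while 0 is the only possible eigenvalue on \<open>Z\<close>; so the power of
      X alone already kills v.\<close>
    obtain q where q: "p = [:- 0, 1:] ^ order 0 p * q" "\<not> [:- 0, 1:] dvd q" using order_decomp[OF p(1)] by blast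
    define w where "w = poly_op (br y) ([:0, 1:] ^ order 0 p) v"
    have w: "w \<in> Z" unfolding w_def
      by (rule poly_op_stable[OF ad_lin(1)]) (use Zst y v stableD in auto)
    have "poly_op (br y) (q * [:0, 1:] ^ order 0 p) v = 0" using p(2) q(1) by (metis minus_zero mult.commute)
    hence qw: "poly_op (br y) q w = 0" unfolding w_def poly_op_mult[OF ad_lin(1)] .
    have "w = 0"
    proof (rule ccontr)
      assume "w \<noteq> 0"
      have q0: "q \<noteq> 0" using q(2) by auto
      obtain c u where "poly q c = 0" "u \<in> Z" "u \<noteq> 0" "br y u = c *s u"
        using eigenvector_exists[OF ad_lin(1) stableD(1)[OF Zst] _ q0 qw w \<open>w \<noteq> 0\<close>] stableD(2)[OF Zst y] by blast
      moreover from this have "c = 0" using no_eigenvalue_degree_0[OF y, of u c] by (simp add: Z_def)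
      ultimately show False using q(2) by (simp add: poly_eq_0_iff_dvd)
    qed
    moreover have "w = (br y ^^ order 0 p) v"
      unfolding w_def using poly_op_monom[OF ad_lin(1)[of y], of 1 "order 0 p" v] by (simp add: monom_altdef)
    ultimately show ?thesis by metis
  qed
  have "stable Z \<and> hh \<subset> Z" using Zst hZ \<open>x \<notin> hh\<close> assms by (auto simp: Z_def)
  then obtain W where W: "stable W \<and> hh \<subset> W" "W \<subseteq> Z" "\<And>W'. stable W' \<and> hh \<subset> W' \<Longrightarrow> W' \<subseteq> W \<Longrightarrow> W' = W"
    using minimal_subspace[where P = "\<lambda>W. stable W \<and> hh \<subset> W" and ?W0.0 = Z] stableD(1) by metis
  have sub: "vec.subspace W" and st: "\<And>y x. y \<in> hh \<Longrightarrow> x \<in> W \<Longrightarrow> br y x \<in> W" using W(1) stableD by blast+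
  obtain K where K: "lcs K = {0}" by (rule lcs_nil)
  have "k \<le> K \<Longrightarrow> \<forall>y\<in>lcs (K - k). \<forall>x\<in>W. br y x \<in> hh" for k
  proof (induction k)
    case 0 thus ?case using K vec.subspace_0[OF hh_sub] by (simp add: br_simps)
  next
    case (Suc k)
    show ?case
    proof
      fix y assume y: "y \<in> lcs (K - Suc k)"
      hence yh: "y \<in> hh" using lcs_hh by blast
      define U where "U = {x \<in> W. br y x \<in> hh}"
      have "stable U"
        unfolding stable_def
      proof (intro conjI ballI)
        show "vec.subspace U" unfolding U_def
          using sub hh_sub by (auto simp: vec.subspace_def br_simps)
        fix y' v assume y': "y' \<in> hh" and v: "v \<in> U"
        have "br y' y \<in> lcs (K - k)"
          using lcs_br[OF y' y] Suc.prems by (simp add: Suc_diff_Suc)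
        hence "br (br y' y) v \<in> hh" using Suc v by (simp add: U_def)
        moreover have "br y' (br y v) \<in> hh" using v y' hh_br by (simp add: U_def)
        moreover have "br y (br y' v) = br y' (br y v) - br (br y' y) v"
          by (subst (2) jacobi) simp
        ultimately have "br y (br y' v) \<in> hh" using vec.subspace_diff[OF hh_sub] by simp
        thus "br y' v \<in> U" using v st y' by (simp add: U_def)
      qed
      \<comment> \<open>Since y acts nilpotently on v, there is a last iterate outside
        \<open>hh\<close>; it lies in \<open>U\<close>, which makes the inclusion strict.\<close>
      moreover have "hh \<subset> U"
      proof -
        obtain v where v: "v \<in> W" "v \<notin> hh" using W(1) by blast
        obtain N where N: "(br y ^^ N) v = 0" using nil[OF yh] v W(2) by blast
        define k where "k = (LEAST k. (br y ^^ k) v \<in> hh)"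
        have k: "(br y ^^ k) v \<in> hh" unfolding k_def using N vec.subspace_0[OF hh_sub] by (metis LeastI)
        have "k \<noteq> 0" using k v by (metis funpow_0)
        then obtain m where m: "k = Suc m" by (metis nat.exhaust)
        have "(br y ^^ m) v \<notin> hh" using not_less_Least[of m "\<lambda>k. (br y ^^ k) v \<in> hh"] m k_def by auto
        moreover have "(br y ^^ j) v \<in> W" for j by (induction j) (use v st yh in auto)
        ultimately have "(br y ^^ m) v \<in> U - hh" using k m by (simp add: U_def)
        moreover have "hh \<subseteq> U" using W(1) hh_br[OF yh] by (auto simp: U_def)
        ultimately show ?thesis by blast
      qed
      moreover have "U \<subseteq> W" by (auto simp: U_def)
      ultimately have "U = W" using W(3) by blast
      thus "\<forall>x\<in>W. br y x \<in> hh" by (auto simp: U_def)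
    qed
  qed
  from this[of K] have hW: "\<forall>y\<in>hh. \<forall>x\<in>W. br y x \<in> hh" by simp
  obtain v where v: "v \<in> W" "v \<notin> hh" using W(1) by blast
  have "br v y \<in> hh" if "y \<in> hh" for y
    using hW that v vec.subspace_neg[OF hh_sub] by (subst br_anti) blast
  thus False using hh_normaliser v by blast
qed


lemma EF_sp: "Eg i \<in> sp (\<lambda>t. t = 1)" "Fg i \<in> sp (\<lambda>t. t = - 1)"
  using sp_eigen[of "Eg i" 1] sp_eigen[of "Fg i" "- 1"] by (simp_all add: rho_EF)

lemma sp_subsetI: "(\<And>a. P (deg a) \<Longrightarrow> b a \<in> T) \<Longrightarrow> vec.subspace T \<Longrightarrow> sp P \<subseteq> T"
  unfolding sp_def by (rule vec.span_minimal) auto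

lemma nil_sp: "nil_plus \<gg> \<subseteq> sp (\<lambda>t. t \<ge> 1)" "nil_minus \<gg> \<subseteq> sp (\<lambda>t. t \<le> - 1)"
proof -
  show "nil_plus \<gg> \<subseteq> sp (\<lambda>t. t \<ge> 1)"
  proof (rule nil_plus_facts(3))
    show "lie_subalgebra \<gg> (sp (\<lambda>t. t \<ge> 1))" by (rule sp_subalgebra) simp
    show "Eg i \<in> sp (\<lambda>t. t \<ge> 1)" for i using EF_sp(1)[of i] sp_mono[of "\<lambda>t. t = 1" "\<lambda>t. t \<ge> 1"] by auto
  qed
  show "nil_minus \<gg> \<subseteq> sp (\<lambda>t. t \<le> - 1)"
  proof (rule nil_minus_facts(3))
    show "lie_subalgebra \<gg> (sp (\<lambda>t. t \<le> - 1))" by (rule sp_subalgebra) simp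
    show "Fg i \<in> sp (\<lambda>t. t \<le> - 1)" for i using EF_sp(2)[of i] sp_mono[of "\<lambda>t. t = - 1" "\<lambda>t. t \<le> - 1"] by auto
  qed
qed

lemma hh_sp: "hh = sp (\<lambda>t. t = 0)"
proof
  show "hh \<subseteq> sp (\<lambda>t. t = 0)" using sp_eigen[of _ 0] rho_central by auto
  show "sp (\<lambda>t. t = 0) \<subseteq> hh"
    by (rule sp_subsetI[OF _ hh_sub]) (rule degree_0_cartan, simp add: br_rho_b)
qed

text \<open>Take a basis vector outside \<open>triangular\<close> of least absolute degree, say
  positive. Every \<open>Fg i\<close> moves it into \<open>triangular\<close>, so by
  \<open>weight_mod_subspace\<close> its coroot weights are all nonpositive. As \<open>rho\<close>
  is a nonnegative combination of coroots, the degree is nonpositive too, a contradiction. Degree 0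
  is covered by the Cartan subalgebra.\<close>

lemma triangular_UNIV: "triangular = UNIV"
proof -
  note T = triangular_facts
  have hT: "hh \<subseteq> triangular" using borel_minus_sub(2) T(2) by blast
  have "b a \<in> triangular" for a
  proof (rule ccontr)
    assume bad: "b a \<notin> triangular"
    define m where "m = (\<lambda>a. nat \<lfloor>\<bar>deg a\<bar>\<rfloor>)"
    obtain a where a: "b a \<notin> triangular" and mn: "\<And>a'. b a' \<notin> triangular \<Longrightarrow> m a \<le> m a'"
      using ex_has_least_nat[where P = "\<lambda>a. b a \<notin> triangular" and m = m, OF bad] by blast
    obtain z :: int where z: "deg a = of_int z" using deg_int by blast
    have small: "sp (\<lambda>t. t = of_int w) \<subseteq> triangular" if "nat \<bar>w\<bar> < nat \<bar>z\<bar>" for w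
    proof (rule sp_subsetI[OF _ T(1)])
      fix a' assume "deg a' = of_int w"
      hence "m a' = nat \<bar>w\<bar>" "m a = nat \<bar>z\<bar>" using z by (simp_all add: m_def flip: of_int_abs)
      hence "m a' < m a" using that by simp
      thus "b a' \<in> triangular" using mn[of a'] by auto
    qed
    consider "z = 0" | "z > 0" | "z < 0" by linarith
    thus False
    proof cases
      case 1
      hence "b a \<in> hh" unfolding hh_sp using z by (intro sp_b) simp
      thus False using a hT by blast
    next
      case 2
      have "n i a \<le> 0" for i
      proof -
        interpret sl2_triple "br (Eg i)" "br (Hc i)" "br (Fg i)" by (rule sl2_ad)
        have "br (Fg i) (b a) \<in> sp (\<lambda>t. t = of_int (z - 1))"
          by (rule sp_br[OF EF_sp(2) sp_b[of "\<lambda>t. t = of_int z"]]) (use z in auto)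
        hence F: "br (Fg i) (b a) \<in> triangular" using small[of "z - 1"] 2 by auto
        have "\<exists>k::nat. complex_of_int (n i a) = - of_nat k"
          by (rule weight_mod_subspace[OF T(1) triangular_stable a F H_b])
        then obtain k :: nat where "complex_of_int (n i a) = of_int (- int k)" by auto
        hence "n i a = - int k" by (simp only: of_int_eq_iff)
        thus ?thesis by simp
      qed
      hence "deg a \<le> 0" unfolding deg_def
        by (intro sum_nonpos mult_nonneg_nonpos) (simp_all add: rcf_def wt_nonneg)
      thus False using 2 z by simp
    next
      case 3
      have "n i a \<ge> 0" for i
      proof -
        interpret sl2_triple "br (Fg i)" "\<lambda>v. - br (Hc i) v" "br (Eg i)" by (rule sl2_ad')
        have "br (Eg i) (b a) \<in> sp (\<lambda>t. t = of_int (z + 1))"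
          by (rule sp_br[OF EF_sp(1) sp_b[of "\<lambda>t. t = of_int z"]]) (use z in auto)
        hence F: "br (Eg i) (b a) \<in> triangular" using small[of "z + 1"] 3 by auto
        have Hb: "- br (Hc i) (b a) = - of_int (n i a) *s b a" by (simp add: H_b vec_eq_iff)
        have "\<exists>k::nat. - complex_of_int (n i a) = - of_nat k"
          by (rule weight_mod_subspace[OF T(1) triangular_stable(2,1) a F Hb])
        then obtain k :: nat where "complex_of_int (n i a) = of_int (int k)" by auto
        hence "n i a = int k" by (simp only: of_int_eq_iff)
        thus ?thesis by simp
      qed
      hence "deg a \<ge> 0" unfolding deg_def
        by (intro sum_nonneg mult_nonneg_nonneg) (simp_all add: rcf_def wt_nonneg)
      thus False using 3 z by simp
    qed
  qed
  hence "vec.span (range b) \<subseteq> triangular" by (intro vec.span_minimal T(1)) auto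
  thus ?thesis using b_span by auto
qed

lemma triangular_decomposition:
  obtains h u v where "x = h + u + v" "h \<in> hh" "u \<in> nil_minus \<gg>" "v \<in> nil_plus \<gg>"
proof -
  have "x \<in> triangular" by (simp add: triangular_UNIV)
  thus ?thesis using that by (auto simp: triangular_def borel_minus_def)
qed

lemma nil_eq: "nil_plus \<gg> = sp (\<lambda>t. t \<ge> 1)" "nil_minus \<gg> = sp (\<lambda>t. t \<le> - 1)"
proof -
  have m: "sp (\<lambda>t. t = 0) \<subseteq> sp (\<lambda>t. t \<le> 0)" "sp (\<lambda>t. t = 0) \<subseteq> sp (\<lambda>t. t \<ge> 0)"
    "sp (\<lambda>t. t \<le> - 1) \<subseteq> sp (\<lambda>t. t \<le> 0)" "sp (\<lambda>t. t \<ge> 1) \<subseteq> sp (\<lambda>t. t \<ge> 0)"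
    by (rule sp_mono; simp)+
  have "x \<in> nil_plus \<gg>" if x: "x \<in> sp (\<lambda>t. t \<ge> 1)" for x
  proof -
    obtain h u v where e: "x = h + u + v" "h \<in> hh" "u \<in> nil_minus \<gg>" "v \<in> nil_plus \<gg>"
      by (rule triangular_decomposition)
    have "h + u \<in> sp (\<lambda>t. t \<le> 0)" using e m hh_sp nil_sp by (intro vec.subspace_add sp_sub) blast+
    moreover have "x - v \<in> sp (\<lambda>t. t \<ge> 1)" using e nil_sp x by (intro vec.subspace_diff sp_sub) blast+
    moreover have "x - v = h + u" using e by simp
    ultimately have "x - v = 0" by (intro sp_disjoint[of _ "\<lambda>t. t \<ge> 1" "\<lambda>t. t \<le> 0"]) auto
    thus ?thesis using e(4) by simp
  qed
  thus "nil_plus \<gg> = sp (\<lambda>t. t \<ge> 1)" using nil_sp by blast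
  have "x \<in> nil_minus \<gg>" if x: "x \<in> sp (\<lambda>t. t \<le> - 1)" for x
  proof -
    obtain h u v where e: "x = h + u + v" "h \<in> hh" "u \<in> nil_minus \<gg>" "v \<in> nil_plus \<gg>"
      by (rule triangular_decomposition)
    have "h + v \<in> sp (\<lambda>t. t \<ge> 0)" using e m hh_sp nil_sp by (intro vec.subspace_add sp_sub) blast+
    moreover have "x - u \<in> sp (\<lambda>t. t \<le> - 1)" using e nil_sp x by (intro vec.subspace_diff sp_sub) blast+
    moreover have "x - u = h + v" using e by simp
    ultimately have "x - u = 0" by (intro sp_disjoint[of _ "\<lambda>t. t \<le> - 1" "\<lambda>t. t \<ge> 0"]) auto
    thus ?thesis using e(3) by simp
  qed
  thus "nil_minus \<gg> = sp (\<lambda>t. t \<le> - 1)" using nil_sp by blast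
qed

text \<open>The common kernel of the simple roots commutes with n_+ and n_-, hence is an ideal by
  the triangular decomposition. It sits in a nilpotent algebra, so it is solvable and therefore
  zero.\<close>

lemma cartan_faithful:
  assumes "y \<in> hh" "\<And>i. al i y = 0"
  shows "y = 0"
proof -
  define K where "K = {y \<in> hh. \<forall>i. al i y = 0}"
  have Ks: "vec.subspace K"
    unfolding vec.subspace_def K_def using vec.subspace_0[OF hh_sub] vec.subspace_add[OF hh_sub] vec.subspace_scale[OF hh_sub]
    by (auto simp: al_0 al_scale al_lin(1))
  have nk: "br x y = 0" if y: "y \<in> K" and x: "x \<in> nil_plus \<gg> \<or> x \<in> nil_minus \<gg>" for x y
  proof -
    have "lie_subalgebra \<gg> {x. br y x = 0}"
      unfolding lie_subalgebra_def using jacobi[of y] by (auto simp: vec.subspace_def br_simps)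
    hence "nil_plus \<gg> \<subseteq> {x. br y x = 0}" "nil_minus \<gg> \<subseteq> {x. br y x = 0}"
      using nil_plus_facts(3) nil_minus_facts(3) y chev(3,4) unfolding K_def by auto
    hence "br y x = 0" using x by blast
    thus ?thesis by (subst br_anti) simp
  qed
  have hk: "br x y \<in> K" if y: "y \<in> K" and x: "x \<in> hh" for x y
  proof -
    have xy: "br x y \<in> hh" using hh_br x y by (simp add: K_def)
    have "al i (br x y) *s Eg i = br (br x y) (Eg i)" for i using chev(3)[OF xy] by simp
    also have "br (br x y) (Eg i) = br x (br y (Eg i)) - br y (br x (Eg i))" for i using jacobi[of x y "Eg i"] by simp
    also have "br x (br y (Eg i)) - br y (br x (Eg i)) = 0" for i
      using x y by (simp add: K_def chev(3) br_simps)
    finally have z: "al i (br x y) *s Eg i = 0" for i .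
    have "al i (br x y) = 0" for i using EF_nonzero(1)[of i] z[of i] by simp
    thus ?thesis using xy by (simp add: K_def)
  qed
  have "lie_ideal \<gg> K"
    unfolding lie_ideal_def
  proof (intro conjI allI ballI Ks)
    fix x y assume y: "y \<in> K"
    obtain h u v where "x = h + u + v" "h \<in> hh" "u \<in> nil_minus \<gg>" "v \<in> nil_plus \<gg>"
      by (rule triangular_decomposition)
    thus "br x y \<in> K" using hk[OF y] nk[OF y] by (simp add: br_simps)
  qed
  moreover have "lie_solvable \<gg> K"
  proof -
    have le: "((\<lambda>D. brk_span \<gg> D D) ^^ k) K \<subseteq> lcs k" for k
    proof (induction k)
      case 0 thus ?case by (auto simp: K_def)
    next
      case (Suc k)
      hence "((\<lambda>D. brk_span \<gg> D D) ^^ k) K \<subseteq> hh" using lcs_hh by blast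
      with Suc show ?case unfolding lcs_Suc funpow.simps o_apply brk_span_def by (intro vec.span_mono) blast
    qed
    have z: "0 \<in> ((\<lambda>D. brk_span \<gg> D D) ^^ k) K" for k
      using vec.subspace_0[OF Ks] by (cases k) (auto simp: brk_span_def vec.span_zero)
    obtain N where "lcs N = {0}" by (rule lcs_nil)
    hence "((\<lambda>D. brk_span \<gg> D D) ^^ N) K = {0}" using le[of N] z[of N] by auto
    thus ?thesis unfolding lie_solvable_def by blast
  qed
  ultimately have "K = {0}" using ss unfolding semisimple_data_def semisimple_def by (elim conjE) blast
  thus ?thesis using assms by (auto simp: K_def)
qed

lemma cartan_expand:
  assumes "y \<in> hh"
  shows "y = (\<Sum>k\<in>UNIV. al k y *s fcw k)"
proof -
  define y' where "y' = (\<Sum>k\<in>UNIV. al k y *s fcw k)"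
  have y': "y' \<in> hh" unfolding y'_def by (intro vec.subspace_sum vec.subspace_scale hh_sub fcw)
  have a: "al i y' = al i y" for i
    unfolding y'_def by (subst al_sum) (simp_all add: fcw if_distrib cong: if_cong)
  have "y + (-1) *s y' = 0"
    by (rule cartan_faithful) (simp_all add: vec.subspace_add[OF hh_sub] vec.subspace_scale[OF hh_sub] assms y' al_lin(1) al_scale a
        del: vec.scale_minus_left)
  thus ?thesis by (simp add: y'_def)
qed

lemma br_fcw: "br (fcw k) x = (\<Sum>j\<in>UNIV. of_real (wt k j) *s br (Hc j) x)"
  by (simp add: fcw_def br_sum br_simps)

text \<open>The Cartan subalgebra is now spanned by the fundamental coweights, which are
  combinations of coroots, and coroots are central in it.\<close>

lemma cartan_abelian: "y \<in> hh \<Longrightarrow> y' \<in> hh \<Longrightarrow> br y y' = 0"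
  by (subst cartan_expand[of y]) (simp_all add: br_sum br_simps br_fcw H_central)

lemma b_weight_ex:
  "\<exists>k :: 'i \<Rightarrow> int. \<forall>y\<in>hh. br y (b a) = (\<Sum>i\<in>UNIV. of_int (k i) * al i y) *s b a"
proof -
  have w: "\<exists>c. br y (b a) = c *s b a" if "y \<in> hh" for y
  proof -
    have f: "br (fcw k) (b a) = (\<Sum>j\<in>UNIV. of_real (wt k j) * of_int (n j a)) *s b a" for k
      by (simp add: br_fcw H_b vec.scale_sum_left)
    hence "br y (b a) = (\<Sum>k\<in>UNIV. al k y * (\<Sum>j\<in>UNIV. of_real (wt k j) * of_int (n j a))) *s b a"
      by (subst cartan_expand[OF that]) (simp only: br_sum br_simps f vec.scale_scale vec.scale_sum_left[symmetric])
    thus ?thesis by blast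
  qed
  obtain k :: "'i \<Rightarrow> int" where "\<And>y. y \<in> hh \<Longrightarrow> br y (b a) = (\<Sum>i\<in>UNIV. of_int (k i) * al i y) *s b a"
    by (rule weight_integral[OF b_nonzero w], assumption) (rule that; assumption)
  thus ?thesis by blast
qed

definition kw :: "'n \<Rightarrow> 'i \<Rightarrow> int" where
  "kw a = (SOME k. \<forall>y\<in>hh. br y (b a) = (\<Sum>i\<in>UNIV. of_int (k i) * al i y) *s b a)"

lemma b_weight: "y \<in> hh \<Longrightarrow> br y (b a) = (\<Sum>i\<in>UNIV. of_int (kw a i) * al i y) *s b a"
  using someI_ex[OF b_weight_ex[of a]] unfolding kw_def by blast

text \<open>The height of the weight of \<open>b a\<close>; the integer form of
  \<open>deg a\<close>.\<close>

definition dg :: "'n \<Rightarrow> int" where "dg a = (\<Sum>i\<in>UNIV. kw a i)"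

lemma deg_dg: "deg a = of_int (dg a)"
proof -
  have "complex_of_real (deg a) *s b a = of_int (dg a) *s b a"
    using weight_rho[OF b_weight, of a] br_rho_b[of a] by (simp add: dg_def)
  hence "complex_of_real (deg a) = complex_of_real (of_int (dg a))"
    using b_nonzero[of a] vec.scale_right_imp_eq by (metis of_real_of_int_eq)
  thus ?thesis by (simp only: of_real_eq_iff)
qed

text \<open>A bracket of two elements of degree at least 1 has degree at least 2. So the span of the
  \<open>Eg i\<close> together with all degrees from 2 on is already a subalgebra containing the
  generators of n_+.\<close>

lemma degree_1_span:
  assumes "x \<in> sp (\<lambda>t. t = 1)"
  shows "x \<in> vec.span (range Eg)"
proof -
  let ?S = "{e + f | e f. e \<in> vec.span (range Eg) \<and> f \<in> sp (\<lambda>t. t \<ge> 2)}"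
  have E1: "vec.span (range Eg) \<subseteq> sp (\<lambda>t. t = 1)" using EF_sp(1) by (intro vec.span_minimal sp_sub) auto
  have m: "sp (\<lambda>t. t = 1) \<subseteq> sp (\<lambda>t. t \<ge> 1)" "sp (\<lambda>t. t \<ge> 2) \<subseteq> sp (\<lambda>t. t \<ge> 1)" by (rule sp_mono; simp)+
  have S1: "u \<in> sp (\<lambda>t. t \<ge> 1)" if "u \<in> ?S" for u using that E1 m vec.subspace_add[OF sp_sub] by blast
  have "nil_plus \<gg> \<subseteq> ?S"
  proof (rule nil_plus_facts(3))
    show "lie_subalgebra \<gg> ?S"
      unfolding lie_subalgebra_def
    proof (intro conjI ballI)
      show "vec.subspace ?S" by (rule vec.subspace_sums[OF vec.subspace_span sp_sub])
      fix u v assume u: "u \<in> ?S" and v: "v \<in> ?S"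
      have "br u v \<in> sp (\<lambda>t. t \<ge> 2)" by (rule sp_br[OF S1[OF u] S1[OF v]]) simp
      moreover have "br u v = 0 + br u v" by simp
      ultimately show "br u v \<in> ?S" using vec.span_zero by blast
    qed
    show "Eg i \<in> ?S" for i
    proof -
      have "Eg i = Eg i + 0" by simp
      moreover have "Eg i \<in> vec.span (range Eg)" by (intro vec.span_base) simp
      ultimately show ?thesis using vec.subspace_0[OF sp_sub] by blast
    qed
  qed
  moreover have "x \<in> nil_plus \<gg>" using assms m nil_eq by blast
  ultimately obtain e f where ef: "x = e + f" "e \<in> vec.span (range Eg)" "f \<in> sp (\<lambda>t. t \<ge> 2)" by blast
  have "x - e \<in> sp (\<lambda>t. t = 1)" using assms E1 ef by (intro vec.subspace_diff sp_sub) blast+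
  moreover have "x - e \<in> sp (\<lambda>t. t \<ge> 2)" using ef by simp
  ultimately have "x - e = 0" by (intro sp_disjoint[of _ "\<lambda>t. t = 1" "\<lambda>t. t \<ge> 2"]) auto
  thus ?thesis using ef by simp
qed

text \<open>On degree 1, which the \<open>Eg j\<close> span, the fundamental coweight
  \<open>fcw i\<close> acts as the projection onto the line of \<open>Eg i\<close>.\<close>

lemma degree_1_root:
  assumes x: "x \<in> sp (\<lambda>t. t = 1)" and w: "\<And>y. y \<in> hh \<Longrightarrow> br y x = al i y *s x"
  shows "\<exists>c. x = c *s Eg i"
proof -
  have "\<exists>c. br (fcw i) x = c *s Eg i"
    using degree_1_span[OF x]
  proof (induction rule: vec.span_induct_alt)
    case base show ?case by (intro exI[of _ 0]) (simp add: br_simps)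
  next
    case (step c u v)
    then obtain j e where "u = Eg j" "br (fcw i) v = e *s Eg i" by blast
    hence "br (fcw i) (c *s u + v) = (if i = j then c + e else e) *s Eg i"
      using chev(3)[OF fcw(1)] by (simp add: br_simps fcw vec.scale_left_distrib)
    thus ?case by blast
  qed
  thus ?thesis using w[OF fcw(1)] by (simp add: fcw)
qed

lemma rho_unique: "x \<in> hh \<Longrightarrow> (\<And>i. al i x = 1) \<Longrightarrow> x = rho"
  using cartan_expand[of x] by (simp add: rho_def)

lemma rho_check_eq: "rho_check \<gg> = rho"
  unfolding rho_check_def
proof (rule the_equality)
  show "rho \<in> hh \<and> (\<forall>i. al i rho = 1)" using rho_hh al_rho by blast
  show "x = rho" if "x \<in> hh \<and> (\<forall>i. al i x = 1)" for x using rho_unique[of x] that by blast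
qed

text \<open>The principal triple: p_1, 2 rho and p_-1, where p_1 has the coefficients
  \<open>2 * rcf i\<close> that make its bracket with p_-1 equal to 2 rho. A vector of positive
  degree killed by p_-1 would be a lowest weight vector of positive weight; negative degrees use the
  opposite triple and p_1.\<close>

lemma principal_injective:
  assumes x: "br rho x = of_real d *s x"
  shows "d > 0 \<Longrightarrow> br (p_minus \<gg>) x = 0 \<Longrightarrow> x = 0"
    "d < 0 \<Longrightarrow> (\<And>i. br (Eg i) x = 0) \<Longrightarrow> x = 0"
proof -
  define p1 where "p1 = (\<Sum>i\<in>UNIV. of_real (2 * rcf i) *s Eg i)"
  define h2 where "h2 = 2 *s rho"
  have "br p1 (p_minus \<gg>) = (\<Sum>i\<in>UNIV. \<Sum>j\<in>UNIV. of_real (2 * rcf i) *s br (Eg i) (Fg j))"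
    by (subst sum.swap) (simp add: p1_def p_minus_def br_sum br_simps vec.scale_sum_right)
  also have "\<dots> = h2" by (simp add: chev(5) if_distrib[where f = "\<lambda>z. _ *s z"] h2_def rho_H vec.scale_sum_right cong: if_cong)
  finally have pp: "br p1 (p_minus \<gg>) = h2" .
  have hp: "br h2 p1 = 2 *s p1" "br h2 (p_minus \<gg>) = - 2 *s p_minus \<gg>"
    by (simp_all add: h2_def p1_def p_minus_def br_sum br_simps rho_EF vec.scale_sum_right sum_negf)
  interpret sl2_triple "br p1" "br h2" "br (p_minus \<gg>)"
  proof
    show "br h2 (br p1 v) = br p1 (br h2 v) + 2 *s br p1 v" for v by (subst jacobi) (simp add: hp br_simps)
    show "br h2 (br (p_minus \<gg>) v) = br (p_minus \<gg>) (br h2 v) - 2 *s br (p_minus \<gg>) v" for v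
      by (subst jacobi) (simp add: hp br_simps)
    show "br p1 (br (p_minus \<gg>) v) = br (p_minus \<gg>) (br p1 v) + br h2 v" for v by (subst jacobi) (simp add: pp)
  qed (simp_all add: br_simps)
  show "x = 0" if d: "d > 0" "br (p_minus \<gg>) x = 0"
  proof (rule ccontr)
    assume nz: "x \<noteq> 0"
    have "\<exists>k::nat. complex_of_real (2 * d) = - of_nat k"
      by (rule weight_mod_subspace[where U = "{0}" and v = x]) (use nz x d in \<open>simp_all add: br_simps h2_def\<close>)
    then obtain k :: nat where "complex_of_real (2 * d) = of_real (- real k)" by auto
    hence "2 * d = - real k" by (simp only: of_real_eq_iff)
    thus False using d by simp
  qed
  interpret r: sl2_triple "br (p_minus \<gg>)" "\<lambda>v. - br h2 v" "br p1"
    by unfold_locales (auto intro!: clinI simp: lin lin_simps EF HE HF vec_eq_iff algebra_simps)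
  show "x = 0" if d: "d < 0" "\<And>i. br (Eg i) x = 0"
  proof (rule ccontr)
    assume nz: "x \<noteq> 0"
    have p: "br p1 x = 0" by (simp add: p1_def br_sum br_simps d)
    have "\<exists>k::nat. - complex_of_real (2 * d) = - of_nat k"
      by (rule r.weight_mod_subspace[where U = "{0}" and v = x]) (use nz x p in \<open>simp_all add: br_simps h2_def\<close>)
    then obtain k :: nat where "complex_of_real (2 * d) = of_real (real k)" by auto
    hence "2 * d = real k" by (simp only: of_real_eq_iff)
    thus False using d by simp
  qed
qed

text \<open>The automorphism permutes the coroots compatibly with the Cartan matrix, so the image of
  \<open>rho\<close> still has value 1 on every simple root; and \<open>hh\<close> is spanned by
  coroots.\<close>

lemma induced_rho:
  assumes "diagram_automorphism \<gg> \<nu>" "induced_automorphism \<gg> \<nu> V"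
  shows "V *v rho = rho" "y \<in> hh \<Longrightarrow> V *v y \<in> hh"
proof -
  have VH: "V *v Hc i = Hc (\<nu> i)" for i using assms(2) by (simp add: induced_automorphism_def)
  have lin: "V *v (\<Sum>i\<in>UNIV. c i *s Hc i) = (\<Sum>i\<in>UNIV. c i *s Hc (\<nu> i))" for c
    by (simp add: vec.linear_sum[OF matrix_vector_mul_linear_gen] matrix_vector_simps VH)
  have in_hh: "(\<Sum>i\<in>UNIV. c i *s Hc (\<nu> i)) \<in> hh" for c
    by (intro vec.subspace_sum vec.subspace_scale hh_sub chev)
  show "V *v y \<in> hh" if "y \<in> hh"
  proof -
    have "V *v fcw k \<in> hh" for k unfolding fcw_def lin by (rule in_hh)
    thus ?thesis
      by (subst cartan_expand[OF that])
        (simp add: vec.linear_sum[OF matrix_vector_mul_linear_gen] matrix_vector_simps vec.subspace_sum[OF hh_sub] vec.subspace_scale[OF hh_sub])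
  qed
  show "V *v rho = rho"
  proof (rule rho_unique)
    show "V *v rho \<in> hh" unfolding rho_H lin by (rule in_hh)
    fix i
    obtain j where j: "i = \<nu> j" using assms(1) by (metis bij_pointE diagram_automorphism_def)
    have "al i (V *v rho) = (\<Sum>k\<in>UNIV. of_real (rcf k) * al (\<nu> j) (Hc (\<nu> k)))"
      unfolding rho_H lin j by (rule al_sum) (rule chev)
    also have "\<dots> = (\<Sum>k\<in>UNIV. of_real (rcf k) * al j (Hc k))"
      using assms(1) by (simp add: diagram_automorphism_def)
    also have "\<dots> = al j rho" unfolding rho_H by (rule al_sum[symmetric]) (rule chev)
    finally show "al i (V *v rho) = 1" by (simp add: al_rho)
  qed
qed

end

lemma (in ss) ss_basis_exists: "\<exists>b n wt. ss_basis \<gg> b n wt"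
proof -
  obtain b :: "'n \<Rightarrow> complex^'n" and n :: "'i \<Rightarrow> 'n \<Rightarrow> int" where
    b: "vec.span (range b) = UNIV" "\<And>i a. br (Hc i) (b a) = of_int (n i a) *s b a"
    by (rule joint_eigenbasis) (rule that; assumption)
  obtain wt :: "'i \<Rightarrow> 'i \<Rightarrow> real" where
    "\<And>i k. al i (\<Sum>j\<in>UNIV. of_real (wt k j) *s Hc j) = (if i = k then 1 else 0)"
    "\<And>j. (\<Sum>k\<in>UNIV. wt k j) \<ge> 0"
    by (rule coroot_gram[OF b]) (rule that; assumption)
  hence "ss_basis \<gg> b n wt" using b by unfold_locales auto
  thus ?thesis by blast
qed


section \<open>Exponentials\<close>

abbreviation mpow :: "complex^'n^'n \<Rightarrow> nat \<Rightarrow> complex^'n^'n" where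
  "mpow A k \<equiv> ((**) A ^^ k) (mat 1)"

lemma mat_mult_entry: "(X ** Y) $ r $ s = (\<Sum>q\<in>UNIV. X $ r $ q * Y $ q $ s)"
  by (simp add: matrix_matrix_mult_def)

lemma mat_axis: "(X *v axis s (1::complex)) $ r = X $ r $ s"
  by (simp add: matrix_vector_mult_def axis_def if_distrib cong: if_cong)

lemma mat_add_distrib:
  fixes A B C :: "'a::comm_ring_1^'n^'n"
  shows "A ** (B + C) = A ** B + A ** C" "(A + B) ** C = A ** C + B ** C"
  by (simp_all add: matrix_matrix_mult_def vec_eq_iff algebra_simps sum.distrib)

lemma vec_sumsI:
  fixes f :: "nat \<Rightarrow> ('a::real_normed_vector)^'m"
  assumes "\<And>i. (\<lambda>k. f k $ i) sums (S $ i)"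
  shows "f sums S"
  unfolding sums_def by (rule vec_tendstoI) (use assms in \<open>simp add: sums_def\<close>)

lemma mpow_bound:
  fixes A :: "complex^'n^'n"
  defines "C \<equiv> (\<Sum>r\<in>UNIV. \<Sum>s\<in>UNIV. norm (A $ r $ s))"
  shows "norm (mpow A k $ r $ s) \<le> C ^ k"
proof (induction k arbitrary: r)
  case 0 thus ?case by (simp add: mat_def)
next
  case (Suc k)
  have "norm (mpow A (Suc k) $ r $ s) \<le> (\<Sum>q\<in>UNIV. norm (A $ r $ q) * C ^ k)"
    unfolding funpow.simps o_apply mat_mult_entry
    by (rule order.trans[OF norm_sum]) (intro sum_mono, simp add: norm_mult mult_left_mono Suc)
  also have "\<dots> = (\<Sum>q\<in>UNIV. norm (A $ r $ q)) * C ^ k" by (simp add: sum_distrib_right)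
  also have "\<dots> \<le> C * C ^ k"
    unfolding C_def by (intro mult_right_mono zero_le_power sum_nonneg member_le_sum[where f = "\<lambda>r. \<Sum>s\<in>UNIV. norm (A $ r $ s)"]) (auto intro: sum_nonneg)
  finally show ?case by simp
qed

lemma mat_exp_entry_summable:
  fixes A :: "complex^'n^'n"
  shows "summable (\<lambda>k. norm (inverse (fact k) *\<^sub>R mpow A k $ r $ s))"
proof -
  define C where "C = (\<Sum>r\<in>UNIV. \<Sum>s\<in>UNIV. norm (A $ r $ s))"
  have "summable (\<lambda>k. inverse (fact k) * C ^ k)" by (rule summable_exp)
  thus ?thesis
    by (rule summable_comparison_test'[where N = 0])
      (simp add: C_def mult_left_mono mpow_bound)
qed

lemma mat_exp_sums: "(\<lambda>k. inverse (fact k) *\<^sub>R mpow A k $ r $ s) sums (mat_exp A $ r $ s)"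
proof -
  define S where "S = (\<chi> r s. \<Sum>k. inverse (fact k) *\<^sub>R mpow A k $ r $ s)"
  have c: "(\<lambda>k. inverse (fact k) *\<^sub>R mpow A k $ r $ s) sums (S $ r $ s)" for r s
    unfolding S_def vec_lambda_beta by (rule summable_sums) (rule summable_norm_cancel[OF mat_exp_entry_summable])
  have "(\<lambda>k. inverse (fact k) *\<^sub>R mpow A k) sums S"
    by (intro vec_sumsI) (use c in simp)
  hence "mat_exp A = S" unfolding mat_exp_def by (rule sums_unique[symmetric])
  thus ?thesis using c by simp
qed

lemma mat_exp_bilinear_sums:
  "(\<lambda>k. inverse (fact k) *\<^sub>R (X ** mpow A k ** Y) $ r $ s) sums ((X ** mat_exp A ** Y) $ r $ s)"
proof -
  have e: "(X ** Z ** Y) $ r $ s = (\<Sum>q\<in>UNIV. \<Sum>p\<in>UNIV. X $ r $ p * Z $ p $ q * Y $ q $ s)" for Z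
    by (simp add: matrix_matrix_mult_def sum_distrib_right)
  have "(\<lambda>k. \<Sum>q\<in>UNIV. \<Sum>p\<in>UNIV. X $ r $ p * (inverse (fact k) *\<^sub>R mpow A k $ p $ q) * Y $ q $ s) sums
    (\<Sum>q\<in>UNIV. \<Sum>p\<in>UNIV. X $ r $ p * mat_exp A $ p $ q * Y $ q $ s)"
    by (intro sums_sum sums_mult sums_mult2 mat_exp_sums)
  thus ?thesis unfolding e by (simp add: scaleR_sum_right)
qed

lemma mat_exp_vec_sums:
  "(\<lambda>k. inverse (fact k) *\<^sub>R (mpow A k *v v) $ r) sums ((mat_exp A *v v) $ r)"
proof -
  have "(\<lambda>k. \<Sum>q\<in>UNIV. (inverse (fact k) *\<^sub>R mpow A k $ r $ q) * v $ q) sums (\<Sum>q\<in>UNIV. mat_exp A $ r $ q * v $ q)"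
    by (intro sums_sum sums_mult2 mat_exp_sums)
  thus ?thesis by (simp add: matrix_vector_mult_def scaleR_sum_right)
qed

lemma mat_exp_vec_summable: "summable (\<lambda>k. norm (inverse (fact k) *\<^sub>R (mpow A k *v v) $ r))"
proof (rule summable_comparison_test'[where N = 0])
  show "summable (\<lambda>k. \<Sum>q\<in>UNIV. norm (inverse (fact k) *\<^sub>R mpow A k $ r $ q) * norm (v $ q))"
    by (intro summable_sum summable_mult2 mat_exp_entry_summable)
  fix k
  have "inverse (fact k) *\<^sub>R (mpow A k *v v) $ r = (\<Sum>q\<in>UNIV. (inverse (fact k) *\<^sub>R mpow A k $ r $ q) * v $ q)"
    by (simp add: matrix_vector_mult_def scaleR_sum_right)
  also have "norm \<dots> \<le> (\<Sum>q\<in>UNIV. norm (inverse (fact k) *\<^sub>R mpow A k $ r $ q) * norm (v $ q))"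
    by (rule order.trans[OF norm_sum]) (simp add: norm_mult mult.assoc)
  finally show "norm (norm (inverse (fact k) *\<^sub>R (mpow A k *v v) $ r)) \<le>
      (\<Sum>q\<in>UNIV. norm (inverse (fact k) *\<^sub>R mpow A k $ r $ q) * norm (v $ q))" by simp
qed

lemma mpow_vec: "mpow A (Suc k) *v v = A *v (mpow A k *v v)"
  by (simp add: matrix_vector_mul_assoc)

lemma mat_exp_eigen:
  assumes "A *v v = c *s v"
  shows "mat_exp A *v v = exp c *s v"
proof -
  have p: "mpow A k *v v = c ^ k *s v" for k
    by (induction k) (simp_all add: matrix_vector_mul_assoc[symmetric] matrix_vector_simps assms mult.commute)
  have "(mat_exp A *v v) $ r = exp c * v $ r" for r
  proof -
    have "(\<lambda>k. (inverse (fact k) *\<^sub>R c ^ k) * v $ r) sums (exp c * v $ r)"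
      by (intro sums_mult2) (use exp_converges[of c] in \<open>simp add: divide_inverse\<close>)
    hence "(\<lambda>k. inverse (fact k) *\<^sub>R (mpow A k *v v) $ r) sums (exp c * v $ r)" by (simp add: p)
    thus ?thesis using mat_exp_vec_sums sums_unique2 by blast
  qed
  thus ?thesis by (simp add: vec_eq_iff)
qed

lemma adjoint_subgroup_mult:
  "g \<in> adjoint_subgroup \<gg> S \<Longrightarrow> h \<in> adjoint_subgroup \<gg> S \<Longrightarrow> g ** h \<in> adjoint_subgroup \<gg> S"
  by (induction rule: adjoint_subgroup.induct)
    (auto simp: matrix_mul_assoc[symmetric] intro: adjoint_subgroup.intros)

lemma adjoint_subgroup_mono: "g \<in> adjoint_subgroup \<gg> S \<Longrightarrow> S \<subseteq> S' \<Longrightarrow> g \<in> adjoint_subgroup \<gg> S'"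
  by (induction rule: adjoint_subgroup.induct) (auto intro: adjoint_subgroup.intros)

lemma adjoint_subgroup_exp: "x \<in> S \<Longrightarrow> mat_exp (matrix (brk \<gg> x)) \<in> adjoint_subgroup \<gg> S"
  using adjoint_subgroup.intros(2)[OF adjoint_subgroup.intros(1)] by fastforce

context lie_alg
begin

definition endo :: "complex^'n^'n \<Rightarrow> bool" where
  "endo Z \<longleftrightarrow> (\<forall>x y. Z *v br x y = br (Z *v x) (Z *v y))"

lemma endo_mult: "endo Z \<Longrightarrow> endo W \<Longrightarrow> endo (Z ** W)"
  by (simp add: endo_def flip: matrix_vector_mul_assoc)

lemma endo_1: "endo (mat 1)" by (simp add: endo_def)

lemma endo_inv:
  assumes "endo Z" "invertible Z"
  shows "endo (matrix_inv Z)"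
proof -
  have i: "matrix_inv Z *v (Z *v v) = v" "Z *v (matrix_inv Z *v v) = v" for v
    by (simp_all add: matrix_vector_mul_assoc matrix_inv assms)
  have "matrix_inv Z *v br x y = br (matrix_inv Z *v x) (matrix_inv Z *v y)" for x y
    using assms(1)[unfolded endo_def, rule_format, of "matrix_inv Z *v x" "matrix_inv Z *v y"] i by metis
  thus ?thesis by (simp add: endo_def)
qed

lemma endo_AD: "endo Z \<longleftrightarrow> (\<forall>x. Z ** AD x = AD (Z *v x) ** Z)"
  by (simp add: endo_def matrix_eq AD flip: matrix_vector_mul_assoc)

lemma br_component: "br x y $ c = (\<Sum>r\<in>UNIV. \<Sum>s\<in>UNIV. x $ r * y $ s * br (axis r 1) (axis s 1) $ c)"
proof -
  have "br x y = br (\<Sum>r\<in>UNIV. x $ r *s axis r 1) (\<Sum>s\<in>UNIV. y $ s *s axis s 1)"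
    by (simp add: basis_expansion)
  also have "\<dots> = (\<Sum>s\<in>UNIV. \<Sum>r\<in>UNIV. x $ r *s (y $ s *s br (axis r 1) (axis s 1)))"
    by (simp only: br_sum br_simps vec.scale_sum_right vec.scale_scale) (simp add: mult.commute)
  finally show ?thesis by (subst sum.swap) (simp add: mult.assoc)
qed

text \<open>With \<open>e k\<close> for the divided power (ad x)^k / k!, the derivation property
  becomes a Leibniz rule without binomial coefficients, which the Cauchy product of absolutely
  convergent series sums to multiplicativity.\<close>

lemma endo_exp: "endo (mat_exp (AD x))"
proof -
  define e where "e = (\<lambda>k v. inverse (fact k) *\<^sub>R (mpow (AD x) k *v v))"
  have e0: "e 0 v = v" for v by (simp add: e_def)
  have br_R: "br (c *\<^sub>R u) v = c *\<^sub>R br u v" "br u (c *\<^sub>R v) = c *\<^sub>R br u v" for c u v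
  proof -
    have sR: "c *\<^sub>R w = complex_of_real c *s w" for w :: "complex^'n"
      unfolding vec_eq_iff vector_scaleR_component vector_smult_component by (simp add: scaleR_conv_of_real)
    show "br (c *\<^sub>R u) v = c *\<^sub>R br u v" "br u (c *\<^sub>R v) = c *\<^sub>R br u v" by (simp_all add: sR br_simps)
  qed
  have eS: "of_nat (Suc k) *\<^sub>R e (Suc k) v = br x (e k v)" for k v
  proof -
    have "e (Suc k) v = (inverse (real (Suc k)) * inverse (fact k)) *\<^sub>R br x (mpow (AD x) k *v v)"
      unfolding e_def mpow_vec AD by (simp add: fact_Suc mult.commute)
    thus ?thesis by (simp add: e_def br_R del: of_nat_Suc)
  qed
  \<comment> \<open>Both sides at k + 1 are compared after multiplication by k + 1; on the right
    this factor is split as i + (k + 1 - i), which corresponds to x acting on the first or on the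
    second argument.\<close>
  have leib: "e k (br u v) = (\<Sum>i\<le>k. br (e i u) (e (k - i) v))" for k u v
  proof (induction k)
    case 0 thus ?case by (simp add: e0)
  next
    case (Suc k)
    have A: "(\<Sum>i\<le>Suc k. real i *\<^sub>R br (e i u) (e (Suc k - i) v)) = (\<Sum>i\<le>k. br (br x (e i u)) (e (k - i) v))"
      by (subst sum.atMost_Suc_shift) (simp add: eS br_R(1)[symmetric] br_simps del: of_nat_Suc)
    have B: "(\<Sum>i\<le>Suc k. real (Suc k - i) *\<^sub>R br (e i u) (e (Suc k - i) v)) = (\<Sum>i\<le>k. br (e i u) (br x (e (k - i) v)))"
      by (subst sum.atMost_Suc) (simp add: Suc_diff_le eS br_R(2)[symmetric] br_simps del: of_nat_Suc cong: sum.cong_simp)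
    have "of_nat (Suc k) *\<^sub>R e (Suc k) (br u v) = (\<Sum>i\<le>k. br x (br (e i u) (e (k - i) v)))"
      by (simp only: eS Suc br_sum)
    also have "\<dots> = (\<Sum>i\<le>k. br (br x (e i u)) (e (k - i) v)) + (\<Sum>i\<le>k. br (e i u) (br x (e (k - i) v)))"
      by (subst jacobi) (simp add: sum.distrib)
    also have "\<dots> = (\<Sum>i\<le>Suc k. (real i + real (Suc k - i)) *\<^sub>R br (e i u) (e (Suc k - i) v))"
      by (simp only: A[symmetric] B[symmetric] sum.distrib[symmetric] scaleR_left_distrib)
    also have "\<dots> = (\<Sum>i\<le>Suc k. real (Suc k) *\<^sub>R br (e i u) (e (Suc k - i) v))"
      by (intro sum.cong refl) (simp add: of_nat_diff)
    also have "\<dots> = real (Suc k) *\<^sub>R (\<Sum>i\<le>Suc k. br (e i u) (e (Suc k - i) v))" by (rule scaleR_sum_right[symmetric])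
    finally have "real (Suc k) *\<^sub>R e (Suc k) (br u v) = real (Suc k) *\<^sub>R (\<Sum>i\<le>Suc k. br (e i u) (e (Suc k - i) v))" by simp
    thus ?case unfolding scaleR_cancel_left by simp
  qed
  have sm: "(\<lambda>k. e k v $ r) sums ((mat_exp (AD x) *v v) $ r)" "summable (\<lambda>k. norm (e k v $ r))" for v r
    using mat_exp_vec_sums[of "AD x" v r] mat_exp_vec_summable[of "AD x" v r] by (simp_all add: e_def)
  have "(mat_exp (AD x) *v br u v) $ c = br (mat_exp (AD x) *v u) (mat_exp (AD x) *v v) $ c" for u v c
  proof -
    have cp: "(\<lambda>k. \<Sum>i\<le>k. e i u $ r * e (k - i) v $ s) sums ((mat_exp (AD x) *v u) $ r * (mat_exp (AD x) *v v) $ s)" for r s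
      using Cauchy_product_sums[OF sm(2)[of u r] sm(2)[of v s]] sums_unique[OF sm(1)[of u r]] sums_unique[OF sm(1)[of v s]] by simp
    have "(\<lambda>k. \<Sum>r\<in>UNIV. \<Sum>s\<in>UNIV. (\<Sum>i\<le>k. e i u $ r * e (k - i) v $ s) * br (axis r 1) (axis s 1) $ c) sums
       (br (mat_exp (AD x) *v u) (mat_exp (AD x) *v v) $ c)"
      unfolding br_component[of "mat_exp (AD x) *v u"] by (intro sums_sum sums_mult2 cp)
    moreover have "(\<Sum>r\<in>UNIV. \<Sum>s\<in>UNIV. (\<Sum>i\<le>k. e i u $ r * e (k - i) v $ s) * br (axis r 1) (axis s 1) $ c) = e k (br u v) $ c" for k
    proof -
      have "e k (br u v) $ c = (\<Sum>i\<le>k. \<Sum>r\<in>UNIV. \<Sum>s\<in>UNIV. e i u $ r * e (k - i) v $ s * br (axis r 1) (axis s 1) $ c)"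
        unfolding leib sum_component br_component[symmetric] ..
      also have "\<dots> = (\<Sum>r\<in>UNIV. \<Sum>i\<le>k. \<Sum>s\<in>UNIV. e i u $ r * e (k - i) v $ s * br (axis r 1) (axis s 1) $ c)" by (rule sum.swap)
      also have "\<dots> = (\<Sum>r\<in>UNIV. \<Sum>s\<in>UNIV. \<Sum>i\<le>k. e i u $ r * e (k - i) v $ s * br (axis r 1) (axis s 1) $ c)"
        by (intro sum.cong refl sum.swap)
      finally show ?thesis by (simp add: sum_distrib_right)
    qed
    ultimately have "(\<lambda>k. e k (br u v) $ c) sums (br (mat_exp (AD x) *v u) (mat_exp (AD x) *v v) $ c)" by simp
    thus ?thesis using sm(1) sums_unique2 by blast
  qed
  thus ?thesis by (simp add: endo_def vec_eq_iff)
qed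

end

section \<open>Graded Lie algebras\<close>

text \<open>Kept independent of the root data because it is used twice, for \<open>rho\<close> and
  for \<open>- rho\<close>; the second use gives the unipotent group of n_-.\<close>

locale grading = lie_alg \<gg> for \<gg> :: "('n::finite, 'i::finite) lie_data" +
  fixes b :: "'n \<Rightarrow> complex^'n" and dg :: "'n \<Rightarrow> int" and rho :: "complex^'n"
  assumes b_spanning: "vec.span (range b) = UNIV"
    and rho_b: "\<And>a. br rho (b a) = of_int (dg a) *s b a"
begin

definition P :: "complex^'n^'n" where "P = (\<chi> r a. b a $ r)"
definition Pi :: "complex^'n^'n" where "Pi = matrix_inv P"
definition co :: "complex^'n \<Rightarrow> 'n \<Rightarrow> complex" where "co x a = (Pi *v x) $ a"
definition cj :: "complex^'n^'n \<Rightarrow> complex^'n^'n" where "cj Z = Pi ** Z ** P"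
text \<open>All homogeneous components of the operator Z have degree in S, read off from its matrix
  \<open>cj Z\<close> in the basis \<open>b\<close>.\<close>

definition sh :: "int set \<Rightarrow> complex^'n^'n \<Rightarrow> bool" where
  "sh S Z \<longleftrightarrow> (\<forall>a a'. dg a - dg a' \<notin> S \<longrightarrow> cj Z $ a $ a' = 0)"

lemma P: "P ** Pi = mat 1" "Pi ** P = mat 1"
  using matrix_inv[OF span_basis_coords(1)[OF b_spanning]] by (simp_all add: P_def Pi_def)

lemma P_vec: "P *v w = (\<Sum>a\<in>UNIV. w $ a *s b a)"
  by (simp add: P_def matrix_vector_mult_def vec_eq_iff mult.commute)

lemma P_axis: "P *v axis a 1 = b a"
  unfolding P_vec axis_def by (simp add: if_distrib[where f = "\<lambda>z. z *s _"] cong: if_cong)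

lemma co_expand: "x = (\<Sum>a\<in>UNIV. co x a *s b a)"
proof -
  have "x = P *v (Pi *v x)" by (simp add: matrix_vector_mul_assoc P)
  also have "\<dots> = (\<Sum>a\<in>UNIV. co x a *s b a)" unfolding P_vec co_def ..
  finally show ?thesis .
qed

lemma co_simps: "co (x + y) a = co x a + co y a" "co (c *s x) a = c * co x a" "co (x - y) a = co x a - co y a"
  "co 0 a = 0" "co (- x) a = - co x a"
  by (simp_all add: co_def matrix_vector_simps)

lemma co_sum: "co (sum f S) a = (\<Sum>i\<in>S. co (f i) a)"
  by (induction S rule: infinite_finite_induct) (simp_all add: co_simps)

lemma co_b: "co (b a) a' = (if a' = a then 1 else 0)"
proof -
  have "Pi *v b a = Pi *v (P *v axis a 1)" by (simp add: P_axis)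
  thus ?thesis by (simp add: co_def matrix_vector_mul_assoc P axis_def)
qed

lemma cj_mult: "cj (Z ** W) = cj Z ** cj W"
proof -
  have "cj Z ** cj W = Pi ** Z ** (P ** Pi) ** W ** P" by (simp add: cj_def matrix_mul_assoc)
  thus ?thesis by (simp add: cj_def P matrix_mul_assoc)
qed

lemma cj_simps: "cj (mat 1) = mat 1" "cj (Z + W) = cj Z + cj W" "cj (Z - W) = cj Z - cj W" "cj (- Z) = - cj Z" "cj 0 = 0"
  by (simp_all add: cj_def P matrix_mult_simps mat_add_distrib)

lemma cj_eq: "cj Z = cj W \<longleftrightarrow> Z = W"
proof
  assume "cj Z = cj W"
  hence "P ** (Pi ** Z ** P) ** Pi = P ** (Pi ** W ** P) ** Pi" by (simp add: cj_def)
  hence "(P ** Pi) ** Z ** (P ** Pi) = (P ** Pi) ** W ** (P ** Pi)" by (simp only: matrix_mul_assoc)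
  thus "Z = W" by (simp add: P)
qed simp

lemma cj_co: "cj Z $ a $ a' = co (Z *v b a') a"
proof -
  have "co (Z *v b a') a = (Pi *v (Z *v (P *v axis a' 1))) $ a"
    by (simp add: P_axis co_def)
  thus ?thesis by (simp add: cj_def matrix_vector_mul_assoc mat_axis matrix_mul_assoc)
qed

lemma co_mult: "co (Z *v x) a = (\<Sum>a'\<in>UNIV. cj Z $ a $ a' * co x a')"
  by (subst (1) co_expand[of x])
    (simp add: vec.linear_sum[OF matrix_vector_mul_linear_gen] matrix_vector_simps co_sum co_simps cj_co mult.commute)

lemma shI: "(\<And>a a'. dg a - dg a' \<notin> S \<Longrightarrow> cj Z $ a $ a' = 0) \<Longrightarrow> sh S Z"
  by (simp add: sh_def)

lemma shD: "sh S Z \<Longrightarrow> dg a - dg a' \<notin> S \<Longrightarrow> cj Z $ a $ a' = 0"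
  by (simp add: sh_def)

lemma sh_mult:
  assumes "sh S Z" "sh S' W" "\<And>s t. s \<in> S \<Longrightarrow> t \<in> S' \<Longrightarrow> s + t \<in> S''"
  shows "sh S'' (Z ** W)"
proof (rule shI)
  fix a a' assume n: "dg a - dg a' \<notin> S''"
  have "cj Z $ a $ c * cj W $ c $ a' = 0" for c
  proof (cases "dg a - dg c \<in> S \<and> dg c - dg a' \<in> S'")
    case True
    hence "(dg a - dg c) + (dg c - dg a') \<in> S''" using assms(3) by blast
    thus ?thesis using n by simp
  next
    case False thus ?thesis using shD[OF assms(1)] shD[OF assms(2)] by auto
  qed
  thus "cj (Z ** W) $ a $ a' = 0" unfolding cj_mult mat_mult_entry by (intro sum.neutral ballI)
qed

lemma sh_mono: "sh S Z \<Longrightarrow> S \<subseteq> S' \<Longrightarrow> sh S' Z" by (auto simp: sh_def)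

lemma sh_lin: "sh S Z \<Longrightarrow> sh S W \<Longrightarrow> sh S (Z + W)" "sh S Z \<Longrightarrow> sh S W \<Longrightarrow> sh S (Z - W)"
  "sh S Z \<Longrightarrow> sh S (- Z)" "sh S 0"
  by (simp_all add: sh_def cj_simps)

lemma sh_1: "0 \<in> S \<Longrightarrow> sh S (mat 1)"
  by (simp add: sh_def cj_simps) (auto simp: mat_def)

lemma sh_sum: "(\<And>i. i \<in> I \<Longrightarrow> sh S (f i)) \<Longrightarrow> sh S (sum f I)"
  by (induction I rule: infinite_finite_induct) (simp_all add: sh_lin)

text \<open>Larger than every difference of degrees, so an operator raising degrees by at least this
  much is zero.\<close>

definition bound :: nat where "bound = nat (Max ((\<lambda>(a, a'). dg a - dg a') ` UNIV)) + 1"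

lemma bound: "dg a - dg a' < int bound"
proof -
  have "dg a - dg a' \<le> Max ((\<lambda>(a, a'). dg a - dg a') ` UNIV)" by (rule Max_ge) (auto intro!: image_eqI[of _ _ "(a, a')"])
  thus ?thesis by (simp add: bound_def)
qed

lemma sh_bound: "sh {int bound..} Z \<Longrightarrow> Z = 0"
proof -
  assume "sh {int bound..} Z"
  hence "cj Z $ a $ a' = 0" for a a' using bound[of a a'] by (auto simp: sh_def)
  hence "cj Z = cj 0" by (simp add: cj_simps vec_eq_iff)
  thus "Z = 0" by (simp only: cj_eq)
qed

lemma cj_AD_rho: "cj (AD rho) $ a $ a' = (if a = a' then of_int (dg a') else 0)"
  by (simp add: cj_co AD rho_b co_simps co_b)

lemma co_rho: "co (br rho x) a = of_int (dg a) * co x a"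
proof -
  have "co (br rho x) a = (\<Sum>a'\<in>UNIV. cj (AD rho) $ a $ a' * co x a')" using co_mult[of "AD rho" x a] by (simp add: AD)
  thus ?thesis by (simp add: cj_AD_rho if_distrib[where f = "\<lambda>z. z * _"] cong: if_cong)
qed

lemma co_br_b: "co (br (b a) (b a')) c \<noteq> 0 \<Longrightarrow> dg c = dg a + dg a'"
proof -
  assume nz: "co (br (b a) (b a')) c \<noteq> 0"
  have "br rho (br (b a) (b a')) = of_int (dg a + dg a') *s br (b a) (b a')"
    by (subst jacobi) (simp add: rho_b br_simps vec.scale_left_distrib)
  hence "of_int (dg c) * co (br (b a) (b a')) c = of_int (dg a + dg a') * co (br (b a) (b a')) c"
    by (metis co_rho co_simps(2))
  hence "complex_of_int (dg c) = of_int (dg a + dg a')" using nz by (metis mult_right_cancel)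
  thus ?thesis by (simp only: of_int_eq_iff)
qed

definition gsp :: "int set \<Rightarrow> (complex^'n) set" where "gsp S = {x. \<forall>a. co x a \<noteq> 0 \<longrightarrow> dg a \<in> S}"

lemma gsp_span: "gsp S = vec.span {b a |a. dg a \<in> S}"
proof
  show "gsp S \<subseteq> vec.span {b a |a. dg a \<in> S}"
  proof
    fix x assume x: "x \<in> gsp S"
    have "co x a *s b a \<in> vec.span {b a |a. dg a \<in> S}" for a
    proof (cases "co x a = 0")
      case True thus ?thesis by (simp add: vec.span_zero)
    next
      case False
      hence "dg a \<in> S" using x by (simp add: gsp_def)
      thus ?thesis by (intro vec.span_scale vec.span_base) blast
    qed
    hence "(\<Sum>a\<in>UNIV. co x a *s b a) \<in> vec.span {b a |a. dg a \<in> S}" by (intro vec.span_sum)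
    thus "x \<in> vec.span {b a |a. dg a \<in> S}" using co_expand[of x] by simp
  qed
  show "vec.span {b a |a. dg a \<in> S} \<subseteq> gsp S"
  proof (rule vec.span_minimal)
    show "{b a |a. dg a \<in> S} \<subseteq> gsp S" by (auto simp: gsp_def co_b split: if_splits)
    show "vec.subspace (gsp S)"
      unfolding vec.subspace_def gsp_def by (auto simp: co_simps) (metis add.right_neutral)
  qed
qed

lemma gsp_sub: "vec.subspace (gsp S)" by (simp add: gsp_span)

lemma AD_sh:
  assumes "x \<in> gsp S"
  shows "sh S (AD x)"
proof (rule shI)
  fix c a' assume n: "dg c - dg a' \<notin> S"
  have z: "co x a * co (br (b a) (b a')) c = 0" for a
    using assms co_br_b[of a a' c] n unfolding gsp_def by force
  have e: "cj (AD x) $ c $ a' = (\<Sum>a\<in>UNIV. co x a * co (br (b a) (b a')) c)"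
    unfolding cj_co AD by (subst (1) co_expand[of x]) (simp add: br_sum br_simps co_sum co_simps)
  show "cj (AD x) $ c $ a' = 0" unfolding e by (intro sum.neutral ballI) (rule z)
qed

lemma sh_vec: "sh S Z \<Longrightarrow> x \<in> gsp S' \<Longrightarrow> (\<And>s t. s \<in> S \<Longrightarrow> t \<in> S' \<Longrightarrow> s + t \<in> S'') \<Longrightarrow> Z *v x \<in> gsp S''"
proof -
  assume Z: "sh S Z" and x: "x \<in> gsp S'" and S: "\<And>s t. s \<in> S \<Longrightarrow> t \<in> S' \<Longrightarrow> s + t \<in> S''"
  have "co (Z *v x) a = 0" if n: "dg a \<notin> S''" for a
  proof -
    have "cj Z $ a $ a' * co x a' = 0" for a'
    proof (cases "dg a - dg a' \<in> S \<and> dg a' \<in> S'")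
      case True thus ?thesis using S[of "dg a - dg a'" "dg a'"] n by simp
    next
      case False thus ?thesis using shD[OF Z] x by (auto simp: gsp_def)
    qed
    thus ?thesis unfolding co_mult by (intro sum.neutral ballI)
  qed
  thus ?thesis by (auto simp: gsp_def)
qed

lemma exp_sh:
  assumes "\<And>k. sh S (mpow A k)"
  shows "sh S (mat_exp A)"
proof (rule shI)
  fix a a' assume "dg a - dg a' \<notin> S"
  hence "(\<lambda>k. inverse (fact k) *\<^sub>R (Pi ** mpow A k ** P) $ a $ a') = (\<lambda>k. 0)"
    using assms by (simp add: sh_def cj_def)
  hence "(\<lambda>k. 0) sums ((Pi ** mat_exp A ** P) $ a $ a')" using mat_exp_bilinear_sums[of Pi A P a a'] by simp
  thus "cj (mat_exp A) $ a $ a' = 0" using sums_zero sums_unique2 unfolding cj_def by blast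
qed

lemma mpow_sh: "sh {k..} A \<Longrightarrow> sh {int j * k..} (mpow A j)"
proof (induction j)
  case 0 show ?case by (simp add: sh_1)
next
  case (Suc j)
  show ?case unfolding funpow.simps o_apply
    by (rule sh_mult[OF Suc.prems Suc.IH[OF Suc.prems]]) (simp add: algebra_simps)
qed

text \<open>For j at least 2 the power A^j raises degrees by at least 2 k, which is at least k +
  1.\<close>

lemma exp_first_order:
  assumes "sh {k..} A" "k \<ge> 1"
  shows "sh {k + 1..} (mat_exp A - mat 1 - A)"
proof (rule shI)
  fix a a' assume n: "dg a - dg a' \<notin> {k + 1..}"
  have z: "cj (mpow A j) $ a $ a' = 0" if "j \<ge> 2" for j
  proof (rule shD[OF mpow_sh[OF assms(1)]])
    have "2 * k \<le> int j * k" using that assms(2) by (intro mult_right_mono) auto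
    thus "dg a - dg a' \<notin> {int j * k..}" using n assms(2) unfolding atLeast_iff by linarith
  qed
  let ?f = "\<lambda>j. inverse (fact j) *\<^sub>R (Pi ** mpow A j ** P) $ a $ a'"
  have "?f sums (\<Sum>j\<in>{0, 1}. ?f j)"
  proof (rule sums_finite)
    fix j assume "j \<notin> {0::nat, 1}"
    hence "j \<ge> 2" by auto
    thus "?f j = 0" using z unfolding cj_def by simp
  qed simp
  hence "(Pi ** mat_exp A ** P) $ a $ a' = (\<Sum>j\<in>{0, 1}. ?f j)" using mat_exp_bilinear_sums sums_unique2 by blast
  hence "cj (mat_exp A) $ a $ a' = cj (mat 1) $ a $ a' + cj A $ a $ a'" by (simp add: cj_def)
  thus "cj (mat_exp A - mat 1 - A) $ a $ a' = 0" by (simp add: cj_simps)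
qed

text \<open>Geometric series, finite because a power of an operator raising degrees
  vanishes.\<close>

lemma unipotent_inv:
  assumes "sh {1..} (Z - mat 1)"
  shows "invertible Z" "sh {1..} (matrix_inv Z - mat 1)"
proof -
  define R where "R = mat 1 - Z"
  have R: "sh {1..} R" using sh_lin(3)[OF assms] by (simp add: R_def)
  define Q where "Q = (\<Sum>j<bound. mpow R j)"
  have Z: "Z = mat 1 - R" by (simp add: R_def)
  have tel: "Z ** (\<Sum>j<m. mpow R j) = mat 1 - mpow R m" for m
    by (induction m) (simp_all add: Z matrix_mult_simps mat_add_distrib)
  have "mpow R bound = 0" using sh_bound mpow_sh[OF R, of bound] by simp
  hence ZQ: "Z ** Q = mat 1" using tel[of bound] by (simp add: Q_def)
  thus "invertible Z" using matrix_inv_unique by blast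
  have inv: "matrix_inv Z = Q" using matrix_inv_unique[OF ZQ] by simp
  have "Q - mat 1 = (\<Sum>j\<in>{..<bound} - {0}. mpow R j)"
    unfolding Q_def by (subst sum.remove[of _ 0]) (auto simp: bound_def)
  moreover have "sh {1..} (mpow R j)" if "j \<noteq> 0" for j
    using mpow_sh[OF R, of j] that by (elim sh_mono) auto
  ultimately show "sh {1..} (matrix_inv Z - mat 1)" unfolding inv by (auto intro!: sh_sum)
qed

lemma sh_add_1: "sh {1..} (Z - mat 1) \<Longrightarrow> sh {0..} Z"
proof -
  assume "sh {1..} (Z - mat 1)"
  hence "sh {0..} (Z - mat 1)" by (rule sh_mono) auto
  from sh_lin(1)[OF this sh_1[of "{0..}"]] show "sh {0..} Z" by simp
qed

lemma unipotent_mult: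
  assumes "sh {1..} (Z - mat 1)" "sh {1..} (W - mat 1)"
  shows "sh {1..} (Z ** W - mat 1)"
proof -
  have "sh {1..} (Z ** (W - mat 1))" by (rule sh_mult[OF sh_add_1[OF assms(1)] assms(2)]) auto
  from sh_lin(1)[OF this assms(1)] show ?thesis by (simp add: matrix_mult_simps)
qed

text \<open>Write g = 1 + R and compare degrees in g ad(rho) = ad(g rho) g. With y = R rho, the
  component of degree k says that the commutator of R with ad(rho), which is - k R in that degree,
  equals ad y. So the first nontrivial component of g is inner, with x = - y / k.\<close>

lemma unipotent_leading_term:
  assumes "endo g" "sh {int k..} (g - mat 1)" "k \<ge> 1"
  shows "\<exists>x \<in> gsp {int k..}. \<forall>a a'. dg a - dg a' = int k \<longrightarrow> cj (g - mat 1) $ a $ a' = cj (AD x) $ a $ a'"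
proof -
  note k1 = assms(3)
  define R where "R = g - mat 1"
  have R: "sh {int k..} R" and g: "g = mat 1 + R" using assms(2) by (simp_all add: R_def)
  define y where "y = R *v rho"
  have rho0: "rho \<in> gsp {0}"
    unfolding gsp_def using co_rho[of rho] by (auto simp: co_simps)
  have y: "y \<in> gsp {int k..}" unfolding y_def by (rule sh_vec[OF R rho0]) auto
  define x where "x = (- inverse (of_nat k)) *s y"
  have x: "x \<in> gsp {int k..}" unfolding x_def by (rule vec.subspace_scale[OF gsp_sub y])
  have lead: "cj R $ a $ a' = cj (AD x) $ a $ a'" if d: "dg a - dg a' = int k" for a a'
  proof -
    have "g ** AD rho = AD (g *v rho) ** g" using assms(1) by (simp add: endo_AD)
    moreover have "g *v rho = rho + y" by (simp add: g y_def matrix_vector_simps)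
    moreover have "AD (rho + y) = AD rho + AD y" by (subst matrix_eq) (simp add: AD matrix_vector_simps br_simps)
    ultimately have "R ** AD rho = AD y + AD y ** R + AD rho ** R"
      by (simp add: g mat_add_distrib)
    hence "cj (R ** AD rho) $ a $ a' = cj (AD y) $ a $ a' + cj (AD y ** R) $ a $ a' + cj (AD rho ** R) $ a $ a'"
      by (simp add: cj_simps)
    moreover have "cj (AD y ** R) $ a $ a' = 0"
    proof (rule shD)
      show "sh {2 * int k..} (AD y ** R)" by (rule sh_mult[OF AD_sh[OF y] R]) auto
      show "dg a - dg a' \<notin> {2 * int k..}" using d k1 by simp
    qed
    moreover have "cj (R ** AD rho) $ a $ a' = cj R $ a $ a' * of_int (dg a')"
      "cj (AD rho ** R) $ a $ a' = of_int (dg a) * cj R $ a $ a'"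
      by (simp_all add: cj_mult mat_mult_entry cj_AD_rho if_distrib[where f = "\<lambda>z. z * _"]
          if_distrib[where f = "\<lambda>z. _ * z"] cong: if_cong)
    ultimately have "cj (AD y) $ a $ a' = (of_int (dg a') - of_int (dg a)) * cj R $ a $ a'" by (simp add: algebra_simps)
    also have "(of_int (dg a') - of_int (dg a) :: complex) = - of_nat k"
      using d by (metis minus_diff_eq of_int_diff of_int_of_nat_eq)
    finally have "cj R $ a $ a' = - inverse (of_nat k) * cj (AD y) $ a $ a'" using k1 by simp
    thus ?thesis by (simp add: x_def cj_co AD br_simps co_simps)
  qed
  show ?thesis using x lead unfolding R_def by blast
qed

text \<open>Dividing g by exp(ad x), for x from the leading term, raises the order k of g - 1 by
  one; at \<open>bound\<close> nothing is left.\<close>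

lemma unipotent_endo_imp_group:
  "endo g \<Longrightarrow> sh {int k..} (g - mat 1) \<Longrightarrow> k \<ge> 1 \<Longrightarrow> g \<in> adjoint_subgroup \<gg> (gsp {1..})"
proof (induction "bound - k" arbitrary: k g)
  case 0
  hence "sh {int bound..} (g - mat 1)" by (elim sh_mono) auto
  hence "g = mat 1" using sh_bound by fastforce
  thus ?case by (simp add: adjoint_subgroup.intros)
next
  case (Suc m)
  define R where "R = g - mat 1"
  have R: "sh {int k..} R" and g: "g = mat 1 + R" using Suc.prems by (simp_all add: R_def)
  obtain x where x: "x \<in> gsp {int k..}"
    and ld: "\<forall>a a'. dg a - dg a' = int k \<longrightarrow> cj (g - mat 1) $ a $ a' = cj (AD x) $ a $ a'"
    using unipotent_leading_term[OF Suc.prems] by blast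
  have lead: "cj R $ a $ a' = cj (AD x) $ a $ a'" if "dg a - dg a' = int k" for a a'
    using ld that by (simp add: R_def)
  define e where "e = mat_exp (AD x)"
  have e1: "sh {int k + 1..} (e - mat 1 - AD x)"
    unfolding e_def by (rule exp_first_order[OF AD_sh[OF x]]) (use Suc.prems in simp)
  have "sh {1..} (e - mat 1 - AD x + AD x)"
    by (rule sh_lin(1)[OF sh_mono[OF e1] sh_mono[OF AD_sh[OF x]]]) (use Suc.prems in auto)
  hence eu: "sh {1..} (e - mat 1)" by simp
  note ei = unipotent_inv[OF eu]
  define g1 where "g1 = matrix_inv e ** g"
  have eg: "e ** g1 = g" by (simp add: g1_def matrix_mul_assoc matrix_inv[OF ei(1)])
  have "endo e" unfolding e_def by (rule endo_exp)
  hence "endo g1" unfolding g1_def using Suc.prems(1) ei(1) by (intro endo_mult endo_inv)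
  moreover have "sh {int (Suc k)..} (g1 - mat 1)"
  proof -
    have "sh {int (Suc k)..} (R - AD x)"
    proof (rule shI)
      fix a a' assume n: "dg a - dg a' \<notin> {int (Suc k)..}"
      show "cj (R - AD x) $ a $ a' = 0"
      proof (cases "dg a - dg a' = int k")
        case True thus ?thesis using lead by (simp add: cj_simps)
      next
        case False
        hence "dg a - dg a' \<notin> {int k..}" using n by auto
        thus ?thesis using shD[OF R] shD[OF AD_sh[OF x]] by (simp add: cj_simps)
      qed
    qed
    hence "sh {int (Suc k)..} ((R - AD x) - (e - mat 1 - AD x))"
      by (rule sh_lin(2)) (use e1 in \<open>simp add: add.commute\<close>)
    moreover have "(R - AD x) - (e - mat 1 - AD x) = g - e" by (simp add: g)
    ultimately have "sh {int (Suc k)..} (g - e)" by metis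
    hence "sh {int (Suc k)..} (matrix_inv e ** (g - e))"
      by (rule sh_mult[OF sh_add_1[OF ei(2)]]) simp
    moreover have "g1 - mat 1 = matrix_inv e ** (g - e)"
      by (simp add: g1_def matrix_mult_simps matrix_inv[OF ei(1)])
    ultimately show ?thesis by (simp only:)
  qed
  ultimately have "g1 \<in> adjoint_subgroup \<gg> (gsp {1..})" using Suc.hyps(2) by (intro Suc.hyps(1)[of "Suc k"]) auto
  moreover have "x \<in> gsp {1..}" using x Suc.prems(3) by (auto simp: gsp_def)
  ultimately show ?case
    using adjoint_subgroup.intros(2)[of g1 \<gg> "gsp {1..}" x] eg by (simp add: e_def AD_def)
qed

text \<open>Trades the group generated by exponentials for polynomial conditions on matrix entries.
  Such conditions pass to rational matrices and to all their regular values.\<close>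

lemma unipotent_group_iff:
  "g \<in> adjoint_subgroup \<gg> (gsp {1..}) \<longleftrightarrow> endo g \<and> sh {1..} (g - mat 1)"
proof
  show "g \<in> adjoint_subgroup \<gg> (gsp {1..}) \<Longrightarrow> endo g \<and> sh {1..} (g - mat 1)"
  proof (induction rule: adjoint_subgroup.induct)
    case 1 show ?case by (simp add: endo_1 sh_lin)
  next
    case (2 g x)
    have e: "sh {1 + 1..} (mat_exp (AD x) - mat 1 - AD x)" by (rule exp_first_order[OF AD_sh[OF 2(2)]]) simp
    have "sh {1..} (mat_exp (AD x) - mat 1 - AD x + AD x)"
      by (rule sh_lin(1)[OF sh_mono[OF e] AD_sh[OF 2(2)]]) auto
    hence "sh {1..} (mat_exp (AD x) - mat 1)" by simp
    thus ?case using 2 unipotent_mult endo_mult[OF endo_exp] by (simp add: AD_def[symmetric])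
  qed
  show "endo g \<and> sh {1..} (g - mat 1) \<Longrightarrow> g \<in> adjoint_subgroup \<gg> (gsp {1..})"
    using unipotent_endo_imp_group[of g 1] by simp
qed

end


section \<open>Degree zero parts of triangular automorphisms\<close>

context grading
begin

definition agree :: "int \<Rightarrow> complex^'n^'n \<Rightarrow> complex^'n^'n \<Rightarrow> bool" where
  "agree k A B \<longleftrightarrow> (\<forall>a a'. dg a - dg a' = k \<longrightarrow> cj A $ a $ a' = cj B $ a $ a')"

lemma agree_mult:
  assumes "sh {..i} A" "sh {..j} B" "sh {..i} A'" "sh {..j} B'" "agree i A A'" "agree j B B'"
  shows "agree (i + j) (A ** B) (A' ** B')"
  unfolding agree_def cj_mult mat_mult_entry
proof (intro allI impI sum.cong refl)
  fix a a' c assume d: "dg a - dg a' = i + j"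
  show "cj A $ a $ c * cj B $ c $ a' = cj A' $ a $ c * cj B' $ c $ a'"
  proof (cases "dg a - dg c = i")
    case True
    hence "dg c - dg a' = j" using d by simp
    thus ?thesis using True assms(5,6) by (simp add: agree_def)
  next
    case False
    hence "dg a - dg c \<notin> {..i} \<or> dg c - dg a' \<notin> {..j}" using d by (auto simp: not_le)
    thus ?thesis using shD[OF assms(1)] shD[OF assms(2)] shD[OF assms(3)] shD[OF assms(4)] by auto
  qed
qed

lemma agree_sh: "sh {k} A \<Longrightarrow> sh {k} B \<Longrightarrow> agree k A B \<Longrightarrow> A = B"
proof -
  assume "sh {k} A" "sh {k} B" "agree k A B"
  hence "cj A $ a $ a' = cj B $ a $ a'" for a a'
    unfolding sh_def agree_def by (cases "dg a - dg a' = k") auto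
  hence "cj A = cj B" by (simp add: vec_eq_iff)
  thus "A = B" by (simp only: cj_eq)
qed

definition diag_part :: "complex^'n^'n \<Rightarrow> complex^'n^'n" where
  "diag_part Z = P ** (\<chi> a a'. if dg a = dg a' then cj Z $ a $ a' else 0) ** Pi"

lemma cj_diag_part: "cj (diag_part Z) $ a $ a' = (if dg a = dg a' then cj Z $ a $ a' else 0)"
proof -
  have "cj (diag_part Z) = (Pi ** P) ** (\<chi> a a'. if dg a = dg a' then cj Z $ a $ a' else 0) ** (Pi ** P)"
    by (simp only: cj_def diag_part_def matrix_mul_assoc)
  thus ?thesis by (simp add: P)
qed

lemma diag_part: "sh {0} (diag_part Z)" "agree 0 Z (diag_part Z)"
  by (simp_all add: sh_def agree_def cj_diag_part)

lemma mat_eq_basis: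
  fixes Z W :: "complex^'n^'n"
  shows "(\<And>a. Z *v b a = W *v b a) \<Longrightarrow> Z = W"
proof -
  assume "\<And>a. Z *v b a = W *v b a"
  hence "cj Z $ a $ a' = cj W $ a $ a'" for a a' by (simp add: cj_co)
  hence "cj Z = cj W" by (simp add: vec_eq_iff)
  thus "Z = W" by (simp only: cj_eq)
qed

lemma co_eqI: "(\<And>a. co x a = co y a) \<Longrightarrow> x = y"
  using co_expand[of x] co_expand[of y] by simp

text \<open>Taking top components is multiplicative for operators bounded above in degree. For a
  basis vector of degree i, the components of degree i on both sides of g ad(b c) = ad(g b c) g give
  the same identity for the diagonal part.\<close>

lemma diag_part_endo:
  assumes g: "endo g" "sh {..0} g"
  shows "endo (diag_part g)"
proof -
  define L where "L = diag_part g"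
  have L: "sh {0} L" "agree 0 g L" "sh {..0} L"
    using diag_part[of g] sh_mono[OF diag_part(1), of "{..0}" g] by (simp_all add: L_def)
  have "L ** AD (b c) = AD (L *v b c) ** L" for c
  proof -
    define i where "i = dg c"
    have bc: "b c \<in> gsp {i}" by (auto simp: gsp_def co_b i_def split: if_splits)
    have Ab: "sh {i} (AD (b c))" by (rule AD_sh[OF bc])
    have Lb: "L *v b c \<in> gsp {i}" by (rule sh_vec[OF L(1) bc]) simp
    have gb: "g *v b c \<in> gsp {..i}" by (rule sh_vec[OF g(2) bc]) simp
    have db: "g *v b c - L *v b c \<in> gsp {..i - 1}"
      unfolding gsp_def
    proof (intro CollectI allI impI)
      fix a assume nz: "co (g *v b c - L *v b c) a \<noteq> 0"
      have "dg a - dg c \<le> 0"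
        using nz shD[OF g(2), of a c] shD[OF L(3), of a c] by (force simp: co_simps cj_co)
      moreover have "dg a - dg c \<noteq> 0"
        using nz L(2) unfolding agree_def by (auto simp: co_simps cj_co)
      ultimately show "dg a \<in> {..i - 1}" by (simp add: i_def)
    qed
    have "agree i (AD (g *v b c)) (AD (L *v b c))"
    proof -
      have "AD (g *v b c) = AD (L *v b c) + AD (g *v b c - L *v b c)"
        by (subst matrix_eq) (simp add: AD matrix_vector_simps br_simps)
      moreover have "dg a - dg a' = i \<Longrightarrow> cj (AD (g *v b c - L *v b c)) $ a $ a' = 0" for a a'
        by (rule shD[OF AD_sh[OF db]]) simp
      ultimately show ?thesis by (simp add: agree_def cj_simps)
    qed
    hence 1: "agree (i + 0) (AD (g *v b c) ** g) (AD (L *v b c) ** L)"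
      using AD_sh[OF gb] g(2) sh_mono[OF AD_sh[OF Lb], of "{..i}"] L by (intro agree_mult) auto
    have 2: "agree (0 + i) (g ** AD (b c)) (L ** AD (b c))"
      using sh_mono[OF Ab, of "{..i}"] g(2) L by (intro agree_mult) (auto simp: agree_def)
    have "agree i (L ** AD (b c)) (AD (L *v b c) ** L)"
      using 1 2 g(1) by (simp add: agree_def endo_AD)
    thus ?thesis
      by (intro agree_sh[of i] sh_mult[OF L(1) Ab] sh_mult[OF AD_sh[OF Lb] L(1)]) auto
  qed
  hence b: "L *v br (b c) y = br (L *v b c) (L *v y)" for c y
    by (metis AD matrix_vector_mul_assoc)
  have "L *v br x y = br (L *v x) (L *v y)" for x y
    by (subst (1 2) co_expand[of x])
      (simp add: br_sum br_simps b vec.linear_sum[OF matrix_vector_mul_linear_gen] matrix_vector_simps)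
  thus ?thesis by (simp add: endo_def L_def)
qed

end

section \<open>The groups N and B_- in terms of degrees\<close>

context ss_basis
begin

sublocale gr: grading \<gg> b dg rho
  by unfold_locales (rule b_span, simp add: br_rho_b deg_dg)

lemma neg_grading: "grading \<gg> b (\<lambda>a. - dg a) (- rho)"
proof (rule grading.intro)
  show "lie_alg \<gg>" by (rule lie_alg_axioms)
  have "br (- rho) (b a) = of_int (- dg a) *s b a" for a
    using gr.rho_b[of a] unfolding br_simps by (simp add: vec_eq_iff)
  thus "grading_axioms \<gg> b (\<lambda>a. - dg a) (- rho)" using b_span by (intro grading_axioms.intro)
qed

abbreviation "neg_sh \<equiv> grading.sh b (\<lambda>a. - dg a)"
abbreviation "neg_gsp \<equiv> grading.gsp b (\<lambda>a. - dg a)"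

lemma neg_sh: "neg_sh S Z \<longleftrightarrow> gr.sh (uminus ` S) Z"
proof -
  have "dg a' - dg a \<in> S \<longleftrightarrow> dg a - dg a' \<in> uminus ` S" for a a'
  proof
    assume "dg a' - dg a \<in> S"
    hence "- (dg a' - dg a) \<in> uminus ` S" by (rule imageI)
    thus "dg a - dg a' \<in> uminus ` S" by simp
  next
    assume "dg a - dg a' \<in> uminus ` S"
    then obtain s where "s \<in> S" "dg a - dg a' = - s" by blast
    moreover from this have "dg a' - dg a = s" by simp
    ultimately show "dg a' - dg a \<in> S" by simp
  qed
  thus ?thesis by (simp add: grading.sh_def[OF neg_grading] gr.sh_def)
qed

lemma sp_gsp: "sp Q = gr.gsp {z. Q (of_int z)}"
  by (simp add: sp_def gr.gsp_span deg_dg)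

lemma nil_gsp: "nil_plus \<gg> = gr.gsp {1..}" "hh = gr.gsp {0}" "nil_minus \<gg> = neg_gsp {1..}" "nil_minus \<gg> = gr.gsp {..-1}"
proof -
  have "{z::int. 1 \<le> real_of_int z} = {1..}" "{z::int. real_of_int z = 0} = {0}"
    "{z::int. real_of_int z \<le> - 1} = {..- 1}" by auto
  thus 1: "nil_plus \<gg> = gr.gsp {1..}" "hh = gr.gsp {0}" "nil_minus \<gg> = gr.gsp {..-1}"
    unfolding nil_eq hh_sp sp_gsp by auto
  show "nil_minus \<gg> = neg_gsp {1..}" unfolding 1 grading.gsp_span[OF neg_grading] gr.gsp_span by (rule arg_cong[where f = vec.span]) auto
qed

lemma borel_gsp: "borel_minus \<gg> = gr.gsp {..0}"
proof
  have "hh \<subseteq> gr.gsp {..0}" "nil_minus \<gg> \<subseteq> gr.gsp {..0}" unfolding nil_gsp(2,4) by (auto simp: gr.gsp_def)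
  thus "borel_minus \<gg> \<subseteq> gr.gsp {..0}"
    unfolding borel_minus_def using vec.subspace_add[OF gr.gsp_sub] by blast
  show "gr.gsp {..0} \<subseteq> borel_minus \<gg>"
    unfolding gr.gsp_span
  proof (rule vec.span_minimal[OF _ borel_minus_sub(1)], rule subsetI)
    fix x assume "x \<in> {b a |a. dg a \<in> {..0}}"
    then obtain a where a: "x = b a" "dg a \<le> 0" by auto
    have "b a \<in> hh \<or> b a \<in> nil_minus \<gg>"
      unfolding nil_gsp(2,4) using a(2) by (cases "dg a = 0") (auto simp: gr.gsp_def gr.co_b)
    thus "x \<in> borel_minus \<gg>" using borel_minus_sub a by blast
  qed
qed

lemma grp_N_iff: "g \<in> grp_N \<gg> \<longleftrightarrow> endo g \<and> gr.sh {1..} (g - mat 1)"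
  unfolding grp_N_def nil_gsp(1) by (rule gr.unipotent_group_iff)

lemma grp_B_minus_lower: "g \<in> grp_B_minus \<gg> \<Longrightarrow> endo g \<and> gr.sh {..0} g"
  unfolding grp_B_minus_def borel_gsp
proof (induction rule: adjoint_subgroup.induct)
  case 1 show ?case by (simp add: endo_1 gr.sh_1)
next
  case (2 g x)
  have A: "gr.sh {..0} (AD x)" by (rule gr.AD_sh[OF 2(2)])
  have "gr.sh {..0} (mpow (AD x) k)" for k
    by (induction k) (auto simp: gr.sh_1 intro: gr.sh_mult[OF A])
  hence "gr.sh {..0} (mat_exp (AD x))" by (rule gr.exp_sh)
  thus ?case using 2 by (auto simp: AD_def[symmetric] intro: endo_mult endo_exp gr.sh_mult)
qed

text \<open>A degree preserving automorphism may be a diagram automorphism, which is not in the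
  adjoint group; being the identity on the Cartan block rules this out. The diagonal part then
  scales each \<open>Eg i\<close>, hence equals exp(ad h) for a suitable h, and removing it from g
  leaves an element of the unipotent group of n_-.\<close>

lemma grp_B_minusI:
  assumes g: "endo g" "gr.sh {..0} g" and h0: "\<And>a a'. dg a = 0 \<Longrightarrow> dg a' = 0 \<Longrightarrow> gr.cj g $ a $ a' = (if a = a' then 1 else 0)"
  shows "g \<in> grp_B_minus \<gg>"
proof -
  define L where "L = gr.diag_part g"
  have Le: "endo L" unfolding L_def by (rule gr.diag_part_endo[OF g])
  have L: "gr.sh {0} L" "gr.agree 0 g L" using gr.diag_part[of g] by (simp_all add: L_def)
  have Lh: "L *v y = y" if "y \<in> hh" for y
  proof (rule gr.co_eqI)
    fix a
    have y: "gr.co y a' = 0" if "dg a' \<noteq> 0" for a' using \<open>y \<in> hh\<close> that by (auto simp: nil_gsp gr.gsp_def)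
    have "gr.co (L *v y) a = (\<Sum>a'\<in>UNIV. if a' = a then gr.co y a' else 0)"
      unfolding gr.co_mult
    proof (intro sum.cong refl)
      fix a'
      show "gr.cj L $ a $ a' * gr.co y a' = (if a' = a then gr.co y a' else 0)"
        using h0[of a a'] y[of a'] by (cases "dg a' = 0") (auto simp: L_def gr.cj_diag_part)
    qed
    thus "gr.co (L *v y) a = gr.co y a" by simp
  qed
  have eg: "L *v br x y = br (L *v x) (L *v y)" for x y using Le by (simp add: endo_def)
  have "\<exists>c. L *v Eg i = c *s Eg i" for i
  proof (rule degree_1_root)
    have "Eg i \<in> gr.gsp {z. real_of_int z = 1}" using EF_sp(1) by (simp add: sp_gsp)
    hence "L *v Eg i \<in> gr.gsp {z. real_of_int z = 1}" by (rule gr.sh_vec[OF L(1)]) simp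
    thus "L *v Eg i \<in> sp (\<lambda>t. t = 1)" by (simp add: sp_gsp)
    fix y assume y: "y \<in> hh"
    show "br y (L *v Eg i) = al i y *s (L *v Eg i)"
      using eg[of y "Eg i"] Lh[OF y] chev(3)[OF y, of i] by (simp add: matrix_vector_simps)
  qed
  then obtain c where c: "\<And>i. L *v Eg i = c i *s Eg i" by metis
  have c0: "c i \<noteq> 0" for i
  proof
    assume "c i = 0"
    hence "L *v br (Eg i) (Fg i) = 0" using c[of i] by (simp add: eg br_simps)
    thus False using Lh[OF chev(1)] EF_nonzero(3)[of i] by (simp add: chev(5))
  qed
  \<comment> \<open>Chosen so that exp(ad h) scales \<open>Eg i\<close> by c i, through logarithms
    of the nonzero scalars and the fundamental coweights.\<close>
  define h where "h = (\<Sum>i\<in>UNIV. Ln (c i) *s fcw i)"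
  have hh: "h \<in> hh" unfolding h_def by (intro vec.subspace_sum vec.subspace_scale hh_sub fcw)
  have alh: "al i h = Ln (c i)" for i
    unfolding h_def by (subst al_sum) (simp_all add: fcw if_distrib cong: if_cong)
  define e where "e = mat_exp (AD (- h))"
  define e' where "e' = mat_exp (AD h)"
  have ee: "e' ** e = mat 1"
  proof (rule gr.mat_eq_basis)
    fix a
    define w where "w = (\<Sum>i\<in>UNIV. of_int (kw a i) * al i h)"
    have "AD h *v b a = w *s b a" "AD (- h) *v b a = (- w) *s b a"
      using b_weight[OF hh, of a] by (simp_all add: AD br_simps w_def)
    hence "e' *v b a = exp w *s b a" "e *v b a = exp (- w) *s b a" unfolding e_def e'_def by (simp_all only: mat_exp_eigen)
    thus "e' ** e *v b a = mat 1 *v b a"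
      by (simp add: matrix_vector_mul_assoc[symmetric] matrix_vector_simps exp_minus)
  qed
  have e0: "gr.sh {0} e"
  proof -
    have "- h \<in> gr.gsp {0}" using hh vec.subspace_neg[OF hh_sub] nil_gsp by blast
    from gr.AD_sh[OF this] have A: "gr.sh {0} (AD (- h))" .
    have "gr.sh {0} (mpow (AD (- h)) k)" for k by (induction k) (auto simp: gr.sh_1 intro: gr.sh_mult[OF A])
    thus ?thesis unfolding e_def by (rule gr.exp_sh)
  qed
  define M where "M = e ** L"
  have ee1: "endo e" unfolding e_def by (rule endo_exp)
  have Me: "endo M" unfolding M_def by (intro endo_mult ee1 Le)
  have eM: "M *v br x y = br (M *v x) (M *v y)" for x y using Me by (simp add: endo_def)
  have Mh: "M *v y = y" if "y \<in> hh" for y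
  proof -
    have "AD (- h) *v y = 0 *s y" using cartan_abelian[OF hh that] by (simp add: AD br_simps)
    hence "e *v y = exp 0 *s y" unfolding e_def by (rule mat_exp_eigen)
    thus ?thesis using Lh[OF that] by (simp add: M_def matrix_vector_mul_assoc[symmetric])
  qed
  have ME: "M *v Eg i = Eg i" for i
  proof -
    have "AD (- h) *v Eg i = (- Ln (c i)) *s Eg i" using chev(3)[OF hh, of i] by (simp add: AD br_simps alh)
    hence "e *v Eg i = exp (- Ln (c i)) *s Eg i" unfolding e_def by (rule mat_exp_eigen)
    thus ?thesis using c0[of i] c[of i] by (simp add: M_def matrix_vector_mul_assoc[symmetric] matrix_vector_simps exp_minus)
  qed
  \<comment> \<open>The difference has degree -1 and is killed by every \<open>Eg i\<close>, because
    M fixes \<open>Eg i\<close> and the coroots; such vectors vanish by the second part of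
    \<open>principal_injective\<close>.\<close>
  have MF: "M *v Fg j = Fg j" for j
  proof -
    have "M *v Fg j - Fg j = 0"
    proof (rule principal_injective(2)[where d = "- 1"])
      have "br rho (M *v Fg j) = M *v br rho (Fg j)" using eM[of rho "Fg j"] Mh[OF rho_hh] by simp
      thus "br rho (M *v Fg j - Fg j) = of_real (- 1) *s (M *v Fg j - Fg j)"
        by (simp add: br_simps rho_EF matrix_vector_simps)
      fix i
      have "br (Eg i) (M *v Fg j) = M *v br (Eg i) (Fg j)" using eM[of "Eg i" "Fg j"] ME by simp
      also have "\<dots> = br (Eg i) (Fg j)" using Mh[OF chev(1)] by (simp add: chev(5) matrix_vector_simps)
      finally show "br (Eg i) (M *v Fg j - Fg j) = 0" by (simp add: br_simps)
    qed simp
    thus ?thesis by simp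
  qed
  have "M = mat 1"
  proof -
    have sub: "lie_subalgebra \<gg> {x. M *v x = x}"
      unfolding lie_subalgebra_def by (auto simp: vec.subspace_def matrix_vector_simps eM)
    have "nil_plus \<gg> \<subseteq> {x. M *v x = x}" by (rule nil_plus_facts(3)[OF sub]) (simp add: ME)
    moreover have "nil_minus \<gg> \<subseteq> {x. M *v x = x}" by (rule nil_minus_facts(3)[OF sub]) (simp add: MF)
    moreover have "M *v x = x" for x
    proof -
      obtain h u v where e: "x = h + u + v" "h \<in> hh" "u \<in> nil_minus \<gg>" "v \<in> nil_plus \<gg>"
        by (rule triangular_decomposition)
      have "M *v u = u" "M *v v = v" using e calculation by auto
      thus ?thesis unfolding e(1) matrix_vector_simps using Mh[OF e(2)] by simp
    qed
    thus ?thesis by (subst matrix_eq) simp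
  qed
  define L1 where "L1 = e ** g"
  have g1: "g = e' ** L1" by (simp add: L1_def matrix_mul_assoc ee)
  have L1e: "endo L1" unfolding L1_def by (intro endo_mult ee1 g)
  have s: "gr.sh {..0} e" "gr.sh {..0} L" using gr.sh_mono[OF e0] gr.sh_mono[OF L(1)] by auto
  have "gr.agree (0 + 0) (e ** g) (e ** L)" by (rule gr.agree_mult[OF s(1) g(2) s _ L(2)]) (simp add: gr.agree_def)
  hence ag: "gr.agree 0 L1 (mat 1)" using \<open>M = mat 1\<close> by (simp add: L1_def M_def)
  have L1s: "gr.sh {..0} L1" unfolding L1_def by (rule gr.sh_mult[OF s(1) g(2)]) simp
  have "gr.sh {..-1} (L1 - mat 1)"
  proof (rule gr.shI)
    fix a a' assume n: "dg a - dg a' \<notin> {..-1}"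
    show "gr.cj (L1 - mat 1) $ a $ a' = 0"
    proof (cases "dg a - dg a' = 0")
      case True thus ?thesis using ag by (simp add: gr.agree_def gr.cj_simps)
    next
      case False
      hence "dg a - dg a' \<notin> {..0}" using n by auto
      thus ?thesis using gr.shD[OF L1s] gr.shD[OF gr.sh_1, of "{..0}"] by (simp add: gr.cj_simps)
    qed
  qed
  moreover have "uminus ` {1..} = {..-1::int}" by (simp add: image_uminus_atLeast)
  ultimately have "neg_sh {1..} (L1 - mat 1)" by (simp add: neg_sh)
  hence "L1 \<in> adjoint_subgroup \<gg> (nil_minus \<gg>)" unfolding nil_gsp(3) grading.unipotent_group_iff[OF neg_grading] using L1e by blast
  hence "L1 \<in> grp_B_minus \<gg>"
    unfolding grp_B_minus_def using borel_minus_sub(3) by (rule adjoint_subgroup_mono)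
  moreover have "e' \<in> grp_B_minus \<gg>"
    unfolding grp_B_minus_def e'_def AD_def using hh borel_minus_sub(2) by (intro adjoint_subgroup_exp) blast
  ultimately show ?thesis unfolding g1 grp_B_minus_def by (intro adjoint_subgroup_mult)
qed

text \<open>Z maps each space of degrees at most d injectively into itself, hence onto itself by
  dimension. No series argument applies, as Z need not be unipotent.\<close>

lemma lower_inv:
  assumes "gr.sh {..0} Z" "invertible Z"
  shows "gr.sh {..0} (matrix_inv Z)"
proof (rule gr.shI)
  fix a a' assume n: "dg a - dg a' \<notin> {..0}"
  let ?V = "gr.gsp {..dg a'}"
  have "(*v) Z ` ?V \<subseteq> ?V" using gr.sh_vec[OF assms(1), of _ "{..dg a'}" "{..dg a'}"] by auto
  moreover have "vec.dim ?V \<le> vec.dim ((*v) Z ` ?V)"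
  proof -
    have "(*v) (matrix_inv Z) ` (*v) Z ` ?V = ?V"
      by (simp add: image_image matrix_vector_mul_assoc matrix_inv[OF assms(2)])
    thus ?thesis using vec.dim_image_le[OF matrix_vector_mul_linear_gen, of "matrix_inv Z" "(*v) Z ` ?V"] by simp
  qed
  moreover have "vec.subspace ((*v) Z ` ?V)" by (rule vec.linear_subspace_image[OF matrix_vector_mul_linear_gen gr.gsp_sub])
  ultimately have "(*v) Z ` ?V = ?V" by (intro vec.subspace_dim_equal gr.gsp_sub)
  moreover have "b a' \<in> ?V" by (auto simp: gr.gsp_def gr.co_b split: if_splits)
  ultimately obtain v where v: "v \<in> ?V" "b a' = Z *v v" by blast
  have "matrix_inv Z *v b a' = v" using v(2) by (simp add: matrix_vector_mul_assoc matrix_inv[OF assms(2)])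
  thus "gr.cj (matrix_inv Z) $ a $ a' = 0" using v(1) n by (auto simp: gr.cj_co gr.gsp_def)
qed

end


section \<open>Logarithmic derivatives and gauge transformations\<close>

context ss_basis
begin

lemma AD_lin: "AD (x + y) = AD x + AD y" "AD (x - y) = AD x - AD y" "AD (- x) = - AD x" "AD (c *s x) *v v = c *s (AD x *v v)"
  by (simp_all add: matrix_eq AD matrix_vector_simps br_simps)

lemma mat_reg_1: "mat_regular_at (mat 1) x" "mat_eval (mat 1) x = mat 1"
  using mat_reg_const[of "mat 1" x] by (simp_all only: const_mat_hom)

lemma mat_deriv_1: "mat_deriv (mat 1 :: ratfun^'n^'n) = 0"
  using mat_deriv_const[of "mat 1"] by (simp only: const_mat_hom)

lemma AD_inj: "AD x = AD y \<Longrightarrow> x = y"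
proof -
  assume "AD x = AD y"
  hence "br x v = br y v" for v by (simp flip: AD)
  hence "br (x - y) v = 0" for v by (simp add: br_simps)
  hence "x - y = 0" by (rule center_trivial)
  thus "x = y" by simp
qed

lemma rat_ad_eval:
  assumes "vec_regular_at X x"
  shows "mat_regular_at (rat_ad \<gg> X) x" "mat_eval (rat_ad \<gg> X) x = AD (vec_eval X x)"
proof -
  have r: "rat_regular_at (X $ j) x" for j using assms by (simp add: vec_regular_at_def)
  show "mat_regular_at (rat_ad \<gg> X) x"
    by (simp add: mat_regular_at_def rat_ad_def rat_regular_sum rat_regular_mult r)
  have "mat_eval (rat_ad \<gg> X) x $ a $ c = AD (vec_eval X x) $ a $ c" for a c
  proof -
    have "mat_eval (rat_ad \<gg> X) x $ a $ c = (\<Sum>j\<in>UNIV. vec_eval X x $ j * br (axis j 1) (axis c 1) $ a)"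
      by (simp add: mat_eval_def vec_eval_def rat_ad_def rat_regular_sum rat_regular_mult r)
    also have "\<dots> = br (\<Sum>j\<in>UNIV. vec_eval X x $ j *s axis j 1) (axis c 1) $ a"
      by (simp add: br_sum br_simps)
    also have "\<dots> = AD (vec_eval X x) $ a $ c" by (simp add: basis_expansion AD_def matrix_def)
    finally show ?thesis .
  qed
  thus "mat_eval (rat_ad \<gg> X) x = AD (vec_eval X x)" by (simp add: vec_eq_iff)
qed

lemma rat_ad_lin: "rat_ad \<gg> (X + Y) = rat_ad \<gg> X + rat_ad \<gg> Y" "rat_ad \<gg> (X - Y) = rat_ad \<gg> X - rat_ad \<gg> Y"
  "rat_ad \<gg> (- X) = - rat_ad \<gg> X"
  by (simp_all add: rat_ad_def vec_eq_iff sum.distrib sum_subtractf sum_negf algebra_simps)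

lemma rat_ad_inj: "rat_ad \<gg> X = rat_ad \<gg> Y \<Longrightarrow> X = Y"
proof -
  assume e: "rat_ad \<gg> X = rat_ad \<gg> Y"
  have "\<forall>\<^sub>F x in cofinite. vec_eval X x = vec_eval Y x"
    using eventually_vec_regular[of X] eventually_vec_regular[of Y]
  proof eventually_elim
    case (elim x)
    have "AD (vec_eval X x) = AD (vec_eval Y x)"
      using rat_ad_eval(2)[OF elim(1)] rat_ad_eval(2)[OF elim(2)] e by simp
    thus ?case by (rule AD_inj)
  qed
  thus "X = Y" by (rule vec_eqI)
qed

text \<open>Rational maps into all Lie algebra automorphisms, wider than the adjoint group, so that
  the possibly outer \<open>V\<close> and the twisting automorphisms built from it are
  included.\<close>

definition aut :: "(ratfun^'n^'n) set" where "aut = rat_points {g. endo g \<and> invertible g}"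

lemma aut_inv:
  assumes "Z \<in> aut"
  shows "invertible Z" "matrix_inv Z \<in> aut"
proof -
  have h: "invertible a \<and> matrix_inv a \<in> {g. endo g \<and> invertible g}" if "a \<in> {g. endo g \<and> invertible g}" for a
    using that by (simp add: endo_inv invertible_matrix_inv)
  show "invertible Z" "matrix_inv Z \<in> aut"
    using rat_points_inv[OF assms[unfolded aut_def] h] by (simp_all add: aut_def)
qed

lemma aut_mult: "Z \<in> aut \<Longrightarrow> W \<in> aut \<Longrightarrow> Z ** W \<in> aut"
  unfolding aut_def by (erule (1) rat_points_mult) (simp add: endo_mult matrix_inv_mult)

lemma aut_const: "endo g \<Longrightarrow> invertible g \<Longrightarrow> const_mat g \<in> aut"
  unfolding aut_def by (rule rat_points_const) simp

lemma rat_ad_conj: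
  assumes "Z \<in> aut"
  shows "rat_ad \<gg> (Z *v X) = Z ** rat_ad \<gg> X ** matrix_inv Z"
proof -
  have "\<forall>\<^sub>F x in cofinite. mat_eval (rat_ad \<gg> (Z *v X) ** Z) x = mat_eval (Z ** rat_ad \<gg> X) x"
    using eventually_vec_regular[of X] eventually_mat_regular[of Z] assms[unfolded aut_def rat_points_iff]
  proof eventually_elim
    case (elim x)
    note zx = mat_reg_vec[OF elim(2,1)]
    show ?case using elim zx
      by (simp add: mat_reg_mult rat_ad_eval endo_AD)
  qed
  hence e: "rat_ad \<gg> (Z *v X) ** Z = Z ** rat_ad \<gg> X" by (rule mat_eqI)
  have "rat_ad \<gg> (Z *v X) = rat_ad \<gg> (Z *v X) ** Z ** matrix_inv Z"
    by (simp add: matrix_inv[OF aut_inv(1)[OF assms]] flip: matrix_mul_assoc)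
  thus ?thesis unfolding e .
qed

text \<open>\<open>log_deriv\<close> is a definite description and is meaningful only if dZ Z^-1 is
  the adjoint matrix of some element. This relation records that existence.\<close>

definition has_ld :: "ratfun^'n^'n \<Rightarrow> ratfun^'n \<Rightarrow> bool" where
  "has_ld Z X \<longleftrightarrow> invertible Z \<and> mat_deriv Z ** matrix_inv Z = rat_ad \<gg> X"

lemma log_deriv_eq: "has_ld Z X \<Longrightarrow> log_deriv \<gg> Z = X"
  unfolding has_ld_def log_deriv_def by (rule the_equality) (auto intro: rat_ad_inj)

lemma has_ld_mult:
  assumes "has_ld Z X" "has_ld W Y" "Z \<in> aut"
  shows "has_ld (Z ** W) (X + Z *v Y)"
proof -
  have i: "invertible Z" "invertible W" using assms by (simp_all add: has_ld_def)
  have "mat_deriv (Z ** W) ** matrix_inv (Z ** W)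
      = mat_deriv Z ** (W ** matrix_inv W) ** matrix_inv Z + Z ** (mat_deriv W ** matrix_inv W) ** matrix_inv Z"
    by (simp add: mat_deriv_mult matrix_inv_mult i mat_add_distrib matrix_mul_assoc)
  also have "\<dots> = rat_ad \<gg> (X + Z *v Y)"
    using assms by (simp add: matrix_inv i has_ld_def rat_ad_lin rat_ad_conj)
  finally show ?thesis using i by (simp add: has_ld_def matrix_inv_mult)
qed

lemma has_ld_const: "invertible g \<Longrightarrow> has_ld (const_mat g) 0"
  by (simp add: has_ld_def const_mat_inv matrix_mult_simps) (simp add: rat_ad_def vec_eq_iff)

text \<open>Z^-1 W has derivative zero, so it is constant, and its value at x is 1.\<close>

lemma has_ld_unique:
  assumes "has_ld Z X" "has_ld W X" "mat_regular_at Z x" "mat_regular_at W x" "mat_eval Z x = mat_eval W x"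
    and "invertible (mat_eval Z x)"
  shows "Z = W"
proof -
  have i: "invertible Z" "invertible W" using assms by (simp_all add: has_ld_def)
  have e: "mat_deriv Z ** matrix_inv Z = mat_deriv W ** matrix_inv W" using assms by (simp add: has_ld_def)
  have "mat_deriv W = mat_deriv W ** matrix_inv W ** W" by (simp add: matrix_inv[OF i(2)] flip: matrix_mul_assoc)
  also have "\<dots> = mat_deriv Z ** matrix_inv Z ** W" by (simp only: e)
  finally have w: "mat_deriv W = mat_deriv Z ** matrix_inv Z ** W" .
  have d0: "mat_deriv (matrix_inv Z ** W) = 0"
    by (simp add: mat_deriv_mult mat_deriv_inv[OF i(1)] w matrix_mult_simps matrix_mul_assoc)
  have r: "mat_regular_at (matrix_inv Z) x" "mat_eval (matrix_inv Z) x = matrix_inv (mat_eval Z x)"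
    using mat_reg_inv[OF assms(3,6)] by simp_all
  have "matrix_inv Z ** W = const_mat (mat_eval (matrix_inv Z ** W) x)"
    by (rule mat_deriv_zero[OF d0 mat_reg_mult(1)[OF r(1) assms(4)]])
  also have "mat_eval (matrix_inv Z ** W) x = mat 1"
    by (simp add: mat_reg_mult[OF r(1) assms(4)] r assms(5)[symmetric] matrix_inv[OF assms(6)])
  finally have zw: "matrix_inv Z ** W = mat 1" by (simp add: const_mat_hom)
  have "W = Z ** (matrix_inv Z ** W)" by (simp add: matrix_mul_assoc matrix_inv[OF i(1)])
  thus ?thesis unfolding zw by simp
qed

text \<open>Entries vanishing at almost all points vanish as rational functions. Thus degree
  conditions pass to the derivative and to the value at every regular point.\<close>

lemma rat_points_sh_entry:
  "Z \<in> rat_points {g. gr.sh S g} \<longleftrightarrow>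
    (\<forall>a a'. dg a - dg a' \<notin> S \<longrightarrow> (const_mat gr.Pi ** Z ** const_mat gr.P) $ a $ a' = 0)"
proof -
  let ?C = "const_mat gr.Pi ** Z ** const_mat gr.P"
  have ev: "\<forall>\<^sub>F x in cofinite. \<forall>a a'. rat_eval (?C $ a $ a') x = gr.cj (mat_eval Z x) $ a $ a'"
    using eventually_mat_regular[of Z]
  proof eventually_elim
    case (elim x)
    have "mat_eval ?C x = gr.cj (mat_eval Z x)" using elim by (simp add: mat_reg_mult gr.cj_def)
    thus ?case by (simp add: mat_eval_def vec_eq_iff)
  qed
  show ?thesis
  proof
    assume Z: "Z \<in> rat_points {g. gr.sh S g}"
    show "\<forall>a a'. dg a - dg a' \<notin> S \<longrightarrow> ?C $ a $ a' = 0"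
    proof (intro allI impI rat_zeroI)
      fix a a' assume n: "dg a - dg a' \<notin> S"
      show "\<forall>\<^sub>F x in cofinite. rat_eval (?C $ a $ a') x = 0"
        using ev Z[unfolded rat_points_iff] by eventually_elim (simp add: gr.shD n)
    qed
  next
    assume z: "\<forall>a a'. dg a - dg a' \<notin> S \<longrightarrow> ?C $ a $ a' = 0"
    show "Z \<in> rat_points {g. gr.sh S g}"
      unfolding rat_points_iff using ev
    proof eventually_elim
      case (elim x)
      have "gr.cj (mat_eval Z x) $ a $ a' = 0" if "dg a - dg a' \<notin> S" for a a'
        using elim[rule_format, of a a'] z that by simp
      thus ?case by (simp add: gr.sh_def)
    qed
  qed
qed

lemma mat_deriv_sh:
  assumes "Z \<in> rat_points {g. gr.sh S g}"
  shows "mat_deriv Z \<in> rat_points {g. gr.sh S g}"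
proof -
  let ?C = "const_mat gr.Pi ** Z ** const_mat gr.P"
  have "mat_deriv ?C = const_mat gr.Pi ** mat_deriv Z ** const_mat gr.P"
    by (simp add: mat_deriv_mult matrix_mult_simps)
  moreover have "mat_deriv ?C $ a $ a' = 0" if "?C $ a $ a' = 0" for a a'
    using that by (simp add: mat_deriv_def)
  ultimately show ?thesis using assms unfolding rat_points_sh_entry by metis
qed

lemma regular_sh:
  assumes "Z \<in> rat_points {g. gr.sh S g}" "mat_regular_at Z x"
  shows "gr.sh S (mat_eval Z x)"
proof (rule gr.shI)
  fix a a' assume n: "dg a - dg a' \<notin> S"
  let ?C = "const_mat gr.Pi ** Z ** const_mat gr.P"
  have "mat_eval ?C x $ a $ a' = 0" using assms(1) n unfolding rat_points_sh_entry by (simp add: mat_eval_def)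
  thus "gr.cj (mat_eval Z x) $ a $ a' = 0" using assms(2) by (simp add: mat_reg_mult gr.cj_def)
qed

text \<open>The automorphism property as an identity between rational matrices, in which form it can
  be differentiated and evaluated at any regular point.\<close>

lemma endo_const_AD:
  assumes "Z \<in> rat_points {g. endo g}"
  shows "Z ** const_mat (AD u) = rat_ad \<gg> (Z *v const_vec u) ** Z"
proof (rule mat_eqI)
  show "\<forall>\<^sub>F x in cofinite. mat_eval (Z ** const_mat (AD u)) x = mat_eval (rat_ad \<gg> (Z *v const_vec u) ** Z) x"
    using eventually_mat_regular[of Z] assms[unfolded rat_points_iff]
  proof eventually_elim
    case (elim x)
    note zx = mat_reg_vec[OF elim(1) vec_reg_const(1)[of u]]
    show ?case using elim zx by (simp add: mat_reg_mult rat_ad_eval endo_AD)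
  qed
qed

lemma regular_endo:
  assumes "Z \<in> rat_points {g. endo g}" "mat_regular_at Z x"
  shows "endo (mat_eval Z x)"
proof -
  have "mat_eval Z x ** AD u = AD (mat_eval Z x *v u) ** mat_eval Z x" for u
  proof -
    note zx = mat_reg_vec[OF assms(2) vec_reg_const(1)[of u]]
    have "mat_eval (Z ** const_mat (AD u)) x = mat_eval (rat_ad \<gg> (Z *v const_vec u) ** Z) x"
      by (simp only: endo_const_AD[OF assms(1)])
    thus ?thesis using assms(2) zx by (simp add: mat_reg_mult rat_ad_eval)
  qed
  thus ?thesis by (simp add: endo_AD)
qed

text \<open>N is closed: the conditions of \<open>grp_N_iff\<close> are identities that persist at
  each point where Z is regular, even one excluded by \<open>rat_points\<close>.\<close>

lemma regular_unipotent:
  assumes "Z \<in> rat_points (grp_N \<gg>)" "mat_regular_at Z x"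
  shows "mat_eval Z x \<in> grp_N \<gg>"
proof -
  have "Z \<in> rat_points {g. endo g}" using assms(1) by (rule rat_points_mono) (auto simp: grp_N_iff)
  moreover have "Z - mat 1 \<in> rat_points {g. gr.sh {1..} g}"
    using assms(1) eventually_mat_regular[of Z] unfolding rat_points_iff
    by eventually_elim (simp add: grp_N_iff mat_reg_diff mat_reg_1)
  moreover have r: "mat_regular_at (Z - mat 1) x" "mat_eval (Z - mat 1) x = mat_eval Z x - mat 1"
    using mat_reg_diff[OF assms(2) mat_reg_1(1)] by (simp_all add: mat_reg_1)
  ultimately show ?thesis using regular_endo assms(2) regular_sh[of "Z - mat 1" "{1..}" x] by (simp add: grp_N_iff)
qed

text \<open>Apply ad v to \<open>rho\<close>, which has degree 0: the component of v of degree d is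
  multiplied by - d, so only degree 0 escapes detection.\<close>

lemma sh_AD_conv:
  assumes "gr.sh S (AD v)"
  shows "v \<in> gr.gsp (insert 0 S)"
proof -
  have rho0: "rho \<in> gr.gsp {0}" using rho_hh nil_gsp(2) by simp
  have "br v rho \<in> gr.gsp S" using gr.sh_vec[OF assms rho0, of S] by (simp add: AD)
  moreover have "gr.co (br v rho) a = - of_int (dg a) * gr.co v a" for a
    by (subst br_anti) (simp add: gr.co_simps gr.co_rho)
  ultimately show ?thesis unfolding gr.gsp_def by auto
qed

text \<open>A derivation \<open>D\<close> raising degrees is \<open>ad x\<close>, where \<open>x\<close> is obtained from \<open>- D \<rho>\<close> by dividing
  each homogeneous component by its degree.\<close>

definition degree_inverse :: "complex^'n^'n" where
  "degree_inverse = gr.P ** (\<chi> a a'. if a = a' then - inverse (of_int (dg a)) else 0) ** gr.Pi"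

lemma co_degree_inverse: "gr.co (degree_inverse *v y) a = - inverse (of_int (dg a)) * gr.co y a"
proof -
  have "gr.Pi *v (degree_inverse *v y) = (gr.Pi ** gr.P) *v ((\<chi> a a'. if a = a' then - inverse (of_int (dg a)) else 0) *v (gr.Pi *v y))"
    by (simp only: degree_inverse_def matrix_vector_mul_assoc matrix_mul_assoc)
  thus ?thesis
    by (simp add: gr.P gr.co_def) (simp add: matrix_vector_mult_def[of "vec_lambda _"] if_distrib[where f = "\<lambda>z. z * _"] cong: if_cong)
qed

lemma raising_derivation:
  assumes D: "\<And>w. D ** AD w = AD (D *v w) + AD w ** D" and s: "gr.sh {1..} D"
  shows "D = AD (degree_inverse *v (D *v rho))"
proof -
  define y where "y = D *v rho"
  have e: "gr.cj (AD v) $ c $ a' = (\<Sum>a\<in>UNIV. gr.co v a * gr.co (br (b a) (b a')) c)" for v c a'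
    unfolding gr.cj_co AD by (subst (1) gr.co_expand[of v]) (simp add: br_sum br_simps gr.co_sum gr.co_simps)
  have rho0: "rho \<in> gr.gsp {0}" using rho_hh nil_gsp(2) by simp
  have y: "y \<in> gr.gsp {1..}" unfolding y_def by (rule gr.sh_vec[OF s rho0]) simp
  have x: "degree_inverse *v y \<in> gr.gsp {1..}" using y unfolding gr.gsp_def by (simp add: co_degree_inverse)
  have "gr.cj D $ c $ a' = gr.cj (AD (degree_inverse *v y)) $ c $ a'" for c a'
  proof (cases "dg c - dg a' \<in> {1..}")
    case False thus ?thesis using gr.shD[OF s] gr.shD[OF gr.AD_sh[OF x]] by simp
  next
    case True
    have "gr.cj (D ** AD rho) $ c $ a' = gr.cj (AD y) $ c $ a' + gr.cj (AD rho ** D) $ c $ a'"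
      unfolding D y_def by (simp add: gr.cj_simps)
    hence "gr.cj D $ c $ a' * of_int (dg a') = gr.cj (AD y) $ c $ a' + of_int (dg c) * gr.cj D $ c $ a'"
      by (simp add: gr.cj_mult mat_mult_entry gr.cj_AD_rho if_distrib[where f = "\<lambda>z. z * _"]
          if_distrib[where f = "\<lambda>z. _ * z"] cong: if_cong)
    hence 1: "gr.cj (AD y) $ c $ a' = - of_int (dg c - dg a') * gr.cj D $ c $ a'" by (simp add: algebra_simps)
    have "gr.cj (AD (degree_inverse *v y)) $ c $ a' = (\<Sum>a\<in>UNIV. - inverse (of_int (dg c - dg a')) * (gr.co y a * gr.co (br (b a) (b a')) c))"
      unfolding e
    proof (intro sum.cong refl)
      fix a
      show "gr.co (degree_inverse *v y) a * gr.co (br (b a) (b a')) c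
          = - inverse (of_int (dg c - dg a')) * (gr.co y a * gr.co (br (b a) (b a')) c)"
      proof (cases "gr.co (br (b a) (b a')) c = 0")
        case False
        hence "dg a = dg c - dg a'" using gr.co_br_b by simp
        thus ?thesis by (simp add: co_degree_inverse)
      qed simp
    qed
    also have "\<dots> = - inverse (of_int (dg c - dg a')) * gr.cj (AD y) $ c $ a'" unfolding e by (rule sum_distrib_left[symmetric])
    also have "\<dots> = gr.cj D $ c $ a'"
    proof -
      have "complex_of_int (dg c - dg a') \<noteq> 0" unfolding of_int_eq_0_iff using True by auto
      thus ?thesis unfolding 1 by (simp del: of_int_diff)
    qed
    finally show ?thesis by simp
  qed
  hence "gr.cj D = gr.cj (AD (degree_inverse *v y))" by (simp add: vec_eq_iff)
  thus ?thesis by (simp only: gr.cj_eq y_def)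
qed

lemma unipotent_aut: "Z \<in> rat_points (grp_N \<gg>) \<Longrightarrow> Z \<in> aut"
  unfolding aut_def by (erule rat_points_mono) (auto simp: grp_N_iff gr.unipotent_inv)

lemma grp_N_mult: "g \<in> grp_N \<gg> \<Longrightarrow> h \<in> grp_N \<gg> \<Longrightarrow> g ** h \<in> grp_N \<gg>"
  by (simp add: grp_N_iff endo_mult gr.unipotent_mult)

lemma grp_N_inv: "g \<in> grp_N \<gg> \<Longrightarrow> invertible g \<and> matrix_inv g \<in> grp_N \<gg>"
  by (simp add: grp_N_iff endo_inv gr.unipotent_inv)

text \<open>Differentiating the automorphism identity shows that D = dZ Z^-1 is, at almost every
  point, a derivation raising degrees, hence inner by \<open>raising_derivation\<close>. The
  corresponding vector is a constant matrix applied to D rho, so it is a rational function of the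
  point.\<close>

lemma unipotent_has_ld:
  assumes "Z \<in> rat_points (grp_N \<gg>)"
  obtains X where "has_ld Z X" "\<forall>\<^sub>F x in cofinite. gr.sh {1..} (AD (vec_eval X x))"
proof -
  define D where "D = mat_deriv Z ** matrix_inv Z"
  have i: "invertible Z" using aut_inv(1)[OF unipotent_aut[OF assms]] .
  define X where "X = const_mat degree_inverse *v (D *v const_vec rho)"
  have Ze: "Z \<in> rat_points {g. endo g}" using assms by (rule rat_points_mono) (auto simp: grp_N_iff)
  have "Z - mat 1 \<in> rat_points {g. gr.sh {1..} g}"
    using assms eventually_mat_regular[of Z] unfolding rat_points_iff
    by eventually_elim (simp add: grp_N_iff mat_reg_diff mat_reg_1)
  hence "mat_deriv (Z - mat 1) \<in> rat_points {g. gr.sh {1..} g}" by (rule mat_deriv_sh)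
  moreover have "mat_deriv (Z - mat 1) = mat_deriv Z"
  proof -
    have "mat_deriv (Z - mat 1) + mat_deriv (mat 1) = mat_deriv (Z - mat 1 + mat 1)" by (simp only: mat_deriv_add)
    thus ?thesis by (simp add: mat_deriv_1)
  qed
  ultimately have Zd: "\<forall>\<^sub>F x in cofinite. gr.sh {1..} (mat_eval (mat_deriv Z) x)" by (simp add: rat_points_iff)
  have deriv_ad: "mat_deriv (rat_ad \<gg> (Z *v const_vec u)) = rat_ad \<gg> (mat_deriv Z *v const_vec u)" for u
    by (simp add: mat_deriv_def rat_ad_def vec_eq_iff rat_deriv_sum rat_deriv_mult matrix_vector_mult_def ext_vec_def)
  have der: "mat_deriv Z ** const_mat (AD u) = rat_ad \<gg> (mat_deriv Z *v const_vec u) ** Z + rat_ad \<gg> (Z *v const_vec u) ** mat_deriv Z" for u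
    using arg_cong[OF endo_const_AD[OF Ze, of u], of mat_deriv] by (simp add: mat_deriv_mult deriv_ad matrix_mult_simps)
  have *: "\<forall>\<^sub>F x in cofinite. mat_eval D x = AD (vec_eval X x) \<and> gr.sh {1..} (mat_eval D x)"
    using eventually_mat_regular[of Z] eventually_mat_regular[of "mat_deriv Z"] Zd assms[unfolded rat_points_iff]
  proof eventually_elim
    case (elim x)
    let ?z = "mat_eval Z x" and ?z' = "mat_eval (mat_deriv Z) x"
    have iz: "invertible ?z" and iN: "matrix_inv ?z \<in> grp_N \<gg>" using grp_N_inv[OF elim(4)] by simp_all
    note ri = mat_reg_inv[OF elim(1) iz]
    have Dr: "mat_regular_at D x" "mat_eval D x = ?z' ** matrix_inv ?z"
      unfolding D_def using mat_reg_mult[OF elim(2) ri(1)] ri(2) by simp_all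
    have Ds: "gr.sh {1..} (mat_eval D x)" unfolding Dr
      by (rule gr.sh_mult[OF elim(3) gr.sh_add_1]) (use iN in \<open>auto simp: grp_N_iff\<close>)
    have ze: "?z ** AD u = AD (?z *v u) ** ?z" for u using elim(4) by (simp add: grp_N_iff endo_AD)
    have dz: "?z' ** AD u = AD (?z' *v u) ** ?z + AD (?z *v u) ** ?z'" for u
    proof -
      note r1 = mat_reg_vec[OF elim(1) vec_reg_const(1)[of u]] and r2 = mat_reg_vec[OF elim(2) vec_reg_const(1)[of u]]
      from arg_cong[OF der[of u], of "\<lambda>M. mat_eval M x"] show ?thesis
        using elim(1,2) r1 r2 by (simp add: mat_reg_mult mat_reg_add rat_ad_eval)
    qed
    have "mat_eval D x ** AD w = AD (mat_eval D x *v w) + AD w ** mat_eval D x" for w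
    proof -
      define u where "u = matrix_inv ?z *v w"
      have zu: "?z *v u = w" by (simp add: u_def matrix_vector_mul_assoc matrix_inv[OF iz])
      have "AD u ** matrix_inv ?z = matrix_inv ?z ** (?z ** AD u) ** matrix_inv ?z"
        by (simp add: matrix_mul_assoc matrix_inv[OF iz])
      also have "\<dots> = matrix_inv ?z ** AD w"
        unfolding ze zu by (simp add: matrix_inv[OF iz] flip: matrix_mul_assoc)
      finally have "?z' ** matrix_inv ?z ** AD w = ?z' ** AD u ** matrix_inv ?z" by (simp flip: matrix_mul_assoc)
      also have "\<dots> = AD (?z' *v u) ** ?z ** matrix_inv ?z + AD w ** ?z' ** matrix_inv ?z"
        unfolding dz zu by (simp add: mat_add_distrib)
      also have "AD (?z' *v u) ** ?z ** matrix_inv ?z = AD (?z' *v u)"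
        by (simp add: matrix_inv[OF iz] flip: matrix_mul_assoc)
      finally show ?thesis unfolding Dr u_def by (simp add: matrix_mul_assoc matrix_vector_mul_assoc)
    qed
    from raising_derivation[OF this Ds] have "mat_eval D x = AD (degree_inverse *v (mat_eval D x *v rho))" .
    moreover have "vec_eval X x = degree_inverse *v (mat_eval D x *v rho)"
      unfolding X_def using Dr(1) by (simp add: mat_reg_vec)
    ultimately show ?case using Ds by (simp only:)
  qed
  have "\<forall>\<^sub>F x in cofinite. mat_eval D x = mat_eval (rat_ad \<gg> X) x"
    using * eventually_vec_regular[of X] by eventually_elim (simp add: rat_ad_eval)
  hence "D = rat_ad \<gg> X" by (rule mat_eqI)
  hence "has_ld Z X" using i by (simp add: has_ld_def D_def)
  moreover have "\<forall>\<^sub>F x in cofinite. gr.sh {1..} (AD (vec_eval X x))"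
  proof (rule eventually_mono[OF *])
    fix x assume h: "mat_eval D x = AD (vec_eval X x) \<and> gr.sh {1..} (mat_eval D x)"
    show "gr.sh {1..} (AD (vec_eval X x))" using conjunct2[OF h] unfolding conjunct1[OF h] .
  qed
  ultimately show ?thesis by (rule that)
qed

end


section \<open>The big cell and freeness\<close>

context ss_basis
begin

definition proj :: "(int \<Rightarrow> bool) \<Rightarrow> complex^'n^'n" where
  "proj Q = gr.P ** (\<chi> a a'. if a = a' then (if Q (dg a) then 1 else 0) else 0) ** gr.Pi"

lemma co_proj: "gr.co (proj Q *v y) a = (if Q (dg a) then gr.co y a else 0)"
proof -
  have "gr.Pi *v (proj Q *v y) = (gr.Pi ** gr.P) *v ((\<chi> a a'. if a = a' then (if Q (dg a) then 1 else 0) else 0) *v (gr.Pi *v y))"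
    by (simp only: proj_def matrix_vector_mul_assoc matrix_mul_assoc)
  thus ?thesis
    by (simp add: gr.P gr.co_def) (simp add: matrix_vector_mult_def[of "vec_lambda _"] if_distrib[where f = "\<lambda>z. z * _"] cong: if_cong)
qed

text \<open>For the degree 0 part v0 of v, ad v0 has degree 0 and at the same time degrees in S, so
  it vanishes, and ad is faithful.\<close>

lemma sh_AD_imp:
  assumes s: "gr.sh S (AD v)" and "0 \<notin> S"
  shows "v \<in> gr.gsp S"
proof -
  define v0 where "v0 = proj (\<lambda>z. z = 0) *v v"
  have v: "v \<in> gr.gsp (insert 0 S)" by (rule sh_AD_conv[OF s])
  have v0: "v0 \<in> gr.gsp {0}" by (simp add: gr.gsp_def v0_def co_proj)
  have v1: "v - v0 \<in> gr.gsp S" using v by (auto simp: gr.gsp_def v0_def co_proj gr.co_simps)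
  have "AD v0 = AD v - AD (v - v0)" by (simp add: AD_lin)
  hence "gr.sh S (AD v0)" using gr.sh_lin(2)[OF s gr.AD_sh[OF v1]] by simp
  hence "gr.cj (AD v0) $ a $ a' = gr.cj 0 $ a $ a'" for a a'
  proof (cases "dg a - dg a' \<in> S")
    case True
    hence "dg a - dg a' \<notin> {0}" using assms(2) by auto
    thus ?thesis using gr.shD[OF gr.AD_sh[OF v0]] by (simp only: gr.cj_simps zero_index)
  next
    case False
    thus ?thesis using gr.shD[OF \<open>gr.sh S (AD v0)\<close>] by (simp only: gr.cj_simps zero_index)
  qed
  hence "gr.cj (AD v0) = gr.cj 0" by (simp add: vec_eq_iff)
  hence "AD v0 = AD 0" unfolding gr.cj_eq by (simp add: matrix_eq AD br_simps)
  hence "v0 = 0" by (rule AD_inj)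
  thus ?thesis using v1 by simp
qed

lemma p_minus_gsp: "p_minus \<gg> \<in> gr.gsp {-1}"
proof -
  have "{z. real_of_int z = - 1} = {-1}" by auto
  hence "Fg i \<in> gr.gsp {-1}" for i using EF_sp(2)[of i] unfolding sp_gsp by simp
  thus ?thesis unfolding p_minus_def by (intro vec.subspace_sum gr.gsp_sub)
qed

text \<open>Block Gauss elimination for z = u l, with \<open>li\<close> the inverse of l. For k = dg
  a, the equation \<open>m k\<close> x = b a says that x has no component of degree above k and that
  z x agrees with b a in degrees up to k; taking these x as columns makes \<open>li\<close> lower
  triangular and z \<open>li\<close> unipotent.\<close>

lemma big_cell:
  fixes z li :: "complex^'n^'n"
  assumes z: "endo z" "invertible z"
    and mi: "\<forall>k\<in>range dg. invertible (m k)" and m: "\<And>k. m k = proj (\<lambda>d. d \<le> k) ** z + (mat 1 - proj (\<lambda>d. d \<le> k))"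
    and li: "\<And>a. li *v b a = matrix_inv (m (dg a)) *v b a"
  shows "gr.sh {..0} li" "z ** li \<in> grp_N \<gg>" "invertible li" "endo (matrix_inv li)"
proof -
  have key: "gr.co (if dg c \<le> dg a then z *v (li *v b a) else li *v b a) c = gr.co (b a) c" for a c
  proof -
    have e: "m (dg a) *v (li *v b a) = b a" unfolding li by (simp add: matrix_vector_mul_assoc matrix_inv[OF mi[rule_format, OF rangeI]])
    have "gr.co (m (dg a) *v (li *v b a)) c = (if dg c \<le> dg a then gr.co (z *v (li *v b a)) c else gr.co (li *v b a) c)"
      unfolding m matrix_vector_simps matrix_vector_mul_assoc[symmetric]
      by (simp add: gr.co_simps co_proj)
    thus ?thesis unfolding e by simp
  qed
  show lis: "gr.sh {..0} li"
  proof (rule gr.shI)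
    fix c a assume "dg c - dg a \<notin> {..0}"
    thus "gr.cj li $ c $ a = 0" using key[of c a] by (auto simp: gr.cj_co gr.co_b split: if_splits)
  qed
  define u where "u = z ** li"
  have us: "gr.sh {1..} (u - mat 1)"
  proof (rule gr.shI)
    fix c a assume "dg c - dg a \<notin> {1..}"
    thus "gr.cj (u - mat 1) $ c $ a = 0"
      using key[of c a] by (simp add: gr.cj_co gr.co_simps matrix_vector_simps u_def flip: matrix_vector_mul_assoc)
  qed
  note ui = gr.unipotent_inv[OF us]
  have liu: "li = matrix_inv z ** u" by (simp add: u_def matrix_mul_assoc matrix_inv[OF z(2)])
  show il: "invertible li" unfolding liu by (rule matrix_inv_mult(1)[OF invertible_matrix_inv(1)[OF z(2)] ui(1)])
  have lil: "gr.sh {..0} (matrix_inv li)" by (rule lower_inv[OF lis il])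
  have uab: "u ** AD (b a) = AD (u *v b a) ** u" for a
  proof -
    define i where "i = dg a"
    have ba: "b a \<in> gr.gsp {i}" by (auto simp: gr.gsp_def gr.co_b i_def split: if_splits)
    \<comment> \<open>\<open>X\<close> measures the failure of u to be an automorphism at b a.
      Unipotency of u puts it in degrees above i; rewriting it through the automorphism z and the
      lower triangular \<open>li\<close> puts it in degrees at most i. Hence it is zero.\<close>
    define X where "X = matrix_inv u ** (AD (u *v b a) ** u) - AD (b a)"
    have r: "(u - mat 1) *v b a \<in> gr.gsp {i + 1..}" by (rule gr.sh_vec[OF us ba]) simp
    have u0: "gr.sh {0..} u" "gr.sh {0..} (matrix_inv u)" using gr.sh_add_1 us ui(2) by blast+
    have s1: "gr.sh {i + 1..} (AD ((u - mat 1) *v b a) ** u)" by (rule gr.sh_mult[OF gr.AD_sh[OF r] u0(1)]) simp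
    have s2: "gr.sh {i + 1..} (AD (b a) ** (u - mat 1))" by (rule gr.sh_mult[OF gr.AD_sh[OF ba] us]) simp
    have s3: "gr.sh {i + 1..} ((u - mat 1) ** AD (b a))" by (rule gr.sh_mult[OF us gr.AD_sh[OF ba]]) simp
    have "AD (u *v b a) ** u - u ** AD (b a) = AD ((u - mat 1) *v b a) ** u + AD (b a) ** (u - mat 1) - (u - mat 1) ** AD (b a)"
      by (simp add: matrix_vector_simps AD_lin matrix_mult_simps mat_add_distrib)
    hence s4: "gr.sh {i + 1..} (AD (u *v b a) ** u - u ** AD (b a))"
      using gr.sh_lin(2)[OF gr.sh_lin(1)[OF s1 s2] s3] by simp
    have "X = matrix_inv u ** (AD (u *v b a) ** u - u ** AD (b a))"
      by (simp add: X_def matrix_mult_simps matrix_mul_assoc matrix_inv[OF ui(1)])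
    hence Xu: "gr.sh {i + 1..} X" using gr.sh_mult[OF u0(2) s4, of "{i + 1..}"] by simp
    have "AD (u *v b a) ** u = AD (z *v (li *v b a)) ** z ** li" by (simp add: u_def matrix_vector_mul_assoc matrix_mul_assoc)
    also have "\<dots> = z ** AD (li *v b a) ** li" using z(1) by (simp add: endo_AD)
    also have "matrix_inv u ** (z ** AD (li *v b a) ** li) = matrix_inv li ** (matrix_inv z ** z) ** AD (li *v b a) ** li"
      unfolding u_def matrix_inv_mult(2)[OF z(2) il] by (simp add: matrix_mul_assoc)
    finally have Xe: "X = matrix_inv li ** AD (li *v b a) ** li - AD (b a)"
      unfolding X_def by (simp add: matrix_inv[OF z(2)])
    have lb: "li *v b a \<in> gr.gsp {..i}" by (rule gr.sh_vec[OF lis ba]) simp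
    have "gr.sh {..i} (matrix_inv li ** AD (li *v b a) ** li)"
      by (rule gr.sh_mult[OF gr.sh_mult[OF lil gr.AD_sh[OF lb], of "{..i}"] lis]) simp_all
    moreover have "gr.sh {..i} (AD (b a))" by (rule gr.sh_mono[OF gr.AD_sh[OF ba]]) simp
    ultimately have Xl: "gr.sh {..i} X" unfolding Xe by (rule gr.sh_lin(2))
    have "gr.cj X $ c $ c' = gr.cj 0 $ c $ c'" for c c'
    proof (cases "dg c - dg c' \<le> i")
      case True
      thus ?thesis using gr.shD[OF Xu, of c c'] by (simp add: gr.cj_simps)
    next
      case False
      thus ?thesis using gr.shD[OF Xl, of c c'] by (simp add: gr.cj_simps)
    qed
    hence "gr.cj X = gr.cj 0" by (simp add: vec_eq_iff)
    hence "X = 0" by (simp only: gr.cj_eq)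
    hence "matrix_inv u ** (AD (u *v b a) ** u) = AD (b a)" by (simp add: X_def)
    hence "u ** AD (b a) = u ** (matrix_inv u ** (AD (u *v b a) ** u))" by simp
    thus ?thesis by (simp add: matrix_mul_assoc matrix_inv[OF ui(1)])
  qed
  have ub: "u *v br (b a) y = br (u *v b a) (u *v y)" for a y
  proof -
    have "(u ** AD (b a)) *v y = (AD (u *v b a) ** u) *v y" by (simp only: uab)
    thus ?thesis by (simp add: AD flip: matrix_vector_mul_assoc)
  qed
  have "u *v br x y = br (u *v x) (u *v y)" for x y
    by (subst (1 2) gr.co_expand[of x])
      (simp add: br_sum br_simps ub vec.linear_sum[OF matrix_vector_mul_linear_gen] matrix_vector_simps)
  hence eu: "endo u" by (simp add: endo_def)
  show "z ** li \<in> grp_N \<gg>" using eu us by (simp add: grp_N_iff u_def)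
  have "matrix_inv li = matrix_inv u ** z"
    unfolding liu matrix_inv_mult(2)[OF invertible_matrix_inv(1)[OF z(2)] ui(1)] invertible_matrix_inv(2)[OF z(2)] ..
  thus "endo (matrix_inv li)" using endo_mult[OF endo_inv[OF eu ui(1)] z(1)] by simp
qed

text \<open>Since Z(0) lies in N, the matrices \<open>M k\<close> of the elimination have unipotent
  value at 0. They are therefore invertible there and at almost every point, and the pointwise
  factors assemble to rational matrices regular at 0.\<close>

lemma rational_big_cell:
  assumes Z: "Z \<in> aut" and r0: "mat_regular_at Z 0" and N0: "mat_eval Z 0 \<in> grp_N \<gg>"
  obtains U L where "Z = U ** L" "U \<in> rat_points (grp_N \<gg>)" "mat_regular_at U 0" "mat_eval U 0 = mat_eval Z 0"
    "L \<in> aut" "L \<in> rat_points {g. gr.sh {..0} g}" "mat_regular_at L 0" "mat_eval L 0 = mat 1"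
proof -
  define le where "le = (\<lambda>k. proj (\<lambda>d. d \<le> k))"
  define M where "M = (\<lambda>k. const_mat (le k) ** Z + const_mat (mat 1 - le k))"
  \<comment> \<open>Assembled by degrees: on vectors of degree k the inverse of the lower factor is
    given by \<open>matrix_inv (M k)\<close>.\<close>
  define Li where "Li = (\<Sum>k\<in>range dg. matrix_inv (M k) ** const_mat (proj (\<lambda>d. d = k)))"
  have Mr: "mat_regular_at (M k) x" "mat_eval (M k) x = le k ** mat_eval Z x + (mat 1 - le k)" if "mat_regular_at Z x" for k x
    using that by (simp_all add: M_def mat_reg_add mat_reg_mult)
  have pb: "proj (\<lambda>d. d = k) *v b a = (if k = dg a then b a else 0)" for k a
    by (rule gr.co_eqI) (auto simp: co_proj gr.co_b gr.co_simps)
  have Lib: "mat_eval Li x *v b a = matrix_inv (mat_eval (M (dg a)) x) *v b a" "mat_regular_at Li x"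
    if "mat_regular_at Z x" "\<forall>k\<in>range dg. invertible (mat_eval (M k) x)" for x a
  proof -
    have rk: "mat_regular_at (matrix_inv (M k)) x" "mat_eval (matrix_inv (M k)) x = matrix_inv (mat_eval (M k) x)"
      if "k \<in> range dg" for k
      using mat_reg_inv[OF Mr(1)[OF \<open>mat_regular_at Z x\<close>]] \<open>\<forall>k\<in>range dg. invertible (mat_eval (M k) x)\<close> that by blast+
    show "mat_regular_at Li x" unfolding Li_def by (intro mat_reg_sum(1) mat_reg_mult(1) rk(1) mat_reg_const(1))
    have "mat_eval Li x = (\<Sum>k\<in>range dg. matrix_inv (mat_eval (M k) x) ** proj (\<lambda>d. d = k))"
      unfolding Li_def by (subst mat_reg_sum(2)) (simp_all add: mat_reg_mult rk)
    moreover have "sum f S *v v = (\<Sum>k\<in>S. f k *v v)" for f :: "int \<Rightarrow> complex^'n^'n" and S v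
      by (induction S rule: infinite_finite_induct) (simp_all add: matrix_vector_simps)
    ultimately have "mat_eval Li x *v b a = (\<Sum>k\<in>range dg. matrix_inv (mat_eval (M k) x) *v (proj (\<lambda>d. d = k) *v b a))"
      by (simp add: matrix_vector_mul_assoc)
    also have "\<dots> = (\<Sum>k\<in>range dg. if k = dg a then matrix_inv (mat_eval (M k) x) *v b a else 0)"
      unfolding pb by (intro sum.cong refl) (simp add: matrix_vector_simps)
    also have "\<dots> = matrix_inv (mat_eval (M (dg a)) x) *v b a" by (subst sum.delta) simp_all
    finally show "mat_eval Li x *v b a = matrix_inv (mat_eval (M (dg a)) x) *v b a" .
  qed
  define h where "h = mat_eval Z 0"
  have hs: "gr.sh {1..} (h - mat 1)" using N0 by (simp add: grp_N_iff h_def)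
  have M0: "mat_eval (M k) 0 = mat 1 + le k ** (h - mat 1)" for k
    unfolding Mr(2)[OF r0] by (simp add: h_def matrix_mult_simps)
  have les: "gr.sh {0} (le k)" for k
  proof (rule gr.shI)
    fix a a' assume "dg a - dg a' \<notin> {0}"
    thus "gr.cj (le k) $ a $ a' = 0" by (auto simp: gr.cj_co le_def co_proj gr.co_b)
  qed
  have Mi: "invertible (mat_eval (M k) 0)" for k
  proof (rule gr.unipotent_inv)
    show "gr.sh {1..} (mat_eval (M k) 0 - mat 1)" unfolding M0 using gr.sh_mult[OF les hs, of "{1..}"] by simp
  qed
  hence Li0: "mat_regular_at Li 0" "mat_eval Li 0 *v b a = matrix_inv (mat_eval (M (dg a)) 0) *v b a" for a
    using Lib[OF r0] by blast+
  \<comment> \<open>At 0 there is nothing to eliminate: Z(0) - 1 raises degrees, so its part in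
    degrees up to \<open>dg a\<close> kills \<open>b a\<close>.\<close>
  have "mat_eval Li 0 = mat 1"
  proof (rule gr.mat_eq_basis)
    fix a
    have ba: "b a \<in> gr.gsp {dg a}" by (auto simp: gr.gsp_def gr.co_b split: if_splits)
    have "(h - mat 1) *v b a \<in> gr.gsp {dg a + 1..}" by (rule gr.sh_vec[OF hs ba]) simp
    hence "le (dg a) *v ((h - mat 1) *v b a) = 0"
      by (intro gr.co_eqI) (auto simp: le_def co_proj gr.co_simps gr.gsp_def)
    hence "mat_eval (M (dg a)) 0 *v b a = b a" unfolding M0 matrix_vector_simps(5) by (simp add: matrix_vector_mul_assoc)
    hence "matrix_inv (mat_eval (M (dg a)) 0) *v (mat_eval (M (dg a)) 0 *v b a) = matrix_inv (mat_eval (M (dg a)) 0) *v b a" by simp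
    thus "mat_eval Li 0 *v b a = mat 1 *v b a"
      unfolding Li0(2) by (simp add: matrix_vector_mul_assoc matrix_inv[OF Mi])
  qed
  have iM: "invertible (M k)" for k by (rule invertible_ratI[OF Mr(1)[OF r0] Mi])
  have evM: "\<forall>\<^sub>F x in cofinite. \<forall>k\<in>range dg. invertible (mat_eval (M k) x)"
  proof -
    have "\<forall>\<^sub>F x in cofinite. invertible (mat_eval (M k) x)" for k
      using eventually_mat_regular[of "M k"] eventually_mat_regular[of "matrix_inv (M k)"]
    proof eventually_elim
      case (elim x)
      have "mat_eval (M k) x ** mat_eval (matrix_inv (M k)) x = mat_eval (M k ** matrix_inv (M k)) x"
        by (rule mat_reg_mult(2)[OF elim, symmetric])
      also have "\<dots> = mat 1" by (simp add: matrix_inv[OF iM] mat_reg_1)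
      finally show ?case by (rule matrix_inv_unique(1))
    qed
    thus ?thesis by (intro eventually_ball_finite ballI) simp_all
  qed
  have main: "\<forall>\<^sub>F x in cofinite. gr.sh {..0} (mat_eval Li x) \<and> mat_eval (Z ** Li) x \<in> grp_N \<gg> \<and>
      invertible (mat_eval Li x) \<and> endo (matrix_inv (mat_eval Li x))"
    using evM eventually_mat_regular[of Z] Z[unfolded aut_def rat_points_iff]
  proof eventually_elim
    case (elim x)
    let ?z = "mat_eval Z x" and ?li = "mat_eval Li x"
    note lb = Lib[OF elim(2,1)]
    have "proj (\<lambda>d. d \<le> k) ** ?z + (mat 1 - proj (\<lambda>d. d \<le> k)) = mat_eval (M k) x" for k
      using Mr(2)[OF elim(2)] by (simp add: le_def)
    note bc = big_cell[OF _ _ elim(1) this[symmetric] lb(1)]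
    have ez: "endo ?z" "invertible ?z" using elim(3) by simp_all
    show ?case using bc[OF ez] mat_reg_mult(2)[OF elim(2) lb(2)] by simp
  qed
  have iLi: "invertible Li" by (rule invertible_ratI[OF Li0(1)]) (simp add: \<open>mat_eval Li 0 = mat 1\<close> invertible_def)
  define L where "L = matrix_inv Li"
  have i1: "invertible (mat_eval Li 0)" by (simp add: \<open>mat_eval Li 0 = mat 1\<close> invertible_def)
  have inv1: "matrix_inv (mat 1 :: complex^'n^'n) = mat 1" by (rule matrix_inv_unique(2)) simp
  have Lx: "\<forall>\<^sub>F x in cofinite. mat_eval L x = matrix_inv (mat_eval Li x)"
    using main eventually_mat_regular[of Li] by eventually_elim (simp add: L_def mat_reg_inv)
  show ?thesis
  proof (rule that[of "Z ** Li" L])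
    show "Z = Z ** Li ** L" by (simp add: L_def matrix_inv[OF iLi] flip: matrix_mul_assoc)
    show "Z ** Li \<in> rat_points (grp_N \<gg>)" unfolding rat_points_iff using main by eventually_elim simp
    show "mat_regular_at (Z ** Li) 0" by (rule mat_reg_mult(1)[OF r0 Li0(1)])
    show "mat_eval (Z ** Li) 0 = mat_eval Z 0" by (simp add: mat_reg_mult[OF r0 Li0(1)] \<open>mat_eval Li 0 = mat 1\<close>)
    show "L \<in> aut" unfolding aut_def rat_points_iff using main Lx
      by eventually_elim (simp add: invertible_matrix_inv)
    show "L \<in> rat_points {g. gr.sh {..0} g}" unfolding rat_points_iff using main Lx
      by eventually_elim (simp add: lower_inv)
    show "mat_regular_at L 0" "mat_eval L 0 = mat 1"
      unfolding L_def using mat_reg_inv[OF Li0(1) i1] by (simp_all add: \<open>mat_eval Li 0 = mat 1\<close> inv1)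
  qed
qed

text \<open>Suppose k - 1 has degrees at least m, where m is at least 1. So has its logarithmic
  derivative, and the leading term of k - 1 is ad w with w of degree m. In degree m - 1 the fixed
  point equation leaves only the bracket of w with p_-1, as the Cartan part of A and Y contribute
  from degree m on. So w = 0, and the order increases.\<close>

lemma gauge_free:
  assumes k: "k \<in> rat_points (grp_N \<gg>)" and Y: "has_ld k Y" and e: "k *v A - Y = A"
    and A: "\<forall>\<^sub>F x in cofinite. vec_eval A x - p_minus \<gg> \<in> hh"
  shows "k = mat 1"
proof -
  obtain Y' where Y': "has_ld k Y'" "\<forall>\<^sub>F x in cofinite. gr.sh {1..} (AD (vec_eval Y' x))"
    by (rule unipotent_has_ld[OF k]) (rule that; assumption)
  have "k - mat 1 \<in> rat_points {g. gr.sh {int (Suc d)..} g}" for d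
  proof (induction d)
    case 0
    show ?case using k eventually_mat_regular[of k] unfolding rat_points_iff
      by eventually_elim (simp add: grp_N_iff mat_reg_diff mat_reg_1)
  next
    case (Suc d)
    have "mat_deriv (k - mat 1) = mat_deriv k"
    proof -
      have "mat_deriv (k - mat 1) + mat_deriv (mat 1) = mat_deriv (k - mat 1 + mat 1)" by (simp only: mat_deriv_add)
      thus ?thesis by (simp add: mat_deriv_1)
    qed
    with mat_deriv_sh[OF Suc] have kd: "\<forall>\<^sub>F x in cofinite. gr.sh {int (Suc d)..} (mat_eval (mat_deriv k) x)"
      by (simp add: rat_points_iff)
    show ?case
      unfolding rat_points_iff
      using kd Suc[unfolded rat_points_iff] k[unfolded rat_points_iff] A eventually_mat_regular[of k]
        eventually_mat_regular[of "mat_deriv k"] eventually_vec_regular[of A] eventually_vec_regular[of Y]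
    proof eventually_elim
      case (elim x)
      define m where "m = Suc d"
      define g where "g = mat_eval k x"
      define R where "R = g - mat 1"
      have gN: "g \<in> grp_N \<gg>" using elim(3) by (simp add: g_def)
      have ke: "mat_eval (k - mat 1) x = R" using elim(5) by (simp add: mat_reg_diff mat_reg_1 R_def g_def)
      have Rs: "gr.sh {int m..} R" using elim(2) ke by (simp add: m_def)
      define y where "y = vec_eval Y x"
      define u where "u = vec_eval A x - p_minus \<gg>"
      have u: "u \<in> gr.gsp {0}" using elim(4) nil_gsp(2) by (simp add: u_def)
      have gi: "invertible g" "matrix_inv g \<in> grp_N \<gg>" using grp_N_inv[OF gN] by simp_all
      have "AD y = mat_eval (mat_deriv k ** matrix_inv k) x"
        using Y rat_ad_eval(2)[OF elim(8)] by (simp add: has_ld_def y_def)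
      also have "\<dots> = mat_eval (mat_deriv k) x ** matrix_inv g"
        using elim(5,6) gi(1) mat_reg_inv[OF elim(5)] by (simp add: mat_reg_mult g_def)
      finally have "gr.sh {int m..} (AD y)"
        using gr.sh_mult[OF elim(1) gr.sh_add_1, of "matrix_inv g" "{int m..}"] gi(2) by (simp add: grp_N_iff m_def)
      hence y: "y \<in> gr.gsp {int m..}" by (rule sh_AD_imp) (simp add: m_def)
      have "vec_eval (k *v A - Y) x = vec_eval A x" by (simp only: e)
      hence "g *v vec_eval A x - y = vec_eval A x"
        using elim(5,7,8) by (simp add: vec_reg_diff mat_reg_vec g_def y_def)
    hence ye: "y = R *v vec_eval A x" by (simp add: R_def matrix_vector_simps(3) algebra_simps)
      have Ra: "R *v p_minus \<gg> = y - R *v u" unfolding ye u_def matrix_vector_simps(4) by simp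
      have Ru: "R *v u \<in> gr.gsp {int m..}" by (rule gr.sh_vec[OF Rs u]) simp
      have Rp: "R *v p_minus \<gg> \<in> gr.gsp {int m..}" unfolding Ra by (rule vec.subspace_diff[OF gr.gsp_sub y Ru])
      have eg: "endo g" using gN by (simp add: grp_N_iff)
      obtain v where v: "v \<in> gr.gsp {int m..}"
        and lead: "\<forall>a a'. dg a - dg a' = int m \<longrightarrow> gr.cj R $ a $ a' = gr.cj (AD v) $ a $ a'"
        using gr.unipotent_leading_term[OF eg Rs[unfolded R_def]] unfolding R_def m_def by auto
      \<comment> \<open>Only the component of exact degree m matters; the remainder of v belongs to
        degrees above m.\<close>
      define w where "w = proj (\<lambda>z. z = int m) *v v"
      have wm: "w \<in> gr.gsp {int m}" by (simp add: gr.gsp_def w_def co_proj)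
      have vw: "v - w \<in> gr.gsp {int m + 1..}" using v by (auto simp: gr.gsp_def w_def co_proj gr.co_simps)
      have RA: "gr.sh {int m + 1..} (R - AD w)"
      proof (rule gr.shI)
        fix a a' assume n: "dg a - dg a' \<notin> {int m + 1..}"
        have z: "gr.cj (AD (v - w)) $ a $ a' = 0" by (rule gr.shD[OF gr.AD_sh[OF vw] n])
        have s: "gr.cj (AD v) $ a $ a' = gr.cj (AD w) $ a $ a'" using z by (simp add: AD_lin gr.cj_simps)
        show "gr.cj (R - AD w) $ a $ a' = 0"
        proof (cases "dg a - dg a' = int m")
          case True thus ?thesis using lead s by (simp add: gr.cj_simps)
        next
          case False
          hence "dg a - dg a' \<notin> {int m..}" using n by auto
          thus ?thesis using gr.shD[OF Rs] gr.shD[OF gr.AD_sh[OF v]] s by (simp add: gr.cj_simps)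
        qed
      qed
      have "(R - AD w) *v p_minus \<gg> \<in> gr.gsp {int m..}" by (rule gr.sh_vec[OF RA p_minus_gsp]) simp
      with Rp have "R *v p_minus \<gg> - (R - AD w) *v p_minus \<gg> \<in> gr.gsp {int m..}" by (rule vec.subspace_diff[OF gr.gsp_sub])
      hence b1: "br w (p_minus \<gg>) \<in> gr.gsp {int m..}" by (simp add: matrix_vector_simps AD)
      have "AD w *v p_minus \<gg> \<in> gr.gsp {int m - 1}" by (rule gr.sh_vec[OF gr.AD_sh[OF wm] p_minus_gsp]) simp
      hence b2: "br w (p_minus \<gg>) \<in> gr.gsp {int m - 1}" by (simp add: AD)
      have "gr.co (br w (p_minus \<gg>)) a = 0" for a
      proof (rule ccontr)
        assume "gr.co (br w (p_minus \<gg>)) a \<noteq> 0"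
        hence "dg a \<in> {int m..}" "dg a \<in> {int m - 1}" using b1 b2 unfolding gr.gsp_def by blast+
        thus False by simp
      qed
      hence "br w (p_minus \<gg>) = 0" by (intro gr.co_eqI) (simp add: gr.co_simps)
      hence pw: "br (p_minus \<gg>) w = 0" by (subst br_anti) simp
      have "br rho w = of_real (real m) *s w"
        
      proof (rule gr.co_eqI)
        fix a
        have "gr.co w a \<noteq> 0 \<Longrightarrow> dg a = int m" using wm unfolding gr.gsp_def by blast
        thus "gr.co (br rho w) a = gr.co (of_real (real m) *s w) a" unfolding gr.co_rho gr.co_simps by force
      qed
      hence "w = 0" by (rule principal_injective(1)) (simp_all add: m_def pw)
      hence "AD w = 0" by (simp add: matrix_eq AD br_simps)
      thus ?case using RA ke by (simp add: m_def algebra_simps)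
    qed
  qed
  hence "k - mat 1 \<in> rat_points {g. gr.sh {int (Suc gr.bound)..} g}" by blast
  hence "\<forall>\<^sub>F x in cofinite. mat_eval (k - mat 1) x = mat_eval 0 x"
    unfolding rat_points_iff
  proof eventually_elim
    case (elim x)
    have "gr.sh {int gr.bound..} (mat_eval (k - mat 1) x)" by (rule gr.sh_mono[OF CollectD[OF elim]]) auto
    hence "mat_eval (k - mat 1) x = 0" by (rule gr.sh_bound)
    thus ?case by (simp add: mat_eval_def vec_eq_iff)
  qed
  hence "k - mat 1 = 0" by (rule mat_eqI)
  thus ?thesis by simp
qed

end


section \<open>Torus elements\<close>

text \<open>Covers the identity and \<open>rat_const\<close>, so that constant torus elements and
  powers of t are treated together.\<close>

definition field_emb :: "(complex \<Rightarrow> 'k::field) \<Rightarrow> bool" where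
  "field_emb emb \<longleftrightarrow> (\<forall>x y. emb (x + y) = emb x + emb y \<and> emb (x * y) = emb x * emb y) \<and> emb 1 = 1"

lemma field_emb_simps:
  assumes "field_emb emb"
  shows "emb 0 = 0" "emb 1 = 1" "emb (x + y) = emb x + emb y" "emb (x * y) = emb x * emb y"
    "emb (sum f S) = (\<Sum>a\<in>S. emb (f a))"
proof -
  show 1: "emb (x + y) = emb x + emb y" "emb (x * y) = emb x * emb y" "emb 1 = 1" for x y
    using assms by (simp_all add: field_emb_def)
  have "emb 0 + 0 = emb 0 + emb 0" using 1(1)[of 0 0] by (simp only: add_0_right)
  hence "0 = emb 0" by (simp only: add_left_cancel)
  thus 0: "emb 0 = 0" by (rule sym)
  show "emb (sum f S) = (\<Sum>a\<in>S. emb (f a))"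
    by (induction S rule: infinite_finite_induct) (simp_all add: 0 1)
qed

lemma field_emb: "field_emb (\<lambda>c. c)" "field_emb rat_const"
  by (simp_all add: field_emb_def)

lemma ext_hom:
  assumes "field_emb emb"
  shows "ext_mat emb (A ** B) = ext_mat emb A ** ext_mat emb B"
    "ext_mat emb A *v ext_vec emb x = ext_vec emb (A *v x)"
    "ext_mat emb (mat 1) = mat 1"
    "ext_vec emb (c *s x) = emb c *s ext_vec emb x"
  by (simp_all add: ext_mat_def ext_vec_def vec_eq_iff matrix_matrix_mult_def matrix_vector_mult_def mat_def
      field_emb_simps[OF assms])

lemma ext_id [simp]: "ext_mat (\<lambda>c. c) A = A" "ext_vec (\<lambda>c. c) v = v"
  by (simp_all add: ext_mat_def ext_vec_def)

lemma rat_t_powi_eval: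
  assumes "x \<noteq> 0"
  shows "rat_regular_at (rat_t powi k) x" "rat_eval (rat_t powi k) x = x powi k"
proof -
  have n: "rat_regular_at (rat_t ^ m) x \<and> rat_eval (rat_t ^ m) x = x ^ m" for m
    by (induction m) (simp_all add: rat_regular_mult)
  have i: "rat_regular_at (inverse (rat_t ^ m)) x" "rat_eval (inverse (rat_t ^ m)) x = inverse (x ^ m)" for m
    using rat_regular_inverse[of "rat_t ^ m" x] n[of m] assms by simp_all
  show "rat_regular_at (rat_t powi k) x" "rat_eval (rat_t powi k) x = x powi k"
    using n i by (cases "k \<ge> 0"; simp add: power_int_def power_inverse)+
qed

context ss_basis
begin

text \<open>Multiplication of the vector \<open>b a\<close> by \<open>d a\<close>, expressed in
  standard coordinates over the larger field.\<close>

definition dmat :: "(complex \<Rightarrow> 'k::field) \<Rightarrow> ('n \<Rightarrow> 'k) \<Rightarrow> 'k^'n^'n" where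
  "dmat emb d = ext_mat emb gr.P ** (\<chi> a a'. if a = a' then d a else 0) ** ext_mat emb gr.Pi"

lemma diag_mult: "(\<chi> a a'. if a = a' then d a else 0) ** (\<chi> a a'. if a = a' then e a else 0)
    = (\<chi> a a'. if a = a' then d a * e a else (0::'k::field))"
  by (simp add: vec_eq_iff matrix_matrix_mult_def if_distrib[where f = "\<lambda>z. z * _"] cong: if_cong)

lemma ext_P: "field_emb emb \<Longrightarrow> ext_mat emb gr.Pi ** ext_mat emb gr.P = mat 1"
  "field_emb emb \<Longrightarrow> ext_mat emb gr.P ** ext_mat emb gr.Pi = mat 1"
  by (simp_all add: gr.P ext_hom(3) flip: ext_hom(1))

lemma dmat_mult:
  assumes "field_emb emb"
  shows "dmat emb d ** dmat emb e = dmat emb (\<lambda>a. d a * e a)"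
proof -
  let ?D = "\<lambda>d. (\<chi> a a'. if a = a' then d a else 0) :: 'a^'n^'n"
  have "dmat emb d ** dmat emb e = ext_mat emb gr.P ** ?D d ** (ext_mat emb gr.Pi ** ext_mat emb gr.P) ** ?D e ** ext_mat emb gr.Pi"
    by (simp only: dmat_def matrix_mul_assoc)
  also have "\<dots> = ext_mat emb gr.P ** (?D d ** ?D e) ** ext_mat emb gr.Pi"
    unfolding ext_P[OF assms] by (simp only: matrix_mul_rid matrix_mul_assoc)
  finally show ?thesis unfolding diag_mult dmat_def .
qed

lemma dmat_1: "field_emb emb \<Longrightarrow> dmat emb (\<lambda>_. 1) = mat 1"
proof -
  assume e: "field_emb emb"
  have "(\<chi> a a'. if a = a' then 1 else 0) = (mat 1 :: 'a^'n^'n)" by (simp add: mat_def)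
  thus ?thesis unfolding dmat_def by (simp only: matrix_mul_rid ext_P[OF e])
qed

lemma dmat_vec:
  assumes e: "field_emb emb"
  shows "dmat emb d *v ext_vec emb x = ext_mat emb gr.P *v (\<chi> a. d a * emb (gr.co x a))"
proof -
  have "dmat emb d *v ext_vec emb x
      = ext_mat emb gr.P *v ((\<chi> a a'. if a = a' then d a else 0) *v ext_vec emb (gr.Pi *v x))"
    by (simp only: dmat_def ext_hom(2)[OF e, symmetric] matrix_vector_mul_assoc matrix_mul_assoc)
  also have "(\<chi> a a'. if a = a' then d a else 0) *v ext_vec emb (gr.Pi *v x) = (\<chi> a. d a * emb (gr.co x a))"
    by (simp add: vec_eq_iff gr.co_def ext_vec_def matrix_vector_mult_def if_distrib[where f = "\<lambda>z. z * _"] cong: if_cong)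
  finally show ?thesis .
qed

lemma co_dmat: "gr.co (dmat (\<lambda>c. c) d *v x) a = d a * gr.co x a"
proof -
  have "dmat (\<lambda>c. c) d *v x = gr.P *v (\<chi> a. d a * gr.co x a)" using dmat_vec[OF field_emb(1), of d x] by simp
  thus ?thesis by (simp add: gr.co_def matrix_vector_mul_assoc gr.P)
qed

lemma dmat_eigen:
  assumes e: "field_emb emb" and x: "\<And>a. gr.co x a \<noteq> 0 \<Longrightarrow> d a = c"
  shows "dmat emb d *v ext_vec emb x = c *s ext_vec emb x"
proof -
  have "(\<chi> a. d a * emb (gr.co x a)) = c *s ext_vec emb (gr.Pi *v x)"
    using x by (auto simp: vec_eq_iff ext_vec_def gr.co_def field_emb_simps[OF e]) (metis field_emb_simps(1)[OF e] mult_zero_right)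
  hence "dmat emb d *v ext_vec emb x = c *s (ext_mat emb gr.P *v ext_vec emb (gr.Pi *v x))"
    unfolding dmat_vec[OF e] by (simp only: matrix_vector_simps(7))
  also have "ext_mat emb gr.P *v ext_vec emb (gr.Pi *v x) = ext_vec emb x"
    by (simp only: ext_hom(2)[OF e] matrix_vector_mul_assoc gr.P matrix_vector_mul_lid)
  finally show ?thesis .
qed

lemma ext_basis_eq:
  assumes e: "field_emb emb" and M: "\<And>a. M *v ext_vec emb (b a) = M' *v ext_vec emb (b a)"
  shows "M = M'"
proof -
  have eb: "ext_vec emb (b a) $ q = ext_mat emb gr.P $ q $ a" for a q by (simp add: ext_vec_def ext_mat_def gr.P_def)
  have "(M ** ext_mat emb gr.P) $ r $ a = (M' ** ext_mat emb gr.P) $ r $ a" for r a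
    using arg_cong[OF M[of a], of "\<lambda>v. v $ r"] by (simp add: matrix_vector_mult_def matrix_matrix_mult_def eb)
  hence "M ** ext_mat emb gr.P = M' ** ext_mat emb gr.P" by (simp add: vec_eq_iff)
  hence "M ** (ext_mat emb gr.P ** ext_mat emb gr.Pi) = M' ** (ext_mat emb gr.P ** ext_mat emb gr.Pi)"
    by (simp only: matrix_mul_assoc)
  thus ?thesis unfolding ext_P[OF e] by simp
qed

lemma dmat_eval:
  assumes "\<And>a. rat_regular_at (d a) x"
  shows "mat_regular_at (dmat rat_const d) x" "mat_eval (dmat rat_const d) x = dmat (\<lambda>c. c) (\<lambda>a. rat_eval (d a) x)"
proof -
  have r: "mat_regular_at (\<chi> a a'. if a = a' then d a else 0) x"
    using assms by (simp add: mat_regular_at_def)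
  have m: "mat_eval (\<chi> a a'. if a = a' then d a else 0) x = (\<chi> a a'. if a = a' then rat_eval (d a) x else 0)"
    by (simp add: mat_eval_def vec_eq_iff)
  show "mat_regular_at (dmat rat_const d) x" "mat_eval (dmat rat_const d) x = dmat (\<lambda>c. c) (\<lambda>a. rat_eval (d a) x)"
    unfolding dmat_def by (simp_all add: mat_reg_mult r m)
qed

lemma co_br: "gr.co (br x y) c = (\<Sum>a\<in>UNIV. \<Sum>a'\<in>UNIV. gr.co x a * gr.co y a' * gr.co (br (b a) (b a')) c)"
proof -
  have "br x y = (\<Sum>a\<in>UNIV. \<Sum>a'\<in>UNIV. (gr.co x a * gr.co y a') *s br (b a) (b a'))"
    by (subst (1) gr.co_expand[of x], subst (1) gr.co_expand[of y])
      (simp add: br_sum br_simps vec.scale_sum_right mult.commute vec.scale_scale, rule sum.swap)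
  thus ?thesis by (simp only: gr.co_sum gr.co_simps)
qed

lemma dmat_endo:
  assumes "\<And>a a' c. gr.co (br (b a) (b a')) c \<noteq> 0 \<Longrightarrow> d c = d a * d a'"
  shows "endo (dmat (\<lambda>c. c) d)"
  unfolding endo_def
proof (intro allI gr.co_eqI)
  fix x y c
  have eq: "d a * gr.co x a * (d a' * gr.co y a') * gr.co (br (b a) (b a')) c
      = d c * (gr.co x a * gr.co y a' * gr.co (br (b a) (b a')) c)" for a a'
  proof (cases "gr.co (br (b a) (b a')) c = 0")
    case False
    show ?thesis unfolding assms[OF False] by simp
  qed simp
  show "gr.co (dmat (\<lambda>c. c) d *v br x y) c = gr.co (br (dmat (\<lambda>c. c) d *v x) (dmat (\<lambda>c. c) d *v y)) c"
    unfolding co_br[of "_ *v _"] co_dmat co_br[of x y] by (simp only: sum_distrib_left eq)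
qed

text \<open>The eigenvalue of \<open>br l\<close> on \<open>b a\<close>. Integrality of l makes each
  \<open>al i l\<close> an integer inside the complex numbers; the floor of its real part recovers
  the integer.\<close>

definition cw :: "complex^'n \<Rightarrow> 'n \<Rightarrow> int" where
  "cw l a = (\<Sum>i\<in>UNIV. kw a i * \<lfloor>Re (al i l)\<rfloor>)"

context
  fixes l assumes l: "integral_coweight \<gg> l"
begin

lemma integral_hh: "l \<in> hh" using l by (simp add: integral_coweight_def)

lemma co_br_l: "gr.co (br l x) a = of_int (cw l a) * gr.co x a"
proof -
  have "al i l = of_int \<lfloor>Re (al i l)\<rfloor>" for i
  proof -
    obtain k where "al i l = of_int k" using l unfolding integral_coweight_def by (blast elim: Ints_cases)
    thus ?thesis by simp
  qed
  hence "of_int (cw l a) = (\<Sum>i\<in>UNIV. of_int (kw a i) * al i l)" for a by (simp add: cw_def)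
  hence w: "br l (b a) = of_int (cw l a) *s b a" for a using b_weight[OF integral_hh] by simp
  have "br l x = (\<Sum>a\<in>UNIV. (gr.co x a * of_int (cw l a)) *s b a)"
    by (subst gr.co_expand[of x]) (simp add: br_sum br_simps w)
  thus ?thesis by (simp add: gr.co_sum gr.co_simps gr.co_b if_distrib[where f = "\<lambda>z. _ * z"] cong: if_cong)
qed

lemma cw_eigen: "br l x = of_int k *s x \<Longrightarrow> gr.co x a \<noteq> 0 \<Longrightarrow> cw l a = k"
  using co_br_l[of x a] by (simp add: gr.co_simps)

lemma br_l_b: "br l (b a) = of_int (cw l a) *s b a"
  by (rule gr.co_eqI) (simp add: co_br_l gr.co_simps gr.co_b)

lemma cw_add:
  assumes "gr.co (br (b a) (b a')) c \<noteq> 0"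
  shows "cw l c = cw l a + cw l a'"
proof (rule cw_eigen[OF _ assms])
  show "br l (br (b a) (b a')) = of_int (cw l a + cw l a') *s br (b a) (b a')"
    unfolding jacobi[of l] br_l_b by (simp add: br_simps vec.scale_left_distrib)
qed

text \<open>The description fixes the matrix on the basis \<open>b\<close>: a basis vector of
  nonzero weight is a root vector, and one whose weight vanishes commutes with \<open>rho\<close>,
  hence lies in the Cartan subalgebra by \<open>degree_0_cartan\<close>.\<close>

lemma torus_eq:
  assumes e: "field_emb emb"
  shows "torus \<gg> emb f l = dmat emb (\<lambda>a. f powi cw l a)"
  unfolding torus_def
proof (rule the_equality)
  have D: "dmat emb (\<lambda>a. f powi cw l a) *v ext_vec emb x = (f powi k) *s ext_vec emb x"
    if "br l x = of_int k *s x" for x k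
    by (rule dmat_eigen[OF e]) (simp add: cw_eigen[OF that])
  have D0: "dmat emb (\<lambda>a. f powi cw l a) *v ext_vec emb x = ext_vec emb x" if "x \<in> hh" for x
    using D[of x 0] cartan_abelian[OF integral_hh that] by simp
  show "(\<forall>x\<in>cartan \<gg>. dmat emb (\<lambda>a. f powi cw l a) *v ext_vec emb x = ext_vec emb x) \<and>
     (\<forall>\<alpha>. is_root \<gg> \<alpha> \<longrightarrow> (\<forall>x\<in>root_space \<gg> \<alpha>. \<forall>k::int. \<alpha> l = of_int k \<longrightarrow>
        dmat emb (\<lambda>a. f powi cw l a) *v ext_vec emb x = (f powi k) *s ext_vec emb x))"
    using D0 integral_hh by (auto simp: root_space_def intro!: D)
next
  fix Z assume Z: "(\<forall>x\<in>cartan \<gg>. Z *v ext_vec emb x = ext_vec emb x) \<and>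
     (\<forall>\<alpha>. is_root \<gg> \<alpha> \<longrightarrow> (\<forall>x\<in>root_space \<gg> \<alpha>. \<forall>k::int. \<alpha> l = of_int k \<longrightarrow>
        Z *v ext_vec emb x = (f powi k) *s ext_vec emb x))"
  show "Z = dmat emb (\<lambda>a. f powi cw l a)"
  proof (rule ext_basis_eq[OF e])
    fix a
    define \<alpha> where "\<alpha> = (\<lambda>h. \<Sum>i\<in>UNIV. of_int (kw a i) * al i h)"
    have Db: "dmat emb (\<lambda>a. f powi cw l a) *v ext_vec emb (b a) = (f powi cw l a) *s ext_vec emb (b a)"
      by (rule dmat_eigen[OF e]) (simp add: gr.co_b split: if_splits)
    have ba: "b a \<in> root_space \<gg> \<alpha>" by (simp add: root_space_def \<alpha>_def b_weight)
    have al: "\<alpha> l = of_int (cw l a)"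
    proof -
      have "\<alpha> l *s b a = of_int (cw l a) *s b a" using ba integral_hh br_l_b[of a] by (simp add: root_space_def)
      thus ?thesis using b_nonzero[of a] by simp
    qed
    show "Z *v ext_vec emb (b a) = dmat emb (\<lambda>a. f powi cw l a) *v ext_vec emb (b a)"
    proof (cases "\<exists>h\<in>hh. \<alpha> h \<noteq> 0")
      case True
      have "is_root \<gg> \<alpha>" unfolding is_root_def using True ba b_nonzero[of a] by blast
      thus ?thesis using Z ba al Db by simp
    next
      case False
      hence "br rho (b a) = 0" using ba rho_hh by (simp add: root_space_def)
      hence h: "b a \<in> hh" by (rule degree_0_cartan)
      have "cw l a = 0" using al False integral_hh by simp
      thus ?thesis using Z h Db by simp
    qed
  qed
qed

abbreviation "tor c \<equiv> dmat (\<lambda>c. c) (\<lambda>a. c powi cw l a)"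
abbreviation "Tor \<equiv> dmat rat_const (\<lambda>a. rat_t powi cw l a)"

lemma tor_endo: "c \<noteq> 0 \<Longrightarrow> endo (tor c)"
  by (rule dmat_endo) (simp add: cw_add power_int_add)

lemma tor_cartan: "x \<in> hh \<Longrightarrow> tor c *v x = x"
  using dmat_eigen[OF field_emb(1), of x "\<lambda>a. c powi cw l a" 1] cw_eigen[of x 0] cartan_abelian[OF integral_hh] by simp

lemma tor_inverse: "c \<noteq> 0 \<Longrightarrow> tor c ** tor (inverse c) = mat 1" "c \<noteq> 0 \<Longrightarrow> tor (inverse c) ** tor c = mat 1"
  by (simp_all add: dmat_mult[OF field_emb(1)] dmat_1[OF field_emb(1)] power_int_inverse)

lemma tor_invertible: "c \<noteq> 0 \<Longrightarrow> invertible (tor c)"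
  by (rule matrix_inv_unique(1)) (rule tor_inverse)

lemma Tor_eval: "x \<noteq> 0 \<Longrightarrow> mat_regular_at Tor x" "x \<noteq> 0 \<Longrightarrow> mat_eval Tor x = tor x"
  using dmat_eval[of "\<lambda>a. rat_t powi cw l a" x] by (simp_all add: rat_t_powi_eval)

lemma Tor_aut: "Tor \<in> aut"
proof -
  have "\<forall>\<^sub>F x::complex in cofinite. x \<noteq> 0" by (simp add: eventually_cofinite)
  thus ?thesis unfolding aut_def rat_points_iff by eventually_elim (simp add: Tor_eval tor_endo tor_invertible)
qed

text \<open>The derivative of t^k is (k / t) t^k, and the exponents k are the eigenvalues of ad
  l.\<close>

lemma Tor_has_ld: "has_ld Tor ((1 / rat_t) *s const_vec l)"
proof -
  let ?D = "\<lambda>d. (\<chi> a a'. if a = a' then d a else 0) :: ratfun^'n^'n"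
  let ?e = "\<lambda>a. 1 / rat_t * rat_const (of_int (cw l a))"
  have i: "invertible Tor" using aut_inv(1)[OF Tor_aut] .
  have "mat_deriv (?D (\<lambda>a. rat_t powi cw l a)) = ?D (\<lambda>a. ?e a * rat_t powi cw l a)"
    by (simp add: mat_deriv_def vec_eq_iff rat_deriv_t_powi mult.commute)
  hence "mat_deriv Tor = dmat rat_const (\<lambda>a. ?e a * rat_t powi cw l a)"
    unfolding dmat_def by (simp only: mat_deriv_mult mat_deriv_const matrix_mult_simps(5,6) add_0_left add_0_right)
  also have "\<dots> = dmat rat_const ?e ** Tor" by (simp only: dmat_mult[OF field_emb(2)])
  finally have "mat_deriv Tor ** matrix_inv Tor = dmat rat_const ?e ** (Tor ** matrix_inv Tor)"
    by (simp only: matrix_mul_assoc)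
  hence "mat_deriv Tor ** matrix_inv Tor = dmat rat_const ?e" by (simp add: matrix_inv[OF i])
  also have "\<dots> = rat_ad \<gg> ((1 / rat_t) *s const_vec l)"
  proof (rule mat_eqI)
    have "\<forall>\<^sub>F x::complex in cofinite. x \<noteq> 0" by (simp add: eventually_cofinite)
    thus "\<forall>\<^sub>F x in cofinite. mat_eval (dmat rat_const ?e) x = mat_eval (rat_ad \<gg> ((1 / rat_t) *s const_vec l)) x"
    proof eventually_elim
      case (elim x)
      have t: "rat_regular_at (1 / rat_t) x" "rat_eval (1 / rat_t) x = 1 / x"
        using rat_regular_inverse[of rat_t x] elim by (simp_all add: divide_inverse)
      have v: "vec_regular_at ((1 / rat_t) *s const_vec l) x" "vec_eval ((1 / rat_t) *s const_vec l) x = (1 / x) *s l"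
        unfolding vec_regular_at_def vec_eval_def vector_smult_component ext_vec_def vec_lambda_beta
        using rat_regular_mult[OF t(1) rat_const(1)] t(2) by (simp_all add: vec_eq_iff)
      have "mat_eval (dmat rat_const ?e) x = dmat (\<lambda>c. c) (\<lambda>a. 1 / x * of_int (cw l a))"
        using dmat_eval(2)[of ?e x] rat_regular_mult[OF t(1) rat_const(1)] t(2) by simp
      also have "\<dots> = AD ((1 / x) *s l)"
      proof (rule gr.mat_eq_basis)
        fix a
        show "dmat (\<lambda>c. c) (\<lambda>a. 1 / x * of_int (cw l a)) *v b a = AD ((1 / x) *s l) *v b a"
          by (rule gr.co_eqI) (simp add: co_dmat AD br_simps gr.co_simps co_br_l)
      qed
      finally show ?case by (simp add: rat_ad_eval v)
    qed
  qed
  finally show ?thesis using i by (simp add: has_ld_def)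
qed

lemma Tor_rescale: "c \<noteq> 0 \<Longrightarrow> mat_rescale c Tor = const_mat (tor c) ** Tor"
proof -
  assume c: "c \<noteq> 0"
  let ?D = "\<lambda>d. (\<chi> a a'. if a = a' then d a else 0) :: ratfun^'n^'n"
  have "mat_rescale c (?D (\<lambda>a. rat_t powi cw l a)) = ?D (\<lambda>a. rat_const (c powi cw l a) * rat_t powi cw l a)"
    using c by (simp add: mat_rescale_def vec_eq_iff rat_rescale_t_powi)
  hence "mat_rescale c Tor = dmat rat_const (\<lambda>a. rat_const (c powi cw l a) * rat_t powi cw l a)"
    unfolding dmat_def using c by (simp add: mat_rescale_mult)
  also have "\<dots> = dmat rat_const (\<lambda>a. rat_const (c powi cw l a)) ** Tor" by (simp only: dmat_mult[OF field_emb(2)])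
  also have "dmat rat_const (\<lambda>a. rat_const (c powi cw l a)) = const_mat (tor c)"
  proof -
    have "const_mat (\<chi> a a'. if a = a' then c powi cw l a else 0) = ?D (\<lambda>a. rat_const (c powi cw l a))"
      by (simp add: ext_mat_def vec_eq_iff)
    thus ?thesis by (simp only: dmat_def const_mat_hom(1) ext_id)
  qed
  finally show ?thesis .
qed

text \<open>An automorphism fixing l preserves the eigenspaces of ad l, on which the torus element
  is scalar.\<close>

lemma torus_commute_aut:
  assumes e: "field_emb emb" and U: "endo U" "U *v l = l"
  shows "ext_mat emb U ** dmat emb (\<lambda>a. f powi cw l a) = dmat emb (\<lambda>a. f powi cw l a) ** ext_mat emb U"
proof (rule ext_basis_eq[OF e])
  fix a
  have "U *v br l (b a) = br l (U *v b a)" using U by (simp add: endo_def)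
  hence w: "br l (U *v b a) = of_int (cw l a) *s (U *v b a)" by (simp add: br_l_b matrix_vector_simps)
  have 1: "dmat emb (\<lambda>a. f powi cw l a) *v ext_vec emb (U *v b a) = (f powi cw l a) *s ext_vec emb (U *v b a)"
    by (rule dmat_eigen[OF e]) (simp add: cw_eigen[OF w])
  have 2: "dmat emb (\<lambda>a. f powi cw l a) *v ext_vec emb (b a) = (f powi cw l a) *s ext_vec emb (b a)"
    by (rule dmat_eigen[OF e]) (simp add: gr.co_b split: if_splits)
  show "(ext_mat emb U ** dmat emb (\<lambda>a. f powi cw l a)) *v ext_vec emb (b a) = (dmat emb (\<lambda>a. f powi cw l a) ** ext_mat emb U) *v ext_vec emb (b a)"
    by (simp only: matrix_vector_mul_assoc[symmetric] 1 2 ext_hom(2)[OF e] matrix_vector_simps(7))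
qed

end

lemma integral_uminus:
  assumes "integral_coweight \<gg> l"
  shows "integral_coweight \<gg> (- l)" "cw (- l) a = - cw l a"
proof -
  note h = integral_hh[OF assms]
  show m: "integral_coweight \<gg> (- l)"
    using assms h al_lin(4)[OF h h] vec.subspace_neg[OF hh_sub h] by (simp add: integral_coweight_def)
  show "cw (- l) a = - cw l a"
  proof (rule cw_eigen[OF m])
    show "br (- l) (b a) = of_int (- cw l a) *s b a" by (simp add: br_simps br_l_b[OF assms])
    show "gr.co (b a) a \<noteq> 0" by (simp add: gr.co_b)
  qed
qed

lemma integral_rho: "integral_coweight \<gg> rho"
  using rho_hh al_rho by (simp add: integral_coweight_def)

end


section \<open>Graded automorphisms and twisted actions\<close>

lemma mat_eval_0 [simp]: "mat_eval 0 x = 0"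
  by (simp add: mat_eval_def vec_eq_iff)

lemma eventually_nonzero: "\<forall>\<^sub>F x::complex in cofinite. x \<noteq> 0"
  by (simp add: eventually_cofinite)

lemma vec_rescale_diff: "c \<noteq> 0 \<Longrightarrow> vec_rescale c (u - v) = vec_rescale c u - vec_rescale c v"
  using vec_rescale_add[of c "u - v" v] by simp

lemma eventually_invertible:
  fixes Z :: "ratfun^'n^'n"
  assumes "invertible Z"
  shows "\<forall>\<^sub>F x in cofinite. invertible (mat_eval Z x)"
  using eventually_mat_regular[of Z] eventually_mat_regular[of "matrix_inv Z"]
proof eventually_elim
  case (elim x)
  have "mat_eval Z x ** mat_eval (matrix_inv Z) x = mat_eval (Z ** matrix_inv Z) x"
    by (rule mat_reg_mult(2)[OF elim, symmetric])
  also have "\<dots> = mat_eval (const_mat (mat 1)) x" by (simp only: matrix_inv[OF assms] const_mat_hom)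
  also have "\<dots> = mat 1" by (rule mat_reg_const)
  finally show ?case by (rule matrix_inv_unique(1))
qed

lemma rat_points_conj:
  assumes "Z \<in> rat_points K" "\<And>g. g \<in> K \<Longrightarrow> U ** g ** W \<in> K'"
  shows "const_mat U ** Z ** const_mat W \<in> rat_points K'"
  using assms(1) eventually_mat_regular[of Z] unfolding rat_points_iff
  by eventually_elim (simp add: mat_reg_mult assms(2))

text \<open>The twisted action with separate automorphisms on the left and on the right. The torus
  element of the regularisation is not fixed by either twisted action alone but intertwines two of
  them.\<close>

definition hat :: "complex \<Rightarrow> complex^'n^'n \<Rightarrow> complex^'n^'n \<Rightarrow> ratfun^'n^'n \<Rightarrow> ratfun^'n^'n" where
  "hat c U1 U2 Z = const_mat U1 ** mat_rescale c Z ** const_mat (matrix_inv U2)"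

definition fhat :: "complex \<Rightarrow> complex^'n^'n \<Rightarrow> ratfun^'n \<Rightarrow> ratfun^'n" where
  "fhat c U X = rat_const c *s (const_mat U *v vec_rescale c X)"

lemma group_hat_eq: "group_hat \<omega> U = hat (inverse \<omega>) U U"
  by (simp add: fun_eq_iff group_hat_def hat_def)

lemma form_hat_eq: "form_hat \<omega> U = fhat (inverse \<omega>) U"
  by (simp only: fun_eq_iff form_hat_def fhat_def simp_thms)

lemma const_inv_mult: "invertible U \<Longrightarrow> const_mat (matrix_inv U) ** const_mat U = mat 1"
  "invertible U \<Longrightarrow> const_mat U ** const_mat (matrix_inv U) = mat 1"
  by (simp_all only: const_mat_hom(1)[symmetric] matrix_inv const_mat_hom(7))

lemma hat_mult:
  assumes "c \<noteq> 0" "invertible U2"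
  shows "hat c U1 U2 Z ** hat c U2 U3 W = hat c U1 U3 (Z ** W)"
proof -
  have "hat c U1 U2 Z ** hat c U2 U3 W
      = const_mat U1 ** mat_rescale c Z ** (const_mat (matrix_inv U2) ** const_mat U2) ** mat_rescale c W ** const_mat (matrix_inv U3)"
    by (simp only: hat_def matrix_mul_assoc)
  thus ?thesis
    unfolding const_inv_mult(1)[OF assms(2)] by (simp only: matrix_mul_rid mat_rescale_mult[OF assms(1)] hat_def matrix_mul_assoc)
qed

lemma hat_const: "c \<noteq> 0 \<Longrightarrow> hat c U1 U2 (const_mat g) = const_mat (U1 ** g ** matrix_inv U2)"
  by (simp add: hat_def const_mat_hom(1))

lemma hat_inv:
  assumes "c \<noteq> 0" "invertible U1" "invertible U2" "invertible Z"
  shows "matrix_inv (hat c U1 U2 Z) = hat c U2 U1 (matrix_inv Z)"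
proof (rule matrix_inv_unique(2))
  have "hat c U1 U2 Z ** hat c U2 U1 (matrix_inv Z) = hat c U1 U1 (const_mat (mat 1))"
    by (simp only: hat_mult[OF assms(1,3)] matrix_inv[OF assms(4)] const_mat_hom(7))
  also have "\<dots> = mat 1"
    unfolding hat_const[OF assms(1)] by (simp only: matrix_mul_rid matrix_inv[OF assms(2)] const_mat_hom(7))
  finally show "hat c U1 U2 Z ** hat c U2 U1 (matrix_inv Z) = mat 1" .
qed

lemma hat_eval:
  assumes "c \<noteq> 0" "mat_regular_at Z 0"
  shows "mat_regular_at (hat c U1 U2 Z) 0" "mat_eval (hat c U1 U2 Z) 0 = U1 ** mat_eval Z 0 ** matrix_inv U2"
proof -
  have "mat_regular_at (mat_rescale c Z) 0" "mat_eval (mat_rescale c Z) 0 = mat_eval Z 0"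
    using mat_rescale_eval[of c Z 0] assms by simp_all
  thus "mat_regular_at (hat c U1 U2 Z) 0" "mat_eval (hat c U1 U2 Z) 0 = U1 ** mat_eval Z 0 ** matrix_inv U2"
    by (simp_all add: hat_def mat_reg_mult)
qed

lemma fhat_mult:
  assumes "c \<noteq> 0" "invertible U2"
  shows "fhat c U1 (Z *v X) = hat c U1 U2 Z *v fhat c U2 X"
proof -
  have 1: "const_mat (matrix_inv U2) *v (const_mat U2 *v y) = y" for y
    by (simp only: matrix_vector_mul_assoc const_inv_mult(1)[OF assms(2)] matrix_vector_mul_lid)
  show ?thesis
    by (simp only: hat_def fhat_def mat_rescale_vec[OF assms(1)] matrix_vector_simps(7) 1 flip: matrix_vector_mul_assoc)
qed

lemma fhat_lin: "c \<noteq> 0 \<Longrightarrow> fhat c U (X - Y) = fhat c U X - fhat c U Y" "c \<noteq> 0 \<Longrightarrow> fhat c U (X + Y) = fhat c U X + fhat c U Y"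
  by (simp_all add: fhat_def vec_rescale_diff vec_rescale_add matrix_vector_simps vec_eq_iff algebra_simps)

context ss_basis
begin

text \<open>Fixing \<open>rho\<close> makes an automorphism preserve degrees, so it normalises N and
  the lower triangular matrices. \<open>V\<close>, constant torus elements and their products are of
  this kind.\<close>

definition gaut :: "complex^'n^'n \<Rightarrow> bool" where
  "gaut U \<longleftrightarrow> endo U \<and> invertible U \<and> U *v rho = rho"

lemma gaut_mult: "gaut U \<Longrightarrow> gaut W \<Longrightarrow> gaut (U ** W)"
  by (simp add: gaut_def endo_mult matrix_inv_mult flip: matrix_vector_mul_assoc)

lemma gaut_inv:
  assumes "gaut U"
  shows "gaut (matrix_inv U)"
proof -
  have i: "invertible U" using assms by (simp add: gaut_def)
  have "matrix_inv U *v (U *v rho) = rho" by (simp add: matrix_vector_mul_assoc matrix_inv[OF i])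
  thus ?thesis using assms by (simp add: gaut_def endo_inv invertible_matrix_inv)
qed

lemma gaut_sh:
  assumes "gaut U"
  shows "gr.sh {0} U"
proof (rule gr.shI)
  fix a a' assume n: "dg a - dg a' \<notin> {0}"
  have "U *v br x y = br (U *v x) (U *v y)" "U *v rho = rho" for x y using assms by (simp_all add: gaut_def endo_def)
  hence "br rho (U *v b a') = U *v br rho (b a')" by (simp only:)
  also have "\<dots> = of_int (dg a') *s (U *v b a')" by (simp add: gr.rho_b matrix_vector_simps)
  finally have "gr.co (br rho (U *v b a')) a = gr.co (of_int (dg a') *s (U *v b a')) a" by simp
  thus "gr.cj U $ a $ a' = 0" using n by (simp add: gr.cj_co gr.co_rho gr.co_simps)
qed

lemma gaut_aut: "gaut U \<Longrightarrow> const_mat U \<in> aut"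
  by (simp add: gaut_def aut_const)

lemma gaut_conj_N:
  assumes "g \<in> grp_N \<gg>" "gaut U"
  shows "U ** g ** matrix_inv U \<in> grp_N \<gg>"
proof -
  have g: "endo g" "gr.sh {1..} (g - mat 1)" using assms(1) by (simp_all add: grp_N_iff)
  have i: "invertible U" using assms(2) by (simp add: gaut_def)
  have "U ** (g - mat 1) ** matrix_inv U = U ** g ** matrix_inv U - mat 1"
    by (simp add: matrix_mult_simps matrix_inv[OF i])
  moreover have "gr.sh {1..} (U ** (g - mat 1) ** matrix_inv U)"
    by (rule gr.sh_mult[OF gr.sh_mult[OF gaut_sh[OF assms(2)] g(2), of "{1..}"] gaut_sh[OF gaut_inv[OF assms(2)]]]) simp_all
  moreover have "endo (U ** g ** matrix_inv U)"
    using assms(2) gaut_inv[OF assms(2)] g(1) by (simp add: gaut_def endo_mult)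
  ultimately show ?thesis by (simp add: grp_N_iff)
qed

lemma gaut_torus:
  assumes "integral_coweight \<gg> l" "c \<noteq> 0"
  shows "gaut (const_torus \<gg> c l)"
  unfolding gaut_def torus_eq[OF assms(1) field_emb(1)]
  using tor_endo[OF assms] tor_invertible[OF assms] tor_cartan[OF assms(1) rho_hh] by blast

lemma torus_inverse:
  assumes e: "field_emb emb" and l: "integral_coweight \<gg> l" and f: "f \<noteq> 0"
  shows "torus \<gg> emb f l ** torus \<gg> emb f (- l) = mat 1" "torus \<gg> emb f (- l) ** torus \<gg> emb f l = mat 1"
proof -
  show "torus \<gg> emb f l ** torus \<gg> emb f (- l) = mat 1"
    unfolding torus_eq[OF l e] torus_eq[OF integral_uminus(1)[OF l] e] dmat_mult[OF e]
    using f by (simp add: integral_uminus(2)[OF l] power_int_minus dmat_1[OF e])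
  thus "torus \<gg> emb f (- l) ** torus \<gg> emb f l = mat 1" by (rule matrix_inv_unique(3))
qed

lemma torus_conj_N:
  assumes l: "integral_coweight \<gg> l" and Z: "Z \<in> rat_points (grp_N \<gg>)"
  shows "t_torus \<gg> l ** Z ** t_torus \<gg> (- l) \<in> rat_points (grp_N \<gg>)"
  unfolding rat_points_iff
  using Z[unfolded rat_points_iff] eventually_mat_regular[of Z] eventually_nonzero
proof eventually_elim
  case (elim x)
  note l' = integral_uminus(1)[OF l]
  note r = Tor_eval[OF l elim(3)] Tor_eval[OF l' elim(3)]
  have "matrix_inv (const_torus \<gg> x l) = const_torus \<gg> x (- l)"
    by (rule matrix_inv_unique(2)[OF torus_inverse(1)[OF field_emb(1) l elim(3)]])
  hence "mat_eval (t_torus \<gg> l ** Z ** t_torus \<gg> (- l)) x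
      = const_torus \<gg> x l ** mat_eval Z x ** matrix_inv (const_torus \<gg> x l)"
    unfolding torus_eq[OF l field_emb(1)] torus_eq[OF l field_emb(2)] torus_eq[OF l' field_emb(1)] torus_eq[OF l' field_emb(2)]
    using r elim(2) by (simp add: mat_reg_mult)
  thus ?case using gaut_conj_N[OF elim(1) gaut_torus[OF l elim(3)]] by simp
qed

lemma hat_aut:
  assumes "c \<noteq> 0" "gaut U1" "gaut U2" "Z \<in> aut"
  shows "hat c U1 U2 Z \<in> aut"
proof -
  have "mat_rescale c Z \<in> aut" using rat_points_rescale[OF assms(1) assms(4)[unfolded aut_def]] unfolding aut_def .
  thus ?thesis unfolding hat_def by (intro aut_mult gaut_aut gaut_inv assms)
qed

lemma hat_N:
  assumes "c \<noteq> 0" "gaut U" "Z \<in> rat_points (grp_N \<gg>)"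
  shows "hat c U U Z \<in> rat_points (grp_N \<gg>)"
  unfolding hat_def by (rule rat_points_conj[OF rat_points_rescale[OF assms(1,3)]]) (rule gaut_conj_N[OF _ assms(2)])

lemma hat_lower:
  assumes "c \<noteq> 0" "gaut U" "Z \<in> rat_points {g. gr.sh {..0} g}"
  shows "hat c U U Z \<in> rat_points {g. gr.sh {..0} g}"
  unfolding hat_def
proof (rule rat_points_conj[OF rat_points_rescale[OF assms(1,3)]])
  fix g assume "g \<in> {g. gr.sh {..0} g}"
  hence g: "gr.sh {..0} g" by simp
  have "gr.sh {..0} (U ** g ** matrix_inv U)"
    by (rule gr.sh_mult[OF gr.sh_mult[OF gaut_sh[OF assms(2)] g, of "{..0}"] gaut_sh[OF gaut_inv[OF assms(2)]]]) simp_all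
  thus "U ** g ** matrix_inv U \<in> {g. gr.sh {..0} g}" by simp
qed

text \<open>The chain rule for t -> c t produces the scalar factor in \<open>fhat\<close>, which is
  at the same time the pullback of dt.\<close>

lemma hat_has_ld:
  assumes c: "c \<noteq> 0" and Z: "has_ld Z X" "Z \<in> aut" and U: "gaut U1" "gaut U2"
  shows "has_ld (hat c U1 U2 Z) (fhat c U1 X)"
proof -
  have i: "invertible Z" using Z(1) by (simp add: has_ld_def)
  have e: "rat_ad \<gg> (vec_rescale c X) = mat_rescale c (rat_ad \<gg> X)"
    using c by (simp add: rat_ad_def mat_rescale_def vec_rescale_def vec_eq_iff rat_rescale_sum rat_rescale_hom)
  have sc: "rat_ad \<gg> (rat_const c *s X') = (\<chi> i j. rat_const c * rat_ad \<gg> X' $ i $ j)" for X'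
    by (simp add: rat_ad_def vec_eq_iff sum_distrib_left mult.assoc)
  have d: "mat_deriv (mat_rescale c Z) ** matrix_inv (mat_rescale c Z)
      = (\<chi> i j. rat_const c * mat_rescale c (mat_deriv Z ** matrix_inv Z) $ i $ j)"
    unfolding mat_deriv_rescale[OF c] mat_rescale_inv(2)[OF c i] mat_rescale_mult[OF c]
    by (simp add: vec_eq_iff matrix_matrix_mult_def sum_distrib_left mult.assoc)
  have 1: "has_ld (mat_rescale c Z) (rat_const c *s vec_rescale c X)"
    using Z(1) mat_rescale_inv(1)[OF c i] unfolding has_ld_def d sc e by simp
  have 2: "mat_rescale c Z \<in> aut" using rat_points_rescale[OF c Z(2)[unfolded aut_def]] unfolding aut_def .
  have u: "invertible U1" "invertible (matrix_inv U2)" using U gaut_inv[OF U(2)] by (simp_all add: gaut_def)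
  have 3: "has_ld (const_mat U1 ** mat_rescale c Z) (0 + const_mat U1 *v (rat_const c *s vec_rescale c X))"
    by (rule has_ld_mult[OF has_ld_const[OF u(1)] 1 gaut_aut[OF U(1)]])
  have "has_ld (const_mat U1 ** mat_rescale c Z ** const_mat (matrix_inv U2))
     (0 + const_mat U1 *v (rat_const c *s vec_rescale c X) + (const_mat U1 ** mat_rescale c Z) *v 0)"
    by (rule has_ld_mult[OF 3 has_ld_const[OF u(2)] aut_mult[OF gaut_aut[OF U(1)] 2]])
  thus ?thesis by (simp only: hat_def fhat_def matrix_vector_simps add_0_left add_0_right)
qed

lemma has_ld_inj: "has_ld Z X \<Longrightarrow> has_ld Z X' \<Longrightarrow> X = X'"
  using log_deriv_eq by blast

section \<open>Projection to the Cartan subalgebra and lower triangular solutions\<close>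

abbreviation "pr0 \<equiv> proj (\<lambda>d. d = 0)"

lemma pr0_iff: "pr0 *v y = y \<longleftrightarrow> y \<in> hh"
proof
  assume e: "pr0 *v y = y"
  have "dg a = 0" if "gr.co y a \<noteq> 0" for a
  proof -
    have "gr.co (pr0 *v y) a \<noteq> 0" unfolding e by (rule that)
    thus ?thesis unfolding co_proj by (simp split: if_splits)
  qed
  thus "y \<in> hh" unfolding nil_gsp(2) gr.gsp_def by simp
next
  assume y: "y \<in> hh"
  show "pr0 *v y = y"
  proof (rule gr.co_eqI)
    fix a
    have "gr.co y a \<noteq> 0 \<Longrightarrow> dg a = 0" using y unfolding nil_gsp(2) gr.gsp_def by blast
    thus "gr.co (pr0 *v y) a = gr.co y a" unfolding co_proj by force
  qed
qed

lemma pr0_hh: "pr0 *v y \<in> hh"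
  unfolding nil_gsp(2) gr.gsp_def by (simp add: co_proj)

text \<open>Both sides say that u is fixed by the constant projection \<open>pr0\<close> onto degree
  0.\<close>

lemma rat_forms_cartan: "u \<in> rat_forms hh \<longleftrightarrow> (\<forall>\<^sub>F x in cofinite. vec_eval u x \<in> hh)"
proof -
  have a: "const_mat pr0 *v u = u \<longleftrightarrow> (\<forall>\<^sub>F x in cofinite. vec_eval u x \<in> hh)"
  proof
    assume e: "const_mat pr0 *v u = u"
    show "\<forall>\<^sub>F x in cofinite. vec_eval u x \<in> hh"
      using eventually_vec_regular[of u]
    proof eventually_elim
      case (elim x)
      have "vec_eval (const_mat pr0 *v u) x = pr0 *v vec_eval u x" using elim by (simp add: mat_reg_vec)
      thus ?case unfolding e pr0_iff[symmetric] by simp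
    qed
  next
    assume h: "\<forall>\<^sub>F x in cofinite. vec_eval u x \<in> hh"
    show "const_mat pr0 *v u = u"
    proof (rule vec_eqI)
      show "\<forall>\<^sub>F x in cofinite. vec_eval (const_mat pr0 *v u) x = vec_eval u x"
        using eventually_vec_regular[of u] h by eventually_elim (simp add: mat_reg_vec pr0_iff)
    qed
  qed
  have b: "const_mat pr0 *v v = v" if "v \<in> vec.span (const_vec ` hh)" for v
    using that
  proof (induction rule: vec.span_induct_alt)
    case base show ?case by (simp add: matrix_vector_simps)
  next
    case (step c x y)
    then obtain h where h: "x = const_vec h" "h \<in> hh" by blast
    have "pr0 *v h = h" unfolding pr0_iff by (rule h(2))
    hence "const_mat pr0 *v x = x" unfolding h(1) const_mat_hom(2) by simp
    thus ?case using step by (simp add: matrix_vector_simps)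
  qed
  have "u \<in> rat_forms hh" if e: "const_mat pr0 *v u = u"
  proof -
    have "axis j 1 = const_vec (axis j 1)" for j :: 'n by (simp add: ext_vec_def axis_def vec_eq_iff)
    hence ax: "const_mat pr0 *v axis j 1 = const_vec (pr0 *v axis j 1)" for j by (simp only: const_mat_hom(2))
    have "const_mat pr0 *v (\<Sum>j\<in>UNIV. u $ j *s axis j 1) = (\<Sum>j\<in>UNIV. u $ j *s const_vec (pr0 *v axis j 1))"
      by (simp add: vec.linear_sum[OF matrix_vector_mul_linear_gen] matrix_vector_simps ax)
    hence "u = (\<Sum>j\<in>UNIV. u $ j *s const_vec (pr0 *v axis j 1))" by (simp only: basis_expansion e)
    moreover have "(\<Sum>j\<in>UNIV. u $ j *s const_vec (pr0 *v axis j 1)) \<in> rat_forms hh"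
      unfolding rat_forms_def by (intro vec.span_sum vec.span_scale vec.span_base imageI pr0_hh)
    ultimately show ?thesis by simp
  qed
  with a b show ?thesis unfolding rat_forms_def by blast
qed

text \<open>The logarithmic derivative C of a lower triangular L is lower triangular. The Cartan
  block of L has derivative governed by the degree 0 part of C, which lies in the abelian Cartan
  subalgebra and acts on it by zero. So this block is constant, equal to its value 1 at the origin,
  and \<open>grp_B_minusI\<close> applies.\<close>

lemma lower_normalized:
  assumes L: "L \<in> aut" "L \<in> rat_points {g. gr.sh {..0} g}" "has_ld L C" "mat_regular_at L 0" "mat_eval L 0 = mat 1"
  shows "L \<in> rat_points (grp_B_minus \<gg>)" "\<forall>\<^sub>F x in cofinite. vec_eval C x \<in> gr.gsp {..0}"
proof -
  have i: "invertible L" and ld: "mat_deriv L ** matrix_inv L = rat_ad \<gg> C" using L(3) by (simp_all add: has_ld_def)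
  show C: "\<forall>\<^sub>F x in cofinite. vec_eval C x \<in> gr.gsp {..0}"
    using eventually_mat_regular[of L] eventually_invertible[OF i] L(2)[unfolded rat_points_iff]
      mat_deriv_sh[OF L(2), unfolded rat_points_iff] eventually_mat_regular[of "mat_deriv L"] eventually_vec_regular[of C]
  proof eventually_elim
    case (elim x)
    have s: "gr.sh {..0} (mat_eval L x)" "gr.sh {..0} (mat_eval (mat_deriv L) x)" using elim(3,4) by simp_all
    have "AD (vec_eval C x) = mat_eval (mat_deriv L ** matrix_inv L) x"
      unfolding ld using rat_ad_eval(2)[OF elim(6)] by simp
    also have "\<dots> = mat_eval (mat_deriv L) x ** matrix_inv (mat_eval L x)"
      using mat_reg_inv[OF elim(1,2)] elim(5) by (simp add: mat_reg_mult)
    finally have "gr.sh {..0} (AD (vec_eval C x))"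
      using gr.sh_mult[OF s(2) lower_inv[OF s(1) elim(2)], of "{..0}"] by simp
    hence "vec_eval C x \<in> gr.gsp (insert 0 {..0})" by (rule sh_AD_conv)
    thus ?case by (simp add: insert_absorb)
  qed
  have dL: "mat_deriv L = rat_ad \<gg> C ** L"
    unfolding ld[symmetric] by (simp add: matrix_inv[OF i] flip: matrix_mul_assoc)
  have "mat_deriv (const_mat pr0 ** L ** const_mat pr0) = const_mat pr0 ** (rat_ad \<gg> C ** L) ** const_mat pr0"
    by (simp add: mat_deriv_mult matrix_mult_simps dL)
  also have "\<dots> = 0"
  proof (rule mat_eqI)
    show "\<forall>\<^sub>F x in cofinite. mat_eval (const_mat pr0 ** (rat_ad \<gg> C ** L) ** const_mat pr0) x = mat_eval 0 x"
      using eventually_mat_regular[of L] L(2)[unfolded rat_points_iff] C eventually_vec_regular[of C]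
    proof eventually_elim
      case (elim x)
      let ?c = "vec_eval C x" and ?l = "mat_eval L x"
      have "mat_eval (const_mat pr0 ** (rat_ad \<gg> C ** L) ** const_mat pr0) x = pr0 ** (AD ?c ** ?l) ** pr0"
        using elim(1,4) by (simp add: mat_reg_mult rat_ad_eval)
      also have "\<dots> = 0"
      proof (rule gr.mat_eq_basis)
        fix a
        define y where "y = ?l *v (pr0 *v b a)"
        have s: "gr.sh {..0} ?l" using elim(2) by simp
        have y: "y \<in> gr.gsp {..0}" unfolding y_def
          by (rule gr.sh_vec[OF s pr0_hh[unfolded nil_gsp(2)]]) simp
        \<comment> \<open>Both arguments have degrees at most 0, so degree 0 of the bracket comes
          only from their Cartan components, which commute.\<close>
        have "gr.co (br ?c y) e = 0" if "dg e = 0" for e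
          unfolding co_br[of ?c y]
        proof (intro sum.neutral ballI)
          fix a1 a2
          show "gr.co ?c a1 * gr.co y a2 * gr.co (br (b a1) (b a2)) e = 0"
          proof (rule ccontr)
            assume "gr.co ?c a1 * gr.co y a2 * gr.co (br (b a1) (b a2)) e \<noteq> 0"
            hence nz: "gr.co ?c a1 \<noteq> 0" "gr.co y a2 \<noteq> 0" "gr.co (br (b a1) (b a2)) e \<noteq> 0" by auto
            have "dg a1 \<in> {..0}" "dg a2 \<in> {..0}" using nz(1,2) elim(3) y unfolding gr.gsp_def by blast+
            moreover have "dg e = dg a1 + dg a2" by (rule gr.co_br_b[OF nz(3)])
            ultimately have "dg a1 = 0" "dg a2 = 0" using that by simp_all
            hence "b a1 \<in> hh" "b a2 \<in> hh" by (auto simp: nil_gsp(2) gr.gsp_def gr.co_b split: if_splits)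
            hence "br (b a1) (b a2) = 0" by (rule cartan_abelian)
            thus False using nz(3) by (simp add: gr.co_simps)
          qed
        qed
        hence "pr0 *v br ?c y = 0" by (intro gr.co_eqI) (simp add: co_proj gr.co_simps)
        hence "(pr0 ** (AD ?c ** ?l) ** pr0) *v b a = 0" by (simp add: AD y_def flip: matrix_vector_mul_assoc)
        thus "(pr0 ** (AD ?c ** ?l) ** pr0) *v b a = 0 *v b a" by simp
      qed
      finally show ?case by simp
    qed
  qed
  finally have d0: "mat_deriv (const_mat pr0 ** L ** const_mat pr0) = 0" .
  have r: "mat_regular_at (const_mat pr0 ** L ** const_mat pr0) 0"
    "mat_eval (const_mat pr0 ** L ** const_mat pr0) 0 = pr0 ** pr0"
    using L(4,5) by (simp_all add: mat_reg_mult)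
  have M: "const_mat pr0 ** L ** const_mat pr0 = const_mat (pr0 ** pr0)"
    using mat_deriv_zero[OF d0 r(1)] unfolding r(2) .
  show "L \<in> rat_points (grp_B_minus \<gg>)"
    unfolding rat_points_iff
    using eventually_mat_regular[of L] L(2)[unfolded rat_points_iff] L(1)[unfolded aut_def rat_points_iff]
  proof eventually_elim
    case (elim x)
    show ?case
    proof (rule grp_B_minusI)
      show "endo (mat_eval L x)" "gr.sh {..0} (mat_eval L x)" using elim by simp_all
      fix a a' assume d: "dg a = 0" "dg a' = 0"
      have "mat_eval (const_mat pr0 ** L ** const_mat pr0) x = pr0 ** mat_eval L x ** pr0" using elim(1) by (simp add: mat_reg_mult)
      hence m: "pr0 ** mat_eval L x ** pr0 = pr0 ** pr0" unfolding M by simp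
      have ba: "pr0 *v b a' = b a'" unfolding pr0_iff using d(2) by (auto simp: nil_gsp(2) gr.gsp_def gr.co_b split: if_splits)
      have "gr.cj (mat_eval L x) $ a $ a' = gr.co (pr0 *v (mat_eval L x *v (pr0 *v b a'))) a"
        unfolding ba gr.cj_co by (simp add: co_proj d)
      also have "\<dots> = gr.co ((pr0 ** pr0) *v b a') a" unfolding m[symmetric] by (simp flip: matrix_vector_mul_assoc)
      also have "\<dots> = (if a = a' then 1 else 0)" by (simp add: ba gr.co_b flip: matrix_vector_mul_assoc)
      finally show "gr.cj (mat_eval L x) $ a $ a' = (if a = a' then 1 else 0)" .
    qed
  qed
qed

text \<open>Formulated for lower triangular factors instead of B_-, so that it can also be applied
  before the lower factor is known to lie in B_-.\<close>

lemma big_cell_unique: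
  assumes n: "n1 \<in> rat_points (grp_N \<gg>)" "n2 \<in> rat_points (grp_N \<gg>)"
    and L: "L1 \<in> rat_points {g. gr.sh {..0} g}" "L2 \<in> rat_points {g. gr.sh {..0} g}" "invertible L1"
    and e: "n1 ** L1 = n2 ** L2"
  shows "n1 = n2" "L1 = L2"
proof -
  have i: "invertible n2" using aut_inv(1)[OF unipotent_aut[OF n(2)]] .
  define K where "K = matrix_inv n2 ** n1"
  have "K = matrix_inv n2 ** (n1 ** L1) ** matrix_inv L1"
    by (simp add: K_def matrix_inv[OF L(3)] flip: matrix_mul_assoc)
  also have "\<dots> = (matrix_inv n2 ** n2) ** L2 ** matrix_inv L1" unfolding e by (simp only: matrix_mul_assoc)
  also have "\<dots> = L2 ** matrix_inv L1" by (simp add: matrix_inv[OF i])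
  finally have K: "K = L2 ** matrix_inv L1" .
  have "matrix_inv n2 \<in> rat_points (grp_N \<gg>)" by (rule rat_points_inv(2)[OF n(2) grp_N_inv])
  hence KN: "K \<in> rat_points (grp_N \<gg>)" unfolding K_def by (rule rat_points_mult[OF _ n(1)]) (rule grp_N_mult)
  have "matrix_inv L1 \<in> rat_points {g. gr.sh {..0} g}"
    unfolding rat_points_iff using L(1)[unfolded rat_points_iff] eventually_invertible[OF L(3)] eventually_mat_regular[of L1]
    by eventually_elim (simp add: mat_reg_inv lower_inv)
  hence KL: "K \<in> rat_points {g. gr.sh {..0} g}"
    unfolding K
  proof (rule rat_points_mult[OF L(2)])
    fix p q assume "p \<in> {g. gr.sh {..0} g}" "q \<in> {g. gr.sh {..0} g}"
    hence "gr.sh {..0} p" "gr.sh {..0} q" by simp_all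
    hence "gr.sh {..0} (p ** q)" by (rule gr.sh_mult) simp
    thus "p ** q \<in> {g. gr.sh {..0} g}" by simp
  qed
  have "K = mat 1"
  proof (rule mat_eqI)
    show "\<forall>\<^sub>F x in cofinite. mat_eval K x = mat_eval (mat 1) x"
      using KN[unfolded rat_points_iff] KL[unfolded rat_points_iff]
    proof eventually_elim
      case (elim x)
      have u: "gr.sh {1..} (mat_eval K x - mat 1)" using elim(1) by (simp add: grp_N_iff)
      have l: "gr.sh {..0} (mat_eval K x - mat 1)" using elim(2) by (intro gr.sh_lin(2) gr.sh_1) simp_all
      have "gr.cj (mat_eval K x - mat 1) $ a $ a' = gr.cj 0 $ a $ a'" for a a'
      proof (cases "dg a - dg a' \<in> {1..}")
        case True
        hence "dg a - dg a' \<notin> {..0}" by simp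
        thus ?thesis using gr.shD[OF l] by (simp only: gr.cj_simps zero_index)
      next
        case False thus ?thesis using gr.shD[OF u] by (simp only: gr.cj_simps zero_index)
      qed
      hence "gr.cj (mat_eval K x - mat 1) = gr.cj 0" by (simp add: vec_eq_iff)
      hence "mat_eval K x - mat 1 = 0" unfolding gr.cj_eq .
      thus ?case by (simp add: mat_reg_1)
    qed
  qed
  have "n1 = n2 ** K" by (simp add: K_def matrix_mul_assoc matrix_inv[OF i])
  thus "n1 = n2" by (simp add: \<open>K = mat 1\<close>)
  have "L2 = L2 ** (matrix_inv L1 ** L1)" by (simp add: matrix_inv[OF L(3)])
  also have "\<dots> = K ** L1" unfolding K by (simp only: matrix_mul_assoc)
  finally show "L1 = L2" by (simp add: \<open>K = mat 1\<close>)
qed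

end


section \<open>The factorisation for a cyclotomic Miura oper\<close>

lemma fhat_uminus: "c \<noteq> 0 \<Longrightarrow> fhat c U (- X) = - fhat c U X"
proof -
  assume c: "c \<noteq> 0"
  have "fhat c U 0 = 0" using fhat_lin(1)[OF c, of U X X] by simp
  thus ?thesis using fhat_lin(1)[OF c, of U 0 X] by simp
qed

lemma inv_points_iff: "Z \<in> inv_points \<omega> U K \<longleftrightarrow> Z \<in> rat_points K \<and> hat (inverse \<omega>) U U Z = Z"
  by (simp add: inv_points_def group_hat_eq)

lemma invertible_1: "invertible (mat 1 :: 'a::field^'n^'n)"
  by (rule matrix_inv_unique(1)[of _ "mat 1"]) simp

locale cyclotomic = ss_basis \<gg> b n wt
  for \<gg> :: "('n::finite, 'i::finite) lie_data" and b n wt +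
  fixes \<nu> :: "'i \<Rightarrow> 'i" and V :: "complex^'n^'n" and \<omega> :: complex and l0 :: "complex^'n"
    and A :: "ratfun^'n" and Y :: "ratfun^'n^'n"
  assumes diagram: "diagram_automorphism \<gg> \<nu>" and induced: "induced_automorphism \<gg> \<nu> V"
    and omega: "\<omega> \<noteq> 0" and l0: "integral_coweight \<gg> l0" and Vl0: "V *v l0 = l0"
    and miura: "cyc_miura_oper \<gg> \<omega> V A"
    and Y_B: "Y \<in> rat_points (grp_B_minus \<gg>)"
    and Y_norm: "normalized_solution \<gg> (regularized_connection \<gg> l0 A) Y"
begin

abbreviation "c \<equiv> inverse \<omega>"
abbreviation "Th \<equiv> t_torus \<gg> l0"
abbreviation "Ti \<equiv> t_torus \<gg> (- l0)"
abbreviation "vs \<equiv> varsigma \<gg> \<omega> V"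
abbreviation "vt \<equiv> vartheta \<gg> \<omega> V l0"
abbreviation "reg \<equiv> regularized_connection \<gg> l0"
abbreviation "XT \<equiv> (1 / rat_t) *s const_vec (- l0)"

lemma c0: "c \<noteq> 0" using omega by simp

lemmas l0' = integral_uminus(1)[OF l0]
lemmas rho' = integral_uminus(1)[OF integral_rho]

lemma V: "gaut V" "V *v (- l0) = - l0"
  using induced induced_rho(1)[OF diagram induced]
  by (simp_all add: gaut_def induced_automorphism_def lie_automorphism_def endo_def Vl0 matrix_vector_simps)

lemma torus_fix:
  assumes "integral_coweight \<gg> l" "x \<in> hh"
  shows "const_torus \<gg> d l *v x = x"
  unfolding torus_eq[OF assms(1) field_emb(1)] by (rule tor_cartan[OF assms])

lemma vs_eq: "vs = const_torus \<gg> \<omega> (- rho) ** V"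
  by (simp only: varsigma_def rho_check_eq)

lemma vs: "gaut vs" "vs *v (- l0) = - l0" "vs *v p_minus \<gg> = \<omega> *s p_minus \<gg>"
proof -
  show "gaut vs" unfolding vs_eq by (rule gaut_mult[OF gaut_torus[OF rho' omega] V(1)])
  show "vs *v (- l0) = - l0"
    unfolding vs_eq matrix_vector_mul_assoc[symmetric] V(2) by (rule torus_fix[OF rho' integral_hh[OF l0']])
  have "V *v p_minus \<gg> = (\<Sum>i\<in>UNIV. Fg (\<nu> i))"
    using induced unfolding p_minus_def
    by (simp add: vec.linear_sum[OF matrix_vector_mul_linear_gen] induced_automorphism_def)
  also have "\<dots> = p_minus \<gg>"
    unfolding p_minus_def by (rule sum.reindex_bij_betw) (use diagram in \<open>simp add: diagram_automorphism_def\<close>)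
  finally have Vp: "V *v p_minus \<gg> = p_minus \<gg>" .
  have e: "br (- rho) (p_minus \<gg>) = of_int 1 *s p_minus \<gg>"
    unfolding p_minus_def by (simp add: br_sum br_simps rho_EF sum_negf)
  have "dmat (\<lambda>c. c) (\<lambda>a. \<omega> powi cw (- rho) a) *v ext_vec (\<lambda>c. c) (p_minus \<gg>) = \<omega> *s ext_vec (\<lambda>c. c) (p_minus \<gg>)"
    by (rule dmat_eigen[OF field_emb(1)]) (simp add: cw_eigen[OF rho' e])
  thus "vs *v p_minus \<gg> = \<omega> *s p_minus \<gg>"
    unfolding vs_eq matrix_vector_mul_assoc[symmetric] Vp torus_eq[OF rho' field_emb(1)] by simp
qed

lemma vt: "gaut vt"
  unfolding vartheta_def by (rule gaut_mult[OF gaut_torus[OF l0' omega] vs(1)])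

lemma inv_vs: "invertible vs" "invertible vt" using vs(1) vt by (simp_all add: gaut_def)

lemma TT: "Th ** Ti = mat 1" "Ti ** Th = mat 1"
  using torus_inverse[OF field_emb(2) l0 rat_t_nonzero] by simp_all

lemma Ti_inv: "invertible Ti" "matrix_inv Ti = Th"
  using matrix_inv_unique[OF TT(2)] by simp_all

lemma T_aut: "Th \<in> aut" "Ti \<in> aut"
  unfolding torus_eq[OF l0 field_emb(2)] torus_eq[OF l0' field_emb(2)] by (rule Tor_aut[OF l0], rule Tor_aut[OF l0'])

lemma Ti_ld: "has_ld Ti XT" "has_ld Th ((1 / rat_t) *s const_vec l0)"
  unfolding torus_eq[OF l0 field_emb(2)] torus_eq[OF l0' field_emb(2)] by (rule Tor_has_ld[OF l0'], rule Tor_has_ld[OF l0])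

text \<open>Substituting t / \<omega> for t multiplies t^(- l0) by \<omega>^(l0). This cancels the
  torus factor by which \<open>vt\<close> differs from \<open>vs\<close>, as \<open>vs\<close> fixes
  l0 and so commutes with these torus elements. Conjugation by the torus therefore exchanges the two
  kinds of invariance.\<close>

lemma T_hat: "hat c vt vs Ti = Ti" "hat c vs vt Th = Th"
proof -
  let ?q = "const_torus \<gg> \<omega> (- l0)" and ?qi = "const_torus \<gg> c (- l0)"
  have qi: "?q ** ?qi = mat 1" unfolding torus_eq[OF l0' field_emb(1)] by (rule tor_inverse(1)[OF l0' omega])
  have r: "mat_rescale c Ti = const_mat ?qi ** Ti"
    unfolding torus_eq[OF l0' field_emb(1)] torus_eq[OF l0' field_emb(2)] by (rule Tor_rescale[OF l0' c0])
  have s: "endo vs" using vs(1) by (simp add: gaut_def)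
  have s1: "vs ** ?qi = ?qi ** vs"
    using torus_commute_aut[OF l0' field_emb(1) s vs(2), of c] unfolding torus_eq[OF l0' field_emb(1)] ext_id .
  have s2: "const_mat vs ** Ti = Ti ** const_mat vs"
    using torus_commute_aut[OF l0' field_emb(2) s vs(2), of rat_t] unfolding torus_eq[OF l0' field_emb(2)] .
  have "hat c vt vs Ti = const_mat (?q ** (vs ** ?qi)) ** Ti ** const_mat (matrix_inv vs)"
    by (simp only: hat_def vartheta_def r const_mat_hom(1) matrix_mul_assoc)
  also have "?q ** (vs ** ?qi) = vs" unfolding s1 by (simp only: matrix_mul_assoc qi matrix_mul_lid)
  also have "const_mat vs ** Ti ** const_mat (matrix_inv vs) = Ti"
    unfolding s2 by (simp only: matrix_mul_assoc[symmetric] const_inv_mult(2)[OF inv_vs(1)] matrix_mul_rid)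
  finally show h: "hat c vt vs Ti = Ti" .
  show "hat c vs vt Th = Th"
    using hat_inv[OF c0 inv_vs(2,1) Ti_inv(1)] unfolding h Ti_inv(2) by (rule sym)
qed

lemma reg_eq: "reg B = Ti *v B - XT"
  by (simp only: regularized_connection_def gauge_transform_def log_deriv_eq[OF Ti_ld(1)])

lemma reg_fhat: "fhat c vt (reg B) = reg (fhat c vs B)"
proof -
  have "has_ld Ti (fhat c vt XT)" using hat_has_ld[OF c0 Ti_ld(1) T_aut(2) vt vs(1)] unfolding T_hat .
  hence "fhat c vt XT = XT" using Ti_ld(1) by (rule has_ld_inj)
  thus ?thesis unfolding reg_eq fhat_lin(1)[OF c0] fhat_mult[OF c0 inv_vs(1)] T_hat by simp
qed

text \<open>\<open>vs\<close> multiplies p_-1 by \<omega>, and the pullback of dt contributes the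
  inverse factor.\<close>

lemma fhat_p: "fhat c vs (const_vec (p_minus \<gg>)) = const_vec (p_minus \<gg>)"
proof -
  have "rat_const c * rat_const \<omega> = 1" unfolding rat_const_hom(4)[symmetric] using omega by (simp del: rat_const_hom(4))
  thus ?thesis unfolding fhat_def vec_rescale_const[OF c0] const_mat_hom(2) vs(3) const_vec_hom(4) vec.scale_scale by simp
qed

lemma torus_rat_fix:
  assumes "integral_coweight \<gg> l" "w \<in> rat_forms hh"
  shows "const_mat (const_torus \<gg> d l) *v w = w"
proof (rule vec_eqI)
  show "\<forall>\<^sub>F x in cofinite. vec_eval (const_mat (const_torus \<gg> d l) *v w) x = vec_eval w x"
    using assms(2)[unfolded rat_forms_cartan] eventually_vec_regular[of w]
    by eventually_elim (simp add: mat_reg_vec torus_fix[OF assms(1)])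
qed

lemma fhat_vs: "fhat c vs w = const_mat (const_torus \<gg> \<omega> (- rho)) *v fhat c V w"
  by (simp only: fhat_def vs_eq const_mat_hom(1) matrix_vector_simps(7) matrix_vector_mul_assoc)

text \<open>The torus factor of \<open>vs\<close> acts trivially on the Cartan subalgebra, so
  \<open>V\<close> and \<open>vs\<close> have the same invariant Cartan forms.\<close>

lemma inv_forms_cartan: "w \<in> inv_forms \<omega> V hh \<longleftrightarrow> w \<in> rat_forms hh \<and> fhat c vs w = w"
proof -
  have "fhat c V w = w \<longleftrightarrow> fhat c vs w = w" if w: "w \<in> rat_forms hh"
  proof
    assume "fhat c V w = w"
    thus "fhat c vs w = w" unfolding fhat_vs using torus_rat_fix[OF rho' w] by simp
  next
    assume e: "fhat c vs w = w"
    let ?t = "const_torus \<gg> \<omega> (- rho)"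
    have i: "invertible ?t" using gaut_torus[OF rho' omega] by (simp add: gaut_def)
    have "const_mat (matrix_inv ?t) *v (const_mat ?t *v y) = y" for y
      by (simp only: matrix_vector_mul_assoc const_inv_mult(1)[OF i] matrix_vector_mul_lid)
    from this[of "fhat c V w"] this[of w] show "fhat c V w = w"
      unfolding fhat_vs[symmetric] e torus_rat_fix[OF rho' w] by simp
  qed
  thus ?thesis unfolding inv_forms_def form_hat_eq by blast
qed

text \<open>The pointwise form in which degree arguments deliver the Miura condition. Invariance of
  the whole connection is expressed through \<open>vs\<close>, which fixes p_-1 dt and agrees with
  \<open>V\<close> on Cartan forms.\<close>

lemma miura_iff: "cyc_miura_oper \<gg> \<omega> V B \<longleftrightarrow>
    (\<forall>\<^sub>F x in cofinite. vec_eval B x - p_minus \<gg> \<in> hh) \<and> fhat c vs B = B"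
proof -
  let ?w = "B - const_vec (p_minus \<gg>)"
  have 1: "cyc_miura_oper \<gg> \<omega> V B \<longleftrightarrow> ?w \<in> inv_forms \<omega> V hh"
  proof
    assume "cyc_miura_oper \<gg> \<omega> V B"
    then obtain w where w: "w \<in> inv_forms \<omega> V hh" "B = const_vec (p_minus \<gg>) + w" unfolding cyc_miura_oper_def by (rule bexE)
    have "?w = w" unfolding w(2) by simp
    thus "?w \<in> inv_forms \<omega> V hh" using w(1) by (simp only:)
  next
    assume "?w \<in> inv_forms \<omega> V hh"
    thus "cyc_miura_oper \<gg> \<omega> V B" unfolding cyc_miura_oper_def by (rule bexI[rotated]) simp
  qed
  have 2: "fhat c vs ?w = ?w \<longleftrightarrow> fhat c vs B = B" unfolding fhat_lin(1)[OF c0] fhat_p by simp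
  have ev: "\<forall>\<^sub>F x in cofinite. vec_eval ?w x = vec_eval B x - p_minus \<gg>"
    using eventually_vec_regular[of B] by eventually_elim (simp add: vec_reg_diff)
  have 3: "(\<forall>\<^sub>F x in cofinite. vec_eval ?w x \<in> hh) \<longleftrightarrow> (\<forall>\<^sub>F x in cofinite. vec_eval B x - p_minus \<gg> \<in> hh)"
    by (rule eventually_subst) (use ev in eventually_elim, simp)
  show ?thesis unfolding 1 inv_forms_cartan rat_forms_cartan 2 3 ..
qed

lemmas A_hh = miura[unfolded miura_iff, THEN conjunct1]
lemmas A_inv = miura[unfolded miura_iff, THEN conjunct2]

text \<open>Both sides are gauge transforms of B by the same element, \<open>Ti ** g\<close> =
  (\<open>Ti ** g ** Th\<close>) \<open>Ti\<close>; the logarithmic derivatives of the two torus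
  factors cancel.\<close>

lemma reg_gauge:
  assumes X: "has_ld g X" and g: "g \<in> aut"
  shows "\<exists>Xm. has_ld (Ti ** g ** Th) Xm \<and> reg (gauge_transform \<gg> g B) = (Ti ** g ** Th) *v reg B - Xm"
proof -
  define Xh where "Xh = (1 / rat_t) *s const_vec l0"
  define X0 where "X0 = XT"
  have Xh: "has_ld Th Xh" and X0: "has_ld Ti X0" using Ti_ld by (simp_all only: Xh_def X0_def)
  have "has_ld (Th ** Ti) (Xh + Th *v X0)" by (rule has_ld_mult[OF Xh X0 T_aut(1)])
  hence "has_ld (mat 1) (Xh + Th *v X0)" unfolding TT .
  moreover have "has_ld (mat 1) 0" using has_ld_const[OF invertible_1] unfolding const_mat_hom .
  ultimately have "Xh + Th *v X0 = 0" by (rule has_ld_inj)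
  hence Xe: "Xh = - (Th *v X0)" by (simp add: eq_neg_iff_add_eq_0)
  have 0: "has_ld (Ti ** g ** Th) (X0 + Ti *v X + (Ti ** g) *v Xh)"
    by (rule has_ld_mult[OF has_ld_mult[OF X0 X T_aut(2)] Xh aut_mult[OF T_aut(2) g]])
  have 1: "(Ti ** g ** Th) *v (Ti *v B) = Ti *v (g *v B)"
    by (simp add: matrix_vector_mul_assoc TT flip: matrix_mul_assoc)
  have 2: "(Ti ** g ** Th) *v X0 = - ((Ti ** g) *v Xh)"
    by (simp add: Xe matrix_vector_simps matrix_vector_mul_assoc)
  have "reg (gauge_transform \<gg> g B) = (Ti ** g ** Th) *v reg B - (X0 + Ti *v X + (Ti ** g) *v Xh)"
    unfolding reg_eq gauge_transform_def log_deriv_eq[OF X] X0_def[symmetric] matrix_vector_simps(4) 1 2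
    by (simp add: algebra_simps)
  with 0 show ?thesis by blast
qed

lemma norm_iff: "normalized_solution \<gg> B Z \<longleftrightarrow>
    Z \<in> rat_points (grp_G \<gg>) \<and> has_ld Z (- B) \<and> mat_regular_at Z 0 \<and> mat_eval Z 0 = mat 1"
proof -
  have "invertible Z" if "mat_regular_at Z 0" "mat_eval Z 0 = mat 1"
    by (rule invertible_ratI[OF that(1)]) (simp add: that(2) invertible_1)
  thus ?thesis unfolding normalized_solution_def has_ld_def rat_ad_lin by blast
qed

lemmas Y = Y_norm[unfolded norm_iff]

lemma Y_sol_eq:
  assumes "normalized_solution \<gg> (reg (gauge_transform \<gg> g A)) Z"
  shows "Y_sol \<gg> l0 A g = Z"
  unfolding Y_sol_def
proof (rule the_equality)
  show "normalized_solution \<gg> (reg (gauge_transform \<gg> g A)) Z" by (rule assms)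
next
  fix W assume "normalized_solution \<gg> (reg (gauge_transform \<gg> g A)) W"
  thus "W = Z" using assms unfolding norm_iff by (intro has_ld_unique[of W _ Z 0]) (auto simp: invertible_1)
qed

lemma Y_aut: "Y \<in> aut" and Y_lower: "Y \<in> rat_points {g. gr.sh {..0} g}"
proof -
  have i: "invertible Y" using Y by (simp add: has_ld_def)
  show "Y \<in> aut" unfolding aut_def rat_points_iff
    using Y_B[unfolded rat_points_iff] eventually_invertible[OF i] by eventually_elim (simp add: grp_B_minus_lower)
  show "Y \<in> rat_points {g. gr.sh {..0} g}" by (rule rat_points_mono[OF Y_B]) (auto simp: grp_B_minus_lower)
qed

text \<open>The regularised connection is invariant for \<open>vt\<close>, so the twisted transform
  of Y solves the same equation with the same value at 0, the fixed point of the rescaling.\<close>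

lemma Y_hat: "hat c vt vt Y = Y"
proof (rule has_ld_unique)
  show "has_ld Y (- reg A)" "mat_regular_at Y 0" using Y by simp_all
  have "has_ld (hat c vt vt Y) (fhat c vt (- reg A))" using Y by (intro hat_has_ld c0 Y_aut vt) simp
  thus "has_ld (hat c vt vt Y) (- reg A)" unfolding fhat_uminus[OF c0] reg_fhat A_inv .
  show "mat_regular_at (hat c vt vt Y) 0" using Y by (intro hat_eval(1) c0) simp
  have "mat_eval (hat c vt vt Y) 0 = mat 1"
    using hat_eval(2)[OF c0, of Y vt vt] Y by (simp add: matrix_inv[OF inv_vs(2)])
  thus "mat_eval (hat c vt vt Y) 0 = mat_eval Y 0" "invertible (mat_eval (hat c vt vt Y) 0)" using Y by (simp_all add: invertible_1)
qed

lemma N_G: "rat_points (grp_N \<gg>) \<subseteq> rat_points (grp_G \<gg>)" and B_G: "rat_points (grp_B_minus \<gg>) \<subseteq> rat_points (grp_G \<gg>)"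
  unfolding grp_N_def grp_B_minus_def grp_G_def by (auto elim!: rat_points_mono intro: adjoint_subgroup_mono)

lemma G_mult: "Z \<in> rat_points (grp_G \<gg>) \<Longrightarrow> W \<in> rat_points (grp_G \<gg>) \<Longrightarrow> Z ** W \<in> rat_points (grp_G \<gg>)"
  by (erule (1) rat_points_mult) (simp add: grp_G_def adjoint_subgroup_mult)

lemma reg_N: "g \<in> rat_points (grp_N \<gg>) \<Longrightarrow> Ti ** g ** Th \<in> rat_points (grp_N \<gg>)"
  using torus_conj_N[OF l0', of g] by simp

lemma reg_hat:
  assumes "hat c vs vs g = g"
  shows "hat c vt vt (Ti ** g ** Th) = Ti ** g ** Th"
proof -
  have "hat c vt vt (Ti ** g ** Th) = hat c vt vs Ti ** hat c vs vs g ** hat c vs vt Th"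
    by (simp only: hat_mult[OF c0 inv_vs(1)])
  thus ?thesis unfolding T_hat assms .
qed

lemma gauge_solution:
  assumes g: "g \<in> rat_points (grp_N \<gg>)" and L: "L = Ti ** g ** Th ** Y ** const_mat h" "h \<in> grp_N \<gg>"
  shows "has_ld L (- reg (gauge_transform \<gg> g A))" "L \<in> rat_points (grp_G \<gg>)" "L \<in> aut"
proof -
  let ?m = "Ti ** g ** Th"
  obtain X where X: "has_ld g X" by (rule unipotent_has_ld[OF g])
  obtain Xm where Xm: "has_ld ?m Xm" "reg (gauge_transform \<gg> g A) = ?m *v reg A - Xm"
    using reg_gauge[OF X unipotent_aut[OF g], of A] by blast
  note mN = reg_N[OF g]
  have h: "endo h" "invertible h" using L(2) grp_N_inv[OF L(2)] by (simp_all add: grp_N_iff)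
  have 1: "has_ld (?m ** Y) (Xm + ?m *v (- reg A))" using Y by (intro has_ld_mult Xm(1) unipotent_aut mN) simp
  have a: "?m ** Y \<in> aut" by (intro aut_mult unipotent_aut mN Y_aut)
  have "has_ld L (Xm + ?m *v (- reg A) + (?m ** Y) *v 0)"
    unfolding L(1) by (rule has_ld_mult[OF 1 has_ld_const[OF h(2)] a])
  thus "has_ld L (- reg (gauge_transform \<gg> g A))" unfolding Xm(2) by (simp add: matrix_vector_simps)
  show "L \<in> aut" unfolding L(1) by (intro aut_mult[OF a] aut_const h)
  have hN: "const_mat h \<in> rat_points (grp_N \<gg>)" by (rule rat_points_const[OF L(2)])
  show "L \<in> rat_points (grp_G \<gg>)"
    unfolding L(1) by (rule G_mult[OF G_mult[OF subsetD[OF N_G mN] subsetD[OF B_G Y_B]] subsetD[OF N_G hN]])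
qed

text \<open>\<open>MOp_gen\<close> only guarantees some g' with regular regularisation and the same
  transformed connection. Then g'^-1 g fixes A, so freeness gives g' = g and the regularisation of g
  itself has a value at 0. That value is fixed by \<open>vt\<close> because 0 is fixed by the
  rescaling.\<close>

lemma generic_imp_factorisation:
  assumes g: "g \<in> inv_points \<omega> vs (grp_N \<gg>)" and M: "gauge_transform \<gg> g A \<in> MOp_gen \<gg> \<omega> V l0 A"
  defines "m \<equiv> regularized_group_elt \<gg> l0 g"
  shows "normalized_solution \<gg> (reg (gauge_transform \<gg> g A)) (Y_sol \<gg> l0 A g)"
    "Y ** const_mat (matrix_inv (mat_eval m 0)) = matrix_inv m ** Y_sol \<gg> l0 A g"
    "mat_eval m 0 \<in> fixed_points vt (grp_N \<gg>)"
proof -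
  have gN: "g \<in> rat_points (grp_N \<gg>)" and gh: "hat c vs vs g = g" using g by (simp_all add: inv_points_iff)
  obtain g' where "g' \<in> inv_points \<omega> vs (grp_N \<gg>)" and g'r: "mat_regular_at (regularized_group_elt \<gg> l0 g') 0"
    "gauge_transform \<gg> g A = gauge_transform \<gg> g' A"
    using M unfolding MOp_gen_def by blast
  hence g': "g' \<in> rat_points (grp_N \<gg>)" by (simp add: inv_points_iff)
  obtain X where X: "has_ld g X" by (rule unipotent_has_ld[OF gN])
  obtain X' where X': "has_ld g' X'" by (rule unipotent_has_ld[OF g'])
  have iN: "matrix_inv g' \<in> rat_points (grp_N \<gg>)" by (rule rat_points_inv(2)[OF g' grp_N_inv])
  obtain Xi where Xi: "has_ld (matrix_inv g') Xi" by (rule unipotent_has_ld[OF iN])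
  have i: "invertible g'" using X' by (simp add: has_ld_def)
  have "has_ld (matrix_inv g' ** g') (Xi + matrix_inv g' *v X')" by (rule has_ld_mult[OF Xi X' unipotent_aut[OF iN]])
  hence "has_ld (mat 1) (Xi + matrix_inv g' *v X')" unfolding matrix_inv[OF i] .
  moreover have "has_ld (mat 1) 0" using has_ld_const[OF invertible_1] unfolding const_mat_hom .
  ultimately have z: "Xi + matrix_inv g' *v X' = 0" by (rule has_ld_inj)
  have e: "g *v A - X = g' *v A - X'" using g'r(2) unfolding gauge_transform_def log_deriv_eq[OF X] log_deriv_eq[OF X'] .
  have "matrix_inv g' ** g = mat 1"
  proof (rule gauge_free[OF _ _ _ A_hh])
    show "matrix_inv g' ** g \<in> rat_points (grp_N \<gg>)" by (rule rat_points_mult[OF iN gN]) (rule grp_N_mult)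
    show "has_ld (matrix_inv g' ** g) (Xi + matrix_inv g' *v X)" by (rule has_ld_mult[OF Xi X unipotent_aut[OF iN]])
    have "(matrix_inv g' ** g) *v A - (Xi + matrix_inv g' *v X) = matrix_inv g' *v (g *v A - X) - Xi"
      by (simp add: matrix_vector_simps algebra_simps flip: matrix_vector_mul_assoc)
    also have "\<dots> = (matrix_inv g' ** g') *v A - (Xi + matrix_inv g' *v X')"
      unfolding e by (simp add: matrix_vector_simps algebra_simps flip: matrix_vector_mul_assoc)
    also have "\<dots> = A" unfolding z matrix_inv[OF i] by simp
    finally show "(matrix_inv g' ** g) *v A - (Xi + matrix_inv g' *v X) = A" .
  qed
  hence "g' ** (matrix_inv g' ** g) = g'" by simp
  hence "g = g'" unfolding matrix_mul_assoc matrix_inv[OF i] by simp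
  hence r: "mat_regular_at m 0" using g'r(1) by (simp add: m_def)
  have m: "m = Ti ** g ** Th" by (simp only: m_def regularized_group_elt_def)
  have mN: "m \<in> rat_points (grp_N \<gg>)" unfolding m by (rule reg_N[OF gN])
  have m0: "mat_eval m 0 \<in> grp_N \<gg>" by (rule regular_unipotent[OF mN r])
  have i0: "invertible (mat_eval m 0)" and i0N: "matrix_inv (mat_eval m 0) \<in> grp_N \<gg>" using grp_N_inv[OF m0] by simp_all
  have im: "invertible m" using aut_inv(1)[OF unipotent_aut[OF mN]] .
  let ?L = "m ** Y ** const_mat (matrix_inv (mat_eval m 0))"
  note s = gauge_solution[OF gN _ i0N, of ?L, unfolded m[symmetric], OF refl]
  have "normalized_solution \<gg> (reg (gauge_transform \<gg> g A)) ?L"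
    unfolding norm_iff using s(1,2) r Y by (simp add: mat_reg_mult matrix_inv[OF i0])
  hence YL: "Y_sol \<gg> l0 A g = ?L" and n: "normalized_solution \<gg> (reg (gauge_transform \<gg> g A)) (Y_sol \<gg> l0 A g)"
    using Y_sol_eq by simp_all
  show "normalized_solution \<gg> (reg (gauge_transform \<gg> g A)) (Y_sol \<gg> l0 A g)" by (rule n)
  show "Y ** const_mat (matrix_inv (mat_eval m 0)) = matrix_inv m ** Y_sol \<gg> l0 A g"
    unfolding YL by (simp add: matrix_mul_assoc matrix_inv[OF im])
  have "mat_eval (hat c vt vt m) 0 = vt ** mat_eval m 0 ** matrix_inv vt" by (rule hat_eval(2)[OF c0 r])
  moreover have "hat c vt vt m = m" unfolding m by (rule reg_hat[OF gh])
  ultimately show "mat_eval m 0 \<in> fixed_points vt (grp_N \<gg>)" using m0 unfolding fixed_points_def by simp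
qed

definition factorises :: "complex^'n^'n \<Rightarrow> ratfun^'n^'n \<Rightarrow> ratfun^'n^'n \<Rightarrow> bool" where
  "factorises g0 m L \<longleftrightarrow> m \<in> inv_points \<omega> vt (grp_N \<gg>) \<and> L \<in> inv_points \<omega> vt (grp_B_minus \<gg>) \<and>
     Y ** const_mat (matrix_inv g0) = matrix_inv m ** L"

lemma factorises_unique:
  assumes g0: "g0 \<in> grp_N \<gg>" and "factorises g0 m1 L1" "factorises g0 m2 L2"
  shows "m1 = m2" "L1 = L2"
proof -
  have m: "m1 \<in> rat_points (grp_N \<gg>)" "m2 \<in> rat_points (grp_N \<gg>)"
    and L: "L1 \<in> rat_points (grp_B_minus \<gg>)" "L2 \<in> rat_points (grp_B_minus \<gg>)"
    and e: "Y ** const_mat (matrix_inv g0) = matrix_inv m1 ** L1" "Y ** const_mat (matrix_inv g0) = matrix_inv m2 ** L2"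
    using assms(2,3) by (simp_all add: factorises_def inv_points_iff)
  have i: "invertible m1" "invertible m2" using aut_inv(1)[OF unipotent_aut] m by blast+
  have mi: "matrix_inv m1 \<in> rat_points (grp_N \<gg>)" "matrix_inv m2 \<in> rat_points (grp_N \<gg>)"
    by (rule rat_points_inv(2)[OF m(1) grp_N_inv], assumption, rule rat_points_inv(2)[OF m(2) grp_N_inv])
  have Ll: "L1 \<in> rat_points {g. gr.sh {..0} g}" "L2 \<in> rat_points {g. gr.sh {..0} g}"
    by (rule rat_points_mono[OF L(1)], use grp_B_minus_lower in blast, rule rat_points_mono[OF L(2)], use grp_B_minus_lower in blast)
  have "L1 = m1 ** (Y ** const_mat (matrix_inv g0))" unfolding e(1) by (simp add: matrix_mul_assoc matrix_inv[OF i(1)])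
  moreover have "invertible (const_mat (matrix_inv g0))" using grp_N_inv[OF g0] by (simp add: const_mat_inv invertible_matrix_inv)
  ultimately have iL: "invertible L1" using i(1) aut_inv(1)[OF Y_aut] by (simp add: matrix_inv_mult)
  have e12: "matrix_inv m1 ** L1 = matrix_inv m2 ** L2" using e by simp
  note u = big_cell_unique[OF mi Ll iL e12]
  show "L1 = L2" by (rule u(2))
  have "matrix_inv (matrix_inv m1) = matrix_inv (matrix_inv m2)" using u(1) by simp
  thus "m1 = m2" using i by (simp add: invertible_matrix_inv)
qed

text \<open>The big cell is applied to Y g0^-1, whose value at 0 is g0^-1, and m is the inverse of
  the upper factor. The product is invariant because Y and g0 are, so transforming its factors gives
  another factorisation of the same matrix and uniqueness makes them invariant. The lower factor L =
  m Y g0^-1 has a logarithmic derivative, as each of its factors has one; this is what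
  \<open>lower_normalized\<close> needs for membership in B_-.\<close>

lemma factorises_exists:
  assumes "g0 \<in> fixed_points vt (grp_N \<gg>)"
  shows "\<exists>m L. factorises g0 m L \<and> mat_regular_at m 0 \<and> mat_eval m 0 = g0 \<and>
    L \<in> aut \<and> L \<in> rat_points {g. gr.sh {..0} g} \<and> mat_regular_at L 0 \<and> mat_eval L 0 = mat 1"
proof -
  define h where "h = matrix_inv g0"
  have g0: "g0 \<in> grp_N \<gg>" "vt ** g0 ** matrix_inv vt = g0" using assms by (simp_all add: fixed_points_def)
  have i: "invertible g0" and h: "h \<in> grp_N \<gg>" "invertible h" "endo h"
    using grp_N_inv[OF g0(1)] by (simp_all add: h_def invertible_matrix_inv grp_N_iff)
  have "matrix_inv (vt ** g0 ** matrix_inv vt) = vt ** h ** matrix_inv vt"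
    by (simp add: matrix_inv_mult invertible_matrix_inv i inv_vs matrix_mul_assoc h_def)
  hence hv: "vt ** h ** matrix_inv vt = h" unfolding g0(2) h_def by simp
  define Z where "Z = Y ** const_mat h"
  have Za: "Z \<in> aut" unfolding Z_def by (intro aut_mult Y_aut aut_const h)
  have Zr: "mat_regular_at Z 0" "mat_eval Z 0 = h" using Y by (simp_all add: Z_def mat_reg_mult)
  have Zh: "hat c vt vt Z = Z"
  proof -
    have "hat c vt vt Z = hat c vt vt Y ** hat c vt vt (const_mat h)"
      unfolding Z_def by (rule hat_mult[OF c0 inv_vs(2), symmetric])
    thus ?thesis unfolding Y_hat hat_const[OF c0] hv Z_def .
  qed
  have hN: "mat_eval Z 0 \<in> grp_N \<gg>" unfolding Zr(2) by (rule h(1))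
  obtain U L where UL: "Z = U ** L" "U \<in> rat_points (grp_N \<gg>)" "mat_regular_at U 0" "mat_eval U 0 = mat_eval Z 0"
    "L \<in> aut" "L \<in> rat_points {g. gr.sh {..0} g}" "mat_regular_at L 0" "mat_eval L 0 = mat 1"
    by (rule rational_big_cell[OF Za Zr(1) hN]) (rule that; assumption)
  have iU: "invertible U" using aut_inv(1)[OF unipotent_aut[OF UL(2)]] .
  have iL: "invertible (hat c vt vt L)" using aut_inv(1)[OF hat_aut[OF c0 vt vt UL(5)]] .
  have "hat c vt vt U ** hat c vt vt L = U ** L" unfolding hat_mult[OF c0 inv_vs(2)] UL(1)[symmetric] by (rule Zh)
  note u = big_cell_unique[OF hat_N[OF c0 vt UL(2)] UL(2) hat_lower[OF c0 vt UL(6)] UL(6) iL this]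
  define m where "m = matrix_inv U"
  have mN: "m \<in> rat_points (grp_N \<gg>)" unfolding m_def by (rule rat_points_inv(2)[OF UL(2) grp_N_inv])
  have mh: "hat c vt vt m = m" unfolding m_def hat_inv[OF c0 inv_vs(2,2) iU, symmetric] u(1) ..
  have i0: "invertible (mat_eval U 0)" unfolding UL(4) Zr(2) by (rule h(2))
  have m0: "mat_regular_at m 0" "mat_eval m 0 = g0"
    using mat_reg_inv[OF UL(3) i0] unfolding m_def UL(4) Zr(2) h_def by (simp_all add: invertible_matrix_inv i)
  have Lm: "L = m ** Z" unfolding UL(1) m_def by (simp add: matrix_mul_assoc matrix_inv[OF iU])
  obtain X where X: "has_ld m X" by (rule unipotent_has_ld[OF mN])
  have YX: "has_ld Y (- reg A)" using Y by simp
  have "has_ld L (X + m *v (- reg A + Y *v 0))"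
    unfolding Lm Z_def by (rule has_ld_mult[OF X has_ld_mult[OF YX has_ld_const[OF h(2)] Y_aut] unipotent_aut[OF mN]])
  note LB = lower_normalized(1)[OF UL(5,6) this UL(7,8)]
  have "matrix_inv m = U" unfolding m_def by (simp add: invertible_matrix_inv iU)
  hence "factorises g0 m L" unfolding factorises_def inv_points_iff h_def[symmetric] Z_def[symmetric]
    using mN mh LB u(2) UL(1) by simp
  thus ?thesis using m0 UL(5-8) by blast
qed

text \<open>A factorisation as such says nothing about the point 0. By uniqueness it is the one
  constructed in \<open>factorises_exists\<close>, which brings regularity and the values
  there.\<close>

lemma factorisation_imp_generic:
  assumes g0: "g0 \<in> fixed_points vt (grp_N \<gg>)" and F: "factorises g0 m L"
  defines "g \<equiv> Th ** m ** Ti"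
  shows "regularized_group_elt \<gg> l0 g = m" "g \<in> inv_points \<omega> vs (grp_N \<gg>)" "mat_regular_at m 0"
    "gauge_transform \<gg> g A \<in> MOp_gen \<gg> \<omega> V l0 A" "mat_eval m 0 = g0" "Y_sol \<gg> l0 A g = L"
proof -
  have g0N: "g0 \<in> grp_N \<gg>" using g0 by (simp add: fixed_points_def)
  obtain m' L' where F': "factorises g0 m' L'" and m': "mat_regular_at m' 0" "mat_eval m' 0 = g0"
    and L': "L' \<in> aut" "L' \<in> rat_points {g. gr.sh {..0} g}" "mat_regular_at L' 0" "mat_eval L' 0 = mat 1"
    using factorises_exists[OF g0] by blast
  note u = factorises_unique[OF g0N F F']
  show m0: "mat_regular_at m 0" "mat_eval m 0 = g0" unfolding u by (rule m')+
  note L = L'[folded u(2)]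
  have mN: "m \<in> rat_points (grp_N \<gg>)" and mh: "hat c vt vt m = m"
    and e: "Y ** const_mat (matrix_inv g0) = matrix_inv m ** L"
    using F by (simp_all add: factorises_def inv_points_iff)
  have im: "invertible m" using aut_inv(1)[OF unipotent_aut[OF mN]] .
  have "Ti ** g ** Th = (Ti ** Th) ** m ** (Ti ** Th)" unfolding g_def by (simp only: matrix_mul_assoc)
  hence gm: "Ti ** g ** Th = m" unfolding TT by simp
  thus gr: "regularized_group_elt \<gg> l0 g = m" by (simp only: regularized_group_elt_def)
  have gN: "g \<in> rat_points (grp_N \<gg>)" unfolding g_def by (rule torus_conj_N[OF l0 mN])
  have "hat c vs vs g = hat c vs vt Th ** hat c vt vt m ** hat c vt vs Ti"
    unfolding g_def by (simp only: hat_mult[OF c0 inv_vs(2)])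
  hence gh: "hat c vs vs g = g" unfolding T_hat mh g_def .
  show gi: "g \<in> inv_points \<omega> vs (grp_N \<gg>)" using gN gh by (simp add: inv_points_iff)
  have Lm: "L = Ti ** g ** Th ** Y ** const_mat (matrix_inv g0)"
  proof -
    have "L = m ** (matrix_inv m ** L)" by (simp add: matrix_mul_assoc matrix_inv[OF im])
    also have "\<dots> = m ** (Y ** const_mat (matrix_inv g0))" by (simp only: e)
    finally show ?thesis by (simp only: gm matrix_mul_assoc)
  qed
  have hN: "matrix_inv g0 \<in> grp_N \<gg>" using grp_N_inv[OF g0N] by simp
  note s = gauge_solution[OF gN Lm hN]
  show "Y_sol \<gg> l0 A g = L" by (rule Y_sol_eq) (use s(1,2) L(3,4) in \<open>simp add: norm_iff\<close>)
  define B where "B = gauge_transform \<gg> g A"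
  obtain X where X: "has_ld g X" and Xu: "\<forall>\<^sub>F x in cofinite. gr.sh {1..} (AD (vec_eval X x))"
    by (rule unipotent_has_ld[OF gN]) (rule that; assumption)
  have BX: "B = g *v A - X" unfolding B_def gauge_transform_def log_deriv_eq[OF X] ..
  have low: "\<forall>\<^sub>F x in cofinite. vec_eval (- reg B) x \<in> gr.gsp {..0}"
    unfolding B_def by (rule lower_normalized(2)[OF L(1,2) s(1) L(3,4)])
  have "XT \<in> rat_forms hh" unfolding rat_forms_def
    by (intro vec.span_scale vec.span_base imageI integral_hh[OF l0'])
  hence XTh: "\<forall>\<^sub>F x in cofinite. vec_eval XT x \<in> hh" unfolding rat_forms_cartan .
  \<comment> \<open>Undoing the regularisation applies a torus element, which preserves degrees, and
    adds a Cartan term; so the upper bound 0 on the degrees of \<open>reg B\<close> carries over to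
    B.\<close>
  have BT: "B = Th *v (XT - (- reg B))"
    unfolding reg_eq by (simp add: matrix_vector_mul_assoc TT)
  have "\<forall>\<^sub>F x in cofinite. vec_eval B x - p_minus \<gg> \<in> hh"
    using low XTh Xu A_hh gN[unfolded rat_points_iff] eventually_vec_regular[of XT] eventually_vec_regular[of "- reg B"]
      eventually_vec_regular[of X] eventually_vec_regular[of A] eventually_mat_regular[of g] eventually_nonzero
  proof eventually_elim
    case (elim x)
    have Th: "mat_regular_at Th x" "mat_eval Th x = const_torus \<gg> x l0"
      unfolding torus_eq[OF l0 field_emb(1)] torus_eq[OF l0 field_emb(2)] using Tor_eval[OF l0 elim(11)] by simp_all
    have "vec_eval (Th *v (XT - (- reg B))) x = const_torus \<gg> x l0 *v (vec_eval XT x - vec_eval (- reg B) x)"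
      using Th vec_reg_diff[OF elim(6,7)] by (simp only: mat_reg_vec)
    hence Be: "vec_eval B x = const_torus \<gg> x l0 *v (vec_eval XT x - vec_eval (- reg B) x)" unfolding BT[symmetric] .
    have "vec_eval XT x \<in> gr.gsp {..0}" using elim(2) unfolding nil_gsp(2) gr.gsp_def by auto
    hence "vec_eval XT x - vec_eval (- reg B) x \<in> gr.gsp {..0}" by (rule vec.subspace_diff[OF gr.gsp_sub _ elim(1)])
    hence B1: "vec_eval B x \<in> gr.gsp {..0}" unfolding Be
      by (rule gr.sh_vec[OF gaut_sh[OF gaut_torus[OF l0 elim(11)]]]) simp
    let ?g = "mat_eval g x" and ?p = "p_minus \<gg>" and ?u = "vec_eval A x - p_minus \<gg>"
    have gs: "gr.sh {1..} (?g - mat 1)" using elim(5) by (simp add: grp_N_iff)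
    have "vec_eval B x = ?g *v vec_eval A x - vec_eval X x"
      unfolding BX using elim(8,9,10) by (simp add: vec_reg_diff mat_reg_vec)
    hence B2e: "vec_eval B x - ?p = (?g - mat 1) *v ?p + ?g *v ?u - vec_eval X x"
      by (simp add: matrix_vector_simps)
    have p1: "(?g - mat 1) *v ?p \<in> gr.gsp {0..}" by (rule gr.sh_vec[OF gs p_minus_gsp]) simp
    have u1: "?g *v ?u \<in> gr.gsp {0..}" by (rule gr.sh_vec[OF gr.sh_add_1[OF gs] elim(4)[unfolded nil_gsp(2)]]) simp
    have "vec_eval X x \<in> gr.gsp (insert 0 {1..})" by (rule sh_AD_conv[OF elim(3)])
    hence x1: "vec_eval X x \<in> gr.gsp {0..}" unfolding gr.gsp_def by force
    have B2: "vec_eval B x - ?p \<in> gr.gsp {0..}"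
      unfolding B2e by (intro vec.subspace_diff vec.subspace_add gr.gsp_sub p1 u1 x1)
    have "?p \<in> gr.gsp {..0}" using p_minus_gsp unfolding gr.gsp_def by force
    hence B3: "vec_eval B x - ?p \<in> gr.gsp {..0}" by (rule vec.subspace_diff[OF gr.gsp_sub B1])
    have "dg a = 0" if "gr.co (vec_eval B x - ?p) a \<noteq> 0" for a
    proof -
      have "dg a \<in> {0..}" "dg a \<in> {..0}" using that B2 B3 unfolding gr.gsp_def by blast+
      thus ?thesis by simp
    qed
    thus ?case unfolding nil_gsp(2) gr.gsp_def by simp
  qed
  \<comment> \<open>Logarithmic derivatives are unique, so the invariance of g passes to X; together
    with the invariance of A this gives that of B.\<close>
  moreover have "fhat c vs B = B"
  proof -
    have "has_ld (hat c vs vs g) (fhat c vs X)" by (rule hat_has_ld[OF c0 X unipotent_aut[OF gN] vs(1) vs(1)])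
    hence "has_ld g (fhat c vs X)" unfolding gh .
    hence "fhat c vs X = X" using X by (rule has_ld_inj)
    thus ?thesis unfolding BX fhat_lin(1)[OF c0] fhat_mult[OF c0 inv_vs(1)] gh A_inv by simp
  qed
  ultimately have "cyc_miura_oper \<gg> \<omega> V B" unfolding miura_iff by simp
  thus "gauge_transform \<gg> g A \<in> MOp_gen \<gg> \<omega> V l0 A"
    unfolding MOp_gen_def B_def using gi m0(1) gr by blast
qed

end

theorem theorem6p2:
  fixes \<gg> :: "('n::finite, 'i::finite) lie_data"
    and \<nu> :: "'i \<Rightarrow> 'i" and V :: "complex^'n^'n"
    and T :: nat and \<omega> :: complex
    and l m :: nat
    and z x :: "nat \<Rightarrow> complex"
    and lam :: "nat \<Rightarrow> complex^'n" and lam0 lam_inf :: "complex^'n"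
    and w y :: "nat \<Rightarrow> complex^'n \<Rightarrow> complex^'n"
    and w_inf :: "complex^'n \<Rightarrow> complex^'n"
    and u A :: "ratfun^'n" and Y :: "ratfun^'n^'n"
  assumes "semisimple_data \<gg>"
    and "diagram_automorphism \<gg> \<nu>" and "induced_automorphism \<gg> \<nu> V"
    and "T \<ge> 1" and "\<nu> ^^ T = id" and "primitive_root_of_unity T \<omega>"
    and "\<forall>i\<in>{1..l}. z i \<noteq> 0"
    and "\<forall>i\<in>{1..l}. \<forall>j\<in>{1..l}. i \<noteq> j \<longrightarrow> Gamma_orbit \<omega> (z i) \<inter> Gamma_orbit \<omega> (z j) = {}"
    and "\<forall>i\<in>{1..l}. integral_coweight \<gg> (lam i) \<and> dominant_coweight \<gg> (lam i)"
    and "lam0 \<in> cartan_invariants \<gg> V" and "integral_coweight \<gg> lam0" and "dominant_coweight \<gg> lam0"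
    and "lam_inf \<in> cartan_invariants \<gg> V" and "integral_coweight \<gg> lam_inf" and "dominant_coweight \<gg> lam_inf"
    and "\<forall>i\<in>{1..l}. w i \<in> weyl_group \<gg>"
    and "\<forall>j\<in>{1..m}. y j \<in> weyl_group \<gg>"
    and "\<forall>j\<in>{1..m}. x j \<noteq> 0 \<and> (\<forall>i\<in>{1..l}. x j \<notin> Gamma_orbit \<omega> (z i))"
    and "u = cyc_miura_u \<gg> T \<omega> V lam0 l z lam w m x y"
    and "A = const_vec (p_minus \<gg>) + u"
    and "cyc_miura_oper \<gg> \<omega> V A"
    and "\<forall>j\<in>{1..m}. cyc_oper_regular_at \<gg> \<omega> V A (x j)"
    and "w_inf \<in> weyl_invariants \<gg> V"
    and "vec_residue_infinity u = shifted_action \<gg> w_inf lam_inf"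
    and "monodromy_free \<gg> A"
    and "Y \<in> rat_points (grp_B_minus \<gg>)"
    and "normalized_solution \<gg> (regularized_connection \<gg> lam0 A) Y"
  shows
    "(\<forall>g \<in> inv_points \<omega> (varsigma \<gg> \<omega> V) (grp_N \<gg>).
        gauge_transform \<gg> g A \<in> MOp_gen \<gg> \<omega> V lam0 A \<longrightarrow>
          (let g_r = regularized_group_elt \<gg> lam0 g; Y_g = Y_sol \<gg> lam0 A g
           in normalized_solution \<gg> (regularized_connection \<gg> lam0 (gauge_transform \<gg> g A)) Y_g \<and>
              Y ** const_mat (matrix_inv (mat_eval g_r 0)) = matrix_inv g_r ** Y_g \<and>
              mat_eval g_r 0 \<in> fixed_points (vartheta \<gg> \<omega> V lam0) (grp_N \<gg>)))
     \<and>
     (\<forall>g0 \<in> fixed_points (vartheta \<gg> \<omega> V lam0) (grp_N \<gg>).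
        let factorises = (\<lambda>n Y'.
              n \<in> inv_points \<omega> (vartheta \<gg> \<omega> V lam0) (grp_N \<gg>) \<and>
              Y' \<in> inv_points \<omega> (vartheta \<gg> \<omega> V lam0) (grp_B_minus \<gg>) \<and>
              Y ** const_mat (matrix_inv g0) = matrix_inv n ** Y')
        in (\<exists>!p. factorises (fst p) (snd p)) \<and>
           (\<forall>n Y'. factorises n Y' \<longrightarrow>
              (let g = t_torus \<gg> lam0 ** n ** t_torus \<gg> (- lam0);
                   g_r = regularized_group_elt \<gg> lam0 g
               in n = g_r \<and>
                  g \<in> inv_points \<omega> (varsigma \<gg> \<omega> V) (grp_N \<gg>) \<and>
                  mat_regular_at g_r 0 \<and>
                  gauge_transform \<gg> g A \<in> MOp_gen \<gg> \<omega> V lam0 A \<and>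
                  mat_eval g_r 0 = g0 \<and>
                  Y' = Y_sol \<gg> lam0 A g)))"
proof -
  have ss: "ss \<gg>"
    using assms(1) by unfold_locales (simp_all add: semisimple_data_def semisimple_def)
  \<comment> \<open>The eigenbasis and the coweight coefficients serve the proof alone; they do not
    occur in the assertion to be shown.\<close>
  obtain b n wt where basis: "ss_basis \<gg> b n wt"
    using ss.ss_basis_exists[OF ss] by blast
  have "\<omega> \<noteq> 0"
    using \<open>T \<ge> 1\<close> \<open>primitive_root_of_unity T \<omega>\<close> by (auto simp: primitive_root_of_unity_def power_0_left)
  moreover have "V *v lam0 = lam0" using \<open>lam0 \<in> cartan_invariants \<gg> V\<close> by (simp add: cartan_invariants_def)
  ultimately have "cyclotomic \<gg> b n wt \<nu> V \<omega> lam0 A Y"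
    using assms by (intro cyclotomic.intro[OF basis] cyclotomic_axioms.intro)
  then interpret C: cyclotomic \<gg> b n wt \<nu> V \<omega> lam0 A Y .
  show ?thesis
  proof (intro conjI ballI impI)
    fix g assume "g \<in> inv_points \<omega> (varsigma \<gg> \<omega> V) (grp_N \<gg>)"
      and "gauge_transform \<gg> g A \<in> MOp_gen \<gg> \<omega> V lam0 A"
    thus "let g_r = regularized_group_elt \<gg> lam0 g; Y_g = Y_sol \<gg> lam0 A g
       in normalized_solution \<gg> (regularized_connection \<gg> lam0 (gauge_transform \<gg> g A)) Y_g \<and>
          Y ** const_mat (matrix_inv (mat_eval g_r 0)) = matrix_inv g_r ** Y_g \<and>
          mat_eval g_r 0 \<in> fixed_points (vartheta \<gg> \<omega> V lam0) (grp_N \<gg>)"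
      unfolding Let_def by (intro conjI C.generic_imp_factorisation)
  next
    fix g0 assume g0: "g0 \<in> fixed_points (vartheta \<gg> \<omega> V lam0) (grp_N \<gg>)"
    hence g0N: "g0 \<in> grp_N \<gg>" by (simp add: fixed_points_def)
    obtain k L where kL: "C.factorises g0 k L" using C.factorises_exists[OF g0] by blast
    have ex1: "\<exists>!p. C.factorises g0 (fst p) (snd p)"
    proof (rule ex1I)
      show "C.factorises g0 (fst (k, L)) (snd (k, L))" using kL by simp
    next
      fix p assume "C.factorises g0 (fst p) (snd p)"
      thus "p = (k, L)" using C.factorises_unique[OF g0N _ kL] by (simp add: prod_eq_iff)
    qed
    have all: "k = regularized_group_elt \<gg> lam0 (t_torus \<gg> lam0 ** k ** t_torus \<gg> (- lam0)) \<and>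
        t_torus \<gg> lam0 ** k ** t_torus \<gg> (- lam0) \<in> inv_points \<omega> (varsigma \<gg> \<omega> V) (grp_N \<gg>) \<and>
        mat_regular_at (regularized_group_elt \<gg> lam0 (t_torus \<gg> lam0 ** k ** t_torus \<gg> (- lam0))) 0 \<and>
        gauge_transform \<gg> (t_torus \<gg> lam0 ** k ** t_torus \<gg> (- lam0)) A \<in> MOp_gen \<gg> \<omega> V lam0 A \<and>
        mat_eval (regularized_group_elt \<gg> lam0 (t_torus \<gg> lam0 ** k ** t_torus \<gg> (- lam0))) 0 = g0 \<and>
        Y' = Y_sol \<gg> lam0 A (t_torus \<gg> lam0 ** k ** t_torus \<gg> (- lam0))"
      if "C.factorises g0 k Y'" for k Y'
      using C.factorisation_imp_generic[OF g0 that] by simp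
    show "let factorises = (\<lambda>n Y'.
              n \<in> inv_points \<omega> (vartheta \<gg> \<omega> V lam0) (grp_N \<gg>) \<and>
              Y' \<in> inv_points \<omega> (vartheta \<gg> \<omega> V lam0) (grp_B_minus \<gg>) \<and>
              Y ** const_mat (matrix_inv g0) = matrix_inv n ** Y')
        in (\<exists>!p. factorises (fst p) (snd p)) \<and>
           (\<forall>n Y'. factorises n Y' \<longrightarrow>
              (let g = t_torus \<gg> lam0 ** n ** t_torus \<gg> (- lam0);
                   g_r = regularized_group_elt \<gg> lam0 g
               in n = g_r \<and>
                  g \<in> inv_points \<omega> (varsigma \<gg> \<omega> V) (grp_N \<gg>) \<and>
                  mat_regular_at g_r 0 \<and>
                  gauge_transform \<gg> g A \<in> MOp_gen \<gg> \<omega> V lam0 A \<and>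
                  mat_eval g_r 0 = g0 \<and>
                  Y' = Y_sol \<gg> lam0 A g))"
      unfolding Let_def C.factorises_def[symmetric] using ex1 all by blast
  qed
qed

end
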